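(* Let $\phi:(\mathbb X,\sigma_0)\to(\mathbb Y,\tau_0)$ be a covering of developable complexes of groups and let $\mathbb Y$ be effective, i.e. the fundamental group $\pi_1(\mathbb Y,\tau_0)$ acts on the universal complex $\tilde Y_{\tau_0}$ with trivial kernel. Let $G:=\pi_1(\mathbb Y,\tau_0)$ and $U:=\phi_\ast(\pi_1(\mathbb X,\sigma_0))\le G$. Then there is an isomorphism of groups $$\mathrm{Deck}(\phi)\cong N_G(U)/U,$$ where $N_G(U)$ is the normalizer of $U$ in $G$.
   Context: Scwols. A scwol $X$ consists of sets $VX$ (vertices), $EX$ (edges), maps $i,t:EX\to VX$ and a composition $E^2X:=\{(a,b)\in EX\times EX: i(a)=t(b)\}\to EX$, $(a,b)\mapsto ab$, with $i(ab)=i(b)$, $t(ab)=t(a)$; $(ab)c=a(bc)$ whenever $i(a)=t(b)$, $i(b)=t(c)$; and $i(a)\neq t(a)$ for all $a\in EX$. $E^3X$ is the set of triples of edges $(a,b,c)$ with $i(a)=t(b)$, $i(b)=t(c)$. A morphism of scwols $f:X\to Y$ maps vertices to vertices and edges to edges, commutes with $i,t$, satisfies $f(ab)=f(a)f(b)$ for $(a,b)\in E^2X$, and for each $\sigma\in VX$ restricts to a bijection $\{a\in EX:i(a)=\sigma\}\to\{a'\in EY:i(a')=f(\sigma)\}$; it is an isomorphism if it is bijective on vertices and edges. Complexes of groups. A complex of groups $\mathbb X$ over $X$ is a tuple $((G_\sigma)_{\sigma\in VX},(\psi_a)_{a\in EX},(g_{a,b})_{(a,b)\in E^2X})$ with groups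 $G_\sigma$, injective homomorphisms $\psi_a:G_{i(a)}\to G_{t(a)}$ and elements $g_{a,b}\in G_{t(a)}$ such that $c_{g_{a,b}}\circ\psi_{ab}=\psi_a\circ\psi_b$ on $E^2X$ and $\psi_a(g_{b,c})g_{a,bc}=g_{a,b}g_{ab,c}$ on $E^3X$, where $c_h(g)=hgh^{-1}$. The same letters are used for all complexes of groups. Underlying scwols are always assumed connected (any two vertices are joined by a finite path as defined below). Morphisms. A morphism $\phi:\mathbb X\to\mathbb Y$ over $f:X\to Y$ consists of $f$, homomorphisms $\phi_\sigma:G_\sigma\to G_{f(\sigma)}$ ($\sigma\in VX$) and elements $\phi(a)\in G_{f(t(a))}$ ($a\in EX$) with $c_{\phi(a)}\circ\psi_{f(a)}\circ\phi_{i(a)}=\phi_{t(a)}\circ\psi_a$ for $a\in EX$ and $\phi_{t(a)}(g_{a,b})\phi(ab)=\phi(a)\psi_{f(a)}(\phi(b))g_{f(a),f(b)}$ for $(a,b)\in E^2X$. Writing $\phi:(\mathbb X,\sigma_0)\to(\mathbb Y,\tau_0)$ means $\sigma_0\in VX$ and $f(\sigma_0)=\tau_0$. The composition of $\phi:\mathbb U\to\mathbb X$ over $f$ and $\eta:\mathbb X\to\mathbb Y$ over $g$ is the morphism $\eta\circ\phi$ over $g\circ f$ with $(\eta\circ\phi)_\sigma=\eta_{f(\sigma)}\circ\phi_\sigma$ and $(\eta\circ\phi)(a)=\eta_{f(t(a))}(\phi(a))\,\eta(f(a))$. $\phi$ is an isomorphism if $f$ and all $\phi_\sigma$ are isomorphisms;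 $\mathrm{Aut}(\mathbb X)$ is the set of isomorphisms $\mathbb X\to\mathbb X$. Coverings. A morphism $\phi:\mathbb X\to\mathbb Y$ over a surjective $f:X\to Y$ is a covering if for all $\sigma\in VX$: $\phi_\sigma$ is injective, and for all $a'\in EY$ with $t(a')=f(\sigma)$ the map $\coprod_{a\in f^{-1}(a'),\,t(a)=\sigma}G_\sigma/\psi_a(G_{i(a)})\to G_{f(\sigma)}/\psi_{a'}(G_{i(a')})$, $g\,\psi_a(G_{i(a)})\mapsto\phi_\sigma(g)\phi(a)\,\psi_{a'}(G_{i(a')})$, is a bijection. Paths. Oriented edges are the $a\in EX$ and formal inverses $a^{-1}$, with $i(a^{-1})=t(a)$, $t(a^{-1})=i(a)$, $(a^{-1})^{-1}=a$. A path in $X$ is a finite sequence of oriented edges $(e_1,\dots,e_k)$ with $t(e_j)=i(e_{j+1})$. An $\mathbb X$-path is a tuple $p=(g_0,e_1,g_1,\dots,e_k,g_k)$ with $(e_1,\dots,e_k)$ a path, $g_0\in G_{i(e_1)}$, $g_j\in G_{t(e_j)}$; $i(p)=i(e_1)$, $t(p)=t(e_k)$ (for length $0$: $p=(g)$ with $g\in G_\sigma$, at a vertex $\sigma$). Concatenation $p\star q$ (when $t(p)=i(q)$) multiplies the last group element of $p$ with the first of $q$; $p^{-1}=(g_k^{-1},e_k^{-1},\dots,e_1^{-1},g_0^{-1})$. $\mathcal P_{\sigma}(\mathbb X)$ denotes the set of $\mathbb X$-paths starting at $\sigma$. Homotopy $\sim$ of $\mathbb X$-paths is the equivalence relation generated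 by the following replacements of subpaths: $(kg,a,h)\to(k,a,\psi_a(g)h)$; $(g,a^{-1},hk)\to(g\psi_a(h),a^{-1},k)$; $(g,a,\psi_a(h),a^{-1},k)\to(ghk)$; $(g,b^{-1},h,b,k)\to(g\psi_b(h)k)$; $(g,b,1,a,k)\to(g,ab,g_{a,b}^{-1}k)$ and $(g,a^{-1},1,b^{-1},k)\to(gg_{a,b},(ab)^{-1},k)$ for $(a,b)\in E^2X$. $[p]$ is the homotopy class. $\pi_1(\mathbb X,\sigma_0)$ is the group of homotopy classes of $\mathbb X$-paths from $\sigma_0$ to $\sigma_0$ with $[p][q]=[p\star q]$. $\mathbb X$ is developable if it arises (up to isomorphism) from an action of a group on a scwol; equivalently (and this may be taken as the definition), for every $\sigma\in VX$ the homomorphism $G_\sigma\to\pi_1(\mathbb X,\sigma)$, $g\mapsto[(g)]$, is injective. Universal complex. For $p,q\in\mathcal P_{\sigma_0}(\mathbb X)$ put $p\equiv q$ iff $[q]=[p\star(g)]$ for some $g\in G_{t(p)}$; $[\![p]\!]$ is the $\equiv$-class. The scwol $\tilde X_{\sigma_0}$ has vertices $[\![p]\!]$, $p\in\mathcal P_{\sigma_0}(\mathbb X)$, edges the triples $([\![p]\!],a,[\![p\star(1,a,1)]\!])$ with $a\in EX$, $i(a)=t(p)$; $i,t$ are the first and third projections, and the composite of $([\![p\star(1,b,1)]\!],a,\cdot)$ with $([\![p]\!],b,\cdot)$ is $([\![p]\!],ab,[\![p\star(1,ab,1)]\!])$. $\pi_1(\mathbb X,\sigma_0)$ acts on it by $[q]\cdot[\![p]\!]=[\![q\star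 p]\!]$ and $[q]\cdot([\![p]\!],a,\cdot)=([\![q\star p]\!],a,\cdot)$. Induced homomorphism. $\mathfrak p_\phi$ is the map from $\mathbb X$-paths to $\mathbb Y$-paths compatible with $\star$ and given by $(g)\mapsto(\phi_\sigma(g))$ for $g\in G_\sigma$, $(1,a,1)\mapsto(1,f(a),\phi(a)^{-1})$, $(1,a^{-1},1)\mapsto(\phi(a),f(a)^{-1},1)$; $\phi_\ast=\phi_{\ast,\sigma_0}:\pi_1(\mathbb X,\sigma_0)\to\pi_1(\mathbb Y,f(\sigma_0))$ is $[p]\mapsto[\mathfrak p_\phi(p)]$. Homotopy of morphisms. Morphisms $\phi,\eta:\mathbb X\to\mathbb Y$ over the same $f$ are homotopic, $\phi\sim\eta$, if there are $k_\sigma\in G_{f(\sigma)}$ ($\sigma\in VX$) with $\eta_\sigma=c_{k_\sigma}\circ\phi_\sigma$ and $\eta(a)=k_{t(a)}\phi(a)\psi_{f(a)}(k_{i(a)}^{-1})$ for all $\sigma\in VX$, $a\in EX$. $[\phi]$ is the homotopy class. Deck transformations. $\mathrm{Deck}(\phi)=\{[\eta]:\eta\in\mathrm{Aut}(\mathbb X),\ \phi\sim\phi\circ\eta\}$, a group under $[\eta^1][\eta^2]=[\eta^1\circ\eta^2]$. *)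

theory Defs
  imports "HOL-Algebra.Group_Action" "HOL-Algebra.Left_Coset"
begin

section \<open>Scwols and complexes of groups\<close>

text \<open>All data are carrier-relative: the values of the component functions are only relevant on
  the vertex set, on the edge set, on composable pairs of edges and on the carriers of the local
  groups.\<close>

record ('v, 'e) scwol =
  verts :: "'v set"
  edges :: "'e set"
  ini   :: "'e \<Rightarrow> 'v"
  ter   :: "'e \<Rightarrow> 'v"
  ecomp :: "'e \<Rightarrow> 'e \<Rightarrow> 'e"

definition composable :: "('v, 'e, 'z) scwol_scheme \<Rightarrow> ('e \<times> 'e) set" where
  "composable X = {(a, b). a \<in> edges X \<and> b \<in> edges X \<and> ini X a = ter X b}"

definition is_scwol :: "('v, 'e, 'z) scwol_scheme \<Rightarrow> bool" where
  "is_scwol X \<longleftrightarrow>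
     (\<forall>a\<in>edges X. ini X a \<in> verts X \<and> ter X a \<in> verts X \<and> ini X a \<noteq> ter X a) \<and>
     (\<forall>(a, b)\<in>composable X. ecomp X a b \<in> edges X \<and>
        ini X (ecomp X a b) = ini X b \<and> ter X (ecomp X a b) = ter X a) \<and>
     (\<forall>a b c. (a, b) \<in> composable X \<longrightarrow> (b, c) \<in> composable X \<longrightarrow>
        ecomp X (ecomp X a b) c = ecomp X a (ecomp X b c))"

text \<open>An edge \<open>a\<close> (\<open>Fwd a\<close>) or its formal inverse (\<open>Bwd a\<close>).\<close>

datatype 'e oedge = Fwd 'e | Bwd 'e

primrec uedge :: "'e oedge \<Rightarrow> 'e" where
  "uedge (Fwd a) = a"
| "uedge (Bwd a) = a"

primrec oini :: "('v, 'e, 'z) scwol_scheme \<Rightarrow> 'e oedge \<Rightarrow> 'v" where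
  "oini X (Fwd a) = ini X a"
| "oini X (Bwd a) = ter X a"

primrec oter :: "('v, 'e, 'z) scwol_scheme \<Rightarrow> 'e oedge \<Rightarrow> 'v" where
  "oter X (Fwd a) = ter X a"
| "oter X (Bwd a) = ini X a"

primrec edge_path :: "('v, 'e, 'z) scwol_scheme \<Rightarrow> 'v \<Rightarrow> 'e oedge list \<Rightarrow> 'v \<Rightarrow> bool" where
  "edge_path X \<sigma> [] \<tau> \<longleftrightarrow> \<sigma> \<in> verts X \<and> \<sigma> = \<tau>"
| "edge_path X \<sigma> (e # es) \<tau> \<longleftrightarrow>
     uedge e \<in> edges X \<and> oini X e = \<sigma> \<and> edge_path X (oter X e) es \<tau>"

definition connected_scwol :: "('v, 'e, 'z) scwol_scheme \<Rightarrow> bool" where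
  "connected_scwol X \<longleftrightarrow> (\<forall>\<sigma>\<in>verts X. \<forall>\<tau>\<in>verts X. \<exists>es. edge_path X \<sigma> es \<tau>)"

definition conj_by :: "('g, 'z) monoid_scheme \<Rightarrow> 'g \<Rightarrow> 'g \<Rightarrow> 'g" where
  "conj_by G h g = h \<otimes>\<^bsub>G\<^esub> g \<otimes>\<^bsub>G\<^esub> inv\<^bsub>G\<^esub> h"

text \<open>The local groups of one complex share an ambient type \<open>'g\<close>; their carriers may overlap.\<close>

record ('v, 'e, 'g) cog = "('v, 'e) scwol" +
  grp   :: "'v \<Rightarrow> 'g monoid"
  psi   :: "'e \<Rightarrow> 'g \<Rightarrow> 'g"
  twist :: "'e \<Rightarrow> 'e \<Rightarrow> 'g"

definition complex_of_groups :: "('v, 'e, 'g) cog \<Rightarrow> bool" where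
  "complex_of_groups X \<longleftrightarrow>
     is_scwol X \<and> connected_scwol X \<and>
     (\<forall>\<sigma>\<in>verts X. group (grp X \<sigma>)) \<and>
     (\<forall>a\<in>edges X. psi X a \<in> mon (grp X (ini X a)) (grp X (ter X a))) \<and>
     (\<forall>(a, b)\<in>composable X.
        twist X a b \<in> carrier (grp X (ter X a)) \<and>
        (\<forall>g\<in>carrier (grp X (ini X b)).
           conj_by (grp X (ter X a)) (twist X a b) (psi X (ecomp X a b) g) = psi X a (psi X b g))) \<and>
     (\<forall>a b c. (a, b) \<in> composable X \<longrightarrow> (b, c) \<in> composable X \<longrightarrow>
        psi X a (twist X b c) \<otimes>\<^bsub>grp X (ter X a)\<^esub> twist X a (ecomp X b c)
        = twist X a b \<otimes>\<^bsub>grp X (ter X a)\<^esub> twist X (ecomp X a b) c)"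

section \<open>Morphisms\<close>

record ('v, 'e, 'w, 'f) scwol_mor =
  vmap :: "'v \<Rightarrow> 'w"
  emap :: "'e \<Rightarrow> 'f"

definition is_scwol_mor ::
    "('v, 'e, 'y) scwol_scheme \<Rightarrow> ('w, 'f, 'z) scwol_scheme \<Rightarrow>
     ('v, 'e, 'w, 'f, 'm) scwol_mor_scheme \<Rightarrow> bool" where
  "is_scwol_mor X Y f \<longleftrightarrow>
     (\<forall>\<sigma>\<in>verts X. vmap f \<sigma> \<in> verts Y) \<and>
     (\<forall>a\<in>edges X. emap f a \<in> edges Y \<and>
        ini Y (emap f a) = vmap f (ini X a) \<and> ter Y (emap f a) = vmap f (ter X a)) \<and>
     (\<forall>(a, b)\<in>composable X. emap f (ecomp X a b) = ecomp Y (emap f a) (emap f b)) \<and>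
     (\<forall>\<sigma>\<in>verts X. bij_betw (emap f) {a \<in> edges X. ini X a = \<sigma>}
                                    {a' \<in> edges Y. ini Y a' = vmap f \<sigma>})"

text \<open>\<open>lmap \<phi> \<sigma>\<close> is the local homomorphism at \<open>\<sigma>\<close>, and \<open>elt \<phi> a\<close> is the group element
  attached to the edge \<open>a\<close>.\<close>

record ('v, 'e, 'g, 'w, 'f, 'h) cog_mor = "('v, 'e, 'w, 'f) scwol_mor" +
  lmap :: "'v \<Rightarrow> 'g \<Rightarrow> 'h"
  elt  :: "'e \<Rightarrow> 'h"

definition is_cog_mor ::
    "('v, 'e, 'g) cog \<Rightarrow> ('w, 'f, 'h) cog \<Rightarrow> ('v, 'e, 'g, 'w, 'f, 'h) cog_mor \<Rightarrow> bool" where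
  "is_cog_mor X Y \<phi> \<longleftrightarrow>
     is_scwol_mor X Y \<phi> \<and>
     (\<forall>\<sigma>\<in>verts X. lmap \<phi> \<sigma> \<in> hom (grp X \<sigma>) (grp Y (vmap \<phi> \<sigma>))) \<and>
     (\<forall>a\<in>edges X.
        elt \<phi> a \<in> carrier (grp Y (vmap \<phi> (ter X a))) \<and>
        (\<forall>g\<in>carrier (grp X (ini X a)).
           conj_by (grp Y (vmap \<phi> (ter X a))) (elt \<phi> a)
             (psi Y (emap \<phi> a) (lmap \<phi> (ini X a) g))
           = lmap \<phi> (ter X a) (psi X a g))) \<and>
     (\<forall>(a, b)\<in>composable X.
        lmap \<phi> (ter X a) (twist X a b) \<otimes>\<^bsub>grp Y (vmap \<phi> (ter X a))\<^esub> elt \<phi> (ecomp X a b)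
        = elt \<phi> a \<otimes>\<^bsub>grp Y (vmap \<phi> (ter X a))\<^esub> psi Y (emap \<phi> a) (elt \<phi> b)
            \<otimes>\<^bsub>grp Y (vmap \<phi> (ter X a))\<^esub> twist Y (emap \<phi> a) (emap \<phi> b))"

text \<open>The composite of \<open>\<phi>: U \<rightarrow> X\<close> and \<open>\<eta>: X \<rightarrow> Y\<close>; the intermediate complex does not enter
  the formulas.\<close>

definition mor_comp ::
    "('u, 'd, 'k) cog \<Rightarrow> ('w, 'f, 'h) cog \<Rightarrow> ('v, 'e, 'g, 'w, 'f, 'h) cog_mor \<Rightarrow>
     ('u, 'd, 'k, 'v, 'e, 'g) cog_mor \<Rightarrow> ('u, 'd, 'k, 'w, 'f, 'h) cog_mor" where
  "mor_comp U Y \<eta> \<phi> =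
     \<lparr>vmap = vmap \<eta> \<circ> vmap \<phi>,
      emap = emap \<eta> \<circ> emap \<phi>,
      lmap = (\<lambda>\<sigma>. lmap \<eta> (vmap \<phi> \<sigma>) \<circ> lmap \<phi> \<sigma>),
      elt = (\<lambda>a. lmap \<eta> (vmap \<phi> (ter U a)) (elt \<phi> a)
                   \<otimes>\<^bsub>grp Y (vmap \<eta> (vmap \<phi> (ter U a)))\<^esub> elt \<eta> (emap \<phi> a))\<rparr>"

definition mor_id :: "('v, 'e, 'g) cog \<Rightarrow> ('v, 'e, 'g, 'v, 'e, 'g) cog_mor" where
  "mor_id X = \<lparr>vmap = id, emap = id, lmap = (\<lambda>\<sigma>. id), elt = (\<lambda>a. \<one>\<^bsub>grp X (ter X a)\<^esub>)\<rparr>"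

definition is_scwol_iso ::
    "('v, 'e, 'y) scwol_scheme \<Rightarrow> ('w, 'f, 'z) scwol_scheme \<Rightarrow>
     ('v, 'e, 'w, 'f, 'm) scwol_mor_scheme \<Rightarrow> bool" where
  "is_scwol_iso X Y f \<longleftrightarrow>
     is_scwol_mor X Y f \<and> bij_betw (vmap f) (verts X) (verts Y) \<and>
     bij_betw (emap f) (edges X) (edges Y)"

definition is_cog_iso ::
    "('v, 'e, 'g) cog \<Rightarrow> ('w, 'f, 'h) cog \<Rightarrow> ('v, 'e, 'g, 'w, 'f, 'h) cog_mor \<Rightarrow> bool" where
  "is_cog_iso X Y \<phi> \<longleftrightarrow>
     is_cog_mor X Y \<phi> \<and> is_scwol_iso X Y \<phi> \<and>
     (\<forall>\<sigma>\<in>verts X. lmap \<phi> \<sigma> \<in> iso (grp X \<sigma>) (grp Y (vmap \<phi> \<sigma>)))"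

definition Aut :: "('v, 'e, 'g) cog \<Rightarrow> ('v, 'e, 'g, 'v, 'e, 'g) cog_mor set" where
  "Aut X = {\<eta>. is_cog_iso X X \<eta>}"

section \<open>Coverings\<close>

definition psi_image :: "('v, 'e, 'g) cog \<Rightarrow> 'e \<Rightarrow> 'g set" where
  "psi_image X a = psi X a ` carrier (grp X (ini X a))"

text \<open>The map on cosets is written as a union over all representatives, which is a single coset
  because the prescription does not depend on the representative.\<close>

definition coset_map ::
    "('v, 'e, 'g) cog \<Rightarrow> ('w, 'f, 'h) cog \<Rightarrow> ('v, 'e, 'g, 'w, 'f, 'h) cog_mor \<Rightarrow>
     'v \<Rightarrow> 'f \<Rightarrow> 'e \<times> 'g set \<Rightarrow> 'h set" where
  "coset_map X Y \<phi> \<sigma> a' = (\<lambda>(a, C).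
     \<Union>g\<in>C. (lmap \<phi> \<sigma> g \<otimes>\<^bsub>grp Y (vmap \<phi> \<sigma>)\<^esub> elt \<phi> a) <#\<^bsub>grp Y (vmap \<phi> \<sigma>)\<^esub> psi_image Y a')"

definition covering ::
    "('v, 'e, 'g) cog \<Rightarrow> ('w, 'f, 'h) cog \<Rightarrow> ('v, 'e, 'g, 'w, 'f, 'h) cog_mor \<Rightarrow> bool" where
  "covering X Y \<phi> \<longleftrightarrow>
     is_cog_mor X Y \<phi> \<and>
     vmap \<phi> ` verts X = verts Y \<and> emap \<phi> ` edges X = edges Y \<and>
     (\<forall>\<sigma>\<in>verts X.
        inj_on (lmap \<phi> \<sigma>) (carrier (grp X \<sigma>)) \<and>
        (\<forall>a'\<in>edges Y. ter Y a' = vmap \<phi> \<sigma> \<longrightarrow>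
           bij_betw (coset_map X Y \<phi> \<sigma> a')
             (SIGMA a : {a \<in> edges X. emap \<phi> a = a' \<and> ter X a = \<sigma>}.
                lcosets\<^bsub>grp X \<sigma>\<^esub> (psi_image X a))
             (lcosets\<^bsub>grp Y (vmap \<phi> \<sigma>)\<^esub> (psi_image Y a'))))"

section \<open>Paths of a complex of groups and the fundamental group\<close>

text \<open>The tuple \<open>(g\<^sub>0, e\<^sub>1, g\<^sub>1, \<dots>, e\<^sub>k, g\<^sub>k)\<close> is
  \<open>Step g\<^sub>0 e\<^sub>1 (Step g\<^sub>1 e\<^sub>2 (\<dots> (Const \<sigma> g\<^sub>k)))\<close>, where \<open>\<sigma>\<close> is the terminal vertex.
  Recording \<open>\<sigma>\<close> is redundant except for paths of length 0, whose vertex cannot be recovered from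
  the group element.\<close>

datatype ('v, 'e, 'g) gpath = Const 'v 'g | Step 'g "'e oedge" "('v, 'e, 'g) gpath"

primrec psrc :: "('v, 'e, 'g) cog \<Rightarrow> ('v, 'e, 'g) gpath \<Rightarrow> 'v" where
  "psrc X (Const \<sigma> g) = \<sigma>"
| "psrc X (Step g e p) = oini X e"

primrec ptgt :: "('v, 'e, 'g) gpath \<Rightarrow> 'v" where
  "ptgt (Const \<sigma> g) = \<sigma>"
| "ptgt (Step g e p) = ptgt p"

primrec is_path :: "('v, 'e, 'g) cog \<Rightarrow> ('v, 'e, 'g) gpath \<Rightarrow> bool" where
  "is_path X (Const \<sigma> g) \<longleftrightarrow> \<sigma> \<in> verts X \<and> g \<in> carrier (grp X \<sigma>)"
| "is_path X (Step g e p) \<longleftrightarrow>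
     uedge e \<in> edges X \<and> g \<in> carrier (grp X (oini X e)) \<and> is_path X p \<and> psrc X p = oter X e"

primrec lmul :: "('v, 'e, 'g) cog \<Rightarrow> 'g \<Rightarrow> ('v, 'e, 'g) gpath \<Rightarrow> ('v, 'e, 'g) gpath" where
  "lmul X h (Const \<sigma> g) = Const \<sigma> (h \<otimes>\<^bsub>grp X \<sigma>\<^esub> g)"
| "lmul X h (Step g e p) = Step (h \<otimes>\<^bsub>grp X (oini X e)\<^esub> g) e p"

primrec pcat :: "('v, 'e, 'g) cog \<Rightarrow> ('v, 'e, 'g) gpath \<Rightarrow> ('v, 'e, 'g) gpath \<Rightarrow> ('v, 'e, 'g) gpath"
  where
  "pcat X (Const \<sigma> g) q = lmul X g q"
| "pcat X (Step g e p) q = Step g e (pcat X p q)"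

definition paths_from :: "('v, 'e, 'g) cog \<Rightarrow> 'v \<Rightarrow> ('v, 'e, 'g) gpath set" where
  "paths_from X \<sigma> = {p. is_path X p \<and> psrc X p = \<sigma>}"

definition loops :: "('v, 'e, 'g) cog \<Rightarrow> 'v \<Rightarrow> ('v, 'e, 'g) gpath set" where
  "loops X \<sigma> = {p. is_path X p \<and> psrc X p = \<sigma> \<and> ptgt p = \<sigma>}"

inductive replacement ::
    "('v, 'e, 'g) cog \<Rightarrow> ('v, 'e, 'g) gpath \<Rightarrow> ('v, 'e, 'g) gpath \<Rightarrow> bool"
  for X :: "('v, 'e, 'g) cog" where
  slide_fwd:
    "\<lbrakk>a \<in> edges X; k \<in> carrier (grp X (ini X a)); g \<in> carrier (grp X (ini X a));
      h \<in> carrier (grp X (ter X a))\<rbrakk> \<Longrightarrow>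
     replacement X
       (Step (k \<otimes>\<^bsub>grp X (ini X a)\<^esub> g) (Fwd a) (Const (ter X a) h))
       (Step k (Fwd a) (Const (ter X a) (psi X a g \<otimes>\<^bsub>grp X (ter X a)\<^esub> h)))"
| slide_bwd:
    "\<lbrakk>a \<in> edges X; g \<in> carrier (grp X (ter X a)); h \<in> carrier (grp X (ini X a));
      k \<in> carrier (grp X (ini X a))\<rbrakk> \<Longrightarrow>
     replacement X
       (Step g (Bwd a) (Const (ini X a) (h \<otimes>\<^bsub>grp X (ini X a)\<^esub> k)))
       (Step (g \<otimes>\<^bsub>grp X (ter X a)\<^esub> psi X a h) (Bwd a) (Const (ini X a) k))"
| cancel_fwd:
    "\<lbrakk>a \<in> edges X; g \<in> carrier (grp X (ini X a)); h \<in> carrier (grp X (ini X a));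
      k \<in> carrier (grp X (ini X a))\<rbrakk> \<Longrightarrow>
     replacement X
       (Step g (Fwd a) (Step (psi X a h) (Bwd a) (Const (ini X a) k)))
       (Const (ini X a) (g \<otimes>\<^bsub>grp X (ini X a)\<^esub> h \<otimes>\<^bsub>grp X (ini X a)\<^esub> k))"
| cancel_bwd:
    "\<lbrakk>b \<in> edges X; g \<in> carrier (grp X (ter X b)); h \<in> carrier (grp X (ini X b));
      k \<in> carrier (grp X (ter X b))\<rbrakk> \<Longrightarrow>
     replacement X
       (Step g (Bwd b) (Step h (Fwd b) (Const (ter X b) k)))
       (Const (ter X b) (g \<otimes>\<^bsub>grp X (ter X b)\<^esub> psi X b h \<otimes>\<^bsub>grp X (ter X b)\<^esub> k))"
| compose_fwd:
    "\<lbrakk>(a, b) \<in> composable X; g \<in> carrier (grp X (ini X b)); k \<in> carrier (grp X (ter X a))\<rbrakk> \<Longrightarrow>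
     replacement X
       (Step g (Fwd b) (Step \<one>\<^bsub>grp X (ini X a)\<^esub> (Fwd a) (Const (ter X a) k)))
       (Step g (Fwd (ecomp X a b))
          (Const (ter X a) (inv\<^bsub>grp X (ter X a)\<^esub> (twist X a b) \<otimes>\<^bsub>grp X (ter X a)\<^esub> k)))"
| compose_bwd:
    "\<lbrakk>(a, b) \<in> composable X; g \<in> carrier (grp X (ter X a)); k \<in> carrier (grp X (ini X b))\<rbrakk> \<Longrightarrow>
     replacement X
       (Step g (Bwd a) (Step \<one>\<^bsub>grp X (ini X a)\<^esub> (Bwd b) (Const (ini X b) k)))
       (Step (g \<otimes>\<^bsub>grp X (ter X a)\<^esub> twist X a b) (Bwd (ecomp X a b)) (Const (ini X b) k))"

text \<open>\<open>s\<close> is a subpath of \<open>p\<close> if \<open>p = p\<^sub>1 \<star> s \<star> p\<^sub>2\<close>; consecutive pieces of the tuple \<open>p\<close> are the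
  case where \<open>p\<^sub>1\<close> ends and \<open>p\<^sub>2\<close> begins with the neutral element.\<close>

definition htpy_step ::
    "('v, 'e, 'g) cog \<Rightarrow> ('v, 'e, 'g) gpath \<Rightarrow> ('v, 'e, 'g) gpath \<Rightarrow> bool" where
  "htpy_step X p q \<longleftrightarrow>
     (\<exists>p1 s s' p2. replacement X s s' \<and> is_path X p1 \<and> is_path X p2 \<and>
        ptgt p1 = psrc X s \<and> ptgt s = psrc X p2 \<and>
        p = pcat X p1 (pcat X s p2) \<and> q = pcat X p1 (pcat X s' p2))"

definition htpy :: "('v, 'e, 'g) cog \<Rightarrow> (('v, 'e, 'g) gpath \<times> ('v, 'e, 'g) gpath) set" where
  "htpy X = {(p, q). is_path X p \<and> is_path X q \<and> equivclp (htpy_step X) p q}"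

definition hclass :: "('v, 'e, 'g) cog \<Rightarrow> ('v, 'e, 'g) gpath \<Rightarrow> ('v, 'e, 'g) gpath set" where
  "hclass X p = htpy X `` {p}"

text \<open>Here and below, operations on classes are written as unions over representatives.\<close>

definition pi1 :: "('v, 'e, 'g) cog \<Rightarrow> 'v \<Rightarrow> ('v, 'e, 'g) gpath set monoid" where
  "pi1 X \<sigma> =
     \<lparr>carrier = loops X \<sigma> // htpy X,
      mult = (\<lambda>P Q. \<Union>p\<in>P. \<Union>q\<in>Q. hclass X (pcat X p q)),
      one = hclass X (Const \<sigma> \<one>\<^bsub>grp X \<sigma>\<^esub>)\<rparr>"

definition developable :: "('v, 'e, 'g) cog \<Rightarrow> bool" where
  "developable X \<longleftrightarrow>
     (\<forall>\<sigma>\<in>verts X. inj_on (\<lambda>g. hclass X (Const \<sigma> g)) (carrier (grp X \<sigma>)))"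

section \<open>The universal complex\<close>

definition fwd_path :: "('v, 'e, 'g) cog \<Rightarrow> 'e \<Rightarrow> ('v, 'e, 'g) gpath" where
  "fwd_path X a = Step \<one>\<^bsub>grp X (ini X a)\<^esub> (Fwd a) (Const (ter X a) \<one>\<^bsub>grp X (ter X a)\<^esub>)"

definition uclass :: "('v, 'e, 'g) cog \<Rightarrow> 'v \<Rightarrow> ('v, 'e, 'g) gpath \<Rightarrow> ('v, 'e, 'g) gpath set" where
  "uclass X \<sigma> p =
     {q \<in> paths_from X \<sigma>. \<exists>g\<in>carrier (grp X (ptgt p)).
        hclass X q = hclass X (pcat X p (Const (ptgt p) g))}"

text \<open>\<open>uext X \<sigma> \<lbrakk>p\<rbrakk> a = \<lbrakk>p \<star> (1, a, 1)\<rbrakk>\<close>\<close>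

definition uext ::
    "('v, 'e, 'g) cog \<Rightarrow> 'v \<Rightarrow> ('v, 'e, 'g) gpath set \<Rightarrow> 'e \<Rightarrow> ('v, 'e, 'g) gpath set" where
  "uext X \<sigma> v a = (\<Union>p\<in>v. uclass X \<sigma> (pcat X p (fwd_path X a)))"

definition universal_complex ::
    "('v, 'e, 'g) cog \<Rightarrow> 'v \<Rightarrow>
     (('v, 'e, 'g) gpath set, ('v, 'e, 'g) gpath set \<times> 'e \<times> ('v, 'e, 'g) gpath set) scwol" where
  "universal_complex X \<sigma> =
     \<lparr>verts = uclass X \<sigma> ` paths_from X \<sigma>,
      edges = {(uclass X \<sigma> p, a, uclass X \<sigma> (pcat X p (fwd_path X a))) | p a.
                 p \<in> paths_from X \<sigma> \<and> a \<in> edges X \<and> ini X a = ptgt p},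
      ini = (\<lambda>(v, a, w). v),
      ter = (\<lambda>(v, a, w). w),
      ecomp = (\<lambda>(v', a, w') (v, b, w). (v, ecomp X a b, uext X \<sigma> v (ecomp X a b)))\<rparr>"

definition act_vert ::
    "('v, 'e, 'g) cog \<Rightarrow> 'v \<Rightarrow> ('v, 'e, 'g) gpath set \<Rightarrow>
     ('v, 'e, 'g) gpath set \<Rightarrow> ('v, 'e, 'g) gpath set" where
  "act_vert X \<sigma> Q v = (\<Union>q\<in>Q. \<Union>p\<in>v. uclass X \<sigma> (pcat X q p))"

definition act_edge ::
    "('v, 'e, 'g) cog \<Rightarrow> 'v \<Rightarrow> ('v, 'e, 'g) gpath set \<Rightarrow>
     ('v, 'e, 'g) gpath set \<times> 'e \<times> ('v, 'e, 'g) gpath set \<Rightarrow>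
     ('v, 'e, 'g) gpath set \<times> 'e \<times> ('v, 'e, 'g) gpath set" where
  "act_edge X \<sigma> Q = (\<lambda>(v, a, w). (act_vert X \<sigma> Q v, a, uext X \<sigma> (act_vert X \<sigma> Q v) a))"

definition act_kernel :: "('v, 'e, 'g) cog \<Rightarrow> 'v \<Rightarrow> ('v, 'e, 'g) gpath set set" where
  "act_kernel X \<sigma> =
     {Q \<in> carrier (pi1 X \<sigma>).
        (\<forall>v\<in>verts (universal_complex X \<sigma>). act_vert X \<sigma> Q v = v) \<and>
        (\<forall>x\<in>edges (universal_complex X \<sigma>). act_edge X \<sigma> Q x = x)}"

definition effective :: "('v, 'e, 'g) cog \<Rightarrow> 'v \<Rightarrow> bool" where
  "effective X \<sigma> \<longleftrightarrow> act_kernel X \<sigma> = {\<one>\<^bsub>pi1 X \<sigma>\<^esub>}"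

section \<open>The induced homomorphism\<close>

primrec map_oedge ::
    "('v, 'e, 'g) cog \<Rightarrow> ('w, 'f, 'h) cog \<Rightarrow> ('v, 'e, 'g, 'w, 'f, 'h) cog_mor \<Rightarrow>
     'e oedge \<Rightarrow> ('w, 'f, 'h) gpath" where
  "map_oedge X Y \<phi> (Fwd a) =
     Step \<one>\<^bsub>grp Y (vmap \<phi> (ini X a))\<^esub> (Fwd (emap \<phi> a))
       (Const (vmap \<phi> (ter X a)) (inv\<^bsub>grp Y (vmap \<phi> (ter X a))\<^esub> (elt \<phi> a)))"
| "map_oedge X Y \<phi> (Bwd a) =
     Step (elt \<phi> a) (Bwd (emap \<phi> a)) (Const (vmap \<phi> (ini X a)) \<one>\<^bsub>grp Y (vmap \<phi> (ini X a))\<^esub>)"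

primrec map_path ::
    "('v, 'e, 'g) cog \<Rightarrow> ('w, 'f, 'h) cog \<Rightarrow> ('v, 'e, 'g, 'w, 'f, 'h) cog_mor \<Rightarrow>
     ('v, 'e, 'g) gpath \<Rightarrow> ('w, 'f, 'h) gpath" where
  "map_path X Y \<phi> (Const \<sigma> g) = Const (vmap \<phi> \<sigma>) (lmap \<phi> \<sigma> g)"
| "map_path X Y \<phi> (Step g e p) =
     pcat Y (Const (vmap \<phi> (oini X e)) (lmap \<phi> (oini X e) g))
       (pcat Y (map_oedge X Y \<phi> e) (map_path X Y \<phi> p))"

definition induced ::
    "('v, 'e, 'g) cog \<Rightarrow> ('w, 'f, 'h) cog \<Rightarrow> ('v, 'e, 'g, 'w, 'f, 'h) cog_mor \<Rightarrow>
     ('v, 'e, 'g) gpath set \<Rightarrow> ('w, 'f, 'h) gpath set" where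
  "induced X Y \<phi> P = (\<Union>p\<in>P. hclass Y (map_path X Y \<phi> p))"

section \<open>Homotopy of morphisms and deck transformations\<close>

text \<open>The first two conjuncts say that both morphisms lie over the same morphism of scwols. Values
  outside the carriers are ignored, so homotopy classes of morphisms do not see them.\<close>

definition mor_htpy ::
    "('v, 'e, 'g) cog \<Rightarrow> ('w, 'f, 'h) cog \<Rightarrow> ('v, 'e, 'g, 'w, 'f, 'h) cog_mor \<Rightarrow>
     ('v, 'e, 'g, 'w, 'f, 'h) cog_mor \<Rightarrow> bool" where
  "mor_htpy X Y \<phi> \<eta> \<longleftrightarrow>
     (\<forall>\<sigma>\<in>verts X. vmap \<eta> \<sigma> = vmap \<phi> \<sigma>) \<and> (\<forall>a\<in>edges X. emap \<eta> a = emap \<phi> a) \<and>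
     (\<exists>k. (\<forall>\<sigma>\<in>verts X. k \<sigma> \<in> carrier (grp Y (vmap \<phi> \<sigma>)) \<and>
             (\<forall>g\<in>carrier (grp X \<sigma>).
                lmap \<eta> \<sigma> g = conj_by (grp Y (vmap \<phi> \<sigma>)) (k \<sigma>) (lmap \<phi> \<sigma> g))) \<and>
          (\<forall>a\<in>edges X.
             elt \<eta> a = k (ter X a) \<otimes>\<^bsub>grp Y (vmap \<phi> (ter X a))\<^esub> elt \<phi> a
               \<otimes>\<^bsub>grp Y (vmap \<phi> (ter X a))\<^esub>
               psi Y (emap \<phi> a) (inv\<^bsub>grp Y (vmap \<phi> (ini X a))\<^esub> (k (ini X a)))))"

definition mor_class ::
    "('v, 'e, 'g) cog \<Rightarrow> ('w, 'f, 'h) cog \<Rightarrow> ('v, 'e, 'g, 'w, 'f, 'h) cog_mor \<Rightarrow>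
     ('v, 'e, 'g, 'w, 'f, 'h) cog_mor set" where
  "mor_class X Y \<phi> = {\<eta>. is_cog_mor X Y \<eta> \<and> mor_htpy X Y \<phi> \<eta>}"

definition Deck ::
    "('v, 'e, 'g) cog \<Rightarrow> ('w, 'f, 'h) cog \<Rightarrow> ('v, 'e, 'g, 'w, 'f, 'h) cog_mor \<Rightarrow>
     ('v, 'e, 'g, 'v, 'e, 'g) cog_mor set monoid" where
  "Deck X Y \<phi> =
     \<lparr>carrier = {mor_class X X \<eta> | \<eta>. \<eta> \<in> Aut X \<and> mor_htpy X Y \<phi> (mor_comp X Y \<phi> \<eta>)},
      mult = (\<lambda>A B. \<Union>\<eta>\<^sub>1\<in>A. \<Union>\<eta>\<^sub>2\<in>B. mor_class X X (mor_comp X X \<eta>\<^sub>1 \<eta>\<^sub>2)),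
      one = mor_class X X (mor_id X)\<rparr>"

end

theory Submission
  imports Defs "HOL-Algebra.Zassenhaus"
begin

text \<open>Homotopy classes of paths form a groupoid, and a morphism \<open>\<phi>\<close> of complexes of groups induces a
  functor \<open>ind\<close> between the groupoids. Given \<open>\<phi> \<circ> \<eta> \<sim> \<phi>\<close> via local elements \<open>k\<close>, naturality reads
  \<open>ind (ind\<^sub>\<eta> P) \<cdot> k = k \<cdot> ind P\<close>; choosing a path \<open>C\<close> from \<open>\<sigma>\<^sub>0\<close> to \<open>\<eta>(\<sigma>\<^sub>0)\<close>, the element
  \<open>n = ind C \<cdot> k(\<sigma>\<^sub>0)\<close> normalizes \<open>U\<close>, and its coset \<open>U n\<close> does not depend on \<open>C\<close>, nor on \<open>k\<close>
  because \<open>k\<close> is unique by effectiveness and developability of \<open>Y\<close>. This assignment is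
  multiplicative. A covering has the unique lifting property: every path of \<open>Y\<close> is \<open>ind S \<cdot> h\<close> for a
  path \<open>S\<close> of \<open>X\<close> and a local element \<open>h\<close>, and \<open>(S, h)\<close> is determined up to \<open>(S g, h) \<sim> (S, \<phi>(g) h)\<close>.
  Uniqueness shows that the coset determines the homotopy class of \<open>\<eta>\<close>; existence lets one read off
  \<open>\<eta>\<close> from \<open>n\<close> by decomposing \<open>n \<cdot> ind P\<close> for paths \<open>P\<close> from \<open>\<sigma>\<^sub>0\<close>.\<close>

section \<open>Paths and homotopies\<close>

text \<open>Forward edges lift uniquely along any morphism of scwols, whereas an inverse edge may
  have several lifts at a vertex; which one to take is decided by the local element in front of it,
  through the coset bijection. A lift of a path of \<open>Y\<close> therefore leaves a local element
  over, and these leftovers are the source of the elements \<open>k\<close>. The obstacle to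
  uniqueness is that the paths occurring in a homotopy between two images need not be images
  themselves, so lifts cannot be compared replacement by replacement inside \<open>X\<close>.
  Letting every path of \<open>Y\<close> act on pairs of a path of \<open>X\<close> and a leftover
  reduces the matter to the generating relations. The two halves of the normalizer condition play
  different roles: moving \<open>n\<close> past \<open>U\<close> in one direction already yields a
  morphism \<eta>, and its invertibility comes from treating the inverse of \<open>n\<close> as
  well; conversely an automorphism gives the second half because it is surjective on paths. Products
  in \<open>Deck\<close> are unions over representatives, so neither their well-definedness nor the
  group laws are available beforehand; both are read off from cosets.\<close>

locale cog =
  fixes X :: "('v, 'e, 'g) cog" (structure)
  assumes complex: "complex_of_groups X"
begin

lemma scwol: "is_scwol X"
  using complex by (simp add: complex_of_groups_def)

lemma group_grp [simp, intro]: "\<sigma> \<in> verts X \<Longrightarrow> group (grp X \<sigma>)"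
  using complex by (simp add: complex_of_groups_def)

lemma ini_vert [simp, intro]: "a \<in> edges X \<Longrightarrow> ini X a \<in> verts X"
  and ter_vert [simp, intro]: "a \<in> edges X \<Longrightarrow> ter X a \<in> verts X"
  using scwol by (auto simp: is_scwol_def)

lemma oini_vert [simp, intro]: "uedge e \<in> edges X \<Longrightarrow> oini X e \<in> verts X"
  and oter_vert [simp, intro]: "uedge e \<in> edges X \<Longrightarrow> oter X e \<in> verts X"
  by (cases e; simp)+

lemma composable_iff: "(a, b) \<in> composable X \<longleftrightarrow> a \<in> edges X \<and> b \<in> edges X \<and> ini X a = ter X b"
  by (simp add: composable_def)

lemma ecomp_edge:
  assumes "a \<in> edges X" "b \<in> edges X" "ini X a = ter X b"
  shows "ecomp X a b \<in> edges X" "ini X (ecomp X a b) = ini X b" "ter X (ecomp X a b) = ter X a"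
  using scwol assms by (auto simp: is_scwol_def composable_def)

lemma psi_mon: "a \<in> edges X \<Longrightarrow> psi X a \<in> mon (grp X (ini X a)) (grp X (ter X a))"
  using complex by (simp add: complex_of_groups_def)

lemma psi_group_hom: "a \<in> edges X \<Longrightarrow> group_hom (grp X (ini X a)) (grp X (ter X a)) (psi X a)"
  using psi_mon by (auto simp: mon_def intro!: group_hom.intro group_hom_axioms.intro)

lemma psi_inj: "a \<in> edges X \<Longrightarrow> inj_on (psi X a) (carrier (grp X (ini X a)))"
  using psi_mon by (auto simp: mon_def)

lemma psi_closed [simp, intro]:
  "a \<in> edges X \<Longrightarrow> g \<in> carrier (grp X (ini X a)) \<Longrightarrow> psi X a g \<in> carrier (grp X (ter X a))"
  using group_hom.hom_closed[OF psi_group_hom] by blast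

lemma psi_mult:
  "\<lbrakk>a \<in> edges X; g \<in> carrier (grp X (ini X a)); h \<in> carrier (grp X (ini X a))\<rbrakk> \<Longrightarrow>
   psi X a (g \<otimes>\<^bsub>grp X (ini X a)\<^esub> h) = psi X a g \<otimes>\<^bsub>grp X (ter X a)\<^esub> psi X a h"
  using group_hom.hom_mult[OF psi_group_hom] by blast

lemma psi_one [simp]: "a \<in> edges X \<Longrightarrow> psi X a \<one>\<^bsub>grp X (ini X a)\<^esub> = \<one>\<^bsub>grp X (ter X a)\<^esub>"
  using group_hom.hom_one[OF psi_group_hom] by blast

lemma psi_inv:
  "\<lbrakk>a \<in> edges X; g \<in> carrier (grp X (ini X a))\<rbrakk> \<Longrightarrow>
   psi X a (inv\<^bsub>grp X (ini X a)\<^esub> g) = inv\<^bsub>grp X (ter X a)\<^esub> psi X a g"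
  using group_hom.hom_inv[OF psi_group_hom] by blast

lemma twist_closed:
  "\<lbrakk>a \<in> edges X; b \<in> edges X; ini X a = ter X b\<rbrakk> \<Longrightarrow> twist X a b \<in> carrier (grp X (ter X a))"
  using complex by (auto simp: complex_of_groups_def composable_def)

text \<open>The conjugation law of the twisting elements with the inverse moved across, so that
  later computations need only associativity and substitution.\<close>

lemma twist_psi:
  assumes "a \<in> edges X" "b \<in> edges X" "ini X a = ter X b" "g \<in> carrier (grp X (ini X b))"
  shows "twist X a b \<otimes>\<^bsub>grp X (ter X a)\<^esub> psi X (ecomp X a b) g
    = psi X a (psi X b g) \<otimes>\<^bsub>grp X (ter X a)\<^esub> twist X a b"
proof -
  interpret H: group "grp X (ter X a)" using assms by auto
  have "psi X a (psi X b g) \<in> carrier (grp X (ter X a))"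
    using assms by simp
  moreover have "conj_by (grp X (ter X a)) (twist X a b) (psi X (ecomp X a b) g) = psi X a (psi X b g)"
    using complex assms by (auto simp: complex_of_groups_def composable_def)
  moreover have "psi X (ecomp X a b) g \<in> carrier (grp X (ter X a))"
    using ecomp_edge[OF assms(1-3)] psi_closed[of "ecomp X a b" g] assms(4) by simp
  ultimately show ?thesis
    using twist_closed[OF assms(1-3)] assms(1,2,4) H.inv_solve_right'[of "psi X a (psi X b g)"
        "twist X a b \<otimes>\<^bsub>grp X (ter X a)\<^esub> psi X (ecomp X a b) g" "twist X a b"]
    by (simp add: conj_by_def assms(3))
qed

text \<open>The local group changes with the vertex within a single computation, so the group laws
  are restated as rewrite rules with the vertex as a parameter instead of being taken from one
  interpretation of \<open>group\<close>.\<close>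

lemma grp_one [simp, intro]: "\<sigma> \<in> verts X \<Longrightarrow> \<one>\<^bsub>grp X \<sigma>\<^esub> \<in> carrier (grp X \<sigma>)"
  and grp_mult [simp, intro]: "\<lbrakk>\<sigma> \<in> verts X; g \<in> carrier (grp X \<sigma>); h \<in> carrier (grp X \<sigma>)\<rbrakk> \<Longrightarrow>
    g \<otimes>\<^bsub>grp X \<sigma>\<^esub> h \<in> carrier (grp X \<sigma>)"
  and grp_inv [simp, intro]: "\<lbrakk>\<sigma> \<in> verts X; g \<in> carrier (grp X \<sigma>)\<rbrakk> \<Longrightarrow>
    inv\<^bsub>grp X \<sigma>\<^esub> g \<in> carrier (grp X \<sigma>)"
  and grp_l_one [simp]: "\<lbrakk>\<sigma> \<in> verts X; g \<in> carrier (grp X \<sigma>)\<rbrakk> \<Longrightarrow> \<one>\<^bsub>grp X \<sigma>\<^esub> \<otimes>\<^bsub>grp X \<sigma>\<^esub> g = g"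
  and grp_r_one [simp]: "\<lbrakk>\<sigma> \<in> verts X; g \<in> carrier (grp X \<sigma>)\<rbrakk> \<Longrightarrow> g \<otimes>\<^bsub>grp X \<sigma>\<^esub> \<one>\<^bsub>grp X \<sigma>\<^esub> = g"
  and grp_l_inv [simp]: "\<lbrakk>\<sigma> \<in> verts X; g \<in> carrier (grp X \<sigma>)\<rbrakk> \<Longrightarrow>
    inv\<^bsub>grp X \<sigma>\<^esub> g \<otimes>\<^bsub>grp X \<sigma>\<^esub> g = \<one>\<^bsub>grp X \<sigma>\<^esub>"
  and grp_r_inv [simp]: "\<lbrakk>\<sigma> \<in> verts X; g \<in> carrier (grp X \<sigma>)\<rbrakk> \<Longrightarrow>
    g \<otimes>\<^bsub>grp X \<sigma>\<^esub> inv\<^bsub>grp X \<sigma>\<^esub> g = \<one>\<^bsub>grp X \<sigma>\<^esub>"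
  and grp_inv_inv [simp]: "\<lbrakk>\<sigma> \<in> verts X; g \<in> carrier (grp X \<sigma>)\<rbrakk> \<Longrightarrow>
    inv\<^bsub>grp X \<sigma>\<^esub> (inv\<^bsub>grp X \<sigma>\<^esub> g) = g"
  and grp_assoc: "\<lbrakk>\<sigma> \<in> verts X; g \<in> carrier (grp X \<sigma>); h \<in> carrier (grp X \<sigma>); k \<in> carrier (grp X \<sigma>)\<rbrakk> \<Longrightarrow>
    g \<otimes>\<^bsub>grp X \<sigma>\<^esub> h \<otimes>\<^bsub>grp X \<sigma>\<^esub> k = g \<otimes>\<^bsub>grp X \<sigma>\<^esub> (h \<otimes>\<^bsub>grp X \<sigma>\<^esub> k)"
  by (simp_all add: group.is_monoid group.inv_closed group.l_inv group.r_inv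
        monoid.one_closed monoid.m_closed group.inv_inv monoid.m_assoc)

lemma grp_cancel [simp]:
  assumes "\<sigma> \<in> verts X" "g \<in> carrier (grp X \<sigma>)" "h \<in> carrier (grp X \<sigma>)"
  shows "inv\<^bsub>grp X \<sigma>\<^esub> g \<otimes>\<^bsub>grp X \<sigma>\<^esub> (g \<otimes>\<^bsub>grp X \<sigma>\<^esub> h) = h"
    and "g \<otimes>\<^bsub>grp X \<sigma>\<^esub> (inv\<^bsub>grp X \<sigma>\<^esub> g \<otimes>\<^bsub>grp X \<sigma>\<^esub> h) = h"
  using assms by (simp_all add: grp_assoc[symmetric])

section \<open>Concatenation of paths and multiplication by local elements\<close>

lemma path_vert: "is_path X p \<Longrightarrow> psrc X p \<in> verts X \<and> ptgt p \<in> verts X"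
  by (induction p) auto

lemma lmul_path:
  "\<lbrakk>is_path X p; h \<in> carrier (grp X (psrc X p))\<rbrakk> \<Longrightarrow> is_path X (lmul X h p)"
  by (cases p) auto

lemma psrc_lmul [simp]: "psrc X (lmul X h p) = psrc X p"
  and ptgt_lmul [simp]: "ptgt (lmul X h p) = ptgt p"
  by (cases p; simp)+

lemma lmul_lmul:
  "\<lbrakk>is_path X p; h \<in> carrier (grp X (psrc X p)); k \<in> carrier (grp X (psrc X p))\<rbrakk> \<Longrightarrow>
   lmul X k (lmul X h p) = lmul X (k \<otimes>\<^bsub>grp X (psrc X p)\<^esub> h) p"
  by (cases p) (auto simp: grp_assoc)

lemma lmul_one: "is_path X p \<Longrightarrow> lmul X \<one>\<^bsub>grp X (psrc X p)\<^esub> p = p"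
  by (cases p) auto

lemma psrc_pcat: "ptgt p = psrc X q \<Longrightarrow> psrc X (pcat X p q) = psrc X p"
  by (induction p) auto

lemma ptgt_pcat [simp]: "ptgt (pcat X p q) = ptgt q"
  by (induction p) auto

lemma pcat_path:
  "\<lbrakk>is_path X p; is_path X q; ptgt p = psrc X q\<rbrakk> \<Longrightarrow> is_path X (pcat X p q)"
  by (induction p) (auto simp: lmul_path psrc_pcat)

lemma pcat_lmul:
  "\<lbrakk>is_path X p; is_path X q; ptgt p = psrc X q; h \<in> carrier (grp X (psrc X p))\<rbrakk> \<Longrightarrow>
   pcat X (lmul X h p) q = lmul X h (pcat X p q)"
  by (cases p) (auto simp: lmul_lmul)

lemma pcat_assoc:
  "\<lbrakk>is_path X p; is_path X q; is_path X r; ptgt p = psrc X q; ptgt q = psrc X r\<rbrakk> \<Longrightarrow>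
   pcat X (pcat X p q) r = pcat X p (pcat X q r)"
  by (induction p) (auto simp: pcat_lmul)

lemma pcat_one_right: "is_path X p \<Longrightarrow> pcat X p (Const (ptgt p) \<one>\<^bsub>grp X (ptgt p)\<^esub>) = p"
  by (induction p) auto

lemma pcat_one_left: "is_path X p \<Longrightarrow> pcat X (Const (psrc X p) \<one>\<^bsub>grp X (psrc X p)\<^esub>) p = p"
  by (simp add: lmul_one)

section \<open>Homotopy and its compatibility with concatenation\<close>

lemma replacement_path:
  "replacement X s s' \<Longrightarrow>
   is_path X s \<and> is_path X s' \<and> psrc X s' = psrc X s \<and> ptgt s' = ptgt s"
proof (induction rule: replacement.induct)
  case (compose_fwd a b g k)
  then show ?case
    using ecomp_edge[of a b] twist_closed[of a b] by (auto simp: composable_iff)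
next
  case (compose_bwd a b g k)
  then show ?case
    using ecomp_edge[of a b] twist_closed[of a b] by (auto simp: composable_iff)
qed auto

lemma htpy_stepE:
  assumes "htpy_step X p q"
  obtains p1 s s' p2 where "replacement X s s'" "is_path X p1" "is_path X p2"
      "ptgt p1 = psrc X s" "ptgt s = psrc X p2"
      "p = pcat X p1 (pcat X s p2)" "q = pcat X p1 (pcat X s' p2)"
  using assms unfolding htpy_step_def by blast

lemma htpy_step_path:
  assumes "htpy_step X p q"
  shows "is_path X p \<and> is_path X q \<and> psrc X q = psrc X p \<and> ptgt q = ptgt p"
proof -
  obtain p1 s s' p2 where *: "replacement X s s'" "is_path X p1" "is_path X p2"
      "ptgt p1 = psrc X s" "ptgt s = psrc X p2"
      "p = pcat X p1 (pcat X s p2)" "q = pcat X p1 (pcat X s' p2)"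
    using assms by (rule htpy_stepE)
  with replacement_path[OF *(1)] show ?thesis
    by (auto intro!: pcat_path simp: psrc_pcat)
qed

lemma htpy_equiv: "equiv {p. is_path X p} (htpy X)"
proof (rule equivI)
  show "htpy X \<subseteq> {p. is_path X p} \<times> {p. is_path X p}"
    by (auto simp: htpy_def)
  show "refl_on {p. is_path X p} (htpy X)"
    by (auto simp: refl_on_def htpy_def)
  show "sym (htpy X)"
    by (auto simp: sym_def htpy_def intro: equivclp_sym)
  show "trans (htpy X)"
    by (auto simp: trans_def htpy_def intro: equivclp_trans)
qed

text \<open>Multiplicativity of \<open>F\<close> isolates the middle factor, so an elementary step
  can change the value only through \<open>s\<close>. The operation \<open>f\<close> is arbitrary:
  this covers end points as well as values in a semigroup.\<close>

lemma htpy_invariant: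
  assumes pcat: "\<And>p q. \<lbrakk>is_path X p; is_path X q; ptgt p = psrc X q\<rbrakk> \<Longrightarrow> F (pcat X p q) = f (F p) (F q)"
    and repl: "\<And>s s'. replacement X s s' \<Longrightarrow> F s = F s'"
    and "(p, q) \<in> htpy X"
  shows "F p = F q"
proof -
  have step: "F p = F q" if st: "htpy_step X p q" for p q
  proof -
    obtain p1 s s' p2 where *: "replacement X s s'" "is_path X p1" "is_path X p2"
        "ptgt p1 = psrc X s" "ptgt s = psrc X p2"
        "p = pcat X p1 (pcat X s p2)" "q = pcat X p1 (pcat X s' p2)"
      using st(1) by (rule htpy_stepE)
    with replacement_path[OF *(1)] repl[OF *(1)] show ?thesis
      by (simp add: pcat pcat_path psrc_pcat)
  qed
  have "equivclp (htpy_step X) p q"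
    using assms(3) by (simp add: htpy_def)
  then show ?thesis
    by (induction rule: equivclp_induct) (auto dest: step)
qed

lemma htpy_ends:
  assumes "(p, q) \<in> htpy X"
  shows "is_path X p" "is_path X q" "psrc X q = psrc X p" "ptgt q = ptgt p"
proof -
  show "is_path X p" "is_path X q" using assms by (auto simp: htpy_def)
  \<comment> \<open>The pair of end points is multiplicative for the operation that keeps the first
    source and the last target.\<close>
  have "(psrc X p, ptgt p) = (psrc X q, ptgt q)"
    by (rule htpy_invariant[where F = "\<lambda>p. (psrc X p, ptgt p)" and f = "\<lambda>x y. (fst x, snd y)"])
       (use assms replacement_path in \<open>auto simp: psrc_pcat\<close>)
  then show "psrc X q = psrc X p" "ptgt q = ptgt p" by auto
qed

lemma htpy_refl: "is_path X p \<Longrightarrow> (p, p) \<in> htpy X"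
  using htpy_equiv by (auto simp: equiv_def refl_on_def)

lemma htpy_sym: "(p, q) \<in> htpy X \<Longrightarrow> (q, p) \<in> htpy X"
  using htpy_equiv by (auto simp: equiv_def sym_def)

lemma htpy_trans: "(p, q) \<in> htpy X \<Longrightarrow> (q, r) \<in> htpy X \<Longrightarrow> (p, r) \<in> htpy X"
  using htpy_equiv unfolding equiv_def trans_def by blast

text \<open>The prefix \<open>r\<close> is absorbed into the piece \<open>p1\<close> of each
  elementary step. Equality of sources is carried through the induction because reassociating
  requires matching ends at every intermediate path.\<close>

lemma htpy_pcat_left:
  assumes "is_path X r" "(p, q) \<in> htpy X" "ptgt r = psrc X p"
  shows "(pcat X r p, pcat X r q) \<in> htpy X"
proof -
  have stp: "htpy_step X (pcat X r p) (pcat X r q)"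
    if st: "htpy_step X p q" "psrc X p = ptgt r" for p q
  proof -
    obtain p1 s s' p2 where *: "replacement X s s'" "is_path X p1" "is_path X p2"
        "ptgt p1 = psrc X s" "ptgt s = psrc X p2"
        "p = pcat X p1 (pcat X s p2)" "q = pcat X p1 (pcat X s' p2)"
      using st(1) by (rule htpy_stepE)
    note s = replacement_path[OF *(1)]
    have "ptgt r = psrc X p1" using st * s by (simp add: psrc_pcat)
    then have "htpy_step X (pcat X (pcat X r p1) (pcat X s p2)) (pcat X (pcat X r p1) (pcat X s' p2))"
      unfolding htpy_step_def using * s assms(1)
      by (intro exI[of _ "pcat X r p1"] exI[of _ s] exI[of _ s'] exI[of _ p2]) (auto intro: pcat_path)
    with * s assms(1) \<open>ptgt r = psrc X p1\<close> show ?thesis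
      by (simp add: pcat_assoc pcat_path psrc_pcat)
  qed
  have "equivclp (htpy_step X) p q" using assms(2) by (simp add: htpy_def)
  then have "psrc X q = psrc X p \<and> equivclp (htpy_step X) (pcat X r p) (pcat X r q)"
  proof (induction rule: equivclp_induct)
    case base
    show ?case by simp
  next
    case (step y z)
    then have "psrc X z = psrc X y" by (auto dest: htpy_step_path)
    moreover have "htpy_step X (pcat X r y) (pcat X r z) \<or> htpy_step X (pcat X r z) (pcat X r y)"
      using step(2) stp assms(3) step(3) \<open>psrc X z = psrc X y\<close> by auto
    ultimately show ?case
      using step(3) by (auto intro: equivclp_into_equivclp)
  qed
  then show ?thesis
    using assms htpy_ends[OF assms(2)] by (simp add: htpy_def pcat_path)
qed

lemma htpy_pcat_right:
  assumes "is_path X r" "(p, q) \<in> htpy X" "ptgt p = psrc X r"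
  shows "(pcat X p r, pcat X q r) \<in> htpy X"
proof -
  have stp: "htpy_step X (pcat X p r) (pcat X q r)"
    if st: "htpy_step X p q" "ptgt p = psrc X r" for p q
  proof -
    obtain p1 s s' p2 where *: "replacement X s s'" "is_path X p1" "is_path X p2"
        "ptgt p1 = psrc X s" "ptgt s = psrc X p2"
        "p = pcat X p1 (pcat X s p2)" "q = pcat X p1 (pcat X s' p2)"
      using st(1) by (rule htpy_stepE)
    note s = replacement_path[OF *(1)]
    have "ptgt p2 = psrc X r" using st * s by simp
    then have "htpy_step X (pcat X p1 (pcat X s (pcat X p2 r))) (pcat X p1 (pcat X s' (pcat X p2 r)))"
      unfolding htpy_step_def using * s assms(1)
      by (intro exI[of _ p1] exI[of _ s] exI[of _ s'] exI[of _ "pcat X p2 r"]) (auto intro: pcat_path simp: psrc_pcat)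
    with * s assms(1) \<open>ptgt p2 = psrc X r\<close> show ?thesis
      by (simp add: pcat_assoc pcat_path psrc_pcat)
  qed
  have "equivclp (htpy_step X) p q" using assms(2) by (simp add: htpy_def)
  then have "ptgt q = ptgt p \<and> equivclp (htpy_step X) (pcat X p r) (pcat X q r)"
  proof (induction rule: equivclp_induct)
    case base
    show ?case by simp
  next
    case (step y z)
    then have "ptgt z = ptgt y" by (auto dest: htpy_step_path)
    moreover have "htpy_step X (pcat X y r) (pcat X z r) \<or> htpy_step X (pcat X z r) (pcat X y r)"
      using step(2) stp assms(3) step(3) \<open>ptgt z = ptgt y\<close> by auto
    ultimately show ?case
      using step(3) by (auto intro: equivclp_into_equivclp)
  qed
  then show ?thesis
    using assms htpy_ends[OF assms(2)] by (simp add: htpy_def pcat_path)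
qed

lemma htpy_pcat:
  "\<lbrakk>(p, p') \<in> htpy X; (q, q') \<in> htpy X; ptgt p = psrc X q\<rbrakk> \<Longrightarrow> (pcat X p q, pcat X p' q') \<in> htpy X"
  by (rule htpy_trans[OF htpy_pcat_right htpy_pcat_left]) (auto dest: htpy_ends)

lemma replacement_htpy: "replacement X s s' \<Longrightarrow> (s, s') \<in> htpy X"
proof -
  assume r: "replacement X s s'"
  note s = replacement_path[OF r]
  have "htpy_step X s s'"
    unfolding htpy_step_def
    by (rule exI[of _ "Const (psrc X s) \<one>\<^bsub>grp X (psrc X s)\<^esub>"], rule exI[of _ s], rule exI[of _ s'],
        rule exI[of _ "Const (ptgt s) \<one>\<^bsub>grp X (ptgt s)\<^esub>"])
      (use s r path_vert[of s] pcat_one_left[of s] pcat_one_left[of s'] pcat_one_right[of s] pcat_one_right[of s']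
        in simp)
  then show ?thesis using s by (auto simp: htpy_def)
qed

end

section \<open>The fundamental groupoid\<close>

text \<open>Classes that are not composable have the empty product, so that associativity needs no side
  conditions.\<close>

definition hmul ::
    "('v, 'e, 'g) cog \<Rightarrow> ('v, 'e, 'g) gpath set \<Rightarrow> ('v, 'e, 'g) gpath set \<Rightarrow> ('v, 'e, 'g) gpath set"
    (infixl "\<odot>\<index>" 70) where
  "P \<odot>\<^bsub>X\<^esub> Q = {r. \<exists>p\<in>P. \<exists>q\<in>Q. is_path X p \<and> is_path X q \<and> ptgt p = psrc X q \<and>
                        (pcat X p q, r) \<in> htpy X}"

text \<open>The hom-sets of the fundamental groupoid, whose objects are the vertices.\<close>

definition arr :: "('v, 'e, 'g) cog \<Rightarrow> 'v \<Rightarrow> 'v \<Rightarrow> ('v, 'e, 'g) gpath set set" where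
  "arr X \<sigma> \<rho> = hclass X ` {p. is_path X p \<and> psrc X p = \<sigma> \<and> ptgt p = \<rho>}"

text \<open>The canonical map of a local group into the vertex group of the groupoid; developability
  is its injectivity at every vertex.\<close>

definition loc :: "('v, 'e, 'g) cog \<Rightarrow> 'v \<Rightarrow> 'g \<Rightarrow> ('v, 'e, 'g) gpath set" where
  "loc X \<sigma> g = hclass X (Const \<sigma> g)"

definition oarr :: "('v, 'e, 'g) cog \<Rightarrow> 'e oedge \<Rightarrow> ('v, 'e, 'g) gpath set" where
  "oarr X e = hclass X (Step \<one>\<^bsub>grp X (oini X e)\<^esub> e (Const (oter X e) \<one>\<^bsub>grp X (oter X e)\<^esub>))"

text \<open>The end points are quantified inside the description, so that the inverse is a function
  of the class alone; a class determines them by \<open>arr_unique\<close>.\<close>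

definition hinv :: "('v, 'e, 'g) cog \<Rightarrow> ('v, 'e, 'g) gpath set \<Rightarrow> ('v, 'e, 'g) gpath set" where
  "hinv X P = (THE Q. \<exists>\<sigma> \<rho>. P \<in> arr X \<sigma> \<rho> \<and> Q \<in> arr X \<rho> \<sigma> \<and>
     P \<odot>\<^bsub>X\<^esub> Q = loc X \<sigma> \<one>\<^bsub>grp X \<sigma>\<^esub> \<and> Q \<odot>\<^bsub>X\<^esub> P = loc X \<rho> \<one>\<^bsub>grp X \<rho>\<^esub>)"

text \<open>The relations of homotopy in an arbitrary semigroup; the two instances are the classes of paths of
  a second complex, and binary relations under composition.\<close>

locale cog_rep = cog X for X :: "('v, 'e, 'g) cog" (structure) +
  fixes op :: "'b \<Rightarrow> 'b \<Rightarrow> 'b" (infixl "\<star>" 70)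
    and A :: "'v \<Rightarrow> 'g \<Rightarrow> 'b" and B :: "'e oedge \<Rightarrow> 'b"
  assumes assoc: "x \<star> y \<star> z = x \<star> (y \<star> z)"
    and A_mult: "\<lbrakk>\<sigma> \<in> verts X; g \<in> carrier (grp X \<sigma>); h \<in> carrier (grp X \<sigma>)\<rbrakk> \<Longrightarrow>
      A \<sigma> g \<star> A \<sigma> h = A \<sigma> (g \<otimes>\<^bsub>grp X \<sigma>\<^esub> h)"
    and B_one_left: "uedge e \<in> edges X \<Longrightarrow> A (oini X e) \<one>\<^bsub>grp X (oini X e)\<^esub> \<star> B e = B e"
    and B_one_right: "uedge e \<in> edges X \<Longrightarrow> B e \<star> A (oter X e) \<one>\<^bsub>grp X (oter X e)\<^esub> = B e"
    and slide: "\<lbrakk>a \<in> edges X; g \<in> carrier (grp X (ini X a))\<rbrakk> \<Longrightarrow>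
      A (ini X a) g \<star> B (Fwd a) = B (Fwd a) \<star> A (ter X a) (psi X a g)"
    and fwd_bwd: "a \<in> edges X \<Longrightarrow> B (Fwd a) \<star> B (Bwd a) = A (ini X a) \<one>\<^bsub>grp X (ini X a)\<^esub>"
    and bwd_fwd: "a \<in> edges X \<Longrightarrow> B (Bwd a) \<star> B (Fwd a) = A (ter X a) \<one>\<^bsub>grp X (ter X a)\<^esub>"
    and compose: "\<lbrakk>a \<in> edges X; b \<in> edges X; ini X a = ter X b\<rbrakk> \<Longrightarrow>
      B (Fwd b) \<star> (B (Fwd a) \<star> A (ter X a) (twist X a b)) = B (Fwd (ecomp X a b))"
begin

primrec eval :: "('v, 'e, 'g) gpath \<Rightarrow> 'b" where
  "eval (Const \<sigma> g) = A \<sigma> g"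
| "eval (Step g e p) = A (oini X e) g \<star> (B e \<star> eval p)"

lemma A_mult_left: "\<lbrakk>\<sigma> \<in> verts X; g \<in> carrier (grp X \<sigma>); h \<in> carrier (grp X \<sigma>)\<rbrakk> \<Longrightarrow>
      A \<sigma> g \<star> (A \<sigma> h \<star> x) = A \<sigma> (g \<otimes>\<^bsub>grp X \<sigma>\<^esub> h) \<star> x"
  by (simp add: assoc[symmetric] A_mult)

lemma eval_lmul:
  "\<lbrakk>is_path X p; h \<in> carrier (grp X (psrc X p))\<rbrakk> \<Longrightarrow> eval (lmul X h p) = A (psrc X p) h \<star> eval p"
  by (cases p) (auto simp: A_mult A_mult_left)

lemma eval_pcat:
  "\<lbrakk>is_path X p; is_path X q; ptgt p = psrc X q\<rbrakk> \<Longrightarrow> eval (pcat X p q) = eval p \<star> eval q"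
  by (induction p) (auto simp: eval_lmul assoc)

text \<open>The rule for inverse edges follows from the one for forward edges: insert the round trip
  \<open>B (Fwd a) \<star> B (Bwd a)\<close> on the right, slide the local element over the forward
  edge and cancel on the left.\<close>

lemma slide_bwd:
  assumes "a \<in> edges X" "h \<in> carrier (grp X (ini X a))"
  shows "B (Bwd a) \<star> A (ini X a) h = A (ter X a) (psi X a h) \<star> B (Bwd a)"
proof -
  have "B (Bwd a) \<star> A (ini X a) h = B (Bwd a) \<star> (A (ini X a) h \<star> (B (Fwd a) \<star> B (Bwd a)))"
    using assms by (simp add: fwd_bwd A_mult)
  also have "\<dots> = B (Bwd a) \<star> B (Fwd a) \<star> (A (ter X a) (psi X a h) \<star> B (Bwd a))"
    using slide[OF assms] by (metis assoc)
  also have "\<dots> = A (ter X a) (psi X a h) \<star> B (Bwd a)"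
    using assms by (simp add: bwd_fwd A_mult_left)
  finally show ?thesis .
qed

text \<open>The twist moved to the other side, which is the shape of the replacement rule. Paths run
  from left to right while \<open>ecomp X a b\<close> traverses \<open>b\<close> before
  \<open>a\<close>, hence the reversed order of the factors.\<close>

lemma compose_inv:
  assumes "a \<in> edges X" "b \<in> edges X" "ini X a = ter X b"
  shows "B (Fwd b) \<star> B (Fwd a) = B (Fwd (ecomp X a b)) \<star> A (ter X a) (inv\<^bsub>grp X (ter X a)\<^esub> twist X a b)"
proof -
  note t = twist_closed[OF assms]
  have "B (Fwd (ecomp X a b)) \<star> A (ter X a) (inv\<^bsub>grp X (ter X a)\<^esub> twist X a b)
     = B (Fwd b) \<star> (B (Fwd a) \<star> (A (ter X a) (twist X a b) \<star> A (ter X a) (inv\<^bsub>grp X (ter X a)\<^esub> twist X a b)))"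
    using assms by (simp add: compose[symmetric] assoc)
  also have "\<dots> = B (Fwd b) \<star> B (Fwd a)"
    using assms t B_one_right[of "Fwd a"] by (simp add: A_mult)
  finally show ?thesis ..
qed

text \<open>The left-hand side is inverse to \<open>B (Fwd b) \<star> B (Fwd a)\<close>, so the law
  arises by inverting the forward composition law.\<close>

lemma compose_bwd:
  assumes "a \<in> edges X" "b \<in> edges X" "ini X a = ter X b"
  shows "B (Bwd a) \<star> B (Bwd b) = A (ter X a) (twist X a b) \<star> B (Bwd (ecomp X a b))"
proof -
  note t = twist_closed[OF assms] and ab = ecomp_edge[OF assms]
  let ?g = "twist X a b"
  let ?g' = "inv\<^bsub>grp X (ter X a)\<^esub> ?g"
  \<comment> \<open>The unit is expanded into the round trip along \<open>b\<close> and
    \<open>a\<close> and back, so that the forward part can be replaced by the composite edge and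
    cancelled.\<close>
  have *: "A (ini X b) \<one>\<^bsub>grp X (ini X b)\<^esub> = B (Fwd b) \<star> B (Fwd a) \<star> B (Bwd a) \<star> B (Bwd b)"
    using assms fwd_bwd[of a] fwd_bwd[of b] B_one_right[of "Fwd b"]
    by (simp add: assoc)
  have "B (Bwd (ecomp X a b)) = B (Bwd (ecomp X a b)) \<star> A (ini X b) \<one>\<^bsub>grp X (ini X b)\<^esub>"
    using ab B_one_right[of "Bwd (ecomp X a b)"] by simp
  also have "\<dots> = B (Bwd (ecomp X a b)) \<star> B (Fwd (ecomp X a b)) \<star> A (ter X a) ?g' \<star> B (Bwd a) \<star> B (Bwd b)"
    unfolding * compose_inv[OF assms] by (simp add: assoc)
  also have "\<dots> = A (ter X a) ?g' \<star> (B (Bwd a) \<star> B (Bwd b))"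
    using assms t ab bwd_fwd[of "ecomp X a b"] by (simp add: assoc A_mult_left)
  finally have "A (ter X a) ?g \<star> B (Bwd (ecomp X a b))
      = A (ter X a) ?g \<star> (A (ter X a) ?g' \<star> (B (Bwd a) \<star> B (Bwd b)))" by simp
  also have "\<dots> = A (ter X a) \<one>\<^bsub>grp X (ter X a)\<^esub> \<star> B (Bwd a) \<star> B (Bwd b)"
    using assms t by (simp add: A_mult_left assoc)
  also have "\<dots> = B (Bwd a) \<star> B (Bwd b)"
    using assms B_one_left[of "Bwd a"] by simp
  finally show ?thesis ..
qed

lemma eval_replacement: "replacement X s s' \<Longrightarrow> eval s = eval s'"
proof (induction rule: replacement.induct)
  case (slide_fwd a k g h)
  have "A (ini X a) (k \<otimes>\<^bsub>grp X (ini X a)\<^esub> g) \<star> (B (Fwd a) \<star> A (ter X a) h)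
    = A (ini X a) k \<star> ((A (ini X a) g \<star> B (Fwd a)) \<star> A (ter X a) h)"
    using slide_fwd by (simp add: A_mult[symmetric] assoc)
  also have "\<dots> = A (ini X a) k \<star> (B (Fwd a) \<star> (A (ter X a) (psi X a g) \<star> A (ter X a) h))"
    using slide_fwd by (simp only: slide assoc)
  finally show ?case using slide_fwd by (simp add: A_mult)
next
  case (slide_bwd a g h k)
  have "A (ter X a) g \<star> (B (Bwd a) \<star> (A (ini X a) h \<star> A (ini X a) k))
    = A (ter X a) g \<star> ((B (Bwd a) \<star> A (ini X a) h) \<star> A (ini X a) k)"
    by (simp add: assoc)
  also have "\<dots> = A (ter X a) g \<star> A (ter X a) (psi X a h) \<star> (B (Bwd a) \<star> A (ini X a) k)"
    using slide_bwd by (simp only: cog_rep.slide_bwd[OF cog_rep_axioms] assoc)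
  finally show ?case using slide_bwd by (simp add: A_mult)
next
  case (cancel_fwd a g h k)
  then have "B (Fwd a) \<star> (A (ter X a) (psi X a h) \<star> (B (Bwd a) \<star> A (ini X a) k))
    = A (ini X a) h \<star> (A (ini X a) \<one>\<^bsub>grp X (ini X a)\<^esub> \<star> A (ini X a) k)"
    by (simp add: fwd_bwd[symmetric] assoc[symmetric] slide)
  with cancel_fwd show ?case by (simp add: A_mult grp_assoc)
next
  case (cancel_bwd b g h k)
  then have "B (Bwd b) \<star> (A (ini X b) h \<star> (B (Fwd b) \<star> A (ter X b) k))
    = A (ter X b) (psi X b h) \<star> (A (ter X b) \<one>\<^bsub>grp X (ter X b)\<^esub> \<star> A (ter X b) k)"
    by (simp add: bwd_fwd[symmetric] assoc[symmetric] cog_rep.slide_bwd[OF cog_rep_axioms])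
  with cancel_bwd show ?case by (simp add: A_mult grp_assoc)
next
  case (compose_fwd a b g k)
  then have ab: "a \<in> edges X" "b \<in> edges X" "ini X a = ter X b" by (auto simp: composable_iff)
  have 1: "B (Fwd b) \<star> (A (ini X a) \<one>\<^bsub>grp X (ini X a)\<^esub> \<star> (B (Fwd a) \<star> A (ter X a) k))
      = B (Fwd b) \<star> B (Fwd a) \<star> A (ter X a) k"
    using B_one_left[of "Fwd a"] ab by (simp add: assoc[symmetric])
  have "B (Fwd b) \<star> B (Fwd a) \<star> A (ter X a) k
    = B (Fwd (ecomp X a b)) \<star> A (ter X a) (inv\<^bsub>grp X (ter X a)\<^esub> twist X a b \<otimes>\<^bsub>grp X (ter X a)\<^esub> k)"
    unfolding compose_inv[OF ab] using ab twist_closed[OF ab] compose_fwd by (simp add: assoc A_mult)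
  with compose_fwd 1 ab ecomp_edge[OF ab] show ?case by simp
next
  case (compose_bwd a b g k)
  then have ab: "a \<in> edges X" "b \<in> edges X" "ini X a = ter X b" by (auto simp: composable_iff)
  have 1: "B (Bwd a) \<star> (A (ini X a) \<one>\<^bsub>grp X (ini X a)\<^esub> \<star> (B (Bwd b) \<star> A (ini X b) k))
      = B (Bwd a) \<star> B (Bwd b) \<star> A (ini X b) k"
    using B_one_right[of "Bwd a"] ab by (simp add: assoc[symmetric])
  with compose_bwd ab ecomp_edge[OF ab] twist_closed[OF ab] show ?case
    by (simp add: cog_rep.compose_bwd[OF cog_rep_axioms] assoc A_mult_left)
qed

lemma eval_htpy: "(p, q) \<in> htpy X \<Longrightarrow> eval p = eval q"
  by (rule htpy_invariant[where f = "(\<star>)"]) (auto simp: eval_pcat eval_replacement)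

end

section \<open>Classes of paths as a groupoid generated by local elements and edges\<close>

context cog
begin

lemma hclass_eq_iff: "is_path X p \<Longrightarrow> hclass X p = hclass X q \<longleftrightarrow> (p, q) \<in> htpy X"
  unfolding hclass_def
  using equiv_class_eq[OF htpy_equiv, of p q] htpy_refl[of p] htpy_sym[of q p] by blast

lemma in_hclass_iff: "q \<in> hclass X p \<longleftrightarrow> (p, q) \<in> htpy X"
  by (simp add: hclass_def)

lemma hmulI:
  "\<lbrakk>p \<in> P; q \<in> Q; is_path X p; is_path X q; ptgt p = psrc X q; (pcat X p q, r) \<in> htpy X\<rbrakk> \<Longrightarrow>
   r \<in> P \<odot> Q"
  unfolding hmul_def by blast

lemma hmulE:
  assumes "r \<in> P \<odot> Q"
  obtains p q where "p \<in> P" "q \<in> Q" "is_path X p" "is_path X q" "ptgt p = psrc X q"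
    "(pcat X p q, r) \<in> htpy X"
  using assms unfolding hmul_def by blast

lemma hmul_hclass:
  assumes "is_path X p" "is_path X q" "ptgt p = psrc X q"
  shows "hclass X p \<odot> hclass X q = hclass X (pcat X p q)"
proof -
  have "(pcat X p' q', r) \<in> htpy X \<Longrightarrow> (pcat X p q, r) \<in> htpy X"
    if "(p, p') \<in> htpy X" "(q, q') \<in> htpy X" for p' q' r
    using htpy_pcat[OF that assms(3)] htpy_trans by blast
  then show ?thesis
    using assms htpy_refl[of p] htpy_refl[of q] hmulI[of p "hclass X p" q "hclass X q"]
    by (auto simp: in_hclass_iff elim: hmulE)
qed

lemma hmul_assoc: "P \<odot> Q \<odot> R = P \<odot> (Q \<odot> R)"
proof -
  \<comment> \<open>Both bracketings are compared with the paths homotopic to a composite of three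
    matching representatives; when nothing matches all three sets are empty.\<close>
  let ?S = "{r. \<exists>p\<in>P. \<exists>q\<in>Q. \<exists>t\<in>R. is_path X p \<and> is_path X q \<and> is_path X t \<and>
    ptgt p = psrc X q \<and> ptgt q = psrc X t \<and> (pcat X p (pcat X q t), r) \<in> htpy X}"
  have "P \<odot> Q \<odot> R = ?S"
  proof (intro equalityI subsetI)
    fix r assume "r \<in> P \<odot> Q \<odot> R"
    then obtain p q s t where *: "p \<in> P" "q \<in> Q" "t \<in> R" "is_path X p" "is_path X q" "is_path X t"
        "ptgt p = psrc X q" "(pcat X p q, s) \<in> htpy X" "ptgt s = psrc X t" "(pcat X s t, r) \<in> htpy X"
      unfolding hmul_def by blast
    then have "ptgt q = psrc X t" using htpy_ends[OF *(8)] by simp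
    with * have "(pcat X p (pcat X q t), r) \<in> htpy X"
      using htpy_pcat_right[OF *(6,8)] by (auto simp: pcat_assoc intro: htpy_trans)
    with * \<open>ptgt q = psrc X t\<close> show "r \<in> ?S" by blast
  next
    fix r assume "r \<in> ?S"
    then obtain p q t where *: "p \<in> P" "q \<in> Q" "t \<in> R" "is_path X p" "is_path X q" "is_path X t"
        "ptgt p = psrc X q" "ptgt q = psrc X t" "(pcat X p (pcat X q t), r) \<in> htpy X" by blast
    then have "pcat X p q \<in> P \<odot> Q"
      by (intro hmulI[of p P q Q] htpy_refl pcat_path)
    moreover have "(pcat X (pcat X p q) t, r) \<in> htpy X" using * by (simp add: pcat_assoc)
    ultimately show "r \<in> P \<odot> Q \<odot> R" using *
      by (intro hmulI[of "pcat X p q" _ t R]) (auto simp: pcat_path)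
  qed
  moreover have "P \<odot> (Q \<odot> R) = ?S"
  proof (intro equalityI subsetI)
    fix r assume "r \<in> P \<odot> (Q \<odot> R)"
    then obtain p q s t where *: "p \<in> P" "q \<in> Q" "t \<in> R" "is_path X p" "is_path X q" "is_path X t"
        "ptgt q = psrc X t" "(pcat X q t, s) \<in> htpy X" "ptgt p = psrc X s" "(pcat X p s, r) \<in> htpy X"
      unfolding hmul_def by blast
    then have "ptgt p = psrc X q" using htpy_ends[OF *(8)] by (simp add: psrc_pcat)
    with * have "(pcat X p (pcat X q t), r) \<in> htpy X"
      using htpy_pcat_left[OF *(4,8)] by (auto simp: psrc_pcat intro: htpy_trans)
    with * \<open>ptgt p = psrc X q\<close> show "r \<in> ?S" by blast
  next
    fix r assume "r \<in> ?S"
    then obtain p q t where *: "p \<in> P" "q \<in> Q" "t \<in> R" "is_path X p" "is_path X q" "is_path X t"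
        "ptgt p = psrc X q" "ptgt q = psrc X t" "(pcat X p (pcat X q t), r) \<in> htpy X" by blast
    then have "pcat X q t \<in> Q \<odot> R"
      by (intro hmulI[of q Q t R] htpy_refl pcat_path)
    with * show "r \<in> P \<odot> (Q \<odot> R)"
      by (intro hmulI[of p P "pcat X q t"]) (auto simp: psrc_pcat pcat_path)
  qed
  ultimately show ?thesis by simp
qed

lemma arrE:
  assumes "P \<in> arr X \<sigma> \<rho>"
  obtains p where "P = hclass X p" "is_path X p" "psrc X p = \<sigma>" "ptgt p = \<rho>"
  using assms by (auto simp: arr_def)

lemma arr_hclass: "is_path X p \<Longrightarrow> hclass X p \<in> arr X (psrc X p) (ptgt p)"
  by (auto simp: arr_def)

lemma arr_verts: "P \<in> arr X \<sigma> \<rho> \<Longrightarrow> \<sigma> \<in> verts X \<and> \<rho> \<in> verts X"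
  using path_vert by (auto simp: arr_def)

lemma arr_unique: "\<lbrakk>P \<in> arr X \<sigma> \<rho>; P \<in> arr X \<sigma>' \<rho>'\<rbrakk> \<Longrightarrow> \<sigma>' = \<sigma> \<and> \<rho>' = \<rho>"
  by (auto elim!: arrE simp: hclass_eq_iff dest: htpy_ends)

lemma hmul_arr [simp, intro]: "\<lbrakk>P \<in> arr X \<sigma> \<rho>; Q \<in> arr X \<rho> \<tau>\<rbrakk> \<Longrightarrow> P \<odot> Q \<in> arr X \<sigma> \<tau>"
  by (elim arrE) (use arr_hclass[OF pcat_path] in \<open>auto simp: hmul_hclass psrc_pcat\<close>)

lemma loc_arr [simp, intro]: "\<lbrakk>\<sigma> \<in> verts X; g \<in> carrier (grp X \<sigma>)\<rbrakk> \<Longrightarrow> loc X \<sigma> g \<in> arr X \<sigma> \<sigma>"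
  using arr_hclass[of "Const \<sigma> g"] by (simp add: loc_def)

lemma oarr_arr [simp, intro]: "uedge e \<in> edges X \<Longrightarrow> oarr X e \<in> arr X (oini X e) (oter X e)"
  using arr_hclass[of "Step \<one>\<^bsub>grp X (oini X e)\<^esub> e (Const (oter X e) \<one>\<^bsub>grp X (oter X e)\<^esub>)"]
  by (simp add: oarr_def)

lemma oarr_Fwd_arr [simp, intro]: "a \<in> edges X \<Longrightarrow> oarr X (Fwd a) \<in> arr X (ini X a) (ter X a)"
  and oarr_Bwd_arr [simp, intro]: "a \<in> edges X \<Longrightarrow> oarr X (Bwd a) \<in> arr X (ter X a) (ini X a)"
  using oarr_arr[of "Fwd a"] oarr_arr[of "Bwd a"] by simp_all

lemma loc_mult: "\<lbrakk>\<sigma> \<in> verts X; g \<in> carrier (grp X \<sigma>); h \<in> carrier (grp X \<sigma>)\<rbrakk> \<Longrightarrow>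
    loc X \<sigma> g \<odot> loc X \<sigma> h = loc X \<sigma> (g \<otimes>\<^bsub>grp X \<sigma>\<^esub> h)"
  by (simp add: loc_def hmul_hclass)

lemma one_left [simp]: "P \<in> arr X \<sigma> \<rho> \<Longrightarrow> loc X \<sigma> \<one>\<^bsub>grp X \<sigma>\<^esub> \<odot> P = P"
  by (auto elim!: arrE simp: loc_def hmul_hclass lmul_one path_vert)

lemma one_right [simp]: "P \<in> arr X \<sigma> \<rho> \<Longrightarrow> P \<odot> loc X \<rho> \<one>\<^bsub>grp X \<rho>\<^esub> = P"
  by (auto elim!: arrE simp: loc_def hmul_hclass pcat_one_right path_vert)

lemma hclass_Step:
  assumes "is_path X (Step g e p)"
  shows "hclass X (Step g e p) = loc X (oini X e) g \<odot> (oarr X e \<odot> hclass X p)"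
  using assms lmul_one[of p] by (simp add: loc_def oarr_def hmul_hclass psrc_pcat)

lemma hclass_replacement: "replacement X s s' \<Longrightarrow> hclass X s = hclass X s'"
  using replacement_htpy replacement_path by (simp add: hclass_eq_iff)

text \<open>Each law is a replacement rule with neutral elements in the free places. The instance
  makes the derived laws for inverse edges available in the groupoid.\<close>

lemma cog_rep_hmul: "cog_rep X (hmul X) (loc X) (oarr X)"
proof
  show "P \<odot> Q \<odot> R = P \<odot> (Q \<odot> R)" for P Q R by (rule hmul_assoc)
next
  fix a g assume a: "a \<in> edges X" "g \<in> carrier (grp X (ini X a))"
  with hclass_replacement[OF replacement.slide_fwd[of a X "\<one>\<^bsub>grp X (ini X a)\<^esub>" g "\<one>\<^bsub>grp X (ter X a)\<^esub>"]]
  show "loc X (ini X a) g \<odot> oarr X (Fwd a) = oarr X (Fwd a) \<odot> loc X (ter X a) (psi X a g)"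
    by (simp add: loc_def oarr_def hmul_hclass)
next
  fix a assume a: "a \<in> edges X"
  with hclass_replacement[OF replacement.cancel_fwd[of a X "\<one>\<^bsub>grp X (ini X a)\<^esub>" "\<one>\<^bsub>grp X (ini X a)\<^esub>" "\<one>\<^bsub>grp X (ini X a)\<^esub>"]]
  show "oarr X (Fwd a) \<odot> oarr X (Bwd a) = loc X (ini X a) \<one>\<^bsub>grp X (ini X a)\<^esub>"
    by (simp add: loc_def oarr_def hmul_hclass)
  from a hclass_replacement[OF replacement.cancel_bwd[of a X "\<one>\<^bsub>grp X (ter X a)\<^esub>" "\<one>\<^bsub>grp X (ini X a)\<^esub>" "\<one>\<^bsub>grp X (ter X a)\<^esub>"]]
  show "oarr X (Bwd a) \<odot> oarr X (Fwd a) = loc X (ter X a) \<one>\<^bsub>grp X (ter X a)\<^esub>"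
    by (simp add: loc_def oarr_def hmul_hclass)
next
  fix a b assume ab: "a \<in> edges X" "b \<in> edges X" "ini X a = ter X b"
  then show "oarr X (Fwd b) \<odot> (oarr X (Fwd a) \<odot> loc X (ter X a) (twist X a b)) = oarr X (Fwd (ecomp X a b))"
    using hclass_replacement[OF replacement.compose_fwd[of a b X "\<one>\<^bsub>grp X (ini X b)\<^esub>" "twist X a b"]]
      twist_closed[OF ab] ecomp_edge[OF ab]
    by (simp add: loc_def oarr_def hmul_hclass composable_iff)
qed (simp_all add: loc_mult one_left[OF oarr_arr] one_right[OF oarr_arr])

lemmas loc_slide = cog_rep.slide[OF cog_rep_hmul]
  and loc_slide_bwd = cog_rep.slide_bwd[OF cog_rep_hmul]
  and oarr_fwd_bwd = cog_rep.fwd_bwd[OF cog_rep_hmul]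
  and oarr_bwd_fwd = cog_rep.bwd_fwd[OF cog_rep_hmul]
  and oarr_compose = cog_rep.compose[OF cog_rep_hmul]

text \<open>Every class is a product of local elements and oriented edges ending in a local element.
  Statements about classes are thus checked on generators without touching representatives; the
  source varies while the target stays fixed.\<close>

lemma arr_induct [consumes 1, case_names loc step]:
  assumes "P \<in> arr X \<sigma> \<rho>"
    and "\<And>g. \<lbrakk>\<rho> \<in> verts X; g \<in> carrier (grp X \<rho>)\<rbrakk> \<Longrightarrow> C \<rho> (loc X \<rho> g)"
    and "\<And>g e Q. \<lbrakk>uedge e \<in> edges X; g \<in> carrier (grp X (oini X e)); Q \<in> arr X (oter X e) \<rho>;
           C (oter X e) Q\<rbrakk> \<Longrightarrow> C (oini X e) (loc X (oini X e) g \<odot> (oarr X e \<odot> Q))"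
  shows "C \<sigma> P"
proof -
  obtain p where p: "P = hclass X p" "is_path X p" "psrc X p = \<sigma>" "ptgt p = \<rho>"
    using assms(1) by (rule arrE)
  have "is_path X p \<Longrightarrow> ptgt p = \<rho> \<Longrightarrow> C (psrc X p) (hclass X p)"
  proof (induction p)
    case (Const \<sigma> g)
    then show ?case using assms(2)[of g] by (simp add: loc_def)
  next
    case (Step g e p)
    then have "C (oter X e) (hclass X p)" "hclass X p \<in> arr X (oter X e) \<rho>"
      using arr_hclass[of p] by auto
    with Step.prems show ?case
      using assms(3)[of e g "hclass X p"] hclass_Step[of g e p] by auto
  qed
  with p show ?thesis by simp
qed

text \<open>The inverse is assembled along the generators: the inverse of the tail, the reversed
  edge, the inverse local element.\<close>

lemma arr_inverse:
  assumes "P \<in> arr X \<sigma> \<rho>"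
  shows "\<exists>Q\<in>arr X \<rho> \<sigma>. P \<odot> Q = loc X \<sigma> \<one>\<^bsub>grp X \<sigma>\<^esub> \<and> Q \<odot> P = loc X \<rho> \<one>\<^bsub>grp X \<rho>\<^esub>"
  using assms
proof (induction rule: arr_induct)
  case (loc g)
  then show ?case by (intro bexI[of _ "loc X \<rho> (inv\<^bsub>grp X \<rho>\<^esub> g)"]) (auto simp: loc_mult)
next
  case (step g e Q)
  then obtain R where R: "R \<in> arr X \<rho> (oter X e)" "Q \<odot> R = loc X (oter X e) \<one>\<^bsub>grp X (oter X e)\<^esub>"
      "R \<odot> Q = loc X \<rho> \<one>\<^bsub>grp X \<rho>\<^esub>" by blast
  let ?e = "case e of Fwd a \<Rightarrow> Bwd a | Bwd a \<Rightarrow> Fwd a"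
  have e: "oarr X ?e \<in> arr X (oter X e) (oini X e)"
      "oarr X e \<odot> oarr X ?e = loc X (oini X e) \<one>\<^bsub>grp X (oini X e)\<^esub>"
      "oarr X ?e \<odot> oarr X e = loc X (oter X e) \<one>\<^bsub>grp X (oter X e)\<^esub>"
    using step(1) by (cases e; simp add: oarr_fwd_bwd oarr_bwd_fwd)+
  let ?g = "loc X (oini X e) g" and ?g' = "loc X (oini X e) (inv\<^bsub>grp X (oini X e)\<^esub> g)"
  let ?S = "R \<odot> (oarr X ?e \<odot> ?g')"
  have g: "?g \<in> arr X (oini X e) (oini X e)" "?g' \<in> arr X (oini X e) (oini X e)"
    using step by auto
  have "?S \<in> arr X \<rho> (oini X e)"
    using R(1) e(1) g by blast
  moreover have "?g \<odot> (oarr X e \<odot> Q) \<odot> ?S = loc X (oini X e) \<one>\<^bsub>grp X (oini X e)\<^esub>"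
  proof -
    have "?g \<odot> (oarr X e \<odot> Q) \<odot> ?S = ?g \<odot> (oarr X e \<odot> ((Q \<odot> R) \<odot> oarr X ?e) \<odot> ?g')"
      by (simp add: hmul_assoc)
    also have "\<dots> = ?g \<odot> ((oarr X e \<odot> oarr X ?e) \<odot> ?g')"
      using e(1) by (simp only: R one_left)
    also have "\<dots> = ?g \<odot> ?g'" using g by (simp only: e one_left)
    finally show ?thesis using step by (simp add: loc_mult)
  qed
  moreover have "?S \<odot> (?g \<odot> (oarr X e \<odot> Q)) = loc X \<rho> \<one>\<^bsub>grp X \<rho>\<^esub>"
  proof -
    have "?S \<odot> (?g \<odot> (oarr X e \<odot> Q)) = R \<odot> (oarr X ?e \<odot> ((?g' \<odot> ?g) \<odot> oarr X e) \<odot> Q)"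
      by (simp add: hmul_assoc)
    also have "?g' \<odot> ?g = loc X (oini X e) \<one>\<^bsub>grp X (oini X e)\<^esub>"
      using step by (simp add: loc_mult)
    also have "R \<odot> (oarr X ?e \<odot> (loc X (oini X e) \<one>\<^bsub>grp X (oini X e)\<^esub> \<odot> oarr X e) \<odot> Q) = R \<odot> Q"
      using step by (simp only: e one_left[OF oarr_arr] one_left)
    finally show ?thesis by (simp only: R)
  qed
  ultimately show ?case by blast
qed

text \<open>A right inverse identifies \<open>hinv\<close>, since some two-sided inverse exists and
  cancels \<open>P\<close> on the left.\<close>

lemma inverse_unique:
  assumes "P \<in> arr X \<sigma> \<rho>" "Q \<in> arr X \<rho> \<sigma>" "P \<odot> Q = loc X \<sigma> \<one>\<^bsub>grp X \<sigma>\<^esub>"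
  shows "hinv X P = Q"
proof -
  obtain R where R: "R \<in> arr X \<rho> \<sigma>" "R \<odot> P = loc X \<rho> \<one>\<^bsub>grp X \<rho>\<^esub>"
      "P \<odot> R = loc X \<sigma> \<one>\<^bsub>grp X \<sigma>\<^esub>"
    using arr_inverse[OF assms(1)] by blast
  have uniq: "S = R" if "S \<in> arr X \<rho> \<sigma>" "P \<odot> S = loc X \<sigma> \<one>\<^bsub>grp X \<sigma>\<^esub>" for S
    by (metis hmul_assoc one_left one_right R that)
  have "hinv X P = R"
    unfolding hinv_def
  proof (rule the_equality)
    show "\<exists>\<sigma> \<rho>. P \<in> arr X \<sigma> \<rho> \<and> R \<in> arr X \<rho> \<sigma> \<and>
        P \<odot> R = loc X \<sigma> \<one>\<^bsub>grp X \<sigma>\<^esub> \<and> R \<odot> P = loc X \<rho> \<one>\<^bsub>grp X \<rho>\<^esub>"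
      using assms R by blast
  next
    fix S assume "\<exists>\<sigma> \<rho>. P \<in> arr X \<sigma> \<rho> \<and> S \<in> arr X \<rho> \<sigma> \<and>
        P \<odot> S = loc X \<sigma> \<one>\<^bsub>grp X \<sigma>\<^esub> \<and> S \<odot> P = loc X \<rho> \<one>\<^bsub>grp X \<rho>\<^esub>"
    then show "S = R" using uniq arr_unique[OF assms(1)] by blast
  qed
  with uniq[OF assms(2,3)] show ?thesis by simp
qed

lemma hinv_arr [simp, intro]: "P \<in> arr X \<sigma> \<rho> \<Longrightarrow> hinv X P \<in> arr X \<rho> \<sigma>"
  and hinv_right [simp]: "P \<in> arr X \<sigma> \<rho> \<Longrightarrow> P \<odot> hinv X P = loc X \<sigma> \<one>\<^bsub>grp X \<sigma>\<^esub>"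
  and hinv_left [simp]: "P \<in> arr X \<sigma> \<rho> \<Longrightarrow> hinv X P \<odot> P = loc X \<rho> \<one>\<^bsub>grp X \<rho>\<^esub>"
  using arr_inverse inverse_unique by blast+

lemma hinv_right_left [simp]: "\<lbrakk>P \<in> arr X \<sigma> \<rho>; Q \<in> arr X \<sigma> \<tau>\<rbrakk> \<Longrightarrow> P \<odot> (hinv X P \<odot> Q) = Q"
  and hinv_left_left [simp]: "\<lbrakk>P \<in> arr X \<sigma> \<rho>; Q \<in> arr X \<rho> \<tau>\<rbrakk> \<Longrightarrow> hinv X P \<odot> (P \<odot> Q) = Q"
  by (simp_all add: hmul_assoc[symmetric])

lemma arr_cancel_right: "\<lbrakk>P \<in> arr X \<rho> \<tau>; Q \<in> arr X \<sigma> \<rho>; R \<in> arr X \<sigma> \<rho>\<rbrakk> \<Longrightarrow> Q \<odot> P = R \<odot> P \<longleftrightarrow> Q = R"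
  by (metis hmul_assoc hinv_right one_right)

text \<open>This is where connectedness of the scwol enters; it supplies the comparison paths from
  the base point to every vertex.\<close>

lemma arr_nonempty:
  assumes "\<sigma> \<in> verts X" "\<rho> \<in> verts X"
  shows "arr X \<sigma> \<rho> \<noteq> {}"
proof -
  have "arr X \<sigma> \<rho> \<noteq> {}" if "edge_path X \<sigma> es \<rho>" for es \<sigma>
    using that
  proof (induction es arbitrary: \<sigma>)
    case Nil
    then have "loc X \<sigma> \<one>\<^bsub>grp X \<sigma>\<^esub> \<in> arr X \<sigma> \<rho>" by auto
    then show ?case by blast
  next
    case (Cons e es)
    then obtain Q where "Q \<in> arr X (oter X e) \<rho>" by auto
    with Cons.prems show ?case using hmul_arr[OF oarr_arr[of e], of Q \<rho>] by auto
  qed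
  then show ?thesis
    using complex assms unfolding complex_of_groups_def connected_scwol_def by blast
qed

section \<open>The fundamental group as a vertex group of the groupoid\<close>

lemma pi1_carrier: "carrier (pi1 X \<sigma>) = arr X \<sigma> \<sigma>"
  by (auto simp: pi1_def arr_def loops_def quotient_def hclass_def)

lemma pi1_one: "\<one>\<^bsub>pi1 X \<sigma>\<^esub> = loc X \<sigma> \<one>\<^bsub>grp X \<sigma>\<^esub>"
  by (simp add: pi1_def loc_def)

text \<open>The union over representatives is a union of equal classes, because homotopy respects
  concatenation. From here on, group computations can be done with \<open>hmul\<close>.\<close>

lemma pi1_mult:
  assumes "P \<in> arr X \<sigma> \<sigma>" "Q \<in> arr X \<sigma> \<sigma>"
  shows "P \<otimes>\<^bsub>pi1 X \<sigma>\<^esub> Q = P \<odot> Q"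
proof -
  obtain p q where p: "P = hclass X p" "is_path X p" "psrc X p = \<sigma>" "ptgt p = \<sigma>"
      and q: "Q = hclass X q" "is_path X q" "psrc X q = \<sigma>" "ptgt q = \<sigma>"
    using assms by (metis arrE)
  have "hclass X (pcat X p' q') = P \<odot> Q" if "p' \<in> P" "q' \<in> Q" for p' q'
  proof -
    have "(pcat X p q, pcat X p' q') \<in> htpy X"
      using that p q htpy_pcat[of p p' q q'] by (simp add: in_hclass_iff)
    with p q hclass_eq_iff[of "pcat X p q" "pcat X p' q'"] show ?thesis
      by (simp add: hmul_hclass pcat_path)
  qed
  moreover have "p \<in> P" "q \<in> Q" using p q by (auto simp: in_hclass_iff htpy_refl)
  ultimately show ?thesis by (auto simp: pi1_def)
qed

lemma group_pi1: "\<sigma> \<in> verts X \<Longrightarrow> group (pi1 X \<sigma>)"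
proof (rule groupI)
  fix P assume "P \<in> carrier (pi1 X \<sigma>)"
  then show "\<exists>Q\<in>carrier (pi1 X \<sigma>). Q \<otimes>\<^bsub>pi1 X \<sigma>\<^esub> P = \<one>\<^bsub>pi1 X \<sigma>\<^esub>"
    by (intro bexI[of _ "hinv X P"]) (auto simp: pi1_carrier pi1_one pi1_mult)
qed (auto simp: pi1_carrier pi1_one pi1_mult hmul_assoc)

end

section \<open>Morphisms and the induced functor\<close>

locale cog_morphism = X: cog X + Y: cog Y
  for X :: "('v, 'e, 'g) cog" and Y :: "('w, 'f, 'h) cog" +
  fixes \<phi> :: "('v, 'e, 'g, 'w, 'f, 'h) cog_mor"
  assumes mor: "is_cog_mor X Y \<phi>"
begin

lemma scwol_mor: "is_scwol_mor X Y \<phi>"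
  using mor by (simp add: is_cog_mor_def)

lemma vmap_vert [simp, intro]: "\<sigma> \<in> verts X \<Longrightarrow> vmap \<phi> \<sigma> \<in> verts Y"
  and emap_edge [simp, intro]: "a \<in> edges X \<Longrightarrow> emap \<phi> a \<in> edges Y"
  and ini_emap [simp]: "a \<in> edges X \<Longrightarrow> ini Y (emap \<phi> a) = vmap \<phi> (ini X a)"
  and ter_emap [simp]: "a \<in> edges X \<Longrightarrow> ter Y (emap \<phi> a) = vmap \<phi> (ter X a)"
  using scwol_mor unfolding is_scwol_mor_def by blast+

lemma emap_ecomp [simp]:
  "\<lbrakk>a \<in> edges X; b \<in> edges X; ini X a = ter X b\<rbrakk> \<Longrightarrow> emap \<phi> (ecomp X a b) = ecomp Y (emap \<phi> a) (emap \<phi> b)"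
  using scwol_mor by (auto simp: is_scwol_mor_def composable_def)

lemma emap_bij:
  "\<sigma> \<in> verts X \<Longrightarrow>
   bij_betw (emap \<phi>) {a \<in> edges X. ini X a = \<sigma>} {a' \<in> edges Y. ini Y a' = vmap \<phi> \<sigma>}"
  using scwol_mor unfolding is_scwol_mor_def by (elim conjE) (rule bspec)

lemma edge_unique: "\<lbrakk>a \<in> edges X; b \<in> edges X; ini X a = ini X b; emap \<phi> a = emap \<phi> b\<rbrakk> \<Longrightarrow> a = b"
  using bij_betw_imp_inj_on[OF emap_bij[of "ini X b"]] by (auto dest: inj_onD)

text \<open>Together with \<open>edge_unique\<close> this is unique lifting of forward edges,
  already contained in the notion of a morphism of scwols. Only inverse edges will require the coset
  condition of a covering.\<close>

lemma edge_lift: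
  assumes "\<sigma> \<in> verts X" "a' \<in> edges Y" "ini Y a' = vmap \<phi> \<sigma>"
  obtains a where "a \<in> edges X" "ini X a = \<sigma>" "emap \<phi> a = a'"
proof -
  have "a' \<in> emap \<phi> ` {a \<in> edges X. ini X a = \<sigma>}"
    unfolding bij_betw_imp_surj_on[OF emap_bij[OF assms(1)]] using assms by simp
  then obtain b where "b \<in> edges X" "ini X b = \<sigma>" "emap \<phi> b = a'" by auto
  then show thesis by (rule that)
qed

lemma lmap_group_hom: "\<sigma> \<in> verts X \<Longrightarrow> group_hom (grp X \<sigma>) (grp Y (vmap \<phi> \<sigma>)) (lmap \<phi> \<sigma>)"
  using mor unfolding is_cog_mor_def by (intro group_hom.intro group_hom_axioms.intro) auto

lemma lmap_closed [simp, intro]: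
  "\<lbrakk>\<sigma> \<in> verts X; g \<in> carrier (grp X \<sigma>)\<rbrakk> \<Longrightarrow> lmap \<phi> \<sigma> g \<in> carrier (grp Y (vmap \<phi> \<sigma>))"
  using group_hom.hom_closed[OF lmap_group_hom] by blast

lemma lmap_mult:
  "\<lbrakk>\<sigma> \<in> verts X; g \<in> carrier (grp X \<sigma>); h \<in> carrier (grp X \<sigma>)\<rbrakk> \<Longrightarrow>
   lmap \<phi> \<sigma> (g \<otimes>\<^bsub>grp X \<sigma>\<^esub> h) = lmap \<phi> \<sigma> g \<otimes>\<^bsub>grp Y (vmap \<phi> \<sigma>)\<^esub> lmap \<phi> \<sigma> h"
  using group_hom.hom_mult[OF lmap_group_hom] by blast

lemma lmap_one [simp]: "\<sigma> \<in> verts X \<Longrightarrow> lmap \<phi> \<sigma> \<one>\<^bsub>grp X \<sigma>\<^esub> = \<one>\<^bsub>grp Y (vmap \<phi> \<sigma>)\<^esub>"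
  using group_hom.hom_one[OF lmap_group_hom] by blast

lemma lmap_inv:
  "\<lbrakk>\<sigma> \<in> verts X; g \<in> carrier (grp X \<sigma>)\<rbrakk> \<Longrightarrow>
   lmap \<phi> \<sigma> (inv\<^bsub>grp X \<sigma>\<^esub> g) = inv\<^bsub>grp Y (vmap \<phi> \<sigma>)\<^esub> lmap \<phi> \<sigma> g"
  using group_hom.hom_inv[OF lmap_group_hom] by blast

lemma elt_closed [simp, intro]: "a \<in> edges X \<Longrightarrow> elt \<phi> a \<in> carrier (grp Y (vmap \<phi> (ter X a)))"
  using mor by (auto simp: is_cog_mor_def)

text \<open>This and the next facts restate laws of \<open>psi Y\<close> with the end points of
  \<open>emap \<phi> a\<close> already rewritten through \<open>vmap \<phi>\<close>, which is the
  normal form met in simplification.\<close>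

lemma psi_emap_closed [simp, intro]:
  "\<lbrakk>a \<in> edges X; g \<in> carrier (grp Y (vmap \<phi> (ini X a)))\<rbrakk> \<Longrightarrow>
   psi Y (emap \<phi> a) g \<in> carrier (grp Y (vmap \<phi> (ter X a)))"
  using Y.psi_closed[of "emap \<phi> a" g] by simp

lemma psi_emap_mult:
  "\<lbrakk>a \<in> edges X; g \<in> carrier (grp Y (vmap \<phi> (ini X a))); h \<in> carrier (grp Y (vmap \<phi> (ini X a)))\<rbrakk> \<Longrightarrow>
   psi Y (emap \<phi> a) (g \<otimes>\<^bsub>grp Y (vmap \<phi> (ini X a))\<^esub> h)
   = psi Y (emap \<phi> a) g \<otimes>\<^bsub>grp Y (vmap \<phi> (ter X a))\<^esub> psi Y (emap \<phi> a) h"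
  using Y.psi_mult[of "emap \<phi> a" g h] by simp

lemma psi_emap_one [simp]:
  "a \<in> edges X \<Longrightarrow> psi Y (emap \<phi> a) \<one>\<^bsub>grp Y (vmap \<phi> (ini X a))\<^esub> = \<one>\<^bsub>grp Y (vmap \<phi> (ter X a))\<^esub>"
  using Y.psi_one[of "emap \<phi> a"] by simp

lemma psi_emap_inv:
  "\<lbrakk>a \<in> edges X; g \<in> carrier (grp Y (vmap \<phi> (ini X a)))\<rbrakk> \<Longrightarrow>
   psi Y (emap \<phi> a) (inv\<^bsub>grp Y (vmap \<phi> (ini X a))\<^esub> g)
   = inv\<^bsub>grp Y (vmap \<phi> (ter X a))\<^esub> psi Y (emap \<phi> a) g"
  using Y.psi_inv[of "emap \<phi> a" g] by simp

lemma psi_emap_inj: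
  "a \<in> edges X \<Longrightarrow> inj_on (psi Y (emap \<phi> a)) (carrier (grp Y (vmap \<phi> (ini X a))))"
  using Y.psi_inj[of "emap \<phi> a"] by simp

lemma elt_slide:
  assumes "a \<in> edges X" "g \<in> carrier (grp X (ini X a))"
  shows "elt \<phi> a \<otimes>\<^bsub>grp Y (vmap \<phi> (ter X a))\<^esub> psi Y (emap \<phi> a) (lmap \<phi> (ini X a) g)
    = lmap \<phi> (ter X a) (psi X a g) \<otimes>\<^bsub>grp Y (vmap \<phi> (ter X a))\<^esub> elt \<phi> a"
proof -
  interpret H: group "grp Y (vmap \<phi> (ter X a))" using assms by auto
  have "conj_by (grp Y (vmap \<phi> (ter X a))) (elt \<phi> a) (psi Y (emap \<phi> a) (lmap \<phi> (ini X a) g))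
      = lmap \<phi> (ter X a) (psi X a g)"
    using mor assms by (auto simp: is_cog_mor_def)
  then show ?thesis
    using assms H.inv_solve_right'[of "lmap \<phi> (ter X a) (psi X a g)"
        "elt \<phi> a \<otimes>\<^bsub>grp Y (vmap \<phi> (ter X a))\<^esub> psi Y (emap \<phi> a) (lmap \<phi> (ini X a) g)" "elt \<phi> a"]
    by (simp add: conj_by_def)
qed

lemma elt_twist:
  assumes "a \<in> edges X" "b \<in> edges X" "ini X a = ter X b"
  shows "lmap \<phi> (ter X a) (twist X a b) \<otimes>\<^bsub>grp Y (vmap \<phi> (ter X a))\<^esub> elt \<phi> (ecomp X a b)
        = elt \<phi> a \<otimes>\<^bsub>grp Y (vmap \<phi> (ter X a))\<^esub> psi Y (emap \<phi> a) (elt \<phi> b)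
            \<otimes>\<^bsub>grp Y (vmap \<phi> (ter X a))\<^esub> twist Y (emap \<phi> a) (emap \<phi> b)"
  using mor assms by (auto simp: is_cog_mor_def composable_def)

lemma emap_arr [simp, intro]:
  "a \<in> edges X \<Longrightarrow> oarr Y (Fwd (emap \<phi> a)) \<in> arr Y (vmap \<phi> (ini X a)) (vmap \<phi> (ter X a))"
  "a \<in> edges X \<Longrightarrow> oarr Y (Bwd (emap \<phi> a)) \<in> arr Y (vmap \<phi> (ter X a)) (vmap \<phi> (ini X a))"
  using Y.oarr_Fwd_arr[of "emap \<phi> a"] Y.oarr_Bwd_arr[of "emap \<phi> a"] by simp_all

lemma emap_slide:
  "\<lbrakk>a \<in> edges X; g \<in> carrier (grp Y (vmap \<phi> (ini X a)))\<rbrakk> \<Longrightarrow>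
   loc Y (vmap \<phi> (ini X a)) g \<odot>\<^bsub>Y\<^esub> oarr Y (Fwd (emap \<phi> a))
   = oarr Y (Fwd (emap \<phi> a)) \<odot>\<^bsub>Y\<^esub> loc Y (vmap \<phi> (ter X a)) (psi Y (emap \<phi> a) g)"
  using Y.loc_slide[of "emap \<phi> a" g] by simp

lemma emap_slide_bwd:
  "\<lbrakk>a \<in> edges X; g \<in> carrier (grp Y (vmap \<phi> (ini X a)))\<rbrakk> \<Longrightarrow>
   oarr Y (Bwd (emap \<phi> a)) \<odot>\<^bsub>Y\<^esub> loc Y (vmap \<phi> (ini X a)) g
   = loc Y (vmap \<phi> (ter X a)) (psi Y (emap \<phi> a) g) \<odot>\<^bsub>Y\<^esub> oarr Y (Bwd (emap \<phi> a))"
  using Y.loc_slide_bwd[of "emap \<phi> a" g] by simp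

section \<open>The functor induced on classes of paths\<close>

definition oedge_image :: "'e oedge \<Rightarrow> ('w, 'f, 'h) gpath set" where
  "oedge_image e = hclass Y (map_oedge X Y \<phi> e)"

lemma map_oedge_path:
  "uedge e \<in> edges X \<Longrightarrow> is_path Y (map_oedge X Y \<phi> e) \<and>
     psrc Y (map_oedge X Y \<phi> e) = vmap \<phi> (oini X e) \<and> ptgt (map_oedge X Y \<phi> e) = vmap \<phi> (oter X e)"
  by (cases e) auto

lemma oedge_image_arr: "uedge e \<in> edges X \<Longrightarrow> oedge_image e \<in> arr Y (vmap \<phi> (oini X e)) (vmap \<phi> (oter X e))"
  using Y.arr_hclass[of "map_oedge X Y \<phi> e"] map_oedge_path[of e] by (simp add: oedge_image_def)

lemma oedge_image_Fwd:
  "a \<in> edges X \<Longrightarrow> oedge_image (Fwd a)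
    = oarr Y (Fwd (emap \<phi> a)) \<odot>\<^bsub>Y\<^esub> loc Y (vmap \<phi> (ter X a)) (inv\<^bsub>grp Y (vmap \<phi> (ter X a))\<^esub> elt \<phi> a)"
  by (simp add: oedge_image_def oarr_def loc_def Y.hmul_hclass)

lemma oedge_image_Bwd:
  "a \<in> edges X \<Longrightarrow> oedge_image (Bwd a)
    = loc Y (vmap \<phi> (ter X a)) (elt \<phi> a) \<odot>\<^bsub>Y\<^esub> oarr Y (Bwd (emap \<phi> a))"
  by (simp add: oedge_image_def oarr_def loc_def Y.hmul_hclass)

text \<open>The axioms of a morphism are exactly the relations required of the images: compatibility
  with \<open>psi\<close> gives the sliding law, and the twist equation gives the composition
  law.\<close>

lemma cog_rep_induced:
  "cog_rep X (hmul Y) (\<lambda>\<sigma> g. loc Y (vmap \<phi> \<sigma>) (lmap \<phi> \<sigma> g)) oedge_image"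
proof
  fix a g assume a: "a \<in> edges X" "g \<in> carrier (grp X (ini X a))"
  let ?H = "grp Y (vmap \<phi> (ter X a))"
  let ?g = "lmap \<phi> (ini X a) g" and ?g' = "lmap \<phi> (ter X a) (psi X a g)"
  interpret H: group ?H using a by auto
  \<comment> \<open>\<open>elt_slide\<close> is solved for the inverse of
    \<open>elt \<phi> a\<close>, since the image of a forward edge ends with that inverse.\<close>
  have eq: "psi Y (emap \<phi> a) ?g \<otimes>\<^bsub>?H\<^esub> inv\<^bsub>?H\<^esub> elt \<phi> a = inv\<^bsub>?H\<^esub> elt \<phi> a \<otimes>\<^bsub>?H\<^esub> ?g'"
    using elt_slide[OF a] a by (simp add: H.inv_solve_left H.m_assoc[symmetric]) (simp add: H.m_assoc)
  have "loc Y (vmap \<phi> (ini X a)) ?g \<odot>\<^bsub>Y\<^esub> oedge_image (Fwd a)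
     = oarr Y (Fwd (emap \<phi> a)) \<odot>\<^bsub>Y\<^esub> loc Y (vmap \<phi> (ter X a)) (psi Y (emap \<phi> a) ?g \<otimes>\<^bsub>?H\<^esub> inv\<^bsub>?H\<^esub> elt \<phi> a)"
    using a by (simp add: oedge_image_Fwd Y.hmul_assoc[symmetric] emap_slide)
       (simp add: Y.hmul_assoc Y.loc_mult)
  also have "\<dots> = oedge_image (Fwd a) \<odot>\<^bsub>Y\<^esub> loc Y (vmap \<phi> (ter X a)) ?g'"
    unfolding eq using a by (simp add: oedge_image_Fwd Y.hmul_assoc Y.loc_mult)
  finally show "loc Y (vmap \<phi> (ini X a)) ?g \<odot>\<^bsub>Y\<^esub> oedge_image (Fwd a)
    = oedge_image (Fwd a) \<odot>\<^bsub>Y\<^esub> loc Y (vmap \<phi> (ter X a)) ?g'" .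
next
  fix a assume a: "a \<in> edges X"
  let ?H = "grp Y (vmap \<phi> (ter X a))"
  let ?x = "loc Y (vmap \<phi> (ter X a)) (elt \<phi> a)"
  let ?y = "loc Y (vmap \<phi> (ter X a)) (inv\<^bsub>?H\<^esub> elt \<phi> a)"
  let ?f = "oarr Y (Fwd (emap \<phi> a))" and ?b = "oarr Y (Bwd (emap \<phi> a))"
  have yx: "?y \<odot>\<^bsub>Y\<^esub> ?x = loc Y (vmap \<phi> (ter X a)) \<one>\<^bsub>?H\<^esub>" "?x \<odot>\<^bsub>Y\<^esub> ?y = loc Y (vmap \<phi> (ter X a)) \<one>\<^bsub>?H\<^esub>"
    using a by (simp_all add: Y.loc_mult)
  have y: "?y \<in> arr Y (vmap \<phi> (ter X a)) (vmap \<phi> (ter X a))" using a by auto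
  have "oedge_image (Fwd a) \<odot>\<^bsub>Y\<^esub> oedge_image (Bwd a) = ?f \<odot>\<^bsub>Y\<^esub> ((?y \<odot>\<^bsub>Y\<^esub> ?x) \<odot>\<^bsub>Y\<^esub> ?b)"
    using a by (simp add: oedge_image_Fwd oedge_image_Bwd Y.hmul_assoc)
  also have "\<dots> = loc Y (vmap \<phi> (ini X a)) \<one>\<^bsub>grp Y (vmap \<phi> (ini X a))\<^esub>"
    unfolding yx using a Y.one_left[OF emap_arr(2)[OF a]] Y.oarr_fwd_bwd[of "emap \<phi> a"] by simp
  finally show "oedge_image (Fwd a) \<odot>\<^bsub>Y\<^esub> oedge_image (Bwd a)
    = loc Y (vmap \<phi> (ini X a)) (lmap \<phi> (ini X a) \<one>\<^bsub>grp X (ini X a)\<^esub>)"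
    using a by simp
  have "oedge_image (Bwd a) \<odot>\<^bsub>Y\<^esub> oedge_image (Fwd a) = ?x \<odot>\<^bsub>Y\<^esub> ((?b \<odot>\<^bsub>Y\<^esub> ?f) \<odot>\<^bsub>Y\<^esub> ?y)"
    using a by (simp add: oedge_image_Fwd oedge_image_Bwd Y.hmul_assoc)
  also have "\<dots> = loc Y (vmap \<phi> (ter X a)) \<one>\<^bsub>?H\<^esub>"
    using a yx Y.one_left[OF y] Y.oarr_bwd_fwd[of "emap \<phi> a"] by simp
  finally show "oedge_image (Bwd a) \<odot>\<^bsub>Y\<^esub> oedge_image (Fwd a)
    = loc Y (vmap \<phi> (ter X a)) (lmap \<phi> (ter X a) \<one>\<^bsub>grp X (ter X a)\<^esub>)"
    using a by simp
next
  fix a b assume ab: "a \<in> edges X" "b \<in> edges X" "ini X a = ter X b"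
  let ?H = "grp Y (vmap \<phi> (ter X a))" and ?L = "loc Y (vmap \<phi> (ter X a))"
  let ?fa = "oarr Y (Fwd (emap \<phi> a))" and ?fb = "oarr Y (Fwd (emap \<phi> b))"
  let ?t = "twist Y (emap \<phi> a) (emap \<phi> b)"
  let ?p = "psi Y (emap \<phi> a) (elt \<phi> b)" and ?tX = "lmap \<phi> (ter X a) (twist X a b)"
  interpret H: group ?H using ab by auto
  note abX = X.ecomp_edge[OF ab] X.twist_closed[OF ab]
  have abY: "?t \<in> carrier ?H" using ab Y.twist_closed[of "emap \<phi> a" "emap \<phi> b"] by simp
  have elb: "elt \<phi> b \<in> carrier (grp Y (vmap \<phi> (ini X a)))" using ab by simp
  have p: "?p \<in> carrier ?H" using elb ab(1) by simp
  have elab: "elt \<phi> (ecomp X a b) \<in> carrier ?H" using elt_closed[of "ecomp X a b"] abX by simp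
  \<comment> \<open>The twist equation is inverted, because along a path the inverses appear in the
    opposite order.\<close>
  have eq: "inv\<^bsub>?H\<^esub> ?p \<otimes>\<^bsub>?H\<^esub> (inv\<^bsub>?H\<^esub> elt \<phi> a \<otimes>\<^bsub>?H\<^esub> ?tX) = ?t \<otimes>\<^bsub>?H\<^esub> inv\<^bsub>?H\<^esub> elt \<phi> (ecomp X a b)"
    using elt_twist[OF ab] ab abX abY p elab by (simp add: H.inv_solve_left' H.inv_solve_right H.m_assoc)
  have "oedge_image (Fwd b) \<odot>\<^bsub>Y\<^esub> (oedge_image (Fwd a) \<odot>\<^bsub>Y\<^esub> ?L ?tX)
     = ?fb \<odot>\<^bsub>Y\<^esub> (loc Y (vmap \<phi> (ini X a)) (inv\<^bsub>grp Y (vmap \<phi> (ini X a))\<^esub> elt \<phi> b) \<odot>\<^bsub>Y\<^esub> ?fa)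
         \<odot>\<^bsub>Y\<^esub> ?L (inv\<^bsub>?H\<^esub> elt \<phi> a \<otimes>\<^bsub>?H\<^esub> ?tX)"
    using ab abX by (simp add: oedge_image_Fwd Y.hmul_assoc Y.loc_mult)
  also have "\<dots> = ?fb \<odot>\<^bsub>Y\<^esub> ?fa \<odot>\<^bsub>Y\<^esub> ?L (inv\<^bsub>?H\<^esub> ?p \<otimes>\<^bsub>?H\<^esub> (inv\<^bsub>?H\<^esub> elt \<phi> a \<otimes>\<^bsub>?H\<^esub> ?tX))"
    using ab(1) elb abX p by (simp add: emap_slide psi_emap_inv Y.hmul_assoc Y.loc_mult)
  also have "\<dots> = ?fb \<odot>\<^bsub>Y\<^esub> (?fa \<odot>\<^bsub>Y\<^esub> ?L ?t) \<odot>\<^bsub>Y\<^esub> ?L (inv\<^bsub>?H\<^esub> elt \<phi> (ecomp X a b))"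
    unfolding eq using ab(1) abY elab by (simp add: Y.hmul_assoc Y.loc_mult)
  also have "\<dots> = oedge_image (Fwd (ecomp X a b))"
    using ab abX Y.oarr_compose[of "emap \<phi> a" "emap \<phi> b"] by (simp add: oedge_image_Fwd)
  finally show "oedge_image (Fwd b) \<odot>\<^bsub>Y\<^esub> (oedge_image (Fwd a) \<odot>\<^bsub>Y\<^esub> ?L ?tX) = oedge_image (Fwd (ecomp X a b))" .
qed (use Y.one_left[OF oedge_image_arr] Y.one_right[OF oedge_image_arr] in
      \<open>auto simp: Y.hmul_assoc Y.loc_mult lmap_mult\<close>)

lemma map_path_path:
  "is_path X p \<Longrightarrow> is_path Y (map_path X Y \<phi> p) \<and>
     psrc Y (map_path X Y \<phi> p) = vmap \<phi> (psrc X p) \<and> ptgt (map_path X Y \<phi> p) = vmap \<phi> (ptgt p)"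
  by (induction p) (auto simp: map_oedge_path Y.pcat_path Y.psrc_pcat Y.lmul_path)

text \<open>Identifies the class of the literal image path with an evaluation on generators, so that
  invariance under homotopy follows from \<open>eval_htpy\<close>.\<close>

lemma hclass_map_path:
  "is_path X p \<Longrightarrow> hclass Y (map_path X Y \<phi> p)
    = cog_rep.eval X (hmul Y) (\<lambda>\<sigma> g. loc Y (vmap \<phi> \<sigma>) (lmap \<phi> \<sigma> g)) oedge_image p"
proof (induction p)
  case (Const \<sigma> g)
  then show ?case by (simp add: cog_rep.eval.simps[OF cog_rep_induced]) (simp add: loc_def)
next
  case (Step g e p)
  then show ?case
    using map_path_path[of p] map_oedge_path[of e]
      Y.hmul_hclass[of "map_oedge X Y \<phi> e" "map_path X Y \<phi> p"]
      Y.hmul_hclass[of "Const (vmap \<phi> (oini X e)) (lmap \<phi> (oini X e) g)"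
        "pcat Y (map_oedge X Y \<phi> e) (map_path X Y \<phi> p)"]
    by (simp add: cog_rep.eval.simps[OF cog_rep_induced])
       (simp add: loc_def oedge_image_def Y.pcat_path Y.psrc_pcat)
qed

lemma induced_hclass:
  assumes "is_path X p"
  shows "induced X Y \<phi> (hclass X p) = hclass Y (map_path X Y \<phi> p)"
proof -
  have "hclass Y (map_path X Y \<phi> q) = hclass Y (map_path X Y \<phi> p)" if "(p, q) \<in> htpy X" for q
    using that X.htpy_ends[OF that] cog_rep.eval_htpy[OF cog_rep_induced that] by (simp add: hclass_map_path)
  moreover have "p \<in> hclass X p" using assms X.htpy_refl by (simp add: X.in_hclass_iff)
  ultimately show ?thesis unfolding induced_def X.in_hclass_iff[symmetric] by blast
qed

abbreviation ind :: "('v, 'e, 'g) gpath set \<Rightarrow> ('w, 'f, 'h) gpath set" where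
  "ind \<equiv> induced X Y \<phi>"

lemma ind_arr [simp, intro]: "P \<in> arr X \<sigma> \<rho> \<Longrightarrow> ind P \<in> arr Y (vmap \<phi> \<sigma>) (vmap \<phi> \<rho>)"
  using map_path_path Y.arr_hclass by (elim X.arrE) (metis induced_hclass)

lemma ind_hmul: "\<lbrakk>P \<in> arr X \<sigma> \<rho>; Q \<in> arr X \<rho> \<tau>\<rbrakk> \<Longrightarrow> ind (P \<odot>\<^bsub>X\<^esub> Q) = ind P \<odot>\<^bsub>Y\<^esub> ind Q"
  by (elim X.arrE) (simp add: X.hmul_hclass X.pcat_path induced_hclass hclass_map_path
      cog_rep.eval_pcat[OF cog_rep_induced])

lemma ind_loc [simp]:
  "\<lbrakk>\<sigma> \<in> verts X; g \<in> carrier (grp X \<sigma>)\<rbrakk> \<Longrightarrow> ind (loc X \<sigma> g) = loc Y (vmap \<phi> \<sigma>) (lmap \<phi> \<sigma> g)"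
  by (simp add: loc_def induced_hclass)

lemma ind_oarr:
  assumes "uedge e \<in> edges X" shows "ind (oarr X e) = oedge_image e"
proof -
  have "is_path X (Step \<one>\<^bsub>grp X (oini X e)\<^esub> e (Const (oter X e) \<one>\<^bsub>grp X (oter X e)\<^esub>))"
    using assms by simp
  then show ?thesis
    unfolding oarr_def
    by (subst induced_hclass, assumption, subst hclass_map_path, assumption)
      (use assms Y.one_left[OF oedge_image_arr] Y.one_right[OF oedge_image_arr] in
        \<open>simp add: cog_rep.eval.simps[OF cog_rep_induced]\<close>)
qed

lemma ind_Fwd:
  "a \<in> edges X \<Longrightarrow> ind (oarr X (Fwd a))
    = oarr Y (Fwd (emap \<phi> a)) \<odot>\<^bsub>Y\<^esub> loc Y (vmap \<phi> (ter X a)) (inv\<^bsub>grp Y (vmap \<phi> (ter X a))\<^esub> elt \<phi> a)"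
  using ind_oarr[of "Fwd a"] by (simp add: oedge_image_Fwd)

lemma ind_Bwd:
  "a \<in> edges X \<Longrightarrow> ind (oarr X (Bwd a))
    = loc Y (vmap \<phi> (ter X a)) (elt \<phi> a) \<odot>\<^bsub>Y\<^esub> oarr Y (Bwd (emap \<phi> a))"
  using ind_oarr[of "Bwd a"] by (simp add: oedge_image_Bwd)

lemma ind_hinv: "P \<in> arr X \<sigma> \<rho> \<Longrightarrow> ind (hinv X P) = hinv Y (ind P)"
  by (rule Y.inverse_unique[of _ "vmap \<phi> \<sigma>" "vmap \<phi> \<rho>", symmetric])
     (use X.arr_verts[of P \<sigma> \<rho>] ind_hmul[of P \<sigma> \<rho> "hinv X P" \<sigma>] in auto)

text \<open>The rule for lifting a forward edge: a local element \<open>h\<close> in front of the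
  image edge becomes the leftover behind the lifted edge. The factor \<open>elt \<phi> a\<close>
  compensates the inverse contained in \<open>ind\<close>; the same expression reappears in
  \<open>edge_act\<close>.\<close>

lemma ind_Fwd_elt:
  assumes "a \<in> edges X" "h \<in> carrier (grp Y (vmap \<phi> (ini X a)))"
  shows "ind (oarr X (Fwd a)) \<odot>\<^bsub>Y\<^esub> loc Y (vmap \<phi> (ter X a)) (elt \<phi> a \<otimes>\<^bsub>grp Y (vmap \<phi> (ter X a))\<^esub> psi Y (emap \<phi> a) h)
    = loc Y (vmap \<phi> (ini X a)) h \<odot>\<^bsub>Y\<^esub> oarr Y (Fwd (emap \<phi> a))"
  using assms by (simp add: ind_Fwd Y.hmul_assoc Y.loc_mult emap_slide Y.grp_assoc[symmetric])

end

section \<open>Composition and homotopy of morphisms\<close>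

lemma (in cog) conj_by_eq_iff:
  assumes "\<sigma> \<in> verts X" "g \<in> carrier (grp X \<sigma>)" "h \<in> carrier (grp X \<sigma>)" "x \<in> carrier (grp X \<sigma>)"
  shows "conj_by (grp X \<sigma>) g h = x \<longleftrightarrow> g \<otimes>\<^bsub>grp X \<sigma>\<^esub> h = x \<otimes>\<^bsub>grp X \<sigma>\<^esub> g"
  unfolding conj_by_def using group.inv_solve_right'[OF group_grp[OF assms(1)], of x "g \<otimes>\<^bsub>grp X \<sigma>\<^esub> h" g] assms
  by auto

text \<open>An introduction rule in which conjugations are replaced by equations of products, the
  form in which compatibility with \<open>psi\<close> is proved for composites and for the
  constructed morphism.\<close>

lemma cog_morphismI:
  assumes "cog X" "cog Y" and f: "is_scwol_mor X Y \<phi>"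
    and lmap: "\<And>\<sigma> g. \<lbrakk>\<sigma> \<in> verts X; g \<in> carrier (grp X \<sigma>)\<rbrakk> \<Longrightarrow> lmap \<phi> \<sigma> g \<in> carrier (grp Y (vmap \<phi> \<sigma>))"
    and lmap_mult: "\<And>\<sigma> g h. \<lbrakk>\<sigma> \<in> verts X; g \<in> carrier (grp X \<sigma>); h \<in> carrier (grp X \<sigma>)\<rbrakk> \<Longrightarrow>
      lmap \<phi> \<sigma> (g \<otimes>\<^bsub>grp X \<sigma>\<^esub> h) = lmap \<phi> \<sigma> g \<otimes>\<^bsub>grp Y (vmap \<phi> \<sigma>)\<^esub> lmap \<phi> \<sigma> h"
    and elt: "\<And>a. a \<in> edges X \<Longrightarrow> elt \<phi> a \<in> carrier (grp Y (vmap \<phi> (ter X a)))"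
    and slide: "\<And>a g. \<lbrakk>a \<in> edges X; g \<in> carrier (grp X (ini X a))\<rbrakk> \<Longrightarrow>
      elt \<phi> a \<otimes>\<^bsub>grp Y (vmap \<phi> (ter X a))\<^esub> psi Y (emap \<phi> a) (lmap \<phi> (ini X a) g)
      = lmap \<phi> (ter X a) (psi X a g) \<otimes>\<^bsub>grp Y (vmap \<phi> (ter X a))\<^esub> elt \<phi> a"
    and twist: "\<And>a b. \<lbrakk>a \<in> edges X; b \<in> edges X; ini X a = ter X b\<rbrakk> \<Longrightarrow>
      lmap \<phi> (ter X a) (twist X a b) \<otimes>\<^bsub>grp Y (vmap \<phi> (ter X a))\<^esub> elt \<phi> (ecomp X a b)
        = elt \<phi> a \<otimes>\<^bsub>grp Y (vmap \<phi> (ter X a))\<^esub> psi Y (emap \<phi> a) (elt \<phi> b)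
            \<otimes>\<^bsub>grp Y (vmap \<phi> (ter X a))\<^esub> twist Y (emap \<phi> a) (emap \<phi> b)"
  shows "cog_morphism X Y \<phi>"
proof -
  interpret X: cog X by fact
  interpret Y: cog Y by fact
  have V: "\<forall>\<sigma>\<in>verts X. vmap \<phi> \<sigma> \<in> verts Y"
    and E: "\<forall>a\<in>edges X. emap \<phi> a \<in> edges Y \<and>
        ini Y (emap \<phi> a) = vmap \<phi> (ini X a) \<and> ter Y (emap \<phi> a) = vmap \<phi> (ter X a)"
    using f unfolding is_scwol_mor_def by blast+
  have "lmap \<phi> \<sigma> \<in> hom (grp X \<sigma>) (grp Y (vmap \<phi> \<sigma>))" if "\<sigma> \<in> verts X" for \<sigma>
    using that lmap lmap_mult by (auto simp: hom_def)
  moreover have "conj_by (grp Y (vmap \<phi> (ter X a))) (elt \<phi> a) (psi Y (emap \<phi> a) (lmap \<phi> (ini X a) g))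
      = lmap \<phi> (ter X a) (psi X a g)" if a: "a \<in> edges X" "g \<in> carrier (grp X (ini X a))" for a g
  proof -
    have "psi Y (emap \<phi> a) (lmap \<phi> (ini X a) g) \<in> carrier (grp Y (vmap \<phi> (ter X a)))"
      using Y.psi_closed[of "emap \<phi> a" "lmap \<phi> (ini X a) g"] lmap[of "ini X a" g] E a by simp
    with a V slide[OF a] elt lmap show ?thesis
      by (subst Y.conj_by_eq_iff) auto
  qed
  ultimately have "is_cog_mor X Y \<phi>"
    unfolding is_cog_mor_def using f elt twist by (auto simp: X.composable_iff)
  then show ?thesis by unfold_locales
qed

locale cog_morphism_comp = f: cog_morphism X Y \<phi> + g: cog_morphism Y Z \<eta>
  for X :: "('v, 'e, 'g) cog" and Y :: "('w, 'f, 'h) cog" and Z :: "('u, 'd, 'k) cog"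
    and \<phi> :: "('v, 'e, 'g, 'w, 'f, 'h) cog_mor" and \<eta> :: "('w, 'f, 'h, 'u, 'd, 'k) cog_mor"
begin

lemma comp_simps [simp]:
  "vmap (mor_comp X Z \<eta> \<phi>) \<sigma> = vmap \<eta> (vmap \<phi> \<sigma>)"
  "emap (mor_comp X Z \<eta> \<phi>) a = emap \<eta> (emap \<phi> a)"
  "lmap (mor_comp X Z \<eta> \<phi>) \<sigma> x = lmap \<eta> (vmap \<phi> \<sigma>) (lmap \<phi> \<sigma> x)"
  "elt (mor_comp X Z \<eta> \<phi>) a = lmap \<eta> (vmap \<phi> (ter X a)) (elt \<phi> a)
     \<otimes>\<^bsub>grp Z (vmap \<eta> (vmap \<phi> (ter X a)))\<^esub> elt \<eta> (emap \<phi> a)"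
  by (simp_all add: mor_comp_def)

lemma scwol_mor_comp: "is_scwol_mor X Z (mor_comp X Z \<eta> \<phi>)"
proof -
  have "bij_betw (emap (mor_comp X Z \<eta> \<phi>)) {a \<in> edges X. ini X a = \<sigma>}
      {a' \<in> edges Z. ini Z a' = vmap (mor_comp X Z \<eta> \<phi>) \<sigma>}" if "\<sigma> \<in> verts X" for \<sigma>
    using bij_betw_trans[OF f.emap_bij[OF that] g.emap_bij] that
    by (simp add: mor_comp_def)
  then show ?thesis
    unfolding is_scwol_mor_def by (auto simp: f.X.composable_iff)
qed

lemma elt_emap_closed [simp, intro]:
  "a \<in> edges X \<Longrightarrow> elt \<eta> (emap \<phi> a) \<in> carrier (grp Z (vmap \<eta> (vmap \<phi> (ter X a))))"
  using g.elt_closed[of "emap \<phi> a"] by simp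

lemma psi_emap_emap_closed [simp, intro]:
  "\<lbrakk>a \<in> edges X; x \<in> carrier (grp Z (vmap \<eta> (vmap \<phi> (ini X a))))\<rbrakk> \<Longrightarrow>
   psi Z (emap \<eta> (emap \<phi> a)) x \<in> carrier (grp Z (vmap \<eta> (vmap \<phi> (ter X a))))"
  using g.psi_emap_closed[of "emap \<phi> a"] by simp

lemma cog_morphism_comp: "cog_morphism X Z (mor_comp X Z \<eta> \<phi>)"
proof (rule cog_morphismI)
  fix a g assume a: "a \<in> edges X" "g \<in> carrier (grp X (ini X a))"
  let ?t = "vmap \<phi> (ter X a)"
  let ?G = "grp Z (vmap \<eta> ?t)"
  let ?y = "lmap \<phi> (ini X a) g"
  have y: "?y \<in> carrier (grp Y (vmap \<phi> (ini X a)))" using a by auto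
  have 1: "elt \<eta> (emap \<phi> a) \<otimes>\<^bsub>?G\<^esub> psi Z (emap \<eta> (emap \<phi> a)) (lmap \<eta> (vmap \<phi> (ini X a)) ?y)
      = lmap \<eta> ?t (psi Y (emap \<phi> a) ?y) \<otimes>\<^bsub>?G\<^esub> elt \<eta> (emap \<phi> a)"
    using g.elt_slide[of "emap \<phi> a" ?y] a y by simp
  have 2: "lmap \<eta> ?t (elt \<phi> a) \<otimes>\<^bsub>?G\<^esub> lmap \<eta> ?t (psi Y (emap \<phi> a) ?y)
      = lmap \<eta> ?t (lmap \<phi> (ter X a) (psi X a g)) \<otimes>\<^bsub>?G\<^esub> lmap \<eta> ?t (elt \<phi> a)"
    using f.elt_slide[OF a] a y by (simp add: g.lmap_mult[symmetric])
  have "lmap \<eta> ?t (elt \<phi> a) \<otimes>\<^bsub>?G\<^esub> elt \<eta> (emap \<phi> a)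
      \<otimes>\<^bsub>?G\<^esub> psi Z (emap \<eta> (emap \<phi> a)) (lmap \<eta> (vmap \<phi> (ini X a)) ?y)
    = lmap \<eta> ?t (elt \<phi> a) \<otimes>\<^bsub>?G\<^esub> lmap \<eta> ?t (psi Y (emap \<phi> a) ?y) \<otimes>\<^bsub>?G\<^esub> elt \<eta> (emap \<phi> a)"
    using 1 a y by (simp add: g.Y.grp_assoc)
  also have "\<dots> = lmap \<eta> ?t (lmap \<phi> (ter X a) (psi X a g)) \<otimes>\<^bsub>?G\<^esub> (lmap \<eta> ?t (elt \<phi> a) \<otimes>\<^bsub>?G\<^esub> elt \<eta> (emap \<phi> a))"
    unfolding 2 using a by (simp add: g.Y.grp_assoc)
  finally show "elt (mor_comp X Z \<eta> \<phi>) a \<otimes>\<^bsub>grp Z (vmap (mor_comp X Z \<eta> \<phi>) (ter X a))\<^esub>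
      psi Z (emap (mor_comp X Z \<eta> \<phi>) a) (lmap (mor_comp X Z \<eta> \<phi>) (ini X a) g)
    = lmap (mor_comp X Z \<eta> \<phi>) (ter X a) (psi X a g) \<otimes>\<^bsub>grp Z (vmap (mor_comp X Z \<eta> \<phi>) (ter X a))\<^esub>
      elt (mor_comp X Z \<eta> \<phi>) a" by simp
next
  fix a b assume ab: "a \<in> edges X" "b \<in> edges X" "ini X a = ter X b"
  let ?t = "vmap \<phi> (ter X a)" and ?i = "vmap \<phi> (ini X a)"
  let ?G = "grp Z (vmap \<eta> ?t)"
  let ?fa = "emap \<phi> a" and ?fb = "emap \<phi> b"
  let ?ga = "emap \<eta> ?fa" and ?gb = "emap \<eta> ?fb"
  note abX = f.X.ecomp_edge[OF ab] f.X.twist_closed[OF ab]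
  have tY: "twist Y ?fa ?fb \<in> carrier (grp Y ?t)"
    using f.Y.twist_closed[of ?fa ?fb] ab by simp
  have tZ: "twist Z ?ga ?gb \<in> carrier ?G"
    using g.Y.twist_closed[of ?ga ?gb] ab by simp
  have elab: "elt \<phi> (ecomp X a b) \<in> carrier (grp Y ?t)" "elt \<eta> (emap \<phi> (ecomp X a b)) \<in> carrier ?G"
    using f.elt_closed[of "ecomp X a b"] elt_emap_closed[of "ecomp X a b"] abX by simp_all
  have elb: "elt \<phi> b \<in> carrier (grp Y ?i)" "elt \<eta> ?fb \<in> carrier (grp Z (vmap \<eta> ?i))"
    "lmap \<eta> ?i (elt \<phi> b) \<in> carrier (grp Z (vmap \<eta> ?i))"
    using ab by simp_all
  have p: "psi Y ?fa (elt \<phi> b) \<in> carrier (grp Y ?t)"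
    "psi Z ?ga (elt \<eta> ?fb) \<in> carrier ?G" "psi Z ?ga (lmap \<eta> ?i (elt \<phi> b)) \<in> carrier ?G"
    using elb ab(1) by blast+
  have la: "lmap \<eta> ?t (elt \<phi> a) \<in> carrier ?G" "lmap \<eta> ?t (psi Y ?fa (elt \<phi> b)) \<in> carrier ?G"
    "lmap \<eta> ?t (twist Y ?fa ?fb) \<in> carrier ?G" "elt \<eta> ?fa \<in> carrier ?G" "vmap \<eta> ?t \<in> verts Z"
    "lmap \<eta> ?t (lmap \<phi> (ter X a) (twist X a b)) \<in> carrier ?G"
    "lmap \<eta> ?t (elt \<phi> (ecomp X a b)) \<in> carrier ?G"
    using p(1) tY ab(1) abX elab by auto
  \<comment> \<open>The twist law of the composite combines four facts: the law of \<phi>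
    transported by \<eta>, the law of \<eta> at the image edges, the exchange of
    \<open>elt \<eta> ?fa\<close> with the image of \<open>elt \<phi> b\<close>, and
    multiplicativity of \<open>psi Z\<close>.\<close>
  have 1: "lmap \<eta> ?t (lmap \<phi> (ter X a) (twist X a b)) \<otimes>\<^bsub>?G\<^esub> lmap \<eta> ?t (elt \<phi> (ecomp X a b))
      = lmap \<eta> ?t (elt \<phi> a) \<otimes>\<^bsub>?G\<^esub> lmap \<eta> ?t (psi Y ?fa (elt \<phi> b)) \<otimes>\<^bsub>?G\<^esub> lmap \<eta> ?t (twist Y ?fa ?fb)"
    using f.elt_twist[OF ab] ab(1) elab p tY abX by (simp add: g.lmap_mult[symmetric])
  have 2: "lmap \<eta> ?t (twist Y ?fa ?fb) \<otimes>\<^bsub>?G\<^esub> elt \<eta> (emap \<phi> (ecomp X a b))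
      = elt \<eta> ?fa \<otimes>\<^bsub>?G\<^esub> psi Z ?ga (elt \<eta> ?fb) \<otimes>\<^bsub>?G\<^esub> twist Z ?ga ?gb"
    using g.elt_twist[of ?fa ?fb] ab by simp
  have 3: "elt \<eta> ?fa \<otimes>\<^bsub>?G\<^esub> psi Z ?ga (lmap \<eta> ?i (elt \<phi> b)) = lmap \<eta> ?t (psi Y ?fa (elt \<phi> b)) \<otimes>\<^bsub>?G\<^esub> elt \<eta> ?fa"
    using g.elt_slide[of ?fa "elt \<phi> b"] ab(1) elb by simp
  have 4: "psi Z ?ga (lmap \<eta> ?i (elt \<phi> b) \<otimes>\<^bsub>grp Z (vmap \<eta> ?i)\<^esub> elt \<eta> ?fb)
      = psi Z ?ga (lmap \<eta> ?i (elt \<phi> b)) \<otimes>\<^bsub>?G\<^esub> psi Z ?ga (elt \<eta> ?fb)"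
    using g.psi_emap_mult[of ?fa] ab(1) elb by simp
  have "lmap \<eta> ?t (lmap \<phi> (ter X a) (twist X a b)) \<otimes>\<^bsub>?G\<^esub>
      (lmap \<eta> ?t (elt \<phi> (ecomp X a b)) \<otimes>\<^bsub>?G\<^esub> elt \<eta> (emap \<phi> (ecomp X a b)))
    = lmap \<eta> ?t (elt \<phi> a) \<otimes>\<^bsub>?G\<^esub> (lmap \<eta> ?t (psi Y ?fa (elt \<phi> b)) \<otimes>\<^bsub>?G\<^esub>
      (lmap \<eta> ?t (twist Y ?fa ?fb) \<otimes>\<^bsub>?G\<^esub> elt \<eta> (emap \<phi> (ecomp X a b))))"
    using 1 la elab(2) by (simp only: g.Y.grp_assoc[symmetric] g.Y.grp_mult)
  also have "\<dots> = lmap \<eta> ?t (elt \<phi> a) \<otimes>\<^bsub>?G\<^esub> ((lmap \<eta> ?t (psi Y ?fa (elt \<phi> b)) \<otimes>\<^bsub>?G\<^esub> elt \<eta> ?fa)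
      \<otimes>\<^bsub>?G\<^esub> (psi Z ?ga (elt \<eta> ?fb) \<otimes>\<^bsub>?G\<^esub> twist Z ?ga ?gb))"
    unfolding 2 using la p tZ by (simp only: g.Y.grp_assoc g.Y.grp_mult)
  also have "\<dots> = lmap \<eta> ?t (elt \<phi> a) \<otimes>\<^bsub>?G\<^esub> elt \<eta> ?fa \<otimes>\<^bsub>?G\<^esub>
      (psi Z ?ga (lmap \<eta> ?i (elt \<phi> b) \<otimes>\<^bsub>grp Z (vmap \<eta> ?i)\<^esub> elt \<eta> ?fb)) \<otimes>\<^bsub>?G\<^esub> twist Z ?ga ?gb"
    unfolding 3[symmetric] 4 using la p tZ by (simp only: g.Y.grp_assoc g.Y.grp_mult)
  finally show "lmap (mor_comp X Z \<eta> \<phi>) (ter X a) (twist X a b)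
      \<otimes>\<^bsub>grp Z (vmap (mor_comp X Z \<eta> \<phi>) (ter X a))\<^esub> elt (mor_comp X Z \<eta> \<phi>) (ecomp X a b)
    = elt (mor_comp X Z \<eta> \<phi>) a \<otimes>\<^bsub>grp Z (vmap (mor_comp X Z \<eta> \<phi>) (ter X a))\<^esub>
      psi Z (emap (mor_comp X Z \<eta> \<phi>) a) (elt (mor_comp X Z \<eta> \<phi>) b)
      \<otimes>\<^bsub>grp Z (vmap (mor_comp X Z \<eta> \<phi>) (ter X a))\<^esub>
      twist Z (emap (mor_comp X Z \<eta> \<phi>) a) (emap (mor_comp X Z \<eta> \<phi>) b)"
    using abX by (simp add: ab(3)[symmetric])
qed (auto simp: f.lmap_mult g.lmap_mult scwol_mor_comp f.X.cog_axioms g.Y.cog_axioms)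

sublocale comp: cog_morphism X Z "mor_comp X Z \<eta> \<phi>"
  by (rule cog_morphism_comp)

text \<open>Both sides are multiplicative, so it suffices to compare them on generators; on an edge
  the claim is the formula for \<open>elt\<close> of a composite, inverted for a forward
  edge.\<close>

lemma ind_comp:
  assumes "P \<in> arr X \<sigma> \<rho>"
  shows "comp.ind P = g.ind (f.ind P)"
  using assms
proof (induction rule: f.X.arr_induct)
  case (loc g)
  then show ?case by simp
next
  case (step x e Q)
  have e: "comp.ind (oarr X e) = g.ind (f.ind (oarr X e))"
  proof (cases e)
    case (Fwd a)
    then have a: "a \<in> edges X" using step by simp
    let ?t = "vmap \<phi> (ter X a)"
    have inv: "inv\<^bsub>grp Z (vmap \<eta> ?t)\<^esub> (lmap \<eta> ?t (elt \<phi> a) \<otimes>\<^bsub>grp Z (vmap \<eta> ?t)\<^esub> elt \<eta> (emap \<phi> a))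
      = inv\<^bsub>grp Z (vmap \<eta> ?t)\<^esub> elt \<eta> (emap \<phi> a) \<otimes>\<^bsub>grp Z (vmap \<eta> ?t)\<^esub> inv\<^bsub>grp Z (vmap \<eta> ?t)\<^esub> lmap \<eta> ?t (elt \<phi> a)"
      using a by (intro group.inv_mult_group g.Y.group_grp) auto
    have "g.ind (f.ind (oarr X (Fwd a)))
        = g.ind (oarr Y (Fwd (emap \<phi> a))) \<odot>\<^bsub>Z\<^esub> g.ind (loc Y ?t (inv\<^bsub>grp Y ?t\<^esub> elt \<phi> a))"
      unfolding f.ind_Fwd[OF a] using a by (intro g.ind_hmul[of _ "vmap \<phi> (ini X a)" ?t _ ?t]) auto
    with a inv show ?thesis
      unfolding Fwd comp.ind_Fwd[OF a]
      by (simp add: g.ind_Fwd g.lmap_inv g.Y.hmul_assoc g.Y.loc_mult)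
  next
    case (Bwd a)
    then have a: "a \<in> edges X" using step by simp
    let ?t = "vmap \<phi> (ter X a)"
    have "g.ind (f.ind (oarr X (Bwd a)))
        = g.ind (loc Y ?t (elt \<phi> a)) \<odot>\<^bsub>Z\<^esub> g.ind (oarr Y (Bwd (emap \<phi> a)))"
      unfolding f.ind_Bwd[OF a] using a by (intro g.ind_hmul[of _ ?t ?t _ "vmap \<phi> (ini X a)"]) auto
    with a show ?thesis
      unfolding Bwd comp.ind_Bwd[OF a]
      by (simp add: g.ind_Bwd g.Y.hmul_assoc[symmetric] g.Y.loc_mult)
  qed
  let ?l = "loc X (oini X e) x"
  have l: "?l \<in> arr X (oini X e) (oini X e)" and e': "oarr X e \<in> arr X (oini X e) (oter X e)"
    using step by auto
  note eQ = f.X.hmul_arr[OF e' step(3)]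
  show ?case
    unfolding comp.ind_hmul[OF l eQ] comp.ind_hmul[OF e' step(3)] f.ind_hmul[OF l eQ]
      f.ind_hmul[OF e' step(3)] g.ind_hmul[OF f.ind_arr[OF l] f.Y.hmul_arr[OF f.ind_arr[OF e'] f.ind_arr[OF step(3)]]]
      g.ind_hmul[OF f.ind_arr[OF e'] f.ind_arr[OF step(3)]] e step(4)
    using step by simp
qed

end

text \<open>\<open>mor_htpy\<close> with an explicit witness and with the inverses cleared.\<close>

definition htpy_by ::
    "('v, 'e, 'g) cog \<Rightarrow> ('w, 'f, 'h) cog \<Rightarrow> ('v, 'e, 'g, 'w, 'f, 'h) cog_mor \<Rightarrow>
     ('v, 'e, 'g, 'w, 'f, 'h) cog_mor \<Rightarrow> ('v \<Rightarrow> 'h) \<Rightarrow> bool" where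
  "htpy_by X Y \<phi> \<eta> k \<longleftrightarrow>
     (\<forall>\<sigma>\<in>verts X. vmap \<eta> \<sigma> = vmap \<phi> \<sigma>) \<and> (\<forall>a\<in>edges X. emap \<eta> a = emap \<phi> a) \<and>
     (\<forall>\<sigma>\<in>verts X. k \<sigma> \<in> carrier (grp Y (vmap \<phi> \<sigma>)) \<and>
        (\<forall>g\<in>carrier (grp X \<sigma>).
           lmap \<eta> \<sigma> g \<otimes>\<^bsub>grp Y (vmap \<phi> \<sigma>)\<^esub> k \<sigma> = k \<sigma> \<otimes>\<^bsub>grp Y (vmap \<phi> \<sigma>)\<^esub> lmap \<phi> \<sigma> g)) \<and>
     (\<forall>a\<in>edges X.
        elt \<eta> a \<otimes>\<^bsub>grp Y (vmap \<phi> (ter X a))\<^esub> psi Y (emap \<phi> a) (k (ini X a))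
        = k (ter X a) \<otimes>\<^bsub>grp Y (vmap \<phi> (ter X a))\<^esub> elt \<phi> a)"

text \<open>The same \<open>k\<close> serves on both sides: each equation is merely multiplied by
  the inverse of a local element or of its image under \<open>psi\<close>.\<close>

lemma mor_htpy_iff:
  assumes "cog_morphism X Y \<phi>" "cog_morphism X Y \<eta>"
  shows "mor_htpy X Y \<phi> \<eta> \<longleftrightarrow> (\<exists>k. htpy_by X Y \<phi> \<eta> k)"
proof -
  interpret f: cog_morphism X Y \<phi> by fact
  interpret g: cog_morphism X Y \<eta> by fact
  have l: "lmap \<eta> \<sigma> g = conj_by (grp Y (vmap \<phi> \<sigma>)) k (lmap \<phi> \<sigma> g) \<longleftrightarrow>
      lmap \<eta> \<sigma> g \<otimes>\<^bsub>grp Y (vmap \<phi> \<sigma>)\<^esub> k = k \<otimes>\<^bsub>grp Y (vmap \<phi> \<sigma>)\<^esub> lmap \<phi> \<sigma> g"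
    if "\<sigma> \<in> verts X" "g \<in> carrier (grp X \<sigma>)" "k \<in> carrier (grp Y (vmap \<phi> \<sigma>))" "vmap \<eta> \<sigma> = vmap \<phi> \<sigma>" for \<sigma> g k
  proof -
    have "lmap \<eta> \<sigma> g \<in> carrier (grp Y (vmap \<phi> \<sigma>))"
      using g.lmap_closed[OF that(1,2)] unfolding that(4) .
    from f.Y.conj_by_eq_iff[OF f.vmap_vert[OF that(1)] that(3) f.lmap_closed[OF that(1,2)] this]
    show ?thesis by metis
  qed
  have e: "elt \<eta> a = k (ter X a) \<otimes>\<^bsub>grp Y (vmap \<phi> (ter X a))\<^esub> elt \<phi> a
               \<otimes>\<^bsub>grp Y (vmap \<phi> (ter X a))\<^esub>
               psi Y (emap \<phi> a) (inv\<^bsub>grp Y (vmap \<phi> (ini X a))\<^esub> (k (ini X a))) \<longleftrightarrow>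
      elt \<eta> a \<otimes>\<^bsub>grp Y (vmap \<phi> (ter X a))\<^esub> psi Y (emap \<phi> a) (k (ini X a))
        = k (ter X a) \<otimes>\<^bsub>grp Y (vmap \<phi> (ter X a))\<^esub> elt \<phi> a"
    if "a \<in> edges X" "\<forall>\<sigma>\<in>verts X. k \<sigma> \<in> carrier (grp Y (vmap \<phi> \<sigma>))" "\<forall>\<sigma>\<in>verts X. vmap \<eta> \<sigma> = vmap \<phi> \<sigma>" for a k
  proof -
    interpret H: group "grp Y (vmap \<phi> (ter X a))" using that by auto
    have "elt \<eta> a \<in> carrier (grp Y (vmap \<phi> (ter X a)))" using g.elt_closed[of a] that by simp
    with that show ?thesis by (auto simp: f.psi_emap_inv H.inv_solve_right)
  qed
  have "(\<forall>\<sigma>\<in>verts X. k \<sigma> \<in> carrier (grp Y (vmap \<phi> \<sigma>)) \<and> (\<forall>g\<in>carrier (grp X \<sigma>).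
            lmap \<eta> \<sigma> g = conj_by (grp Y (vmap \<phi> \<sigma>)) (k \<sigma>) (lmap \<phi> \<sigma> g))) \<and>
        (\<forall>a\<in>edges X. elt \<eta> a = k (ter X a) \<otimes>\<^bsub>grp Y (vmap \<phi> (ter X a))\<^esub> elt \<phi> a
               \<otimes>\<^bsub>grp Y (vmap \<phi> (ter X a))\<^esub>
               psi Y (emap \<phi> a) (inv\<^bsub>grp Y (vmap \<phi> (ini X a))\<^esub> (k (ini X a)))) \<longleftrightarrow>
     (\<forall>\<sigma>\<in>verts X. k \<sigma> \<in> carrier (grp Y (vmap \<phi> \<sigma>)) \<and> (\<forall>g\<in>carrier (grp X \<sigma>).
           lmap \<eta> \<sigma> g \<otimes>\<^bsub>grp Y (vmap \<phi> \<sigma>)\<^esub> k \<sigma> = k \<sigma> \<otimes>\<^bsub>grp Y (vmap \<phi> \<sigma>)\<^esub> lmap \<phi> \<sigma> g)) \<and>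
     (\<forall>a\<in>edges X. elt \<eta> a \<otimes>\<^bsub>grp Y (vmap \<phi> (ter X a))\<^esub> psi Y (emap \<phi> a) (k (ini X a))
        = k (ter X a) \<otimes>\<^bsub>grp Y (vmap \<phi> (ter X a))\<^esub> elt \<phi> a)"
    if "\<forall>\<sigma>\<in>verts X. vmap \<eta> \<sigma> = vmap \<phi> \<sigma>" for k
    by (intro conj_cong ball_cong refl l e) (use that in auto)
  then show ?thesis
    unfolding mor_htpy_def htpy_by_def by (simp only: ex_simps cong: conj_cong)
qed

section \<open>Coverings and path lifting\<close>

locale cog_htpy = f: cog_morphism X Y \<phi> + g: cog_morphism X Y \<eta>
  for X :: "('v, 'e, 'g) cog" and Y :: "('w, 'f, 'h) cog"
    and \<phi> \<eta> :: "('v, 'e, 'g, 'w, 'f, 'h) cog_mor" +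
  fixes k :: "'v \<Rightarrow> 'h"
  assumes htpy: "htpy_by X Y \<phi> \<eta> k"
begin

lemma k_closed [simp, intro]: "\<sigma> \<in> verts X \<Longrightarrow> k \<sigma> \<in> carrier (grp Y (vmap \<phi> \<sigma>))"
  and vmap_eq: "\<sigma> \<in> verts X \<Longrightarrow> vmap \<eta> \<sigma> = vmap \<phi> \<sigma>"
  and emap_eq: "a \<in> edges X \<Longrightarrow> emap \<eta> a = emap \<phi> a"
  and lmap_k: "\<lbrakk>\<sigma> \<in> verts X; g \<in> carrier (grp X \<sigma>)\<rbrakk> \<Longrightarrow>
    lmap \<eta> \<sigma> g \<otimes>\<^bsub>grp Y (vmap \<phi> \<sigma>)\<^esub> k \<sigma> = k \<sigma> \<otimes>\<^bsub>grp Y (vmap \<phi> \<sigma>)\<^esub> lmap \<phi> \<sigma> g"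
  and elt_k: "a \<in> edges X \<Longrightarrow>
    elt \<eta> a \<otimes>\<^bsub>grp Y (vmap \<phi> (ter X a))\<^esub> psi Y (emap \<phi> a) (k (ini X a))
    = k (ter X a) \<otimes>\<^bsub>grp Y (vmap \<phi> (ter X a))\<^esub> elt \<phi> a"
  using htpy by (simp_all add: htpy_by_def)

lemma lmap_closed' [simp, intro]:
  "\<lbrakk>\<sigma> \<in> verts X; g \<in> carrier (grp X \<sigma>)\<rbrakk> \<Longrightarrow> lmap \<eta> \<sigma> g \<in> carrier (grp Y (vmap \<phi> \<sigma>))"
  and elt_closed' [simp, intro]: "a \<in> edges X \<Longrightarrow> elt \<eta> a \<in> carrier (grp Y (vmap \<phi> (ter X a)))"
  using g.lmap_closed[of \<sigma> g] g.elt_closed[of a] by (simp_all add: vmap_eq)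

text \<open>The elements \<open>k\<close> are the components of a natural transformation between the
  induced functors. Naturality squares can be pasted, so only generators have to be checked, and
  there the squares are the two conditions of a homotopy.\<close>

lemma ind_natural:
  assumes "P \<in> arr X \<sigma> \<rho>"
  shows "g.ind P \<odot>\<^bsub>Y\<^esub> loc Y (vmap \<phi> \<rho>) (k \<rho>) = loc Y (vmap \<phi> \<sigma>) (k \<sigma>) \<odot>\<^bsub>Y\<^esub> f.ind P"
  using assms
proof (induction rule: f.X.arr_induct)
  case (loc g)
  then show ?case by (simp add: vmap_eq f.Y.loc_mult lmap_k)
next
  case (step x e Q)
  have e: "g.ind (oarr X e) \<odot>\<^bsub>Y\<^esub> loc Y (vmap \<phi> (oter X e)) (k (oter X e))
      = loc Y (vmap \<phi> (oini X e)) (k (oini X e)) \<odot>\<^bsub>Y\<^esub> f.ind (oarr X e)"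
  proof (cases e)
    case (Fwd a)
    then have a: "a \<in> edges X" using step by simp
    let ?H = "grp Y (vmap \<phi> (ter X a))"
    interpret H: group ?H using a by auto
    \<comment> \<open>The edge condition solved for the inverses that the images of a forward edge
      carry.\<close>
    have eq: "inv\<^bsub>?H\<^esub> elt \<eta> a \<otimes>\<^bsub>?H\<^esub> k (ter X a)
        = psi Y (emap \<phi> a) (k (ini X a)) \<otimes>\<^bsub>?H\<^esub> inv\<^bsub>?H\<^esub> elt \<phi> a"
      using a by (simp add: H.inv_solve_right H.m_assoc elt_k[symmetric])
    have "g.ind (oarr X (Fwd a)) \<odot>\<^bsub>Y\<^esub> loc Y (vmap \<phi> (ter X a)) (k (ter X a))
      = oarr Y (Fwd (emap \<phi> a)) \<odot>\<^bsub>Y\<^esub> loc Y (vmap \<phi> (ter X a)) (inv\<^bsub>?H\<^esub> elt \<eta> a \<otimes>\<^bsub>?H\<^esub> k (ter X a))"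
      using a by (simp add: g.ind_Fwd vmap_eq emap_eq f.Y.hmul_assoc f.Y.loc_mult)
    also have "\<dots> = (oarr Y (Fwd (emap \<phi> a)) \<odot>\<^bsub>Y\<^esub> loc Y (vmap \<phi> (ter X a)) (psi Y (emap \<phi> a) (k (ini X a))))
        \<odot>\<^bsub>Y\<^esub> loc Y (vmap \<phi> (ter X a)) (inv\<^bsub>?H\<^esub> elt \<phi> a)"
      unfolding eq using a by (simp add: f.Y.hmul_assoc f.Y.loc_mult)
    also have "\<dots> = loc Y (vmap \<phi> (ini X a)) (k (ini X a)) \<odot>\<^bsub>Y\<^esub> f.ind (oarr X (Fwd a))"
      using a by (simp add: f.ind_Fwd f.emap_slide[symmetric] f.Y.hmul_assoc)
    finally show ?thesis using Fwd by simp
  next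
    case (Bwd a)
    then have a: "a \<in> edges X" using step by simp
    let ?H = "grp Y (vmap \<phi> (ter X a))"
    have "g.ind (oarr X (Bwd a)) \<odot>\<^bsub>Y\<^esub> loc Y (vmap \<phi> (ini X a)) (k (ini X a))
      = loc Y (vmap \<phi> (ter X a)) (elt \<eta> a) \<odot>\<^bsub>Y\<^esub>
        (oarr Y (Bwd (emap \<phi> a)) \<odot>\<^bsub>Y\<^esub> loc Y (vmap \<phi> (ini X a)) (k (ini X a)))"
      using a by (simp add: g.ind_Bwd vmap_eq emap_eq f.Y.hmul_assoc)
    also have "\<dots> = loc Y (vmap \<phi> (ter X a)) (elt \<eta> a \<otimes>\<^bsub>?H\<^esub> psi Y (emap \<phi> a) (k (ini X a)))
        \<odot>\<^bsub>Y\<^esub> oarr Y (Bwd (emap \<phi> a))"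
      using a by (simp add: f.emap_slide_bwd f.Y.hmul_assoc[symmetric] f.Y.loc_mult)
    also have "\<dots> = loc Y (vmap \<phi> (ter X a)) (k (ter X a)) \<odot>\<^bsub>Y\<^esub> f.ind (oarr X (Bwd a))"
      unfolding elt_k[OF a] using a by (simp add: f.ind_Bwd f.Y.hmul_assoc[symmetric] f.Y.loc_mult)
    finally show ?thesis using Bwd by simp
  qed
  let ?o = "oini X e" and ?t = "oter X e"
  let ?l = "loc X ?o x"
  have l: "?l \<in> arr X ?o ?o" and e': "oarr X e \<in> arr X ?o ?t" and o: "?o \<in> verts X"
    using step by auto
  note eQ = f.X.hmul_arr[OF e' step(3)]
  have "g.ind (?l \<odot>\<^bsub>X\<^esub> (oarr X e \<odot>\<^bsub>X\<^esub> Q)) \<odot>\<^bsub>Y\<^esub> loc Y (vmap \<phi> \<rho>) (k \<rho>)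
      = g.ind ?l \<odot>\<^bsub>Y\<^esub> (g.ind (oarr X e) \<odot>\<^bsub>Y\<^esub> (g.ind Q \<odot>\<^bsub>Y\<^esub> loc Y (vmap \<phi> \<rho>) (k \<rho>)))"
    unfolding g.ind_hmul[OF l eQ] g.ind_hmul[OF e' step(3)] by (simp add: f.Y.hmul_assoc)
  also have "\<dots> = g.ind ?l \<odot>\<^bsub>Y\<^esub> (g.ind (oarr X e) \<odot>\<^bsub>Y\<^esub> loc Y (vmap \<phi> ?t) (k ?t)) \<odot>\<^bsub>Y\<^esub> f.ind Q"
    unfolding step(4) by (simp add: f.Y.hmul_assoc)
  also have "\<dots> = (g.ind ?l \<odot>\<^bsub>Y\<^esub> loc Y (vmap \<phi> ?o) (k ?o)) \<odot>\<^bsub>Y\<^esub> (f.ind (oarr X e) \<odot>\<^bsub>Y\<^esub> f.ind Q)"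
    unfolding e by (simp add: f.Y.hmul_assoc)
  also have "g.ind ?l \<odot>\<^bsub>Y\<^esub> loc Y (vmap \<phi> ?o) (k ?o) = loc Y (vmap \<phi> ?o) (k ?o) \<odot>\<^bsub>Y\<^esub> f.ind ?l"
    using step(2) o by (simp add: vmap_eq f.Y.loc_mult lmap_k)
  finally show ?case
    unfolding f.ind_hmul[OF l eQ] f.ind_hmul[OF e' step(3)] by (simp add: f.Y.hmul_assoc)
qed

end

section \<open>The coset bijections of a covering and the lifting of paths\<close>

locale cog_covering = cog_morphism X Y \<phi>
  for X :: "('v, 'e, 'g) cog" and Y :: "('w, 'f, 'h) cog"
    and \<phi> :: "('v, 'e, 'g, 'w, 'f, 'h) cog_mor" +
  assumes cov: "covering X Y \<phi>"
begin

lemma lmap_inj: "\<sigma> \<in> verts X \<Longrightarrow> inj_on (lmap \<phi> \<sigma>) (carrier (grp X \<sigma>))"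
  using cov by (simp add: covering_def)

lemma lmap_eq_iff: "\<lbrakk>\<sigma> \<in> verts X; g \<in> carrier (grp X \<sigma>); h \<in> carrier (grp X \<sigma>)\<rbrakk> \<Longrightarrow>
    lmap \<phi> \<sigma> g = lmap \<phi> \<sigma> h \<longleftrightarrow> g = h"
  using lmap_inj by (auto dest: inj_onD)

lemma psi_image_subgroup: "a \<in> edges X \<Longrightarrow> subgroup (psi_image X a) (grp X (ter X a))"
  unfolding psi_image_def by (rule group_hom.img_is_subgroup[OF X.psi_group_hom])

lemma psi_image_subgroup_Y: "a \<in> edges X \<Longrightarrow> subgroup (psi_image Y (emap \<phi> a)) (grp Y (vmap \<phi> (ter X a)))"
  unfolding psi_image_def using group_hom.img_is_subgroup[OF Y.psi_group_hom[of "emap \<phi> a"]] by simp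

text \<open>The union defining \<open>coset_map\<close> is over equal cosets: replacing
  \<open>g\<close> by \<open>g\<close> times \<open>psi X a r\<close> moves the image of
  \<open>r\<close> across \<open>elt \<phi> a\<close> by \<open>elt_slide\<close>, where it lands in
  the subgroup.\<close>

lemma coset_map_coset:
  assumes "a \<in> edges X" "g \<in> carrier (grp X (ter X a))"
  shows "coset_map X Y \<phi> (ter X a) (emap \<phi> a) (a, g <#\<^bsub>grp X (ter X a)\<^esub> psi_image X a)
    = (lmap \<phi> (ter X a) g \<otimes>\<^bsub>grp Y (vmap \<phi> (ter X a))\<^esub> elt \<phi> a)
        <#\<^bsub>grp Y (vmap \<phi> (ter X a))\<^esub> psi_image Y (emap \<phi> a)"
proof -
  let ?G = "grp X (ter X a)" and ?H = "grp Y (vmap \<phi> (ter X a))"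
  interpret G: group ?G using assms by auto
  interpret H: group ?H using assms by auto
  have "(lmap \<phi> (ter X a) g' \<otimes>\<^bsub>?H\<^esub> elt \<phi> a) <#\<^bsub>?H\<^esub> psi_image Y (emap \<phi> a)
      = (lmap \<phi> (ter X a) g \<otimes>\<^bsub>?H\<^esub> elt \<phi> a) <#\<^bsub>?H\<^esub> psi_image Y (emap \<phi> a)"
    if g': "g' \<in> g <#\<^bsub>?G\<^esub> psi_image X a" for g'
  proof -
    obtain r where r: "r \<in> carrier (grp X (ini X a))" "g' = g \<otimes>\<^bsub>?G\<^esub> psi X a r"
      using g' by (auto simp: l_coset_def psi_image_def)
    let ?r = "lmap \<phi> (ini X a) r"
    have rY: "?r \<in> carrier (grp Y (vmap \<phi> (ini X a)))" using r assms by auto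
    have "lmap \<phi> (ter X a) g' \<otimes>\<^bsub>?H\<^esub> elt \<phi> a
      = lmap \<phi> (ter X a) g \<otimes>\<^bsub>?H\<^esub> (lmap \<phi> (ter X a) (psi X a r) \<otimes>\<^bsub>?H\<^esub> elt \<phi> a)"
      using r assms by (simp add: lmap_mult H.m_assoc)
    also have "\<dots> = (lmap \<phi> (ter X a) g \<otimes>\<^bsub>?H\<^esub> elt \<phi> a) \<otimes>\<^bsub>?H\<^esub> psi Y (emap \<phi> a) ?r"
      unfolding elt_slide[OF assms(1) r(1), symmetric] using rY assms by (simp add: H.m_assoc)
    finally have "lmap \<phi> (ter X a) g' \<otimes>\<^bsub>?H\<^esub> elt \<phi> a
        \<in> (lmap \<phi> (ter X a) g \<otimes>\<^bsub>?H\<^esub> elt \<phi> a) <#\<^bsub>?H\<^esub> psi_image Y (emap \<phi> a)"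
      using rY assms by (auto simp: l_coset_def psi_image_def)
    then show ?thesis
      using H.l_repr_independence[OF _ _ psi_image_subgroup_Y[OF assms(1)]] assms by (metis H.m_closed X.ter_vert elt_closed lmap_closed)
  qed
  moreover have "g \<in> g <#\<^bsub>?G\<^esub> psi_image X a"
    using G.lcos_self[OF assms(2) psi_image_subgroup[OF assms(1)]] .
  ultimately show ?thesis unfolding coset_map_def prod.case by blast
qed

lemma coset_map_bij:
  "\<lbrakk>\<sigma> \<in> verts X; a' \<in> edges Y; ter Y a' = vmap \<phi> \<sigma>\<rbrakk> \<Longrightarrow>
   bij_betw (coset_map X Y \<phi> \<sigma> a')
     (SIGMA a : {a \<in> edges X. emap \<phi> a = a' \<and> ter X a = \<sigma>}. lcosets\<^bsub>grp X \<sigma>\<^esub> (psi_image X a))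
     (lcosets\<^bsub>grp Y (vmap \<phi> \<sigma>)\<^esub> (psi_image Y a'))"
  using cov unfolding covering_def by blast

text \<open>Surjectivity on cosets with the representative made explicit by \<open>s\<close>. In
  lifting an inverse edge, \<open>g\<close> joins the lift and \<open>s\<close> is what
  remains.\<close>

lemma coset_surj:
  assumes "\<sigma> \<in> verts X" "a' \<in> edges Y" "ter Y a' = vmap \<phi> \<sigma>" "h \<in> carrier (grp Y (vmap \<phi> \<sigma>))"
  obtains a g s where "a \<in> edges X" "emap \<phi> a = a'" "ter X a = \<sigma>" "g \<in> carrier (grp X \<sigma>)"
    "s \<in> carrier (grp Y (vmap \<phi> (ini X a)))"
    "h = lmap \<phi> \<sigma> g \<otimes>\<^bsub>grp Y (vmap \<phi> \<sigma>)\<^esub> elt \<phi> a \<otimes>\<^bsub>grp Y (vmap \<phi> \<sigma>)\<^esub> psi Y a' s"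
proof -
  interpret H: group "grp Y (vmap \<phi> \<sigma>)" using assms by auto
  have sub: "subgroup (psi_image Y a') (grp Y (vmap \<phi> \<sigma>))"
    unfolding psi_image_def using group_hom.img_is_subgroup[OF Y.psi_group_hom[OF assms(2)]] assms(3) by simp
  have "h <#\<^bsub>grp Y (vmap \<phi> \<sigma>)\<^esub> psi_image Y a' \<in> lcosets\<^bsub>grp Y (vmap \<phi> \<sigma>)\<^esub> (psi_image Y a')"
    using assms(4) by (auto simp: LCOSETS_def)
  then have "h <#\<^bsub>grp Y (vmap \<phi> \<sigma>)\<^esub> psi_image Y a' \<in> coset_map X Y \<phi> \<sigma> a' `
      (SIGMA a : {a \<in> edges X. emap \<phi> a = a' \<and> ter X a = \<sigma>}. lcosets\<^bsub>grp X \<sigma>\<^esub> (psi_image X a))"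
    unfolding bij_betw_imp_surj_on[OF coset_map_bij[OF assms(1-3)]] .
  then obtain x where x: "h <#\<^bsub>grp Y (vmap \<phi> \<sigma>)\<^esub> psi_image Y a' = coset_map X Y \<phi> \<sigma> a' x"
      "x \<in> (SIGMA a : {a \<in> edges X. emap \<phi> a = a' \<and> ter X a = \<sigma>}. lcosets\<^bsub>grp X \<sigma>\<^esub> (psi_image X a))"
    by (rule imageE)
  obtain a C where xaC: "x = (a, C)" by (cases x)
  with x(2) have a: "a \<in> edges X" "emap \<phi> a = a'" "ter X a = \<sigma>" "C \<in> lcosets\<^bsub>grp X \<sigma>\<^esub> (psi_image X a)"
    by auto
  then obtain g where g: "g \<in> carrier (grp X \<sigma>)" "C = g <#\<^bsub>grp X \<sigma>\<^esub> psi_image X a"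
    by (auto simp: LCOSETS_def)
  have "h \<in> h <#\<^bsub>grp Y (vmap \<phi> \<sigma>)\<^esub> psi_image Y a'"
    by (rule H.lcos_self[OF assms(4) sub])
  also have "\<dots> = (lmap \<phi> \<sigma> g \<otimes>\<^bsub>grp Y (vmap \<phi> \<sigma>)\<^esub> elt \<phi> a) <#\<^bsub>grp Y (vmap \<phi> \<sigma>)\<^esub> psi_image Y a'"
    using x(1) xaC a g coset_map_coset[of a g] by simp
  finally obtain s where "s \<in> carrier (grp Y (ini Y a'))"
      "h = lmap \<phi> \<sigma> g \<otimes>\<^bsub>grp Y (vmap \<phi> \<sigma>)\<^esub> elt \<phi> a \<otimes>\<^bsub>grp Y (vmap \<phi> \<sigma>)\<^esub> psi Y a' s"
    by (auto simp: l_coset_def psi_image_def)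
  with a g show thesis by (intro that[of a g s]) auto
qed

text \<open>The factors \<open>psi Y (emap \<phi> a) s\<close> and
  \<open>psi Y (emap \<phi> a) s'\<close> disappear in the coset, so both sides represent the same
  coset of \<open>Y\<close>; injectivity then identifies the edges and the cosets upstairs.\<close>

lemma coset_inj:
  assumes a: "a \<in> edges X" "g \<in> carrier (grp X (ter X a))" "s \<in> carrier (grp Y (vmap \<phi> (ini X a)))"
    and b: "b \<in> edges X" "g' \<in> carrier (grp X (ter X a))" "s' \<in> carrier (grp Y (vmap \<phi> (ini X b)))"
    and ab: "emap \<phi> b = emap \<phi> a" "ter X b = ter X a"
    and eq: "lmap \<phi> (ter X a) g \<otimes>\<^bsub>grp Y (vmap \<phi> (ter X a))\<^esub> elt \<phi> a \<otimes>\<^bsub>grp Y (vmap \<phi> (ter X a))\<^esub> psi Y (emap \<phi> a) s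
      = lmap \<phi> (ter X a) g' \<otimes>\<^bsub>grp Y (vmap \<phi> (ter X a))\<^esub> elt \<phi> b \<otimes>\<^bsub>grp Y (vmap \<phi> (ter X a))\<^esub> psi Y (emap \<phi> a) s'"
  shows "b = a \<and> (\<exists>r\<in>carrier (grp X (ini X a)). g' = g \<otimes>\<^bsub>grp X (ter X a)\<^esub> psi X a r)"
proof -
  let ?G = "grp X (ter X a)" and ?H = "grp Y (vmap \<phi> (ter X a))"
  interpret G: group ?G using assms by auto
  interpret H: group ?H using assms by auto
  let ?x = "lmap \<phi> (ter X a) g \<otimes>\<^bsub>?H\<^esub> elt \<phi> a" and ?y = "lmap \<phi> (ter X a) g' \<otimes>\<^bsub>?H\<^esub> elt \<phi> b"
  let ?I = "psi_image Y (emap \<phi> a)"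
  have cl: "?x \<in> carrier ?H" "?y \<in> carrier ?H"
    using a b ab elt_closed[OF b(1)] by auto
  have s: "psi Y (emap \<phi> a) s \<in> ?I" "psi Y (emap \<phi> a) s' \<in> ?I"
    using a b ab ini_emap[OF b(1)] ini_emap[OF a(1)] by (auto simp: psi_image_def)
  note sub = psi_image_subgroup_Y[OF a(1)]
  have "?x <#\<^bsub>?H\<^esub> ?I = (?x \<otimes>\<^bsub>?H\<^esub> psi Y (emap \<phi> a) s) <#\<^bsub>?H\<^esub> ?I"
    using s by (intro H.l_repr_independence[OF _ cl(1) sub]) (auto simp: l_coset_def)
  also have "\<dots> = ?y <#\<^bsub>?H\<^esub> ?I"
    unfolding eq using s by (intro H.l_repr_independence[OF _ cl(2) sub, symmetric]) (auto simp: l_coset_def)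
  finally have "coset_map X Y \<phi> (ter X a) (emap \<phi> a) (a, g <#\<^bsub>?G\<^esub> psi_image X a)
      = coset_map X Y \<phi> (ter X a) (emap \<phi> a) (b, g' <#\<^bsub>?G\<^esub> psi_image X b)"
    using coset_map_coset[OF a(1,2)] coset_map_coset[of b g'] a b ab by simp
  then have "(a, g <#\<^bsub>?G\<^esub> psi_image X a) = (b, g' <#\<^bsub>?G\<^esub> psi_image X b)"
    using a b ab
    by (intro inj_onD[OF bij_betw_imp_inj_on[OF coset_map_bij[of "ter X a" "emap \<phi> a"]]]) (auto simp: LCOSETS_def)
  moreover have "g' \<in> g' <#\<^bsub>?G\<^esub> psi_image X b"
    using G.lcos_self[OF b(2)] psi_image_subgroup[OF b(1)] ab by simp
  ultimately show ?thesis by (auto simp: l_coset_def psi_image_def)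
qed

text \<open>The initial local element \<open>h\<close> is kept general because the leftover of one
  generator has to be fed into the next.\<close>

lemma path_lift:
  assumes "Q \<in> arr Y \<tau> \<tau>'" "\<sigma> \<in> verts X" "vmap \<phi> \<sigma> = \<tau>" "h \<in> carrier (grp Y \<tau>)"
  shows "\<exists>\<rho> S h'. S \<in> arr X \<sigma> \<rho> \<and> vmap \<phi> \<rho> = \<tau>' \<and> h' \<in> carrier (grp Y \<tau>') \<and>
    loc Y \<tau> h \<odot>\<^bsub>Y\<^esub> Q = ind S \<odot>\<^bsub>Y\<^esub> loc Y \<tau>' h'"
  using assms
proof (induction arbitrary: \<sigma> h rule: Y.arr_induct)
  case (loc g)
  then show ?case
    by (intro exI[of _ \<sigma>] exI[of _ "loc X \<sigma> \<one>\<^bsub>grp X \<sigma>\<^esub>"] exI[of _ "h \<otimes>\<^bsub>grp Y \<tau>'\<^esub> g"])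
       (auto simp: Y.loc_mult)
next
  case (step g e Q)
  let ?o = "oini Y e" and ?t = "oter Y e"
  have o: "?o \<in> verts Y" using step by auto
  have *: "loc Y ?o h \<odot>\<^bsub>Y\<^esub> (loc Y ?o g \<odot>\<^bsub>Y\<^esub> (oarr Y e \<odot>\<^bsub>Y\<^esub> Q))
      = loc Y ?o (h \<otimes>\<^bsub>grp Y ?o\<^esub> g) \<odot>\<^bsub>Y\<^esub> oarr Y e \<odot>\<^bsub>Y\<^esub> Q"
    using step o by (simp add: Y.hmul_assoc[symmetric] Y.loc_mult)
  let ?x = "h \<otimes>\<^bsub>grp Y ?o\<^esub> g"
  have x: "?x \<in> carrier (grp Y ?o)" using step o by simp
  have "\<exists>\<rho> R h'. R \<in> arr X \<sigma> \<rho> \<and> vmap \<phi> \<rho> = ?t \<and> h' \<in> carrier (grp Y ?t) \<and>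
    loc Y ?o ?x \<odot>\<^bsub>Y\<^esub> oarr Y e = ind R \<odot>\<^bsub>Y\<^esub> loc Y ?t h'"
  proof (cases e)
    case (Fwd a')
    then obtain a where a: "a \<in> edges X" "ini X a = \<sigma>" "emap \<phi> a = a'"
      using edge_lift[of \<sigma> a'] step by auto
    then show ?thesis
      using Fwd x ind_Fwd_elt[of a ?x] psi_emap_closed[of a ?x]
      by (intro exI[of _ "ter X a"] exI[of _ "oarr X (Fwd a)"]
        exI[of _ "elt \<phi> a \<otimes>\<^bsub>grp Y (vmap \<phi> (ter X a))\<^esub> psi Y a' ?x"]) auto
  next
    case (Bwd a')
    \<comment> \<open>The accumulated element in front of the inverse edge selects, through its
      coset, both the edge \<open>a\<close> along which to go back and the element \<open>u\<close>
      to put before it.\<close>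
    then obtain a u s where a: "a \<in> edges X" "emap \<phi> a = a'" "ter X a = \<sigma>" "u \<in> carrier (grp X \<sigma>)"
      "s \<in> carrier (grp Y (vmap \<phi> (ini X a)))"
      "?x = lmap \<phi> \<sigma> u \<otimes>\<^bsub>grp Y (vmap \<phi> \<sigma>)\<^esub> elt \<phi> a \<otimes>\<^bsub>grp Y (vmap \<phi> \<sigma>)\<^esub> psi Y a' s"
      using coset_surj[of \<sigma> a' ?x] step x by auto
    let ?L = "loc Y (vmap \<phi> (ter X a))"
    have ps: "psi Y (emap \<phi> a) s \<in> carrier (grp Y (vmap \<phi> (ter X a)))" using a by blast
    have u: "loc X \<sigma> u \<in> arr X \<sigma> \<sigma>" using a step by auto
    have "?L ?x \<odot>\<^bsub>Y\<^esub> oarr Y (Bwd a')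
      = ?L (lmap \<phi> \<sigma> u) \<odot>\<^bsub>Y\<^esub> (?L (elt \<phi> a) \<odot>\<^bsub>Y\<^esub> (?L (psi Y (emap \<phi> a) s) \<odot>\<^bsub>Y\<^esub> oarr Y (Bwd (emap \<phi> a))))"
      unfolding a(6) using a ps step(5) elt_closed[OF a(1)] by (simp add: Y.hmul_assoc[symmetric] Y.loc_mult Y.grp_assoc)
    also have "?L (psi Y (emap \<phi> a) s) \<odot>\<^bsub>Y\<^esub> oarr Y (Bwd (emap \<phi> a))
       = oarr Y (Bwd (emap \<phi> a)) \<odot>\<^bsub>Y\<^esub> loc Y (vmap \<phi> (ini X a)) s"
      by (rule emap_slide_bwd[OF a(1,5), symmetric])
    also have "?L (lmap \<phi> \<sigma> u) \<odot>\<^bsub>Y\<^esub> (?L (elt \<phi> a) \<odot>\<^bsub>Y\<^esub> (oarr Y (Bwd (emap \<phi> a)) \<odot>\<^bsub>Y\<^esub> loc Y (vmap \<phi> (ini X a)) s))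
      = ind (loc X \<sigma> u \<odot>\<^bsub>X\<^esub> oarr X (Bwd a)) \<odot>\<^bsub>Y\<^esub> loc Y (vmap \<phi> (ini X a)) s"
      using a step(5) ind_hmul[OF u, of "oarr X (Bwd a)" "ini X a"] X.oarr_Bwd_arr[of a]
      by (simp add: ind_Bwd Y.hmul_assoc)
    finally have **: "?L ?x \<odot>\<^bsub>Y\<^esub> oarr Y (Bwd a')
      = ind (loc X \<sigma> u \<odot>\<^bsub>X\<^esub> oarr X (Bwd a)) \<odot>\<^bsub>Y\<^esub> loc Y (vmap \<phi> (ini X a)) s" .
    have "loc X \<sigma> u \<odot>\<^bsub>X\<^esub> oarr X (Bwd a) \<in> arr X \<sigma> (ini X a)"
      using X.hmul_arr[OF u, of "oarr X (Bwd a)"] X.oarr_Bwd_arr[OF a(1)] a(3) by simp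
    moreover have "vmap \<phi> (ini X a) = ?t" using a(1,2) ini_emap[of a] Bwd by simp
    moreover have "loc Y ?o ?x \<odot>\<^bsub>Y\<^esub> oarr Y e
      = ind (loc X \<sigma> u \<odot>\<^bsub>X\<^esub> oarr X (Bwd a)) \<odot>\<^bsub>Y\<^esub> loc Y (vmap \<phi> (ini X a)) s"
      using ** Bwd a(3) step(6) by simp
    ultimately show ?thesis using a(5) by metis
  qed
  then obtain \<rho> R h' where R: "R \<in> arr X \<sigma> \<rho>" "vmap \<phi> \<rho> = ?t" "h' \<in> carrier (grp Y ?t)"
    "loc Y ?o ?x \<odot>\<^bsub>Y\<^esub> oarr Y e = ind R \<odot>\<^bsub>Y\<^esub> loc Y ?t h'" by blast
  obtain \<rho>' S h'' where S: "S \<in> arr X \<rho> \<rho>'" "vmap \<phi> \<rho>' = \<tau>'" "h'' \<in> carrier (grp Y \<tau>')"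
    "loc Y ?t h' \<odot>\<^bsub>Y\<^esub> Q = ind S \<odot>\<^bsub>Y\<^esub> loc Y \<tau>' h''"
    using step.IH[of \<rho> h'] R X.arr_verts[OF R(1)] by blast
  have "loc Y ?o ?x \<odot>\<^bsub>Y\<^esub> oarr Y e \<odot>\<^bsub>Y\<^esub> Q = ind (R \<odot>\<^bsub>X\<^esub> S) \<odot>\<^bsub>Y\<^esub> loc Y \<tau>' h''"
    unfolding R(4) ind_hmul[OF R(1) S(1)] using S(4) by (simp add: Y.hmul_assoc)
  then show ?case
    unfolding * using S(2,3) X.hmul_arr[OF R(1) S(1)] by blast
qed

end

section \<open>Unique lifting\<close>

lemma (in cog) grp_l_cancel:
  "\<lbrakk>\<sigma> \<in> verts X; g \<in> carrier (grp X \<sigma>); h \<in> carrier (grp X \<sigma>); k \<in> carrier (grp X \<sigma>)\<rbrakk> \<Longrightarrow>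
   g \<otimes>\<^bsub>grp X \<sigma>\<^esub> h = g \<otimes>\<^bsub>grp X \<sigma>\<^esub> k \<longleftrightarrow> h = k"
  by (metis grp_cancel(1))

lemma (in cog) grp_r_cancel:
  "\<lbrakk>\<sigma> \<in> verts X; g \<in> carrier (grp X \<sigma>); h \<in> carrier (grp X \<sigma>); k \<in> carrier (grp X \<sigma>)\<rbrakk> \<Longrightarrow>
   h \<otimes>\<^bsub>grp X \<sigma>\<^esub> g = k \<otimes>\<^bsub>grp X \<sigma>\<^esub> g \<longleftrightarrow> h = k"
  by (rule group.right_cancel) auto

context cog_covering
begin

text \<open>Pairs \<open>(P, h)\<close> of a class \<open>P\<close> of paths of \<open>X\<close> from \<open>\<sigma>\<^sub>0\<close> to \<open>\<sigma>\<close> and a local element \<open>h\<close> at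
  \<open>vmap \<phi> \<sigma>\<close>, modulo \<open>(P g, h) \<sim> (P, \<phi>(g) h)\<close>, form the fibres of an action of the paths of \<open>Y\<close> by
  partial bijections, the cosets of a covering making edges act bijectively. Unique lifting holds
  since \<open>ind P \<cdot> h\<close> moves the class of \<open>(1, 1)\<close> to that of \<open>(P, h)\<close>.\<close>

definition lift_ok :: "'v \<Rightarrow> 'v \<Rightarrow> ('v, 'e, 'g) gpath set \<Rightarrow> 'h \<Rightarrow> bool" where
  "lift_ok \<sigma>\<^sub>0 \<sigma> P h \<longleftrightarrow> P \<in> arr X \<sigma>\<^sub>0 \<sigma> \<and> h \<in> carrier (grp Y (vmap \<phi> \<sigma>))"

definition lift_class ::
    "'v \<Rightarrow> 'v \<Rightarrow> ('v, 'e, 'g) gpath set \<Rightarrow> 'h \<Rightarrow> ('v \<times> ('v, 'e, 'g) gpath set \<times> 'h) set" where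
  "lift_class \<sigma>\<^sub>0 \<sigma> P h = {(\<sigma>, Q, m) | Q m. Q \<in> arr X \<sigma>\<^sub>0 \<sigma> \<and>
     (\<exists>k\<in>carrier (grp X \<sigma>). P = Q \<odot>\<^bsub>X\<^esub> loc X \<sigma> k \<and> m = lmap \<phi> \<sigma> k \<otimes>\<^bsub>grp Y (vmap \<phi> \<sigma>)\<^esub> h)}"

lemma lift_ok_verts: "lift_ok \<sigma>\<^sub>0 \<sigma> P h \<Longrightarrow> \<sigma> \<in> verts X"
  using X.arr_verts by (auto simp: lift_ok_def)

text \<open>One inclusion suffices, as the relation between the two pairs is symmetric under
  replacing \<open>k\<close> by its inverse.\<close>

lemma lift_class_subset:
  assumes ok: "lift_ok \<sigma>\<^sub>0 \<sigma> P h" "lift_ok \<sigma>\<^sub>0 \<sigma> P' h'"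
    and k: "k \<in> carrier (grp X \<sigma>)" "P = P' \<odot>\<^bsub>X\<^esub> loc X \<sigma> k" "h' = lmap \<phi> \<sigma> k \<otimes>\<^bsub>grp Y (vmap \<phi> \<sigma>)\<^esub> h"
  shows "lift_class \<sigma>\<^sub>0 \<sigma> P h \<subseteq> lift_class \<sigma>\<^sub>0 \<sigma> P' h'"
proof
  fix u assume "u \<in> lift_class \<sigma>\<^sub>0 \<sigma> P h"
  then obtain Q l where Q: "u = (\<sigma>, Q, lmap \<phi> \<sigma> l \<otimes>\<^bsub>grp Y (vmap \<phi> \<sigma>)\<^esub> h)" "Q \<in> arr X \<sigma>\<^sub>0 \<sigma>"
      "l \<in> carrier (grp X \<sigma>)" "P = Q \<odot>\<^bsub>X\<^esub> loc X \<sigma> l"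
    by (auto simp: lift_class_def)
  note v = lift_ok_verts[OF ok(1)]
  let ?k' = "inv\<^bsub>grp X \<sigma>\<^esub> k"
  have "P' = P' \<odot>\<^bsub>X\<^esub> (loc X \<sigma> k \<odot>\<^bsub>X\<^esub> loc X \<sigma> ?k')"
    using ok v k by (simp add: X.loc_mult lift_ok_def)
  also have "\<dots> = Q \<odot>\<^bsub>X\<^esub> (loc X \<sigma> l \<odot>\<^bsub>X\<^esub> loc X \<sigma> ?k')"
    using k(2) Q(4) by (simp add: X.hmul_assoc[symmetric])
  finally have "P' = Q \<odot>\<^bsub>X\<^esub> loc X \<sigma> (l \<otimes>\<^bsub>grp X \<sigma>\<^esub> ?k')"
    using v k Q by (simp add: X.loc_mult)
  moreover have "lmap \<phi> \<sigma> l \<otimes>\<^bsub>grp Y (vmap \<phi> \<sigma>)\<^esub> h = lmap \<phi> \<sigma> (l \<otimes>\<^bsub>grp X \<sigma>\<^esub> ?k') \<otimes>\<^bsub>grp Y (vmap \<phi> \<sigma>)\<^esub> h'"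
    using v k Q ok by (simp add: lmap_mult lmap_inv Y.grp_assoc lift_ok_def)
  ultimately show "u \<in> lift_class \<sigma>\<^sub>0 \<sigma> P' h'"
    using Q v k by (auto simp: lift_class_def intro!: bexI[of _ "l \<otimes>\<^bsub>grp X \<sigma>\<^esub> ?k'"])
qed

lemma lift_class_eq_iff:
  assumes ok: "lift_ok \<sigma>\<^sub>0 \<sigma> P h" "lift_ok \<sigma>\<^sub>0 \<sigma>' P' h'"
  shows "lift_class \<sigma>\<^sub>0 \<sigma> P h = lift_class \<sigma>\<^sub>0 \<sigma>' P' h' \<longleftrightarrow> \<sigma>' = \<sigma> \<and>
    (\<exists>k\<in>carrier (grp X \<sigma>). P = P' \<odot>\<^bsub>X\<^esub> loc X \<sigma> k \<and> h' = lmap \<phi> \<sigma> k \<otimes>\<^bsub>grp Y (vmap \<phi> \<sigma>)\<^esub> h)"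
    (is "?L \<longleftrightarrow> ?R")
proof
  assume L: ?L
  have "(\<sigma>', P', h') \<in> lift_class \<sigma>\<^sub>0 \<sigma>' P' h'"
    using ok lift_ok_verts[OF ok(2)]
    by (auto simp: lift_class_def lift_ok_def intro!: bexI[of _ "\<one>\<^bsub>grp X \<sigma>'\<^esub>"])
  then show ?R unfolding L[symmetric] by (auto simp: lift_class_def)
next
  assume ?R
  then obtain k where k: "\<sigma>' = \<sigma>" "k \<in> carrier (grp X \<sigma>)" "P = P' \<odot>\<^bsub>X\<^esub> loc X \<sigma> k"
      "h' = lmap \<phi> \<sigma> k \<otimes>\<^bsub>grp Y (vmap \<phi> \<sigma>)\<^esub> h" by blast
  note v = lift_ok_verts[OF ok(1)]
  have "P' = P \<odot>\<^bsub>X\<^esub> loc X \<sigma> (inv\<^bsub>grp X \<sigma>\<^esub> k)" "h = lmap \<phi> \<sigma> (inv\<^bsub>grp X \<sigma>\<^esub> k) \<otimes>\<^bsub>grp Y (vmap \<phi> \<sigma>)\<^esub> h'"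
    using k v ok by (simp_all add: X.hmul_assoc X.loc_mult lmap_inv lift_ok_def)
  note inv = X.grp_inv[OF v k(2)] this
  from ok(2) have ok': "lift_ok \<sigma>\<^sub>0 \<sigma> P' h'" unfolding k(1) .
  show ?L unfolding k(1)
    using lift_class_subset[OF ok(1) ok' k(2-4)] lift_class_subset[OF ok' ok(1) inv] by (rule subset_antisym)
qed

section \<open>The action of the paths of \<open>Y\<close> on classes of lifts\<close>

definition lift_classes :: "'v \<Rightarrow> 'w \<Rightarrow> ('v \<times> ('v, 'e, 'g) gpath set \<times> 'h) set set" where
  "lift_classes \<sigma>\<^sub>0 \<tau> = {lift_class \<sigma>\<^sub>0 \<sigma> P h | \<sigma> P h. lift_ok \<sigma>\<^sub>0 \<sigma> P h \<and> vmap \<phi> \<sigma> = \<tau>}"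

text \<open>A relation instead of a function, since an element at \<tau> acts only on the classes
  over \<tau>; products then become relational composition, which is associative without side
  conditions.\<close>

definition loc_act :: "'v \<Rightarrow> 'w \<Rightarrow> 'h \<Rightarrow> ('v \<times> ('v, 'e, 'g) gpath set \<times> 'h) set rel" where
  "loc_act \<sigma>\<^sub>0 \<tau> g = {(lift_class \<sigma>\<^sub>0 \<sigma> P h, lift_class \<sigma>\<^sub>0 \<sigma> P (h \<otimes>\<^bsub>grp Y \<tau>\<^esub> g)) | \<sigma> P h.
     lift_ok \<sigma>\<^sub>0 \<sigma> P h \<and> vmap \<phi> \<sigma> = \<tau>}"

text \<open>The leftover behind the lifted edge is the one dictated by \<open>ind_Fwd_elt\<close>:
  the path grows by the unique lift of the edge, and the class of \<open>ind P\<close> followed by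
  \<open>h\<close> is multiplied by the edge of \<open>Y\<close>.\<close>

definition edge_act :: "'v \<Rightarrow> 'f \<Rightarrow> ('v \<times> ('v, 'e, 'g) gpath set \<times> 'h) set rel" where
  "edge_act \<sigma>\<^sub>0 a' = {(lift_class \<sigma>\<^sub>0 (ini X a) P h,
       lift_class \<sigma>\<^sub>0 (ter X a) (P \<odot>\<^bsub>X\<^esub> oarr X (Fwd a))
         (elt \<phi> a \<otimes>\<^bsub>grp Y (vmap \<phi> (ter X a))\<^esub> psi Y a' h)) | a P h.
     a \<in> edges X \<and> emap \<phi> a = a' \<and> lift_ok \<sigma>\<^sub>0 (ini X a) P h}"

primrec oedge_act :: "'v \<Rightarrow> 'f oedge \<Rightarrow> ('v \<times> ('v, 'e, 'g) gpath set \<times> 'h) set rel" where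
  "oedge_act \<sigma>\<^sub>0 (Fwd a) = edge_act \<sigma>\<^sub>0 a"
| "oedge_act \<sigma>\<^sub>0 (Bwd a) = (edge_act \<sigma>\<^sub>0 a)\<inverse>"

lemma lift_ok_mult: "\<lbrakk>lift_ok \<sigma>\<^sub>0 \<sigma> P h; g \<in> carrier (grp Y (vmap \<phi> \<sigma>))\<rbrakk> \<Longrightarrow>
    lift_ok \<sigma>\<^sub>0 \<sigma> P (h \<otimes>\<^bsub>grp Y (vmap \<phi> \<sigma>)\<^esub> g)"
  using lift_ok_verts by (auto simp: lift_ok_def)

lemma lift_ok_edge: "\<lbrakk>lift_ok \<sigma>\<^sub>0 (ini X a) P h; a \<in> edges X\<rbrakk> \<Longrightarrow>
    lift_ok \<sigma>\<^sub>0 (ter X a) (P \<odot>\<^bsub>X\<^esub> oarr X (Fwd a))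
      (elt \<phi> a \<otimes>\<^bsub>grp Y (vmap \<phi> (ter X a))\<^esub> psi Y (emap \<phi> a) h)"
  by (auto simp: lift_ok_def)

lemma lift_class_mult:
  assumes "lift_ok \<sigma>\<^sub>0 \<sigma> P h" "lift_ok \<sigma>\<^sub>0 \<sigma>' P' h'" "g \<in> carrier (grp Y (vmap \<phi> \<sigma>))"
    and "lift_class \<sigma>\<^sub>0 \<sigma> P h = lift_class \<sigma>\<^sub>0 \<sigma>' P' h'"
  shows "\<sigma>' = \<sigma> \<and> lift_class \<sigma>\<^sub>0 \<sigma> P (h \<otimes>\<^bsub>grp Y (vmap \<phi> \<sigma>)\<^esub> g)
    = lift_class \<sigma>\<^sub>0 \<sigma>' P' (h' \<otimes>\<^bsub>grp Y (vmap \<phi> \<sigma>)\<^esub> g)"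
proof -
  obtain k where k: "\<sigma>' = \<sigma>" "k \<in> carrier (grp X \<sigma>)" "P = P' \<odot>\<^bsub>X\<^esub> loc X \<sigma> k"
      "h' = lmap \<phi> \<sigma> k \<otimes>\<^bsub>grp Y (vmap \<phi> \<sigma>)\<^esub> h"
    using assms(4) unfolding lift_class_eq_iff[OF assms(1,2)] by blast
  have "h' \<otimes>\<^bsub>grp Y (vmap \<phi> \<sigma>)\<^esub> g = lmap \<phi> \<sigma> k \<otimes>\<^bsub>grp Y (vmap \<phi> \<sigma>)\<^esub> (h \<otimes>\<^bsub>grp Y (vmap \<phi> \<sigma>)\<^esub> g)"
    using k assms lift_ok_verts[OF assms(1)] by (simp add: Y.grp_assoc lift_ok_def)
  moreover have ok: "lift_ok \<sigma>\<^sub>0 \<sigma> P (h \<otimes>\<^bsub>grp Y (vmap \<phi> \<sigma>)\<^esub> g)" "lift_ok \<sigma>\<^sub>0 \<sigma> P' (h' \<otimes>\<^bsub>grp Y (vmap \<phi> \<sigma>)\<^esub> g)"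
    using lift_ok_mult[OF assms(1,3)] lift_ok_mult[of \<sigma>\<^sub>0 \<sigma> P' h' g] assms(2,3) k(1) by auto
  ultimately show ?thesis
    using k unfolding k(1) lift_class_eq_iff[OF ok] by blast
qed

lemma loc_act_iff:
  assumes "lift_ok \<sigma>\<^sub>0 \<sigma> P h" "g \<in> carrier (grp Y \<tau>)"
  shows "(lift_class \<sigma>\<^sub>0 \<sigma> P h, v) \<in> loc_act \<sigma>\<^sub>0 \<tau> g \<longleftrightarrow>
    vmap \<phi> \<sigma> = \<tau> \<and> v = lift_class \<sigma>\<^sub>0 \<sigma> P (h \<otimes>\<^bsub>grp Y \<tau>\<^esub> g)"
proof
  assume "(lift_class \<sigma>\<^sub>0 \<sigma> P h, v) \<in> loc_act \<sigma>\<^sub>0 \<tau> g"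
  then obtain \<sigma>' P' h' where *: "lift_class \<sigma>\<^sub>0 \<sigma> P h = lift_class \<sigma>\<^sub>0 \<sigma>' P' h'"
      "v = lift_class \<sigma>\<^sub>0 \<sigma>' P' (h' \<otimes>\<^bsub>grp Y \<tau>\<^esub> g)" "lift_ok \<sigma>\<^sub>0 \<sigma>' P' h'" "vmap \<phi> \<sigma>' = \<tau>"
    unfolding loc_act_def by blast
  moreover have "\<sigma>' = \<sigma>" using * lift_class_eq_iff[OF assms(1) *(3)] by simp
  ultimately show "vmap \<phi> \<sigma> = \<tau> \<and> v = lift_class \<sigma>\<^sub>0 \<sigma> P (h \<otimes>\<^bsub>grp Y \<tau>\<^esub> g)"
    using lift_class_mult[OF assms(1) *(3), of g] assms(2) by simp
qed (use assms in \<open>auto simp: loc_act_def\<close>)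

text \<open>From right to left this is well-definedness of the edge action, by uniqueness of edge
  lifts and \<open>elt_slide\<close>. From left to right it is injectivity, even for two lifts not
  known to coincide; there \<open>coset_inj\<close> is decisive.\<close>

lemma lift_class_edge_eq_iff:
  assumes ok: "lift_ok \<sigma>\<^sub>0 (ini X a) P h" "lift_ok \<sigma>\<^sub>0 (ini X b) P' h'"
    and ab: "a \<in> edges X" "b \<in> edges X" "emap \<phi> b = emap \<phi> a"
  shows "lift_class \<sigma>\<^sub>0 (ter X a) (P \<odot>\<^bsub>X\<^esub> oarr X (Fwd a)) (elt \<phi> a \<otimes>\<^bsub>grp Y (vmap \<phi> (ter X a))\<^esub> psi Y (emap \<phi> a) h)
      = lift_class \<sigma>\<^sub>0 (ter X b) (P' \<odot>\<^bsub>X\<^esub> oarr X (Fwd b)) (elt \<phi> b \<otimes>\<^bsub>grp Y (vmap \<phi> (ter X b))\<^esub> psi Y (emap \<phi> b) h')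
    \<longleftrightarrow> lift_class \<sigma>\<^sub>0 (ini X a) P h = lift_class \<sigma>\<^sub>0 (ini X b) P' h'" (is "?L \<longleftrightarrow> ?R")
proof
  let ?H = "grp Y (vmap \<phi> (ter X a))"
  have ht: "h \<in> carrier (grp Y (vmap \<phi> (ini X a)))" "h' \<in> carrier (grp Y (vmap \<phi> (ini X b)))"
    using ok by (auto simp: lift_ok_def)
  {
    assume ?R
    then obtain k where k: "ini X b = ini X a" "k \<in> carrier (grp X (ini X a))"
        "P = P' \<odot>\<^bsub>X\<^esub> loc X (ini X a) k" "h' = lmap \<phi> (ini X a) k \<otimes>\<^bsub>grp Y (vmap \<phi> (ini X a))\<^esub> h"
      unfolding lift_class_eq_iff[OF ok] by blast
    have ba: "b = a" using edge_unique[OF ab(2,1) k(1) ab(3)] .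
    have P: "P \<odot>\<^bsub>X\<^esub> oarr X (Fwd a) = P' \<odot>\<^bsub>X\<^esub> oarr X (Fwd a) \<odot>\<^bsub>X\<^esub> loc X (ter X a) (psi X a k)"
      using k ab by (simp add: X.hmul_assoc X.loc_slide)
    have lk: "lmap \<phi> (ini X a) k \<in> carrier (grp Y (vmap \<phi> (ini X a)))" using k ab by auto
    have "elt \<phi> a \<otimes>\<^bsub>?H\<^esub> psi Y (emap \<phi> a) h'
        = (elt \<phi> a \<otimes>\<^bsub>?H\<^esub> psi Y (emap \<phi> a) (lmap \<phi> (ini X a) k)) \<otimes>\<^bsub>?H\<^esub> psi Y (emap \<phi> a) h"
      using k ab ht lk by (simp add: psi_emap_mult Y.grp_assoc)
    also have "\<dots> = lmap \<phi> (ter X a) (psi X a k) \<otimes>\<^bsub>?H\<^esub> (elt \<phi> a \<otimes>\<^bsub>?H\<^esub> psi Y (emap \<phi> a) h)"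
      using k ab ht by (simp add: elt_slide Y.grp_assoc)
    finally show ?L
      using P k ab ok lift_ok_edge[OF ok(1) ab(1)] lift_ok_edge[OF ok(2) ab(2)] ba
      by (subst lift_class_eq_iff) auto
  }
  assume ?L
  then obtain k where k: "ter X b = ter X a" "k \<in> carrier (grp X (ter X a))"
      "P \<odot>\<^bsub>X\<^esub> oarr X (Fwd a) = P' \<odot>\<^bsub>X\<^esub> oarr X (Fwd b) \<odot>\<^bsub>X\<^esub> loc X (ter X a) k"
      "elt \<phi> b \<otimes>\<^bsub>?H\<^esub> psi Y (emap \<phi> a) h' = lmap \<phi> (ter X a) k \<otimes>\<^bsub>?H\<^esub> (elt \<phi> a \<otimes>\<^bsub>?H\<^esub> psi Y (emap \<phi> a) h)"
    unfolding lift_class_eq_iff[OF lift_ok_edge[OF ok(1) ab(1)] lift_ok_edge[OF ok(2) ab(2)]]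
    using ab by auto
  have "psi Y (emap \<phi> a) h \<in> carrier ?H" "elt \<phi> b \<in> carrier ?H"
    using ab ht k(1) elt_closed[OF ab(2)] by auto
  \<comment> \<open>The image of the neutral element is inserted on the right to match
    \<open>coset_inj\<close> with \<open>k\<close> and the neutral element as
    representatives.\<close>
  then have "lmap \<phi> (ter X a) k \<otimes>\<^bsub>?H\<^esub> elt \<phi> a \<otimes>\<^bsub>?H\<^esub> psi Y (emap \<phi> a) h
    = lmap \<phi> (ter X a) \<one>\<^bsub>grp X (ter X a)\<^esub> \<otimes>\<^bsub>?H\<^esub> elt \<phi> b \<otimes>\<^bsub>?H\<^esub> psi Y (emap \<phi> a) h'"
    using k(2,4) ab by (simp add: Y.grp_assoc)
  from coset_inj[OF ab(1) k(2) ht(1) ab(2) _ ht(2) ab(3) k(1) this] ab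
  obtain r where ba: "b = a" and r: "r \<in> carrier (grp X (ini X a))" "\<one>\<^bsub>grp X (ter X a)\<^esub> = k \<otimes>\<^bsub>grp X (ter X a)\<^esub> psi X a r"
    by auto
  let ?r = "inv\<^bsub>grp X (ini X a)\<^esub> r"
  have r': "?r \<in> carrier (grp X (ini X a))" using r ab by auto
  \<comment> \<open>Thus \<open>k\<close> comes from the initial vertex of \<open>a\<close>, and
    \<open>?r\<close> is the element relating the two pairs before the edge.\<close>
  have kr: "k = psi X a ?r"
    using r k(2) ab X.grp_r_one[of "ter X a"] X.psi_inv[of a r]
      group.inv_equality[OF X.group_grp[OF X.ter_vert[OF ab(1)]], of k "psi X a r"]
    by simp
  have P'a: "P' \<in> arr X \<sigma>\<^sub>0 (ini X a)" "P \<in> arr X \<sigma>\<^sub>0 (ini X a)" using ok ba by (auto simp: lift_ok_def)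
  have "P \<odot>\<^bsub>X\<^esub> oarr X (Fwd a) = P' \<odot>\<^bsub>X\<^esub> loc X (ini X a) ?r \<odot>\<^bsub>X\<^esub> oarr X (Fwd a)"
    using k(3) ba kr r' ab by (simp add: X.hmul_assoc X.loc_slide)
  moreover have "P' \<odot>\<^bsub>X\<^esub> loc X (ini X a) ?r \<in> arr X \<sigma>\<^sub>0 (ini X a)"
    using P'a r' ab X.hmul_arr[OF P'a(1)] by blast
  ultimately have P: "P = P' \<odot>\<^bsub>X\<^esub> loc X (ini X a) ?r"
    using X.arr_cancel_right[OF X.oarr_Fwd_arr[OF ab(1)] P'a(2)] by blast
  have lr: "lmap \<phi> (ini X a) ?r \<in> carrier (grp Y (vmap \<phi> (ini X a)))" using r' ab by auto
  have "elt \<phi> a \<otimes>\<^bsub>?H\<^esub> psi Y (emap \<phi> a) h'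
      = (lmap \<phi> (ter X a) (psi X a ?r) \<otimes>\<^bsub>?H\<^esub> elt \<phi> a) \<otimes>\<^bsub>?H\<^esub> psi Y (emap \<phi> a) h"
    using k(4) ba kr ab r' ht by (simp add: Y.grp_assoc)
  also have "\<dots> = elt \<phi> a \<otimes>\<^bsub>?H\<^esub> psi Y (emap \<phi> a) (lmap \<phi> (ini X a) ?r \<otimes>\<^bsub>grp Y (vmap \<phi> (ini X a))\<^esub> h)"
    unfolding elt_slide[OF ab(1) r', symmetric] using lr ht ab by (simp add: psi_emap_mult Y.grp_assoc)
  finally have "psi Y (emap \<phi> a) h' = psi Y (emap \<phi> a) (lmap \<phi> (ini X a) ?r \<otimes>\<^bsub>grp Y (vmap \<phi> (ini X a))\<^esub> h)"
    using Y.grp_l_cancel[of "vmap \<phi> (ter X a)" "elt \<phi> a"] ab(1) lr ht unfolding ba by simp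
  then have "h' = lmap \<phi> (ini X a) ?r \<otimes>\<^bsub>grp Y (vmap \<phi> (ini X a))\<^esub> h"
    using inj_onD[OF psi_emap_inj[OF ab(1)]] lr ht ba ab by simp
  with P r' ba show ?R unfolding lift_class_eq_iff[OF ok] by blast
qed

lemma edge_act_iff:
  assumes "lift_ok \<sigma>\<^sub>0 \<sigma> P h"
  shows "(lift_class \<sigma>\<^sub>0 \<sigma> P h, v) \<in> edge_act \<sigma>\<^sub>0 a' \<longleftrightarrow>
    (\<exists>a\<in>edges X. emap \<phi> a = a' \<and> ini X a = \<sigma> \<and>
       v = lift_class \<sigma>\<^sub>0 (ter X a) (P \<odot>\<^bsub>X\<^esub> oarr X (Fwd a)) (elt \<phi> a \<otimes>\<^bsub>grp Y (vmap \<phi> (ter X a))\<^esub> psi Y a' h))"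
proof
  assume "(lift_class \<sigma>\<^sub>0 \<sigma> P h, v) \<in> edge_act \<sigma>\<^sub>0 a'"
  then obtain a P' h' where *: "lift_class \<sigma>\<^sub>0 \<sigma> P h = lift_class \<sigma>\<^sub>0 (ini X a) P' h'"
      "v = lift_class \<sigma>\<^sub>0 (ter X a) (P' \<odot>\<^bsub>X\<^esub> oarr X (Fwd a)) (elt \<phi> a \<otimes>\<^bsub>grp Y (vmap \<phi> (ter X a))\<^esub> psi Y a' h')"
      "a \<in> edges X" "emap \<phi> a = a'" "lift_ok \<sigma>\<^sub>0 (ini X a) P' h'"
    unfolding edge_act_def by blast
  then have "ini X a = \<sigma>" using lift_class_eq_iff[OF assms *(5)] by simp
  with * assms show "\<exists>a\<in>edges X. emap \<phi> a = a' \<and> ini X a = \<sigma> \<and>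
       v = lift_class \<sigma>\<^sub>0 (ter X a) (P \<odot>\<^bsub>X\<^esub> oarr X (Fwd a)) (elt \<phi> a \<otimes>\<^bsub>grp Y (vmap \<phi> (ter X a))\<^esub> psi Y a' h)"
    using lift_class_edge_eq_iff[of \<sigma>\<^sub>0 a P h a P' h'] by (intro bexI[of _ a]) auto
qed (use assms in \<open>unfold edge_act_def, blast\<close>)

lemma edge_act_lift_iff:
  assumes "a \<in> edges X" "lift_ok \<sigma>\<^sub>0 (ini X a) P h"
  shows "(lift_class \<sigma>\<^sub>0 (ini X a) P h, v) \<in> edge_act \<sigma>\<^sub>0 (emap \<phi> a) \<longleftrightarrow>
    v = lift_class \<sigma>\<^sub>0 (ter X a) (P \<odot>\<^bsub>X\<^esub> oarr X (Fwd a))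
          (elt \<phi> a \<otimes>\<^bsub>grp Y (vmap \<phi> (ter X a))\<^esub> psi Y (emap \<phi> a) h)"
  unfolding edge_act_iff[OF assms(2)] using edge_unique[OF _ assms(1)] assms(1) by blast

lemma relcomp_functional_iff:
  "(\<And>w. (u, w) \<in> R \<longleftrightarrow> w = w0) \<Longrightarrow> (u, v) \<in> R O S \<longleftrightarrow> (w0, v) \<in> S"
  by (simp add: relcomp_unfold)

lemma lift_rel_eqI:
  assumes "\<And>u v. (u, v) \<in> R \<Longrightarrow> u \<in> lift_classes \<sigma>\<^sub>0 \<tau>" "\<And>u v. (u, v) \<in> S \<Longrightarrow> u \<in> lift_classes \<sigma>\<^sub>0 \<tau>"
    and "\<And>\<sigma> P h v. \<lbrakk>lift_ok \<sigma>\<^sub>0 \<sigma> P h; vmap \<phi> \<sigma> = \<tau>\<rbrakk> \<Longrightarrow>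
      (lift_class \<sigma>\<^sub>0 \<sigma> P h, v) \<in> R \<longleftrightarrow> (lift_class \<sigma>\<^sub>0 \<sigma> P h, v) \<in> S"
  shows "R = S"
proof -
  have "(u, v) \<in> R \<longleftrightarrow> (u, v) \<in> S" if "u \<in> lift_classes \<sigma>\<^sub>0 \<tau>" for u v
    using that assms(3) unfolding lift_classes_def by blast
  with assms(1,2) have "(u, v) \<in> R \<longleftrightarrow> (u, v) \<in> S" for u v by blast
  then show ?thesis by auto
qed

lemma lift_classesI: "\<lbrakk>lift_ok \<sigma>\<^sub>0 \<sigma> P h; vmap \<phi> \<sigma> = \<tau>\<rbrakk> \<Longrightarrow> lift_class \<sigma>\<^sub>0 \<sigma> P h \<in> lift_classes \<sigma>\<^sub>0 \<tau>"
  unfolding lift_classes_def by blast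

lemma loc_act_domain: "(u, v) \<in> loc_act \<sigma>\<^sub>0 \<tau> g \<Longrightarrow> u \<in> lift_classes \<sigma>\<^sub>0 \<tau>"
  unfolding loc_act_def lift_classes_def by blast

lemma edge_act_domain: "(u, v) \<in> edge_act \<sigma>\<^sub>0 a' \<Longrightarrow> u \<in> lift_classes \<sigma>\<^sub>0 (ini Y a')"
  unfolding edge_act_def by (auto intro: lift_classesI)

lemma edge_act_range:
  assumes "(u, v) \<in> edge_act \<sigma>\<^sub>0 a'"
  shows "v \<in> lift_classes \<sigma>\<^sub>0 (ter Y a')"
proof -
  obtain a P h where "v = lift_class \<sigma>\<^sub>0 (ter X a) (P \<odot>\<^bsub>X\<^esub> oarr X (Fwd a))
         (elt \<phi> a \<otimes>\<^bsub>grp Y (vmap \<phi> (ter X a))\<^esub> psi Y a' h)"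
       "a \<in> edges X" "emap \<phi> a = a'" "lift_ok \<sigma>\<^sub>0 (ini X a) P h"
    using assms unfolding edge_act_def by blast
  then show ?thesis using lift_ok_edge[of \<sigma>\<^sub>0 a P h] ter_emap[of a] by (auto intro: lift_classesI)
qed

text \<open>Each vertex of \<open>Y\<close> has its own partial identity, which matches the
  vertex-dependent units in \<open>cog_rep\<close>.\<close>

lemma loc_act_one: "\<tau> \<in> verts Y \<Longrightarrow> loc_act \<sigma>\<^sub>0 \<tau> \<one>\<^bsub>grp Y \<tau>\<^esub> = Id_on (lift_classes \<sigma>\<^sub>0 \<tau>)"
  unfolding loc_act_def lift_classes_def Id_on_def lift_ok_def by (force)

lemma edge_act_single_valued: "single_valued (edge_act \<sigma>\<^sub>0 a')"
proof (rule single_valuedI)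
  fix u v w assume uv: "(u, v) \<in> edge_act \<sigma>\<^sub>0 a'" "(u, w) \<in> edge_act \<sigma>\<^sub>0 a'"
  then obtain \<sigma> P h where u: "u = lift_class \<sigma>\<^sub>0 \<sigma> P h" "lift_ok \<sigma>\<^sub>0 \<sigma> P h"
    unfolding edge_act_def by blast
  show "v = w" using uv unfolding u(1) edge_act_iff[OF u(2)] using edge_unique by metis
qed

lemma edge_act_inverse_single_valued: "single_valued ((edge_act \<sigma>\<^sub>0 a')\<inverse>)"
proof (rule single_valuedI)
  fix u v w assume "(u, v) \<in> (edge_act \<sigma>\<^sub>0 a')\<inverse>" "(u, w) \<in> (edge_act \<sigma>\<^sub>0 a')\<inverse>"
  then show "v = w" unfolding edge_act_def using lift_class_edge_eq_iff by auto
qed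

lemma edge_act_total:
  assumes "a' \<in> edges Y" "u \<in> lift_classes \<sigma>\<^sub>0 (ini Y a')"
  shows "\<exists>v. (u, v) \<in> edge_act \<sigma>\<^sub>0 a'"
proof -
  obtain \<sigma> P h where u: "u = lift_class \<sigma>\<^sub>0 \<sigma> P h" "lift_ok \<sigma>\<^sub>0 \<sigma> P h" "vmap \<phi> \<sigma> = ini Y a'"
    using assms unfolding lift_classes_def by blast
  obtain a where "a \<in> edges X" "ini X a = \<sigma>" "emap \<phi> a = a'"
    using edge_lift[OF lift_ok_verts[OF u(2)] assms(1)] u(3) by metis
  then show ?thesis unfolding u(1) edge_act_iff[OF u(2)] by blast
qed

text \<open>A preimage is found by factoring \<open>h\<close> with \<open>coset_surj\<close>: the
  path is extended by \<open>g\<close> and the reversed edge, and \<open>s\<close> becomes the new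
  leftover. Applying the edge returns an equivalent pair, with \<open>g\<close> moved back from the
  path to the leftover.\<close>

lemma edge_act_surj:
  assumes "a' \<in> edges Y" "v \<in> lift_classes \<sigma>\<^sub>0 (ter Y a')"
  shows "\<exists>u. (u, v) \<in> edge_act \<sigma>\<^sub>0 a'"
proof -
  obtain \<sigma> P h where v: "v = lift_class \<sigma>\<^sub>0 \<sigma> P h" "lift_ok \<sigma>\<^sub>0 \<sigma> P h" "vmap \<phi> \<sigma> = ter Y a'"
    using assms unfolding lift_classes_def by blast
  have \<sigma>: "\<sigma> \<in> verts X" by (rule lift_ok_verts[OF v(2)])
  have h: "h \<in> carrier (grp Y (vmap \<phi> \<sigma>))" and P: "P \<in> arr X \<sigma>\<^sub>0 \<sigma>" using v(2) by (auto simp: lift_ok_def)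
  obtain a g s where a: "a \<in> edges X" "emap \<phi> a = a'" "ter X a = \<sigma>" "g \<in> carrier (grp X \<sigma>)"
    "s \<in> carrier (grp Y (vmap \<phi> (ini X a)))"
    "h = lmap \<phi> \<sigma> g \<otimes>\<^bsub>grp Y (vmap \<phi> \<sigma>)\<^esub> elt \<phi> a \<otimes>\<^bsub>grp Y (vmap \<phi> \<sigma>)\<^esub> psi Y a' s"
    using coset_surj[OF \<sigma> assms(1) v(3)[symmetric] h] by metis
  let ?Q = "P \<odot>\<^bsub>X\<^esub> loc X \<sigma> g \<odot>\<^bsub>X\<^esub> oarr X (Bwd a)"
  have Pg: "P \<odot>\<^bsub>X\<^esub> loc X \<sigma> g \<in> arr X \<sigma>\<^sub>0 \<sigma>" using P a \<sigma> by blast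
  have Q: "?Q \<in> arr X \<sigma>\<^sub>0 (ini X a)" using Pg a X.oarr_Bwd_arr[OF a(1)] by blast
  have ok: "lift_ok \<sigma>\<^sub>0 (ini X a) ?Q s" using Q a by (simp add: lift_ok_def)
  have 1: "?Q \<odot>\<^bsub>X\<^esub> oarr X (Fwd a) = P \<odot>\<^bsub>X\<^esub> loc X \<sigma> g"
    using a X.one_right[OF Pg] by (simp add: X.hmul_assoc X.oarr_bwd_fwd)
  have ok2: "lift_ok \<sigma>\<^sub>0 \<sigma> (P \<odot>\<^bsub>X\<^esub> loc X \<sigma> g) (elt \<phi> a \<otimes>\<^bsub>grp Y (vmap \<phi> \<sigma>)\<^esub> psi Y a' s)"
    using lift_ok_edge[OF ok a(1)] 1 a by simp
  have "lift_class \<sigma>\<^sub>0 (ter X a) (?Q \<odot>\<^bsub>X\<^esub> oarr X (Fwd a)) (elt \<phi> a \<otimes>\<^bsub>grp Y (vmap \<phi> (ter X a))\<^esub> psi Y a' s) = v"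
    unfolding 1 v(1) a(3) lift_class_eq_iff[OF ok2 v(2)]
    using a \<sigma> elt_closed[OF a(1)] psi_emap_closed[OF a(1,5)] by (auto simp: Y.grp_assoc intro!: bexI[of _ g])
  then show ?thesis
    using edge_act_iff[OF ok, of v a'] a by blast
qed

lemma edge_act_inverse:
  assumes "a' \<in> edges Y"
  shows "edge_act \<sigma>\<^sub>0 a' O (edge_act \<sigma>\<^sub>0 a')\<inverse> = Id_on (lift_classes \<sigma>\<^sub>0 (ini Y a'))"
    and "(edge_act \<sigma>\<^sub>0 a')\<inverse> O edge_act \<sigma>\<^sub>0 a' = Id_on (lift_classes \<sigma>\<^sub>0 (ter Y a'))"
  using edge_act_domain edge_act_range edge_act_total[OF assms] edge_act_surj[OF assms]
    single_valuedD[OF edge_act_single_valued] single_valuedD[OF edge_act_inverse_single_valued]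
  unfolding Id_on_def relcomp_unfold converse_unfold by (fastforce)+

text \<open>This makes homotopic paths of \<open>Y\<close> act by the same relation. Inverse edges
  act by converses, so their laws follow once forward edges are known to act by bijections between
  fibres.\<close>

lemma cog_rep_lift: "cog_rep Y (O) (loc_act \<sigma>\<^sub>0) (oedge_act \<sigma>\<^sub>0)"
proof
  show "(R O S) O T = R O S O T" for R S T :: "('v \<times> ('v, 'e, 'g) gpath set \<times> 'h) set rel"
    by (rule O_assoc)
next
  fix \<tau> g h assume \<tau>: "\<tau> \<in> verts Y" "g \<in> carrier (grp Y \<tau>)" "h \<in> carrier (grp Y \<tau>)"
  show "loc_act \<sigma>\<^sub>0 \<tau> g O loc_act \<sigma>\<^sub>0 \<tau> h = loc_act \<sigma>\<^sub>0 \<tau> (g \<otimes>\<^bsub>grp Y \<tau>\<^esub> h)"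
  proof (rule lift_rel_eqI[where \<tau> = \<tau> and \<sigma>\<^sub>0 = \<sigma>\<^sub>0])
    fix \<sigma> P x v assume ok: "lift_ok \<sigma>\<^sub>0 \<sigma> P x" "vmap \<phi> \<sigma> = \<tau>"
    then have "lift_ok \<sigma>\<^sub>0 \<sigma> P (x \<otimes>\<^bsub>grp Y \<tau>\<^esub> g)" "x \<in> carrier (grp Y \<tau>)"
      using lift_ok_mult[of \<sigma>\<^sub>0 \<sigma> P x g] \<tau> by (auto simp: lift_ok_def)
    with ok \<tau> show "(lift_class \<sigma>\<^sub>0 \<sigma> P x, v) \<in> loc_act \<sigma>\<^sub>0 \<tau> g O loc_act \<sigma>\<^sub>0 \<tau> h \<longleftrightarrow>
        (lift_class \<sigma>\<^sub>0 \<sigma> P x, v) \<in> loc_act \<sigma>\<^sub>0 \<tau> (g \<otimes>\<^bsub>grp Y \<tau>\<^esub> h)"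
      by (simp add: relcomp_unfold loc_act_iff Y.grp_assoc)
  qed (auto dest: loc_act_domain)
next
  fix e assume e: "uedge e \<in> edges Y"
  have *: "Id_on (lift_classes \<sigma>\<^sub>0 (ini Y a')) O edge_act \<sigma>\<^sub>0 a' = edge_act \<sigma>\<^sub>0 a'"
    "edge_act \<sigma>\<^sub>0 a' O Id_on (lift_classes \<sigma>\<^sub>0 (ter Y a')) = edge_act \<sigma>\<^sub>0 a'"
    "(edge_act \<sigma>\<^sub>0 a')\<inverse> O Id_on (lift_classes \<sigma>\<^sub>0 (ini Y a')) = (edge_act \<sigma>\<^sub>0 a')\<inverse>"
    "Id_on (lift_classes \<sigma>\<^sub>0 (ter Y a')) O (edge_act \<sigma>\<^sub>0 a')\<inverse> = (edge_act \<sigma>\<^sub>0 a')\<inverse>" for a'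
    using edge_act_domain edge_act_range unfolding Id_on_def relcomp_unfold converse_unfold by auto
  show "loc_act \<sigma>\<^sub>0 (oini Y e) \<one>\<^bsub>grp Y (oini Y e)\<^esub> O oedge_act \<sigma>\<^sub>0 e = oedge_act \<sigma>\<^sub>0 e"
    "oedge_act \<sigma>\<^sub>0 e O loc_act \<sigma>\<^sub>0 (oter Y e) \<one>\<^bsub>grp Y (oter Y e)\<^esub> = oedge_act \<sigma>\<^sub>0 e"
    using e by (cases e; simp add: loc_act_one *)+
next
  fix a' g assume a': "a' \<in> edges Y" "g \<in> carrier (grp Y (ini Y a'))"
  have "loc_act \<sigma>\<^sub>0 (ini Y a') g O edge_act \<sigma>\<^sub>0 a' = edge_act \<sigma>\<^sub>0 a' O loc_act \<sigma>\<^sub>0 (ter Y a') (psi Y a' g)"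
  proof (rule lift_rel_eqI[where \<tau> = "ini Y a'" and \<sigma>\<^sub>0 = \<sigma>\<^sub>0])
    fix \<sigma> P x v assume ok: "lift_ok \<sigma>\<^sub>0 \<sigma> P x" "vmap \<phi> \<sigma> = ini Y a'"
    then have x: "lift_ok \<sigma>\<^sub>0 \<sigma> P (x \<otimes>\<^bsub>grp Y (ini Y a')\<^esub> g)" "x \<in> carrier (grp Y (ini Y a'))"
      using lift_ok_mult[of \<sigma>\<^sub>0 \<sigma> P x g] a' by (auto simp: lift_ok_def)
    obtain a where a: "a \<in> edges X" "ini X a = \<sigma>" "emap \<phi> a = a'"
      using edge_lift[OF lift_ok_verts[OF ok(1)] a'(1)] ok(2) by metis
    have t: "ter Y a' = vmap \<phi> (ter X a)" "ini Y a' = vmap \<phi> (ini X a)" using a ter_emap[of a] ini_emap[of a] by simp_all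
    let ?H = "grp Y (vmap \<phi> (ter X a))"
    have oka: "lift_ok \<sigma>\<^sub>0 (ter X a) (P \<odot>\<^bsub>X\<^esub> oarr X (Fwd a)) (elt \<phi> a \<otimes>\<^bsub>?H\<^esub> psi Y a' x)"
      using lift_ok_edge[of \<sigma>\<^sub>0 a P x] a ok by simp
    have ps: "psi Y a' g \<in> carrier ?H" "psi Y a' x \<in> carrier ?H"
      using a' x(2) Y.psi_closed[of a'] t by auto
    have "psi Y a' (x \<otimes>\<^bsub>grp Y (ini Y a')\<^esub> g) = psi Y a' x \<otimes>\<^bsub>?H\<^esub> psi Y a' g"
      using a' x(2) Y.psi_mult[of a'] t by auto
    then have el: "elt \<phi> a \<otimes>\<^bsub>?H\<^esub> psi Y a' (x \<otimes>\<^bsub>grp Y (ini Y a')\<^esub> g)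
        = elt \<phi> a \<otimes>\<^bsub>?H\<^esub> psi Y a' x \<otimes>\<^bsub>?H\<^esub> psi Y a' g"
      using a ps by (simp add: Y.grp_assoc)
    note ok' = ok(1)[folded a(2)] x(1)[folded a(2)]
    have "(lift_class \<sigma>\<^sub>0 \<sigma> P x, v) \<in> loc_act \<sigma>\<^sub>0 (ini Y a') g O edge_act \<sigma>\<^sub>0 a' \<longleftrightarrow>
        (lift_class \<sigma>\<^sub>0 \<sigma> P (x \<otimes>\<^bsub>grp Y (ini Y a')\<^esub> g), v) \<in> edge_act \<sigma>\<^sub>0 a'"
      by (rule relcomp_functional_iff) (use loc_act_iff[OF ok(1) a'(2)] ok(2) in simp)
    also have "\<dots> \<longleftrightarrow>
        v = lift_class \<sigma>\<^sub>0 (ter X a) (P \<odot>\<^bsub>X\<^esub> oarr X (Fwd a)) (elt \<phi> a \<otimes>\<^bsub>?H\<^esub> psi Y a' (x \<otimes>\<^bsub>grp Y (ini Y a')\<^esub> g))"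
      using edge_act_lift_iff[OF a(1) ok'(2)] unfolding a(2,3) .
    also have "\<dots> \<longleftrightarrow> (lift_class \<sigma>\<^sub>0 (ter X a) (P \<odot>\<^bsub>X\<^esub> oarr X (Fwd a)) (elt \<phi> a \<otimes>\<^bsub>?H\<^esub> psi Y a' x), v)
        \<in> loc_act \<sigma>\<^sub>0 (ter Y a') (psi Y a' g)"
      using loc_act_iff[OF oka, of "psi Y a' g" "ter Y a'"] el t ps by simp
    also have "\<dots> \<longleftrightarrow> (lift_class \<sigma>\<^sub>0 \<sigma> P x, v) \<in> edge_act \<sigma>\<^sub>0 a' O loc_act \<sigma>\<^sub>0 (ter Y a') (psi Y a' g)"
      by (rule relcomp_functional_iff[symmetric]) (use edge_act_lift_iff[OF a(1) ok'(1)] a(2,3) in simp)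
    finally show "(lift_class \<sigma>\<^sub>0 \<sigma> P x, v) \<in> loc_act \<sigma>\<^sub>0 (ini Y a') g O edge_act \<sigma>\<^sub>0 a' \<longleftrightarrow>
        (lift_class \<sigma>\<^sub>0 \<sigma> P x, v) \<in> edge_act \<sigma>\<^sub>0 a' O loc_act \<sigma>\<^sub>0 (ter Y a') (psi Y a' g)" .
  qed (auto dest: loc_act_domain edge_act_domain)
  then show "loc_act \<sigma>\<^sub>0 (ini Y a') g O oedge_act \<sigma>\<^sub>0 (Fwd a') = oedge_act \<sigma>\<^sub>0 (Fwd a') O loc_act \<sigma>\<^sub>0 (ter Y a') (psi Y a' g)"
    by simp
next
  fix a' assume a': "a' \<in> edges Y"
  then show "oedge_act \<sigma>\<^sub>0 (Fwd a') O oedge_act \<sigma>\<^sub>0 (Bwd a') = loc_act \<sigma>\<^sub>0 (ini Y a') \<one>\<^bsub>grp Y (ini Y a')\<^esub>"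
    "oedge_act \<sigma>\<^sub>0 (Bwd a') O oedge_act \<sigma>\<^sub>0 (Fwd a') = loc_act \<sigma>\<^sub>0 (ter Y a') \<one>\<^bsub>grp Y (ter Y a')\<^esub>"
    by (simp_all add: edge_act_inverse loc_act_one)
next
  fix a' b' assume ab': "a' \<in> edges Y" "b' \<in> edges Y" "ini Y a' = ter Y b'"
  note abY = Y.ecomp_edge[OF ab'] Y.twist_closed[OF ab']
  have "edge_act \<sigma>\<^sub>0 b' O edge_act \<sigma>\<^sub>0 a' O loc_act \<sigma>\<^sub>0 (ter Y a') (twist Y a' b') = edge_act \<sigma>\<^sub>0 (ecomp Y a' b')"
  proof (rule lift_rel_eqI[where \<tau> = "ini Y b'" and \<sigma>\<^sub>0 = \<sigma>\<^sub>0])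
    fix \<sigma> P x v assume ok: "lift_ok \<sigma>\<^sub>0 \<sigma> P x" "vmap \<phi> \<sigma> = ini Y b'"
    obtain b where b: "b \<in> edges X" "ini X b = \<sigma>" "emap \<phi> b = b'"
      using edge_lift[OF lift_ok_verts[OF ok(1)] ab'(2)] ok(2) by metis
    obtain a where a: "a \<in> edges X" "ini X a = ter X b" "emap \<phi> a = a'"
      using edge_lift[OF X.ter_vert[OF b(1)] ab'(1)] b(3) ab'(3) ter_emap[OF b(1)] by metis
    note ab = a(1) b(1) a(2)
    note abX = X.ecomp_edge[OF ab] X.twist_closed[OF ab]
    have ia: "ini Y a' = vmap \<phi> (ini X a)" "ter Y a' = vmap \<phi> (ter X a)" "ini Y b' = vmap \<phi> (ini X b)"
      using a b ini_emap[of a] ter_emap[of a] ini_emap[of b] by simp_all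
    let ?H = "grp Y (vmap \<phi> (ter X a))" and ?K = "grp Y (vmap \<phi> (ini X a))"
    let ?t = "twist Y a' b'"
    let ?y = "elt \<phi> b \<otimes>\<^bsub>?K\<^esub> psi Y b' x"
    have okb: "lift_ok \<sigma>\<^sub>0 (ini X a) (P \<odot>\<^bsub>X\<^esub> oarr X (Fwd b)) ?y"
      using lift_ok_edge[of \<sigma>\<^sub>0 b P x] a b ok by simp
    let ?Pa = "P \<odot>\<^bsub>X\<^esub> oarr X (Fwd b) \<odot>\<^bsub>X\<^esub> oarr X (Fwd a)"
    have oka: "lift_ok \<sigma>\<^sub>0 (ter X a) ?Pa (elt \<phi> a \<otimes>\<^bsub>?H\<^esub> psi Y a' ?y)"
      using lift_ok_edge[OF okb a(1)] a by simp
    have t: "?t \<in> carrier ?H" using abY ia by simp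
    have x: "x \<in> carrier (grp Y (ini Y b'))" using ok by (simp add: lift_ok_def)
    have pb: "psi Y b' x \<in> carrier ?K" "elt \<phi> b \<in> carrier ?K"
      using Y.psi_closed[OF ab'(2) x] ab' ia elt_closed[OF b(1)] a by simp_all
    have pa: "psi Y a' (psi Y b' x) \<in> carrier ?H" "psi Y a' (elt \<phi> b) \<in> carrier ?H"
      using Y.psi_closed[OF ab'(1)] pb ia by simp_all
    have pm: "psi Y a' ?y = psi Y a' (elt \<phi> b) \<otimes>\<^bsub>?H\<^esub> psi Y a' (psi Y b' x)"
      using Y.psi_mult[OF ab'(1), of "elt \<phi> b" "psi Y b' x"] pb ia by simp
    have pab: "psi Y (ecomp Y a' b') x \<in> carrier ?H"
      using Y.psi_closed[OF abY(1), of x] x abY ia by simp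
    have elab: "elt \<phi> (ecomp X a b) \<in> carrier ?H" using elt_closed[of "ecomp X a b"] abX by simp
    have tw: "?t \<otimes>\<^bsub>?H\<^esub> psi Y (ecomp Y a' b') x = psi Y a' (psi Y b' x) \<otimes>\<^bsub>?H\<^esub> ?t"
      using Y.twist_psi[OF ab' x] ia by simp
    have et: "lmap \<phi> (ter X a) (twist X a b) \<otimes>\<^bsub>?H\<^esub> elt \<phi> (ecomp X a b)
        = elt \<phi> a \<otimes>\<^bsub>?H\<^esub> (psi Y a' (elt \<phi> b) \<otimes>\<^bsub>?H\<^esub> ?t)"
      using elt_twist[OF ab] a b pa t by (simp add: Y.grp_assoc)
    have "lmap \<phi> (ter X a) (twist X a b) \<otimes>\<^bsub>?H\<^esub> (elt \<phi> (ecomp X a b) \<otimes>\<^bsub>?H\<^esub> psi Y (ecomp Y a' b') x)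
      = elt \<phi> a \<otimes>\<^bsub>?H\<^esub> (psi Y a' (elt \<phi> b) \<otimes>\<^bsub>?H\<^esub> ?t) \<otimes>\<^bsub>?H\<^esub> psi Y (ecomp Y a' b') x"
      unfolding et[symmetric] using elab pab a abX by (simp add: Y.grp_assoc)
    also have "\<dots> = elt \<phi> a \<otimes>\<^bsub>?H\<^esub> psi Y a' ?y \<otimes>\<^bsub>?H\<^esub> ?t"
      unfolding pm using tw pa pab t a by (simp add: Y.grp_assoc)
    finally have el: "elt \<phi> a \<otimes>\<^bsub>?H\<^esub> psi Y a' ?y \<otimes>\<^bsub>?H\<^esub> ?t
      = lmap \<phi> (ter X a) (twist X a b) \<otimes>\<^bsub>?H\<^esub> (elt \<phi> (ecomp X a b) \<otimes>\<^bsub>?H\<^esub> psi Y (ecomp Y a' b') x)" ..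
    have okab: "lift_ok \<sigma>\<^sub>0 (ter X a) (P \<odot>\<^bsub>X\<^esub> oarr X (Fwd (ecomp X a b)))
        (elt \<phi> (ecomp X a b) \<otimes>\<^bsub>?H\<^esub> psi Y (ecomp Y a' b') x)"
      using lift_ok_edge[of \<sigma>\<^sub>0 "ecomp X a b" P x] abX a b ok by simp
    have okt: "lift_ok \<sigma>\<^sub>0 (ter X a) ?Pa (elt \<phi> a \<otimes>\<^bsub>?H\<^esub> psi Y a' ?y \<otimes>\<^bsub>?H\<^esub> ?t)"
      using lift_ok_mult[OF oka t] .
    have "P \<odot>\<^bsub>X\<^esub> oarr X (Fwd (ecomp X a b)) = ?Pa \<odot>\<^bsub>X\<^esub> loc X (ter X a) (twist X a b)"
      using X.oarr_compose[OF ab] by (simp add: X.hmul_assoc)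
    \<comment> \<open>Lifting the composite edge at once or its two factors in succession gives
      pairs that differ by the twisting element of \<open>X\<close>, which the equivalence of pairs
      absorbs.\<close>
    then have key: "lift_class \<sigma>\<^sub>0 (ter X a) (P \<odot>\<^bsub>X\<^esub> oarr X (Fwd (ecomp X a b)))
        (elt \<phi> (ecomp X a b) \<otimes>\<^bsub>?H\<^esub> psi Y (ecomp Y a' b') x)
      = lift_class \<sigma>\<^sub>0 (ter X a) ?Pa (elt \<phi> a \<otimes>\<^bsub>?H\<^esub> psi Y a' ?y \<otimes>\<^bsub>?H\<^esub> ?t)"
      unfolding lift_class_eq_iff[OF okab okt] using el abX(4) by blast
    have "(lift_class \<sigma>\<^sub>0 \<sigma> P x, v) \<in> edge_act \<sigma>\<^sub>0 b' O edge_act \<sigma>\<^sub>0 a' O loc_act \<sigma>\<^sub>0 (ter Y a') ?t \<longleftrightarrow>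
        (lift_class \<sigma>\<^sub>0 (ini X a) (P \<odot>\<^bsub>X\<^esub> oarr X (Fwd b)) ?y, v) \<in> edge_act \<sigma>\<^sub>0 a' O loc_act \<sigma>\<^sub>0 (ter Y a') ?t"
      by (rule relcomp_functional_iff) (use edge_act_lift_iff[OF b(1) ok(1)[folded b(2)]] a b in simp)
    also have "\<dots> \<longleftrightarrow> (lift_class \<sigma>\<^sub>0 (ter X a) ?Pa (elt \<phi> a \<otimes>\<^bsub>?H\<^esub> psi Y a' ?y), v) \<in> loc_act \<sigma>\<^sub>0 (ter Y a') ?t"
      by (rule relcomp_functional_iff) (use edge_act_lift_iff[OF a(1) okb] a in simp)
    also have "\<dots> \<longleftrightarrow> v = lift_class \<sigma>\<^sub>0 (ter X a) ?Pa (elt \<phi> a \<otimes>\<^bsub>?H\<^esub> psi Y a' ?y \<otimes>\<^bsub>?H\<^esub> ?t)"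
      using loc_act_iff[OF oka, of ?t "ter Y a'"] t ia by simp
    also have "\<dots> \<longleftrightarrow> (lift_class \<sigma>\<^sub>0 \<sigma> P x, v) \<in> edge_act \<sigma>\<^sub>0 (ecomp Y a' b')"
      unfolding key[symmetric] using edge_act_lift_iff[of "ecomp X a b" \<sigma>\<^sub>0 P x v] ok(1) abX a b by simp
    finally show "(lift_class \<sigma>\<^sub>0 \<sigma> P x, v) \<in> edge_act \<sigma>\<^sub>0 b' O edge_act \<sigma>\<^sub>0 a' O loc_act \<sigma>\<^sub>0 (ter Y a') ?t \<longleftrightarrow>
      (lift_class \<sigma>\<^sub>0 \<sigma> P x, v) \<in> edge_act \<sigma>\<^sub>0 (ecomp Y a' b')" .
  qed (use abY in \<open>auto dest: edge_act_domain\<close>)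
  then show "oedge_act \<sigma>\<^sub>0 (Fwd b') O oedge_act \<sigma>\<^sub>0 (Fwd a') O loc_act \<sigma>\<^sub>0 (ter Y a') (twist Y a' b')
      = oedge_act \<sigma>\<^sub>0 (Fwd (ecomp Y a' b'))" by simp
qed

end

context cog_covering
begin

abbreviation act :: "'v \<Rightarrow> ('w, 'f, 'h) gpath \<Rightarrow> ('v \<times> ('v, 'e, 'g) gpath set \<times> 'h) set rel" where
  "act \<sigma>\<^sub>0 \<equiv> cog_rep.eval Y (O) (loc_act \<sigma>\<^sub>0) (oedge_act \<sigma>\<^sub>0)"

lemmas act_simps = cog_rep.eval.simps[OF cog_rep_lift]

lemma loc_act_single_valued: "g \<in> carrier (grp Y \<tau>) \<Longrightarrow> single_valued (loc_act \<sigma>\<^sub>0 \<tau> g)"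
proof (rule single_valuedI)
  fix u v w assume g: "g \<in> carrier (grp Y \<tau>)" and uv: "(u, v) \<in> loc_act \<sigma>\<^sub>0 \<tau> g" "(u, w) \<in> loc_act \<sigma>\<^sub>0 \<tau> g"
  then obtain \<sigma> P h where u: "u = lift_class \<sigma>\<^sub>0 \<sigma> P h" "lift_ok \<sigma>\<^sub>0 \<sigma> P h"
    unfolding loc_act_def by blast
  show "v = w" using uv unfolding u(1) loc_act_iff[OF u(2) g] by simp
qed

lemma act_single_valued: "is_path Y q \<Longrightarrow> single_valued (act \<sigma>\<^sub>0 q)"
proof (induction q)
  case (Const \<tau> g)
  then show ?case by (simp add: act_simps loc_act_single_valued)
next
  case (Step g e q)
  moreover have "single_valued (oedge_act \<sigma>\<^sub>0 e)"
    using edge_act_single_valued edge_act_inverse_single_valued by (cases e) auto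
  ultimately show ?case by (simp add: act_simps loc_act_single_valued single_valued_relcomp)
qed

text \<open>The correction by \<open>elt \<phi>\<close> built into the image of an edge cancels the
  one in \<open>edge_act\<close>, so the leftover is neutral again after the edge.\<close>

lemma act_map_oedge:
  assumes "R \<in> arr X \<sigma>\<^sub>0 (oini X e)" "uedge e \<in> edges X"
  shows "(lift_class \<sigma>\<^sub>0 (oini X e) R \<one>\<^bsub>grp Y (vmap \<phi> (oini X e))\<^esub>,
      lift_class \<sigma>\<^sub>0 (oter X e) (R \<odot>\<^bsub>X\<^esub> oarr X e) \<one>\<^bsub>grp Y (vmap \<phi> (oter X e))\<^esub>) \<in> act \<sigma>\<^sub>0 (map_oedge X Y \<phi> e)"
proof (cases e)
  case (Fwd a)
  with assms have a: "a \<in> edges X" "R \<in> arr X \<sigma>\<^sub>0 (ini X a)" by simp_all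
  let ?H = "grp Y (vmap \<phi> (ter X a))" and ?K = "grp Y (vmap \<phi> (ini X a))"
  have ok: "lift_ok \<sigma>\<^sub>0 (ini X a) R \<one>\<^bsub>?K\<^esub>" using a by (simp add: lift_ok_def)
  have ok2: "lift_ok \<sigma>\<^sub>0 (ter X a) (R \<odot>\<^bsub>X\<^esub> oarr X (Fwd a)) (elt \<phi> a)"
    using lift_ok_edge[OF ok a(1)] a(1) by simp
  have "(lift_class \<sigma>\<^sub>0 (ini X a) R \<one>\<^bsub>?K\<^esub>, lift_class \<sigma>\<^sub>0 (ini X a) R \<one>\<^bsub>?K\<^esub>)
      \<in> loc_act \<sigma>\<^sub>0 (vmap \<phi> (ini X a)) \<one>\<^bsub>?K\<^esub>"
    using loc_act_iff[OF ok, of "\<one>\<^bsub>?K\<^esub>"] a by simp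
  moreover have "(lift_class \<sigma>\<^sub>0 (ini X a) R \<one>\<^bsub>?K\<^esub>, lift_class \<sigma>\<^sub>0 (ter X a) (R \<odot>\<^bsub>X\<^esub> oarr X (Fwd a)) (elt \<phi> a))
      \<in> edge_act \<sigma>\<^sub>0 (emap \<phi> a)"
    using edge_act_lift_iff[OF a(1) ok] a(1) by simp
  moreover have "(lift_class \<sigma>\<^sub>0 (ter X a) (R \<odot>\<^bsub>X\<^esub> oarr X (Fwd a)) (elt \<phi> a),
      lift_class \<sigma>\<^sub>0 (ter X a) (R \<odot>\<^bsub>X\<^esub> oarr X (Fwd a)) \<one>\<^bsub>?H\<^esub>) \<in> loc_act \<sigma>\<^sub>0 (vmap \<phi> (ter X a)) (inv\<^bsub>?H\<^esub> elt \<phi> a)"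
    using loc_act_iff[OF ok2, of "inv\<^bsub>?H\<^esub> elt \<phi> a"] a by simp
  ultimately show ?thesis using Fwd a by (simp add: act_simps) blast
next
  case (Bwd a)
  with assms have a: "a \<in> edges X" "R \<in> arr X \<sigma>\<^sub>0 (ter X a)" by simp_all
  let ?H = "grp Y (vmap \<phi> (ter X a))" and ?K = "grp Y (vmap \<phi> (ini X a))"
  let ?R = "R \<odot>\<^bsub>X\<^esub> oarr X (Bwd a)"
  have R: "?R \<odot>\<^bsub>X\<^esub> oarr X (Fwd a) = R" "?R \<in> arr X \<sigma>\<^sub>0 (ini X a)"
    using a X.hmul_arr[OF a(2) X.oarr_Bwd_arr[OF a(1)]] by (simp_all add: X.hmul_assoc X.oarr_bwd_fwd)
  have ok: "lift_ok \<sigma>\<^sub>0 (ini X a) ?R \<one>\<^bsub>?K\<^esub>" using a R by (simp add: lift_ok_def)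
  have ok2: "lift_ok \<sigma>\<^sub>0 (ter X a) R \<one>\<^bsub>?H\<^esub>" using a by (simp add: lift_ok_def)
  have "(lift_class \<sigma>\<^sub>0 (ini X a) ?R \<one>\<^bsub>?K\<^esub>, lift_class \<sigma>\<^sub>0 (ini X a) ?R \<one>\<^bsub>?K\<^esub>)
      \<in> loc_act \<sigma>\<^sub>0 (vmap \<phi> (ini X a)) \<one>\<^bsub>?K\<^esub>"
    using loc_act_iff[OF ok, of "\<one>\<^bsub>?K\<^esub>"] a by simp
  moreover have "(lift_class \<sigma>\<^sub>0 (ini X a) ?R \<one>\<^bsub>?K\<^esub>, lift_class \<sigma>\<^sub>0 (ter X a) R (elt \<phi> a)) \<in> edge_act \<sigma>\<^sub>0 (emap \<phi> a)"
    using edge_act_lift_iff[OF a(1) ok] a(1) R by simp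
  moreover have "(lift_class \<sigma>\<^sub>0 (ter X a) R \<one>\<^bsub>?H\<^esub>, lift_class \<sigma>\<^sub>0 (ter X a) R (elt \<phi> a))
      \<in> loc_act \<sigma>\<^sub>0 (vmap \<phi> (ter X a)) (elt \<phi> a)"
    using loc_act_iff[OF ok2, of "elt \<phi> a"] a by simp
  ultimately show ?thesis using Bwd a by (simp add: act_simps) blast
qed

text \<open>An image path acts by extending the path component and leaves no leftover: the factor
  \<open>lmap \<phi> \<sigma> g\<close> produced by a local element is moved into the path component
  by the equivalence. Hence a path can be recovered from its image.\<close>

lemma act_map_path:
  assumes "is_path X p" "R \<in> arr X \<sigma>\<^sub>0 (psrc X p)"
  shows "(lift_class \<sigma>\<^sub>0 (psrc X p) R \<one>\<^bsub>grp Y (vmap \<phi> (psrc X p))\<^esub>,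
      lift_class \<sigma>\<^sub>0 (ptgt p) (R \<odot>\<^bsub>X\<^esub> hclass X p) \<one>\<^bsub>grp Y (vmap \<phi> (ptgt p))\<^esub>) \<in> act \<sigma>\<^sub>0 (map_path X Y \<phi> p)"
  using assms
proof (induction p arbitrary: R)
  case (Const \<sigma> g)
  then have g: "\<sigma> \<in> verts X" "g \<in> carrier (grp X \<sigma>)" "R \<in> arr X \<sigma>\<^sub>0 \<sigma>" by simp_all
  let ?K = "grp Y (vmap \<phi> \<sigma>)"
  have ok: "lift_ok \<sigma>\<^sub>0 \<sigma> R \<one>\<^bsub>?K\<^esub>" "lift_ok \<sigma>\<^sub>0 \<sigma> (R \<odot>\<^bsub>X\<^esub> loc X \<sigma> g) \<one>\<^bsub>?K\<^esub>" "lift_ok \<sigma>\<^sub>0 \<sigma> R (lmap \<phi> \<sigma> g)"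
    using g by (auto simp: lift_ok_def)
  have "lift_class \<sigma>\<^sub>0 \<sigma> (R \<odot>\<^bsub>X\<^esub> loc X \<sigma> g) \<one>\<^bsub>?K\<^esub> = lift_class \<sigma>\<^sub>0 \<sigma> R (lmap \<phi> \<sigma> g)"
    unfolding lift_class_eq_iff[OF ok(2,3)] using g by (auto intro!: bexI[of _ g])
  with loc_act_iff[OF ok(1), of "lmap \<phi> \<sigma> g"] g show ?case by (simp add: act_simps loc_def)
next
  case (Step g e p)
  let ?o = "oini X e" and ?t = "oter X e"
  let ?K = "grp Y (vmap \<phi> ?o)"
  have g: "g \<in> carrier (grp X ?o)" "R \<in> arr X \<sigma>\<^sub>0 ?o" "?o \<in> verts X" "uedge e \<in> edges X"
      "is_path X p" "psrc X p = ?t" using Step.prems by auto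
  let ?R = "R \<odot>\<^bsub>X\<^esub> loc X ?o g"
  have R: "?R \<in> arr X \<sigma>\<^sub>0 ?o" using g by blast
  have ok: "lift_ok \<sigma>\<^sub>0 ?o R \<one>\<^bsub>?K\<^esub>" "lift_ok \<sigma>\<^sub>0 ?o ?R \<one>\<^bsub>?K\<^esub>" "lift_ok \<sigma>\<^sub>0 ?o R (lmap \<phi> ?o g)"
    using g by (auto simp: lift_ok_def)
  have "lift_class \<sigma>\<^sub>0 ?o ?R \<one>\<^bsub>?K\<^esub> = lift_class \<sigma>\<^sub>0 ?o R (lmap \<phi> ?o g)"
    unfolding lift_class_eq_iff[OF ok(2,3)] using g by (auto intro!: bexI[of _ g])
  then have 1: "(lift_class \<sigma>\<^sub>0 ?o R \<one>\<^bsub>?K\<^esub>, lift_class \<sigma>\<^sub>0 ?o ?R \<one>\<^bsub>?K\<^esub>) \<in> act \<sigma>\<^sub>0 (Const (vmap \<phi> ?o) (lmap \<phi> ?o g))"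
    using loc_act_iff[OF ok(1), of "lmap \<phi> ?o g"] g by (simp add: act_simps)
  note 2 = act_map_oedge[OF R g(4)]
  have "?R \<odot>\<^bsub>X\<^esub> oarr X e \<in> arr X \<sigma>\<^sub>0 (psrc X p)"
    using X.hmul_arr[OF R X.oarr_arr[OF g(4)]] g(6) by simp
  from Step.IH[OF g(5) this]
  have 3: "(lift_class \<sigma>\<^sub>0 ?t (?R \<odot>\<^bsub>X\<^esub> oarr X e) \<one>\<^bsub>grp Y (vmap \<phi> ?t)\<^esub>,
      lift_class \<sigma>\<^sub>0 (ptgt p) (R \<odot>\<^bsub>X\<^esub> hclass X (Step g e p)) \<one>\<^bsub>grp Y (vmap \<phi> (ptgt p))\<^esub>) \<in> act \<sigma>\<^sub>0 (map_path X Y \<phi> p)"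
    using X.hclass_Step[OF Step.prems(1)] g(6) by (simp add: X.hmul_assoc)
  note mp = map_path_path[OF g(5)] and mo = map_oedge_path[OF g(4)]
  have "act \<sigma>\<^sub>0 (map_path X Y \<phi> (Step g e p)) = act \<sigma>\<^sub>0 (Const (vmap \<phi> ?o) (lmap \<phi> ?o g)) O
      act \<sigma>\<^sub>0 (map_oedge X Y \<phi> e) O act \<sigma>\<^sub>0 (map_path X Y \<phi> p)"
    unfolding map_path.simps using mp mo g
    by (subst cog_rep.eval_pcat[OF cog_rep_lift]; (subst cog_rep.eval_pcat[OF cog_rep_lift])?)
       (auto simp: Y.pcat_path Y.psrc_pcat)
  with 1 2 3 show ?case by auto
qed

text \<open>It converts an equation between classes in \<open>Y\<close> into an element of a local
  group of \<open>X\<close>. Both the comparison of deck transformations and the construction of one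
  rely on it in this way.\<close>

lemma unique_lift:
  assumes P: "P \<in> arr X \<sigma>\<^sub>0 \<sigma>" "P' \<in> arr X \<sigma>\<^sub>0 \<sigma>'"
    and h: "h \<in> carrier (grp Y (vmap \<phi> \<sigma>))" "h' \<in> carrier (grp Y (vmap \<phi> \<sigma>'))"
    and eq: "ind P \<odot>\<^bsub>Y\<^esub> loc Y (vmap \<phi> \<sigma>) h = ind P' \<odot>\<^bsub>Y\<^esub> loc Y (vmap \<phi> \<sigma>') h'"
  shows "\<sigma>' = \<sigma> \<and> (\<exists>k\<in>carrier (grp X \<sigma>). P = P' \<odot>\<^bsub>X\<^esub> loc X \<sigma> k \<and>
    h' = lmap \<phi> \<sigma> k \<otimes>\<^bsub>grp Y (vmap \<phi> \<sigma>)\<^esub> h)"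
proof -
  let ?u = "lift_class \<sigma>\<^sub>0 \<sigma>\<^sub>0 (loc X \<sigma>\<^sub>0 \<one>\<^bsub>grp X \<sigma>\<^sub>0\<^esub>) \<one>\<^bsub>grp Y (vmap \<phi> \<sigma>\<^sub>0)\<^esub>"
  have *: "\<exists>q. is_path Y q \<and> hclass Y q = ind P \<odot>\<^bsub>Y\<^esub> loc Y (vmap \<phi> \<sigma>) h \<and> (?u, lift_class \<sigma>\<^sub>0 \<sigma> P h) \<in> act \<sigma>\<^sub>0 q"
    if P: "P \<in> arr X \<sigma>\<^sub>0 \<sigma>" and h: "h \<in> carrier (grp Y (vmap \<phi> \<sigma>))" for P \<sigma> h
  proof -
    obtain p where p: "P = hclass X p" "is_path X p" "psrc X p = \<sigma>\<^sub>0" "ptgt p = \<sigma>"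
      using P by (rule X.arrE)
    have v: "\<sigma>\<^sub>0 \<in> verts X" "\<sigma> \<in> verts X" using X.arr_verts[OF P] by auto
    note mp = map_path_path[OF p(2)]
    let ?q = "pcat Y (map_path X Y \<phi> p) (Const (vmap \<phi> \<sigma>) h)"
    have q: "is_path Y ?q" using mp p v h by (intro Y.pcat_path) auto
    have "hclass Y ?q = ind P \<odot>\<^bsub>Y\<^esub> loc Y (vmap \<phi> \<sigma>) h"
      using mp p v h by (simp add: induced_hclass loc_def Y.hmul_hclass)
    moreover have "(?u, lift_class \<sigma>\<^sub>0 \<sigma> P \<one>\<^bsub>grp Y (vmap \<phi> \<sigma>)\<^esub>) \<in> act \<sigma>\<^sub>0 (map_path X Y \<phi> p)"
      using act_map_path[OF p(2), of "loc X \<sigma>\<^sub>0 \<one>\<^bsub>grp X \<sigma>\<^sub>0\<^esub>" \<sigma>\<^sub>0] p v P X.one_left[OF P] by simp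
    moreover have "lift_ok \<sigma>\<^sub>0 \<sigma> P \<one>\<^bsub>grp Y (vmap \<phi> \<sigma>)\<^esub>" using P v by (simp add: lift_ok_def)
    then have "(lift_class \<sigma>\<^sub>0 \<sigma> P \<one>\<^bsub>grp Y (vmap \<phi> \<sigma>)\<^esub>, lift_class \<sigma>\<^sub>0 \<sigma> P h) \<in> act \<sigma>\<^sub>0 (Const (vmap \<phi> \<sigma>) h)"
      using loc_act_iff[of \<sigma>\<^sub>0 \<sigma> P "\<one>\<^bsub>grp Y (vmap \<phi> \<sigma>)\<^esub>" h "vmap \<phi> \<sigma>"] h v by (simp add: act_simps)
    ultimately have "(?u, lift_class \<sigma>\<^sub>0 \<sigma> P h) \<in> act \<sigma>\<^sub>0 ?q"
      using cog_rep.eval_pcat[OF cog_rep_lift, of "map_path X Y \<phi> p" "Const (vmap \<phi> \<sigma>) h" \<sigma>\<^sub>0] mp p v h by auto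
    with q \<open>hclass Y ?q = _\<close> show ?thesis by blast
  qed
  obtain q where q: "is_path Y q" "hclass Y q = ind P \<odot>\<^bsub>Y\<^esub> loc Y (vmap \<phi> \<sigma>) h"
      "(?u, lift_class \<sigma>\<^sub>0 \<sigma> P h) \<in> act \<sigma>\<^sub>0 q"
    using *[OF P(1) h(1)] by blast
  obtain q' where q': "is_path Y q'" "hclass Y q' = ind P' \<odot>\<^bsub>Y\<^esub> loc Y (vmap \<phi> \<sigma>') h'"
      "(?u, lift_class \<sigma>\<^sub>0 \<sigma>' P' h') \<in> act \<sigma>\<^sub>0 q'"
    using *[OF P(2) h(2)] by blast
  have "(q, q') \<in> htpy Y" using q(1,2) q'(2) eq Y.hclass_eq_iff by metis
  then have "act \<sigma>\<^sub>0 q = act \<sigma>\<^sub>0 q'" by (rule cog_rep.eval_htpy[OF cog_rep_lift])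
  then have "lift_class \<sigma>\<^sub>0 \<sigma> P h = lift_class \<sigma>\<^sub>0 \<sigma>' P' h'"
    using q(3) q'(3) single_valuedD[OF act_single_valued[OF q(1)]] by metis
  with P h show ?thesis
    using lift_class_eq_iff[of \<sigma>\<^sub>0 \<sigma> P h \<sigma>' P' h'] by (simp add: lift_ok_def)
qed

end

section \<open>The universal complex and the kernel of the action on it\<close>

context cog
begin

lemma uclass_eq:
  assumes "is_path X p" "is_path X p'" "psrc X p = \<sigma>" "psrc X p' = \<sigma>" "ptgt p' = ptgt p"
    and g: "g \<in> carrier (grp X (ptgt p))" "hclass X p' = hclass X p \<odot> loc X (ptgt p) g"
  shows "uclass X \<sigma> p' = uclass X \<sigma> p"
proof -
  let ?\<rho> = "ptgt p"
  have v: "?\<rho> \<in> verts X" using assms(1) path_vert by blast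
  have "uclass X \<sigma> r = {q \<in> paths_from X \<sigma>. \<exists>g\<in>carrier (grp X ?\<rho>). hclass X q = hclass X r \<odot> loc X ?\<rho> g}"
    if "is_path X r" "ptgt r = ?\<rho>" for r
    using that v by (simp add: uclass_def loc_def hmul_hclass cong: bex_cong)
  note u = this[OF assms(1) refl] this[OF assms(2,5)]
  have "(\<exists>h\<in>carrier (grp X ?\<rho>). hclass X q = hclass X p' \<odot> loc X ?\<rho> h) \<longleftrightarrow>
      (\<exists>h\<in>carrier (grp X ?\<rho>). hclass X q = hclass X p \<odot> loc X ?\<rho> h)" for q
  proof
    assume "\<exists>h\<in>carrier (grp X ?\<rho>). hclass X q = hclass X p' \<odot> loc X ?\<rho> h"
    then obtain h where "h \<in> carrier (grp X ?\<rho>)" "hclass X q = hclass X p' \<odot> loc X ?\<rho> h" by blast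
    with v g show "\<exists>h\<in>carrier (grp X ?\<rho>). hclass X q = hclass X p \<odot> loc X ?\<rho> h"
      by (intro bexI[of _ "g \<otimes>\<^bsub>grp X ?\<rho>\<^esub> h"]) (auto simp: hmul_assoc loc_mult)
  next
    assume "\<exists>h\<in>carrier (grp X ?\<rho>). hclass X q = hclass X p \<odot> loc X ?\<rho> h"
    then obtain h where "h \<in> carrier (grp X ?\<rho>)" "hclass X q = hclass X p \<odot> loc X ?\<rho> h" by blast
    with v g show "\<exists>h\<in>carrier (grp X ?\<rho>). hclass X q = hclass X p' \<odot> loc X ?\<rho> h"
      by (intro bexI[of _ "inv\<^bsub>grp X ?\<rho>\<^esub> g \<otimes>\<^bsub>grp X ?\<rho>\<^esub> h"]) (auto simp: hmul_assoc loc_mult)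
  qed
  then show ?thesis unfolding u by simp
qed

lemma uclass_self: "\<lbrakk>is_path X p; psrc X p = \<sigma>\<rbrakk> \<Longrightarrow> p \<in> uclass X \<sigma> p"
  using path_vert[of p] pcat_one_right[of p]
  by (auto simp: uclass_def paths_from_def intro!: bexI[of _ "\<one>\<^bsub>grp X (ptgt p)\<^esub>"])

lemma uclassD:
  assumes "q \<in> uclass X \<sigma> p" "is_path X p"
  obtains g where "is_path X q" "psrc X q = \<sigma>" "ptgt q = ptgt p"
    "g \<in> carrier (grp X (ptgt p))" "hclass X q = hclass X p \<odot> loc X (ptgt p) g"
proof -
  obtain g where g: "is_path X q" "psrc X q = \<sigma>" "g \<in> carrier (grp X (ptgt p))"
      "hclass X q = hclass X (pcat X p (Const (ptgt p) g))"
    using assms by (auto simp: uclass_def paths_from_def)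
  then have "(q, pcat X p (Const (ptgt p) g)) \<in> htpy X" by (simp add: hclass_eq_iff)
  from htpy_ends(4)[OF this] have "ptgt q = ptgt p" by simp
  moreover have "hclass X q = hclass X p \<odot> loc X (ptgt p) g"
    using g assms(2) path_vert[of p] by (simp add: loc_def hmul_hclass)
  ultimately show thesis using g by (intro that)
qed

lemma hclass_fwd_path: "a \<in> edges X \<Longrightarrow> hclass X (fwd_path X a) = oarr X (Fwd a)"
  by (simp add: oarr_def fwd_path_def)

text \<open>Changing the representative by a local element \<open>g\<close> changes the extended
  path by \<open>psi X a g\<close>, because \<open>g\<close> slides over the edge.\<close>

lemma uext_uclass:
  assumes p: "is_path X p" "psrc X p = \<sigma>" and a: "a \<in> edges X" "ini X a = ptgt p"
  shows "uext X \<sigma> (uclass X \<sigma> p) a = uclass X \<sigma> (pcat X p (fwd_path X a))"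
proof -
  have f: "is_path X (fwd_path X a)" "psrc X (fwd_path X a) = ptgt p" "ptgt (fwd_path X a) = ter X a"
    using a path_vert[OF p(1)] by (auto simp: fwd_path_def)
  have "uclass X \<sigma> (pcat X q (fwd_path X a)) = uclass X \<sigma> (pcat X p (fwd_path X a))"
    if "q \<in> uclass X \<sigma> p" for q
  proof -
    obtain g where g: "is_path X q" "psrc X q = \<sigma>" "ptgt q = ptgt p"
        "g \<in> carrier (grp X (ptgt p))" "hclass X q = hclass X p \<odot> loc X (ptgt p) g"
      using uclassD[OF \<open>q \<in> uclass X \<sigma> p\<close> p(1)] .
    have "hclass X (pcat X q (fwd_path X a)) = hclass X q \<odot> oarr X (Fwd a)"
      using g f a by (simp add: hmul_hclass[symmetric] hclass_fwd_path)
    also have "\<dots> = hclass X p \<odot> (loc X (ini X a) g \<odot> oarr X (Fwd a))"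
      using g(5) a by (simp add: hmul_assoc)
    also have "\<dots> = hclass X p \<odot> oarr X (Fwd a) \<odot> loc X (ter X a) (psi X a g)"
      using loc_slide[of a g] a g(4) by (simp add: hmul_assoc)
    also have "hclass X p \<odot> oarr X (Fwd a) = hclass X (pcat X p (fwd_path X a))"
      using p f a by (simp add: hmul_hclass[symmetric] hclass_fwd_path)
    finally show ?thesis
      using g p f a by (intro uclass_eq[of _ _ _ "psi X a g"]) (auto simp: pcat_path psrc_pcat)
  qed
  with uclass_self[OF p] show ?thesis unfolding uext_def by blast
qed

text \<open>The condition says that \<open>Q\<close> fixes every vertex of the universal complex.
  Edges are then fixed too, since the image of an edge is computed from the image of its initial
  vertex and its label.\<close>

lemma act_kernelI:
  assumes Q: "Q \<in> arr X \<sigma> \<sigma>"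
    and fix_Q: "\<And>P \<rho>. P \<in> arr X \<sigma> \<rho> \<Longrightarrow> \<exists>g\<in>carrier (grp X \<rho>). Q \<odot> P = P \<odot> loc X \<rho> g"
  shows "Q \<in> act_kernel X \<sigma>"
proof -
  obtain q0 where q0: "Q = hclass X q0" "is_path X q0" "psrc X q0 = \<sigma>" "ptgt q0 = \<sigma>"
    using Q by (rule arrE)
  have vert: "act_vert X \<sigma> Q (uclass X \<sigma> p) = uclass X \<sigma> p" if p: "is_path X p" "psrc X p = \<sigma>" for p
  proof -
    have "uclass X \<sigma> (pcat X q r) = uclass X \<sigma> p" if q: "q \<in> Q" and r: "r \<in> uclass X \<sigma> p" for q r
    proof -
      obtain g where g: "is_path X r" "psrc X r = \<sigma>" "ptgt r = ptgt p"
          "g \<in> carrier (grp X (ptgt p))" "hclass X r = hclass X p \<odot> loc X (ptgt p) g"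
        using uclassD[OF r p(1)] .
      have "(q0, q) \<in> htpy X" using q q0 by (simp add: in_hclass_iff)
      then have q': "hclass X q = Q" "is_path X q" "psrc X q = \<sigma>" "ptgt q = \<sigma>"
        using htpy_ends[of q0 q] q0 hclass_eq_iff[of q0 q] by auto
      obtain x where x: "x \<in> carrier (grp X (ptgt r))" "Q \<odot> hclass X r = hclass X r \<odot> loc X (ptgt r) x"
        using fix_Q[of "hclass X r" "ptgt r"] arr_hclass[OF g(1)] g(2) by auto
      have v: "ptgt p \<in> verts X" using path_vert[OF p(1)] by simp
      have "hclass X (pcat X q r) = hclass X p \<odot> loc X (ptgt p) (g \<otimes>\<^bsub>grp X (ptgt p)\<^esub> x)"
        using q' g x v by (simp add: hmul_hclass[symmetric] hmul_assoc loc_mult)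
      then show ?thesis
        using q' g x v p by (intro uclass_eq[of _ _ _ "g \<otimes>\<^bsub>grp X (ptgt p)\<^esub> x"]) (auto simp: pcat_path psrc_pcat)
    qed
    moreover have "q0 \<in> Q" using q0 htpy_refl by (simp add: in_hclass_iff)
    ultimately show ?thesis using uclass_self[OF p] unfolding act_vert_def by blast
  qed
  have "act_vert X \<sigma> Q v = v" if "v \<in> verts (universal_complex X \<sigma>)" for v
    using that vert by (auto simp: universal_complex_def paths_from_def)
  moreover have "act_edge X \<sigma> Q x = x" if "x \<in> edges (universal_complex X \<sigma>)" for x
    using that vert uext_uclass by (auto simp: universal_complex_def paths_from_def act_edge_def)
  ultimately show ?thesis
    using Q by (simp add: act_kernel_def pi1_carrier)
qed

lemma effectiveD:
  assumes "effective X \<sigma>" "Q \<in> arr X \<sigma> \<sigma>"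
    and "\<And>P \<rho>. P \<in> arr X \<sigma> \<rho> \<Longrightarrow> \<exists>g\<in>carrier (grp X \<rho>). Q \<odot> P = P \<odot> loc X \<rho> g"
  shows "Q = loc X \<sigma> \<one>\<^bsub>grp X \<sigma>\<^esub>"
  using act_kernelI[OF assms(2,3)] assms(1) unfolding effective_def pi1_one by auto

lemma developable_loc_eq_iff:
  "\<lbrakk>developable X; \<sigma> \<in> verts X; g \<in> carrier (grp X \<sigma>); h \<in> carrier (grp X \<sigma>)\<rbrakk> \<Longrightarrow>
   loc X \<sigma> g = loc X \<sigma> h \<longleftrightarrow> g = h"
  unfolding developable_def loc_def by (auto dest: inj_onD)

end

section \<open>Deck transformations\<close>

context cog_covering
begin

definition deck_coset :: "'v \<Rightarrow> ('v, 'e, 'g, 'v, 'e, 'g) cog_mor \<Rightarrow> ('v \<Rightarrow> 'h) \<Rightarrow> ('w, 'f, 'h) gpath set set" where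
  "deck_coset \<sigma>\<^sub>0 \<eta> k = {ind C \<odot>\<^bsub>Y\<^esub> loc Y (vmap \<phi> \<sigma>\<^sub>0) (k \<sigma>\<^sub>0) | C. C \<in> arr X \<sigma>\<^sub>0 (vmap \<eta> \<sigma>\<^sub>0)}"

end

text \<open>Here \<eta> is a morphism and not yet an automorphism: the construction from a
  normalizing element yields morphisms, whose invertibility is established afterwards.\<close>

locale deck_mor = cog_covering X Y \<phi> + e: cog_morphism X X \<eta>
  for X :: "('v, 'e, 'g) cog" and Y :: "('w, 'f, 'h) cog"
    and \<phi> :: "('v, 'e, 'g, 'w, 'f, 'h) cog_mor" and \<eta> :: "('v, 'e, 'g, 'v, 'e, 'g) cog_mor" +
  fixes k :: "'v \<Rightarrow> 'h"
  assumes htpy: "htpy_by X Y \<phi> (mor_comp X Y \<phi> \<eta>) k"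
begin

sublocale c: cog_morphism_comp X X Y \<eta> \<phi> ..

sublocale h: cog_htpy X Y \<phi> "mor_comp X Y \<phi> \<eta>" k
  by unfold_locales (rule htpy)

lemma vmap_vmap [simp]: "\<sigma> \<in> verts X \<Longrightarrow> vmap \<phi> (vmap \<eta> \<sigma>) = vmap \<phi> \<sigma>"
  using h.vmap_eq by simp

lemma emap_emap [simp]: "a \<in> edges X \<Longrightarrow> emap \<phi> (emap \<eta> a) = emap \<phi> a"
  using h.emap_eq by simp

lemma lmap_lmap_closed [simp, intro]:
  "\<lbrakk>\<sigma> \<in> verts X; g \<in> carrier (grp X (vmap \<eta> \<sigma>))\<rbrakk> \<Longrightarrow> lmap \<phi> (vmap \<eta> \<sigma>) g \<in> carrier (grp Y (vmap \<phi> \<sigma>))"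
  using lmap_closed[of "vmap \<eta> \<sigma>" g] by simp

lemma elt_emap_closed [simp, intro]: "a \<in> edges X \<Longrightarrow> elt \<phi> (emap \<eta> a) \<in> carrier (grp Y (vmap \<phi> (ter X a)))"
  using elt_closed[of "emap \<eta> a"] by simp

lemma lmap_vmap_mult:
  "\<lbrakk>\<sigma> \<in> verts X; g \<in> carrier (grp X (vmap \<eta> \<sigma>)); h \<in> carrier (grp X (vmap \<eta> \<sigma>))\<rbrakk> \<Longrightarrow>
   lmap \<phi> (vmap \<eta> \<sigma>) (g \<otimes>\<^bsub>grp X (vmap \<eta> \<sigma>)\<^esub> h)
   = lmap \<phi> (vmap \<eta> \<sigma>) g \<otimes>\<^bsub>grp Y (vmap \<phi> \<sigma>)\<^esub> lmap \<phi> (vmap \<eta> \<sigma>) h"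
  using lmap_mult[of "vmap \<eta> \<sigma>" g h] by simp

lemma elt_emap_slide:
  "\<lbrakk>a \<in> edges X; g \<in> carrier (grp X (vmap \<eta> (ini X a)))\<rbrakk> \<Longrightarrow>
   elt \<phi> (emap \<eta> a) \<otimes>\<^bsub>grp Y (vmap \<phi> (ter X a))\<^esub> psi Y (emap \<phi> a) (lmap \<phi> (vmap \<eta> (ini X a)) g)
   = lmap \<phi> (vmap \<eta> (ter X a)) (psi X (emap \<eta> a) g) \<otimes>\<^bsub>grp Y (vmap \<phi> (ter X a))\<^esub> elt \<phi> (emap \<eta> a)"
  using elt_slide[of "emap \<eta> a" g] by simp

lemma lmap_k: "\<lbrakk>\<sigma> \<in> verts X; g \<in> carrier (grp X \<sigma>)\<rbrakk> \<Longrightarrow>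
    lmap \<phi> (vmap \<eta> \<sigma>) (lmap \<eta> \<sigma> g) \<otimes>\<^bsub>grp Y (vmap \<phi> \<sigma>)\<^esub> k \<sigma> = k \<sigma> \<otimes>\<^bsub>grp Y (vmap \<phi> \<sigma>)\<^esub> lmap \<phi> \<sigma> g"
  using h.lmap_k by simp

lemma elt_k: "a \<in> edges X \<Longrightarrow>
    lmap \<phi> (vmap \<eta> (ter X a)) (elt \<eta> a) \<otimes>\<^bsub>grp Y (vmap \<phi> (ter X a))\<^esub>
      (elt \<phi> (emap \<eta> a) \<otimes>\<^bsub>grp Y (vmap \<phi> (ter X a))\<^esub> psi Y (emap \<phi> a) (k (ini X a)))
    = k (ter X a) \<otimes>\<^bsub>grp Y (vmap \<phi> (ter X a))\<^esub> elt \<phi> a"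
  using h.elt_k[of a] by (simp add: Y.grp_assoc)

lemma natural:
  assumes "P \<in> arr X \<sigma> \<rho>"
  shows "ind (e.ind P) \<odot>\<^bsub>Y\<^esub> loc Y (vmap \<phi> \<rho>) (k \<rho>) = loc Y (vmap \<phi> \<sigma>) (k \<sigma>) \<odot>\<^bsub>Y\<^esub> ind P"
  using h.ind_natural[OF assms] c.ind_comp[OF assms] by simp

lemma deck_coset_arr:
  assumes "\<sigma>\<^sub>0 \<in> verts X" "n \<in> deck_coset \<sigma>\<^sub>0 \<eta> k"
  shows "n \<in> arr Y (vmap \<phi> \<sigma>\<^sub>0) (vmap \<phi> \<sigma>\<^sub>0)"
proof -
  obtain C where C: "C \<in> arr X \<sigma>\<^sub>0 (vmap \<eta> \<sigma>\<^sub>0)" "n = ind C \<odot>\<^bsub>Y\<^esub> loc Y (vmap \<phi> \<sigma>\<^sub>0) (k \<sigma>\<^sub>0)"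
    using assms(2) unfolding deck_coset_def by blast
  have "ind C \<in> arr Y (vmap \<phi> \<sigma>\<^sub>0) (vmap \<phi> \<sigma>\<^sub>0)" using ind_arr[OF C(1)] assms(1) by simp
  then show ?thesis unfolding C(2) using assms(1) by blast
qed

lemma deck_coset_nonempty: "\<sigma>\<^sub>0 \<in> verts X \<Longrightarrow> deck_coset \<sigma>\<^sub>0 \<eta> k \<noteq> {}"
  using X.arr_nonempty[of \<sigma>\<^sub>0 "vmap \<eta> \<sigma>\<^sub>0"] e.vmap_vert unfolding deck_coset_def by blast

text \<open>Multiplying by an element of the coset carries the image of \<open>P\<close> to a class
  that lifts to \<open>C\<close> followed by the image of \<open>P\<close> under \<eta>, with
  leftover \<open>k \<rho>\<close>. Multiplicativity, uniqueness and the normalizing property are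
  all read off from this identity.\<close>

lemma deck_coset_act:
  assumes "C \<in> arr X \<sigma>\<^sub>0 (vmap \<eta> \<sigma>\<^sub>0)" "P \<in> arr X \<sigma>\<^sub>0 \<rho>"
  shows "ind C \<odot>\<^bsub>Y\<^esub> loc Y (vmap \<phi> \<sigma>\<^sub>0) (k \<sigma>\<^sub>0) \<odot>\<^bsub>Y\<^esub> ind P
    = ind (C \<odot>\<^bsub>X\<^esub> e.ind P) \<odot>\<^bsub>Y\<^esub> loc Y (vmap \<phi> \<rho>) (k \<rho>)"
  unfolding ind_hmul[OF assms(1) e.ind_arr[OF assms(2)]] Y.hmul_assoc natural[OF assms(2)] ..

text \<open>Two choices of the connecting path \<open>C\<close> differ by a loop at the base point,
  that is, by a factor from the image of \<phi> on the left.\<close>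

lemma deck_coset_eq:
  assumes "\<sigma>\<^sub>0 \<in> verts X" "n \<in> deck_coset \<sigma>\<^sub>0 \<eta> k"
  shows "deck_coset \<sigma>\<^sub>0 \<eta> k = {ind P \<odot>\<^bsub>Y\<^esub> n | P. P \<in> arr X \<sigma>\<^sub>0 \<sigma>\<^sub>0}"
proof -
  obtain C where C: "C \<in> arr X \<sigma>\<^sub>0 (vmap \<eta> \<sigma>\<^sub>0)" "n = ind C \<odot>\<^bsub>Y\<^esub> loc Y (vmap \<phi> \<sigma>\<^sub>0) (k \<sigma>\<^sub>0)"
    using assms(2) unfolding deck_coset_def by blast
  show ?thesis
  proof (intro equalityI subsetI)
    fix x assume "x \<in> deck_coset \<sigma>\<^sub>0 \<eta> k"
    then obtain D where D: "D \<in> arr X \<sigma>\<^sub>0 (vmap \<eta> \<sigma>\<^sub>0)" "x = ind D \<odot>\<^bsub>Y\<^esub> loc Y (vmap \<phi> \<sigma>\<^sub>0) (k \<sigma>\<^sub>0)"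
      unfolding deck_coset_def by blast
    let ?P = "D \<odot>\<^bsub>X\<^esub> hinv X C"
    have P: "?P \<in> arr X \<sigma>\<^sub>0 \<sigma>\<^sub>0" using D C by blast
    have "?P \<odot>\<^bsub>X\<^esub> C = D" using D C by (simp add: X.hmul_assoc)
    then have "x = ind ?P \<odot>\<^bsub>Y\<^esub> n"
      unfolding D(2) C(2) using ind_hmul[OF P C(1)] by (simp add: Y.hmul_assoc)
    with P show "x \<in> {ind P \<odot>\<^bsub>Y\<^esub> n | P. P \<in> arr X \<sigma>\<^sub>0 \<sigma>\<^sub>0}" by blast
  next
    fix x assume "x \<in> {ind P \<odot>\<^bsub>Y\<^esub> n | P. P \<in> arr X \<sigma>\<^sub>0 \<sigma>\<^sub>0}"
    then obtain P where P: "P \<in> arr X \<sigma>\<^sub>0 \<sigma>\<^sub>0" "x = ind P \<odot>\<^bsub>Y\<^esub> n" by blast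
    have "x = ind (P \<odot>\<^bsub>X\<^esub> C) \<odot>\<^bsub>Y\<^esub> loc Y (vmap \<phi> \<sigma>\<^sub>0) (k \<sigma>\<^sub>0)"
      unfolding P(2) C(2) using ind_hmul[OF P(1) C(1)] by (simp add: Y.hmul_assoc)
    with X.hmul_arr[OF P(1) C(1)] show "x \<in> deck_coset \<sigma>\<^sub>0 \<eta> k" unfolding deck_coset_def by blast
  qed
qed

text \<open>A homotopy \<open>m\<close> from \<eta> to \<open>\<eta>'\<close> changes the witness to
  the image of \<open>m\<close> times \<open>k\<close>. The extra factor is absorbed by replacing
  \<open>C\<close> with \<open>C\<close> followed by \<open>m\<close> at the base point, so the set
  of values is unchanged.\<close>

lemma deck_mor_htpy:
  assumes "cog_htpy X X \<eta> \<eta>' m"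
  shows "\<exists>k'. deck_mor X Y \<phi> \<eta>' k' \<and> (\<forall>\<sigma>\<^sub>0\<in>verts X. deck_coset \<sigma>\<^sub>0 \<eta>' k' = deck_coset \<sigma>\<^sub>0 \<eta> k)"
proof -
  interpret m: cog_htpy X X \<eta> \<eta>' m by fact
  interpret c': cog_morphism_comp X X Y \<eta>' \<phi> ..
  let ?k = "\<lambda>\<sigma>. lmap \<phi> (vmap \<eta> \<sigma>) (m \<sigma>) \<otimes>\<^bsub>grp Y (vmap \<phi> \<sigma>)\<^esub> k \<sigma>"
  have lm: "lmap \<eta>' \<sigma> g \<in> carrier (grp X (vmap \<eta> \<sigma>))" if "\<sigma> \<in> verts X" "g \<in> carrier (grp X \<sigma>)" for \<sigma> g
    using that by blast
  have 1: "lmap \<phi> (vmap \<eta> \<sigma>) (lmap \<eta>' \<sigma> g) \<otimes>\<^bsub>grp Y (vmap \<phi> \<sigma>)\<^esub> ?k \<sigma> = ?k \<sigma> \<otimes>\<^bsub>grp Y (vmap \<phi> \<sigma>)\<^esub> lmap \<phi> \<sigma> g"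
    if \<sigma>: "\<sigma> \<in> verts X" "g \<in> carrier (grp X \<sigma>)" for \<sigma> g
  proof -
    let ?H = "grp Y (vmap \<phi> \<sigma>)"
    have "lmap \<phi> (vmap \<eta> \<sigma>) (lmap \<eta>' \<sigma> g) \<otimes>\<^bsub>?H\<^esub> ?k \<sigma>
        = lmap \<phi> (vmap \<eta> \<sigma>) (lmap \<eta>' \<sigma> g \<otimes>\<^bsub>grp X (vmap \<eta> \<sigma>)\<^esub> m \<sigma>) \<otimes>\<^bsub>?H\<^esub> k \<sigma>"
      using \<sigma> lm by (simp add: lmap_vmap_mult Y.grp_assoc)
    also have "\<dots> = lmap \<phi> (vmap \<eta> \<sigma>) (m \<sigma>) \<otimes>\<^bsub>?H\<^esub> (lmap \<phi> (vmap \<eta> \<sigma>) (lmap \<eta> \<sigma> g) \<otimes>\<^bsub>?H\<^esub> k \<sigma>)"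
      using \<sigma> by (simp add: m.lmap_k lmap_vmap_mult Y.grp_assoc)
    also have "\<dots> = ?k \<sigma> \<otimes>\<^bsub>?H\<^esub> lmap \<phi> \<sigma> g"
      using \<sigma> by (simp add: lmap_k Y.grp_assoc)
    finally show ?thesis .
  qed
  have 2: "lmap \<phi> (vmap \<eta> (ter X a)) (elt \<eta>' a) \<otimes>\<^bsub>grp Y (vmap \<phi> (ter X a))\<^esub> elt \<phi> (emap \<eta> a)
        \<otimes>\<^bsub>grp Y (vmap \<phi> (ter X a))\<^esub> psi Y (emap \<phi> a) (?k (ini X a))
      = ?k (ter X a) \<otimes>\<^bsub>grp Y (vmap \<phi> (ter X a))\<^esub> elt \<phi> a" if a: "a \<in> edges X" for a
  proof -
    let ?H = "grp Y (vmap \<phi> (ter X a))"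
    let ?p = "psi Y (emap \<phi> a) (k (ini X a))"
    let ?l = "lmap \<phi> (vmap \<eta> (ter X a))" and ?m = "lmap \<phi> (vmap \<eta> (ini X a)) (m (ini X a))"
    have cl: "elt \<eta>' a \<in> carrier (grp X (vmap \<eta> (ter X a)))"
      "psi X (emap \<eta> a) (m (ini X a)) \<in> carrier (grp X (vmap \<eta> (ter X a)))"
      "?m \<in> carrier (grp Y (vmap \<phi> (ini X a)))" "?p \<in> carrier ?H"
      using a by auto
    have "?l (elt \<eta>' a) \<otimes>\<^bsub>?H\<^esub> elt \<phi> (emap \<eta> a) \<otimes>\<^bsub>?H\<^esub> psi Y (emap \<phi> a) (?k (ini X a))
        = ?l (elt \<eta>' a) \<otimes>\<^bsub>?H\<^esub> (elt \<phi> (emap \<eta> a) \<otimes>\<^bsub>?H\<^esub> psi Y (emap \<phi> a) ?m) \<otimes>\<^bsub>?H\<^esub> ?p"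
      using a cl by (simp add: psi_emap_mult Y.grp_assoc)
    also have "\<dots> = ?l (elt \<eta>' a \<otimes>\<^bsub>grp X (vmap \<eta> (ter X a))\<^esub> psi X (emap \<eta> a) (m (ini X a)))
        \<otimes>\<^bsub>?H\<^esub> (elt \<phi> (emap \<eta> a) \<otimes>\<^bsub>?H\<^esub> ?p)"
      using a cl by (simp add: elt_emap_slide lmap_vmap_mult Y.grp_assoc)
    also have "\<dots> = ?l (m (ter X a)) \<otimes>\<^bsub>?H\<^esub> (?l (elt \<eta> a) \<otimes>\<^bsub>?H\<^esub> (elt \<phi> (emap \<eta> a) \<otimes>\<^bsub>?H\<^esub> ?p))"
      using a cl by (simp add: m.elt_k lmap_vmap_mult Y.grp_assoc)
    also have "\<dots> = ?k (ter X a) \<otimes>\<^bsub>?H\<^esub> elt \<phi> a"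
      using a cl by (simp add: elt_k Y.grp_assoc)
    finally show ?thesis .
  qed
  have "htpy_by X Y \<phi> (mor_comp X Y \<phi> \<eta>') ?k"
    unfolding htpy_by_def using 1 2 by (simp add: m.vmap_eq m.emap_eq)
  then have "deck_mor X Y \<phi> \<eta>' ?k" by unfold_locales
  moreover have "deck_coset \<sigma>\<^sub>0 \<eta>' ?k = deck_coset \<sigma>\<^sub>0 \<eta> k" if \<sigma>: "\<sigma>\<^sub>0 \<in> verts X" for \<sigma>\<^sub>0
  proof -
    let ?m = "loc X (vmap \<eta> \<sigma>\<^sub>0) (m \<sigma>\<^sub>0)"
    have m: "?m \<in> arr X (vmap \<eta> \<sigma>\<^sub>0) (vmap \<eta> \<sigma>\<^sub>0)" using \<sigma> by blast
    have *: "ind C \<odot>\<^bsub>Y\<^esub> loc Y (vmap \<phi> \<sigma>\<^sub>0) (?k \<sigma>\<^sub>0) = ind (C \<odot>\<^bsub>X\<^esub> ?m) \<odot>\<^bsub>Y\<^esub> loc Y (vmap \<phi> \<sigma>\<^sub>0) (k \<sigma>\<^sub>0)"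
      if "C \<in> arr X \<sigma>\<^sub>0 (vmap \<eta> \<sigma>\<^sub>0)" for C
      using ind_hmul[OF that m] \<sigma> by (simp add: Y.hmul_assoc Y.loc_mult)
    have "\<exists>D\<in>arr X \<sigma>\<^sub>0 (vmap \<eta> \<sigma>\<^sub>0). C = D \<odot>\<^bsub>X\<^esub> ?m" if "C \<in> arr X \<sigma>\<^sub>0 (vmap \<eta> \<sigma>\<^sub>0)" for C
      by (rule bexI[of _ "C \<odot>\<^bsub>X\<^esub> hinv X ?m"])
         (use that m X.hmul_arr[OF that X.hinv_arr[OF m]] in \<open>simp_all add: X.hmul_assoc\<close>)
    then show ?thesis
      unfolding deck_coset_def m.vmap_eq[OF \<sigma>] using * X.hmul_arr[OF _ m, of _ \<sigma>\<^sub>0] by (safe; metis)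
  qed
  ultimately show ?thesis by blast
qed

end

context cog_covering
begin

text \<open>If \<open>C\<close> and \<open>C'\<close> give \<open>n\<close> and \<open>n'\<close>,
  then \<open>C\<close> followed by the image of \<open>C'\<close> under \<eta> gives their product.
  The order is preserved, so the assignment is a homomorphism and not an antihomomorphism.\<close>

lemma deck_comp:
  assumes "deck_mor X Y \<phi> \<eta> k" "deck_mor X Y \<phi> \<eta>' k'" "\<sigma>\<^sub>0 \<in> verts X"
    and n: "n \<in> deck_coset \<sigma>\<^sub>0 \<eta> k" "n' \<in> deck_coset \<sigma>\<^sub>0 \<eta>' k'"
  shows "\<exists>k''. deck_mor X Y \<phi> (mor_comp X X \<eta> \<eta>') k'' \<and> n \<odot>\<^bsub>Y\<^esub> n' \<in> deck_coset \<sigma>\<^sub>0 (mor_comp X X \<eta> \<eta>') k''"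
proof -
  interpret d: deck_mor X Y \<phi> \<eta> k by fact
  interpret d': deck_mor X Y \<phi> \<eta>' k' by fact
  interpret c: cog_morphism_comp X X X \<eta>' \<eta> ..
  interpret cc: cog_morphism_comp X X Y "mor_comp X X \<eta> \<eta>'" \<phi> ..
  \<comment> \<open>The witness pastes two homotopies: the one for \<eta>, evaluated after
    \<open>\<eta>'\<close>, followed by the one for \<open>\<eta>'\<close>.\<close>
  let ?k = "\<lambda>\<sigma>. k (vmap \<eta>' \<sigma>) \<otimes>\<^bsub>grp Y (vmap \<phi> \<sigma>)\<^esub> k' \<sigma>"
  have kc: "k (vmap \<eta>' \<sigma>) \<in> carrier (grp Y (vmap \<phi> \<sigma>))" if "\<sigma> \<in> verts X" for \<sigma>
    using d.h.k_closed[of "vmap \<eta>' \<sigma>"] that by simp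
  have 1: "lmap \<phi> (vmap \<eta> (vmap \<eta>' \<sigma>)) (lmap \<eta> (vmap \<eta>' \<sigma>) (lmap \<eta>' \<sigma> g)) \<otimes>\<^bsub>grp Y (vmap \<phi> \<sigma>)\<^esub> ?k \<sigma>
      = ?k \<sigma> \<otimes>\<^bsub>grp Y (vmap \<phi> \<sigma>)\<^esub> lmap \<phi> \<sigma> g" if \<sigma>: "\<sigma> \<in> verts X" "g \<in> carrier (grp X \<sigma>)" for \<sigma> g
  proof -
    let ?H = "grp Y (vmap \<phi> \<sigma>)"
    let ?x = "lmap \<phi> (vmap \<eta> (vmap \<eta>' \<sigma>)) (lmap \<eta> (vmap \<eta>' \<sigma>) (lmap \<eta>' \<sigma> g))"
    have x: "?x \<in> carrier ?H"
      using \<sigma> d.lmap_lmap_closed[of "vmap \<eta>' \<sigma>" "lmap \<eta> (vmap \<eta>' \<sigma>) (lmap \<eta>' \<sigma> g)"] by simp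
    have "?x \<otimes>\<^bsub>?H\<^esub> ?k \<sigma> = (?x \<otimes>\<^bsub>?H\<^esub> k (vmap \<eta>' \<sigma>)) \<otimes>\<^bsub>?H\<^esub> k' \<sigma>"
      using \<sigma> x kc by (simp add: Y.grp_assoc)
    also have "?x \<otimes>\<^bsub>?H\<^esub> k (vmap \<eta>' \<sigma>) = k (vmap \<eta>' \<sigma>) \<otimes>\<^bsub>?H\<^esub> lmap \<phi> (vmap \<eta>' \<sigma>) (lmap \<eta>' \<sigma> g)"
      using d.lmap_k[of "vmap \<eta>' \<sigma>" "lmap \<eta>' \<sigma> g"] \<sigma> by simp
    also have "\<dots> \<otimes>\<^bsub>?H\<^esub> k' \<sigma> = k (vmap \<eta>' \<sigma>) \<otimes>\<^bsub>?H\<^esub> (k' \<sigma> \<otimes>\<^bsub>?H\<^esub> lmap \<phi> \<sigma> g)"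
      using \<sigma> kc by (simp add: Y.grp_assoc d'.lmap_k)
    also have "\<dots> = ?k \<sigma> \<otimes>\<^bsub>?H\<^esub> lmap \<phi> \<sigma> g" using \<sigma> kc by (simp add: Y.grp_assoc)
    finally show ?thesis .
  qed
  have 2: "lmap \<phi> (vmap \<eta> (vmap \<eta>' (ter X a))) (lmap \<eta> (vmap \<eta>' (ter X a)) (elt \<eta>' a)
          \<otimes>\<^bsub>grp X (vmap \<eta> (vmap \<eta>' (ter X a)))\<^esub> elt \<eta> (emap \<eta>' a))
        \<otimes>\<^bsub>grp Y (vmap \<phi> (ter X a))\<^esub> elt \<phi> (emap \<eta> (emap \<eta>' a))
        \<otimes>\<^bsub>grp Y (vmap \<phi> (ter X a))\<^esub> psi Y (emap \<phi> a) (?k (ini X a))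
      = ?k (ter X a) \<otimes>\<^bsub>grp Y (vmap \<phi> (ter X a))\<^esub> elt \<phi> a" if a: "a \<in> edges X" for a
  proof -
    let ?H = "grp Y (vmap \<phi> (ter X a))" and ?t = "vmap \<eta>' (ter X a)" and ?b = "emap \<eta>' a"
    let ?l = "lmap \<phi> (vmap \<eta> ?t)"
    let ?p = "psi Y (emap \<phi> a) (k (vmap \<eta>' (ini X a)))" and ?p' = "psi Y (emap \<phi> a) (k' (ini X a))"
    have cl: "elt \<eta>' a \<in> carrier (grp X ?t)" "lmap \<eta> ?t (elt \<eta>' a) \<in> carrier (grp X (vmap \<eta> ?t))"
      "elt \<eta> ?b \<in> carrier (grp X (vmap \<eta> ?t))" "elt \<phi> (emap \<eta> ?b) \<in> carrier ?H" "elt \<phi> ?b \<in> carrier ?H"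
      "?p \<in> carrier ?H" "?p' \<in> carrier ?H" "lmap \<phi> ?t (elt \<eta>' a) \<in> carrier ?H"
      using a d.elt_emap_closed[of ?b] kc by auto
    have cl2: "?l (lmap \<eta> ?t (elt \<eta>' a)) \<in> carrier ?H" "?l (elt \<eta> ?b) \<in> carrier ?H"
      using d.lmap_lmap_closed[of ?t] cl a by auto
    have "?l (lmap \<eta> ?t (elt \<eta>' a) \<otimes>\<^bsub>grp X (vmap \<eta> ?t)\<^esub> elt \<eta> ?b)
        = ?l (lmap \<eta> ?t (elt \<eta>' a)) \<otimes>\<^bsub>?H\<^esub> ?l (elt \<eta> ?b)"
      using d.lmap_vmap_mult[of ?t] a cl by simp
    moreover have "psi Y (emap \<phi> a) (?k (ini X a)) = ?p \<otimes>\<^bsub>?H\<^esub> ?p'"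
      using a kc by (simp add: psi_emap_mult)
    ultimately have "?l (lmap \<eta> ?t (elt \<eta>' a) \<otimes>\<^bsub>grp X (vmap \<eta> ?t)\<^esub> elt \<eta> ?b)
        \<otimes>\<^bsub>?H\<^esub> elt \<phi> (emap \<eta> ?b) \<otimes>\<^bsub>?H\<^esub> psi Y (emap \<phi> a) (?k (ini X a))
      = ?l (lmap \<eta> ?t (elt \<eta>' a)) \<otimes>\<^bsub>?H\<^esub> (?l (elt \<eta> ?b) \<otimes>\<^bsub>?H\<^esub> (elt \<phi> (emap \<eta> ?b) \<otimes>\<^bsub>?H\<^esub> ?p)) \<otimes>\<^bsub>?H\<^esub> ?p'"
      using a cl cl2 by (simp add: Y.grp_assoc)
    also have "?l (elt \<eta> ?b) \<otimes>\<^bsub>?H\<^esub> (elt \<phi> (emap \<eta> ?b) \<otimes>\<^bsub>?H\<^esub> ?p) = k ?t \<otimes>\<^bsub>?H\<^esub> elt \<phi> ?b"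
      using d.elt_k[of ?b] a by simp
    also have "?l (lmap \<eta> ?t (elt \<eta>' a)) \<otimes>\<^bsub>?H\<^esub> (k ?t \<otimes>\<^bsub>?H\<^esub> elt \<phi> ?b) \<otimes>\<^bsub>?H\<^esub> ?p'
      = (?l (lmap \<eta> ?t (elt \<eta>' a)) \<otimes>\<^bsub>?H\<^esub> k ?t) \<otimes>\<^bsub>?H\<^esub> elt \<phi> ?b \<otimes>\<^bsub>?H\<^esub> ?p'"
      using a cl cl2 kc by (simp add: Y.grp_assoc)
    also have "?l (lmap \<eta> ?t (elt \<eta>' a)) \<otimes>\<^bsub>?H\<^esub> k ?t = k ?t \<otimes>\<^bsub>?H\<^esub> lmap \<phi> ?t (elt \<eta>' a)"
      using d.lmap_k[of ?t "elt \<eta>' a"] a cl by simp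
    also have "\<dots> \<otimes>\<^bsub>?H\<^esub> elt \<phi> ?b \<otimes>\<^bsub>?H\<^esub> ?p' = k ?t \<otimes>\<^bsub>?H\<^esub> (lmap \<phi> ?t (elt \<eta>' a) \<otimes>\<^bsub>?H\<^esub> (elt \<phi> ?b \<otimes>\<^bsub>?H\<^esub> ?p'))"
      using a cl kc by (simp add: Y.grp_assoc)
    also have "\<dots> = ?k (ter X a) \<otimes>\<^bsub>?H\<^esub> elt \<phi> a"
      using a cl kc by (simp add: d'.elt_k Y.grp_assoc)
    finally show ?thesis .
  qed
  have "htpy_by X Y \<phi> (mor_comp X Y \<phi> (mor_comp X X \<eta> \<eta>')) ?k"
    unfolding htpy_by_def using 1 2 kc by simp
  then have "deck_mor X Y \<phi> (mor_comp X X \<eta> \<eta>') ?k" by unfold_locales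
  moreover have "n \<odot>\<^bsub>Y\<^esub> n' \<in> deck_coset \<sigma>\<^sub>0 (mor_comp X X \<eta> \<eta>') ?k"
  proof -
    obtain C where C: "C \<in> arr X \<sigma>\<^sub>0 (vmap \<eta> \<sigma>\<^sub>0)" "n = ind C \<odot>\<^bsub>Y\<^esub> loc Y (vmap \<phi> \<sigma>\<^sub>0) (k \<sigma>\<^sub>0)"
      using n(1) unfolding deck_coset_def by blast
    obtain C' where C': "C' \<in> arr X \<sigma>\<^sub>0 (vmap \<eta>' \<sigma>\<^sub>0)" "n' = ind C' \<odot>\<^bsub>Y\<^esub> loc Y (vmap \<phi> \<sigma>\<^sub>0) (k' \<sigma>\<^sub>0)"
      using n(2) unfolding deck_coset_def by blast
    have "n \<odot>\<^bsub>Y\<^esub> n' = (ind C \<odot>\<^bsub>Y\<^esub> loc Y (vmap \<phi> \<sigma>\<^sub>0) (k \<sigma>\<^sub>0) \<odot>\<^bsub>Y\<^esub> ind C') \<odot>\<^bsub>Y\<^esub> loc Y (vmap \<phi> \<sigma>\<^sub>0) (k' \<sigma>\<^sub>0)"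
      unfolding C(2) C'(2) by (simp add: Y.hmul_assoc)
    also have "\<dots> = ind (C \<odot>\<^bsub>X\<^esub> d.e.ind C') \<odot>\<^bsub>Y\<^esub> loc Y (vmap \<phi> \<sigma>\<^sub>0) (?k \<sigma>\<^sub>0)"
      unfolding d.deck_coset_act[OF C(1) C'(1)] using assms(3) kc by (simp add: Y.hmul_assoc Y.loc_mult)
    finally show ?thesis
      unfolding deck_coset_def using X.hmul_arr[OF C(1) d.e.ind_arr[OF C'(1)]] by auto
  qed
  ultimately show ?thesis by blast
qed

text \<open>Multiplying the common \<open>n\<close> by a path to \<sigma> yields two lifts of one
  class, so \<open>unique_lift\<close> identifies the image vertices and provides
  \<open>m \<sigma>\<close> relating \<open>k'\<close> to \<open>k\<close>. The homotopy equations
  for \<open>m\<close> hold after applying \<phi> and multiplying by an element on the right, which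
  the covering allows to cancel.\<close>

lemma deck_unique:
  assumes "deck_mor X Y \<phi> \<eta> k" "deck_mor X Y \<phi> \<eta>' k'" "\<sigma>\<^sub>0 \<in> verts X"
    and n: "n \<in> deck_coset \<sigma>\<^sub>0 \<eta> k" "n \<in> deck_coset \<sigma>\<^sub>0 \<eta>' k'"
  shows "\<exists>m. cog_htpy X X \<eta> \<eta>' m"
proof -
  interpret d: deck_mor X Y \<phi> \<eta> k by fact
  interpret d': deck_mor X Y \<phi> \<eta>' k' by fact
  obtain C where C: "C \<in> arr X \<sigma>\<^sub>0 (vmap \<eta> \<sigma>\<^sub>0)" "n = ind C \<odot>\<^bsub>Y\<^esub> loc Y (vmap \<phi> \<sigma>\<^sub>0) (k \<sigma>\<^sub>0)"
    using n(1) unfolding deck_coset_def by blast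
  obtain C' where C': "C' \<in> arr X \<sigma>\<^sub>0 (vmap \<eta>' \<sigma>\<^sub>0)" "n = ind C' \<odot>\<^bsub>Y\<^esub> loc Y (vmap \<phi> \<sigma>\<^sub>0) (k' \<sigma>\<^sub>0)"
    using n(2) unfolding deck_coset_def by blast
  have "vmap \<eta>' \<sigma> = vmap \<eta> \<sigma> \<and> (\<exists>m\<in>carrier (grp X (vmap \<eta> \<sigma>)).
      k' \<sigma> = lmap \<phi> (vmap \<eta> \<sigma>) m \<otimes>\<^bsub>grp Y (vmap \<phi> \<sigma>)\<^esub> k \<sigma>)" if \<sigma>: "\<sigma> \<in> verts X" for \<sigma>
  proof -
    obtain P where P: "P \<in> arr X \<sigma>\<^sub>0 \<sigma>" using X.arr_nonempty[OF assms(3) \<sigma>] by blast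
    have "ind (C \<odot>\<^bsub>X\<^esub> d.e.ind P) \<odot>\<^bsub>Y\<^esub> loc Y (vmap \<phi> (vmap \<eta> \<sigma>)) (k \<sigma>)
        = ind (C' \<odot>\<^bsub>X\<^esub> d'.e.ind P) \<odot>\<^bsub>Y\<^esub> loc Y (vmap \<phi> (vmap \<eta>' \<sigma>)) (k' \<sigma>)"
      using d.deck_coset_act[OF C(1) P] d'.deck_coset_act[OF C'(1) P] C(2) C'(2) \<sigma> by simp
    from unique_lift[OF X.hmul_arr[OF C(1) d.e.ind_arr[OF P]] X.hmul_arr[OF C'(1) d'.e.ind_arr[OF P]] _ _ this] \<sigma>
    show ?thesis by auto
  qed
  then obtain m where v: "\<And>\<sigma>. \<sigma> \<in> verts X \<Longrightarrow> vmap \<eta>' \<sigma> = vmap \<eta> \<sigma>"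
    and m: "\<And>\<sigma>. \<sigma> \<in> verts X \<Longrightarrow> m \<sigma> \<in> carrier (grp X (vmap \<eta> \<sigma>))"
    and k': "\<And>\<sigma>. \<sigma> \<in> verts X \<Longrightarrow> k' \<sigma> = lmap \<phi> (vmap \<eta> \<sigma>) (m \<sigma>) \<otimes>\<^bsub>grp Y (vmap \<phi> \<sigma>)\<^esub> k \<sigma>"
    by metis
  \<comment> \<open>Both edges lie over \<open>emap \<phi> a\<close> and start at the same
    vertex.\<close>
  have E: "emap \<eta>' a = emap \<eta> a" if a: "a \<in> edges X" for a
    using edge_unique[of "emap \<eta>' a" "emap \<eta> a"] a v by simp
  have 1: "lmap \<eta>' \<sigma> g \<otimes>\<^bsub>grp X (vmap \<eta> \<sigma>)\<^esub> m \<sigma> = m \<sigma> \<otimes>\<^bsub>grp X (vmap \<eta> \<sigma>)\<^esub> lmap \<eta> \<sigma> g"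
    if \<sigma>: "\<sigma> \<in> verts X" "g \<in> carrier (grp X \<sigma>)" for \<sigma> g
  proof -
    let ?H = "grp Y (vmap \<phi> \<sigma>)" and ?l = "lmap \<phi> (vmap \<eta> \<sigma>)"
    have g': "lmap \<eta>' \<sigma> g \<in> carrier (grp X (vmap \<eta> \<sigma>))" using d'.e.lmap_closed[OF \<sigma>] v \<sigma> by simp
    have "?l (lmap \<eta>' \<sigma> g \<otimes>\<^bsub>grp X (vmap \<eta> \<sigma>)\<^esub> m \<sigma>) \<otimes>\<^bsub>?H\<^esub> k \<sigma> = ?l (lmap \<eta>' \<sigma> g) \<otimes>\<^bsub>?H\<^esub> k' \<sigma>"
      using \<sigma> g' m k' by (simp add: d.lmap_vmap_mult Y.grp_assoc)
    also have "\<dots> = k' \<sigma> \<otimes>\<^bsub>?H\<^esub> lmap \<phi> \<sigma> g"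
      using d'.lmap_k[OF \<sigma>] v \<sigma> by simp
    also have "\<dots> = ?l (m \<sigma>) \<otimes>\<^bsub>?H\<^esub> (?l (lmap \<eta> \<sigma> g) \<otimes>\<^bsub>?H\<^esub> k \<sigma>)"
      using \<sigma> m k' by (simp add: d.lmap_k Y.grp_assoc)
    also have "\<dots> = ?l (m \<sigma> \<otimes>\<^bsub>grp X (vmap \<eta> \<sigma>)\<^esub> lmap \<eta> \<sigma> g) \<otimes>\<^bsub>?H\<^esub> k \<sigma>"
      using \<sigma> m by (simp add: d.lmap_vmap_mult Y.grp_assoc)
    finally have "?l (lmap \<eta>' \<sigma> g \<otimes>\<^bsub>grp X (vmap \<eta> \<sigma>)\<^esub> m \<sigma>) = ?l (m \<sigma> \<otimes>\<^bsub>grp X (vmap \<eta> \<sigma>)\<^esub> lmap \<eta> \<sigma> g)"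
      using \<sigma> g' m by (subst (asm) Y.grp_r_cancel) auto
    then show ?thesis using \<sigma> g' m by (subst (asm) lmap_eq_iff) auto
  qed
  have 2: "elt \<eta>' a \<otimes>\<^bsub>grp X (vmap \<eta> (ter X a))\<^esub> psi X (emap \<eta> a) (m (ini X a))
      = m (ter X a) \<otimes>\<^bsub>grp X (vmap \<eta> (ter X a))\<^esub> elt \<eta> a" if a: "a \<in> edges X" for a
  proof -
    let ?H = "grp Y (vmap \<phi> (ter X a))" and ?l = "lmap \<phi> (vmap \<eta> (ter X a))"
    let ?G = "grp X (vmap \<eta> (ter X a))"
    let ?q = "elt \<phi> (emap \<eta> a) \<otimes>\<^bsub>?H\<^esub> psi Y (emap \<phi> a) (k (ini X a))"
    let ?m = "lmap \<phi> (vmap \<eta> (ini X a)) (m (ini X a))"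
    have cl: "elt \<eta>' a \<in> carrier ?G" "psi X (emap \<eta> a) (m (ini X a)) \<in> carrier ?G" "m (ter X a) \<in> carrier ?G"
      "?q \<in> carrier ?H" "psi Y (emap \<phi> a) (k (ini X a)) \<in> carrier ?H"
      "m (ini X a) \<in> carrier (grp X (vmap \<eta> (ini X a)))" "?m \<in> carrier (grp Y (vmap \<phi> (ini X a)))"
      using a m d'.e.elt_closed[OF a] v by auto
    have "?l (elt \<eta>' a \<otimes>\<^bsub>?G\<^esub> psi X (emap \<eta> a) (m (ini X a))) \<otimes>\<^bsub>?H\<^esub> ?q
      = ?l (elt \<eta>' a) \<otimes>\<^bsub>?H\<^esub> ((?l (psi X (emap \<eta> a) (m (ini X a))) \<otimes>\<^bsub>?H\<^esub> elt \<phi> (emap \<eta> a)) \<otimes>\<^bsub>?H\<^esub> psi Y (emap \<phi> a) (k (ini X a)))"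
      using a cl by (simp add: d.lmap_vmap_mult Y.grp_assoc)
    also have "\<dots> = ?l (elt \<eta>' a) \<otimes>\<^bsub>?H\<^esub> (elt \<phi> (emap \<eta> a) \<otimes>\<^bsub>?H\<^esub> psi Y (emap \<phi> a) (k' (ini X a)))"
      unfolding d.elt_emap_slide[OF a cl(6), symmetric] using a cl k' by (simp add: psi_emap_mult Y.grp_assoc)
    also have "\<dots> = k' (ter X a) \<otimes>\<^bsub>?H\<^esub> elt \<phi> a"
      using d'.elt_k[OF a] a v E by simp
    also have "\<dots> = ?l (m (ter X a)) \<otimes>\<^bsub>?H\<^esub> (?l (elt \<eta> a) \<otimes>\<^bsub>?H\<^esub> ?q)"
      unfolding d.elt_k[OF a] using a cl k' by (simp add: Y.grp_assoc)
    also have "\<dots> = ?l (m (ter X a) \<otimes>\<^bsub>?G\<^esub> elt \<eta> a) \<otimes>\<^bsub>?H\<^esub> ?q"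
      using a cl by (simp add: d.lmap_vmap_mult Y.grp_assoc)
    finally have "?l (elt \<eta>' a \<otimes>\<^bsub>?G\<^esub> psi X (emap \<eta> a) (m (ini X a))) = ?l (m (ter X a) \<otimes>\<^bsub>?G\<^esub> elt \<eta> a)"
      using a cl by (subst (asm) Y.grp_r_cancel) auto
    then show ?thesis using a cl by (subst (asm) lmap_eq_iff) auto
  qed
  have "htpy_by X X \<eta> \<eta>' m"
    unfolding htpy_by_def using 1 2 v E m by simp
  then have "cog_htpy X X \<eta> \<eta>' m" by unfold_locales
  then show ?thesis by blast
qed

end

section \<open>Construction of deck transformations\<close>

context cog_covering
begin

text \<open>Moving \<open>n\<close> past the image of \<phi> in one direction suffices for a
  morphism: this makes images under the sought \<eta> independent of the paths chosen from the base
  point.\<close>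

lemma deck_exists:
  assumes \<sigma>\<^sub>0: "\<sigma>\<^sub>0 \<in> verts X" and n: "n \<in> arr Y (vmap \<phi> \<sigma>\<^sub>0) (vmap \<phi> \<sigma>\<^sub>0)"
    and conj: "\<And>P. P \<in> arr X \<sigma>\<^sub>0 \<sigma>\<^sub>0 \<Longrightarrow> \<exists>P'\<in>arr X \<sigma>\<^sub>0 \<sigma>\<^sub>0. n \<odot>\<^bsub>Y\<^esub> ind P = ind P' \<odot>\<^bsub>Y\<^esub> n"
  shows "\<exists>\<eta> k. deck_mor X Y \<phi> \<eta> k \<and> n \<in> deck_coset \<sigma>\<^sub>0 \<eta> k"
proof -
  \<comment> \<open>The reference path at the base point is trivial, so that the decomposition found
    there is one of \<open>n\<close> itself and places \<open>n\<close> in the coset.\<close>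
  define p where "p = (\<lambda>\<sigma>. if \<sigma> = \<sigma>\<^sub>0 then loc X \<sigma>\<^sub>0 \<one>\<^bsub>grp X \<sigma>\<^sub>0\<^esub> else SOME P. P \<in> arr X \<sigma>\<^sub>0 \<sigma>)"
  have p: "p \<sigma> \<in> arr X \<sigma>\<^sub>0 \<sigma>" if "\<sigma> \<in> verts X" for \<sigma>
    using X.arr_nonempty[OF \<sigma>\<^sub>0 that] \<sigma>\<^sub>0 by (auto simp: p_def some_in_eq)
  have "\<exists>\<rho> S h. S \<in> arr X \<sigma>\<^sub>0 \<rho> \<and> vmap \<phi> \<rho> = vmap \<phi> \<sigma> \<and> h \<in> carrier (grp Y (vmap \<phi> \<sigma>)) \<and>
      n \<odot>\<^bsub>Y\<^esub> ind (p \<sigma>) = ind S \<odot>\<^bsub>Y\<^esub> loc Y (vmap \<phi> \<sigma>) h" if "\<sigma> \<in> verts X" for \<sigma>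
  proof -
    have np: "n \<odot>\<^bsub>Y\<^esub> ind (p \<sigma>) \<in> arr Y (vmap \<phi> \<sigma>\<^sub>0) (vmap \<phi> \<sigma>)"
      using n ind_arr[OF p[OF that]] by blast
    show ?thesis
      using path_lift[OF np \<sigma>\<^sub>0 refl, of "\<one>\<^bsub>grp Y (vmap \<phi> \<sigma>\<^sub>0)\<^esub>"] Y.one_left[OF np] \<sigma>\<^sub>0 by simp
  qed
  then obtain v p' h where p': "\<And>\<sigma>. \<sigma> \<in> verts X \<Longrightarrow> p' \<sigma> \<in> arr X \<sigma>\<^sub>0 (v \<sigma>)"
    and fv [simp]: "\<And>\<sigma>. \<sigma> \<in> verts X \<Longrightarrow> vmap \<phi> (v \<sigma>) = vmap \<phi> \<sigma>"
    and h [simp]: "\<And>\<sigma>. \<sigma> \<in> verts X \<Longrightarrow> h \<sigma> \<in> carrier (grp Y (vmap \<phi> \<sigma>))"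
    and np: "\<And>\<sigma>. \<sigma> \<in> verts X \<Longrightarrow> n \<odot>\<^bsub>Y\<^esub> ind (p \<sigma>) = ind (p' \<sigma>) \<odot>\<^bsub>Y\<^esub> loc Y (vmap \<phi> \<sigma>) (h \<sigma>)"
    by metis
  have v [simp]: "v \<sigma> \<in> verts X" if "\<sigma> \<in> verts X" for \<sigma>
    using X.arr_verts[OF p'[OF that]] by simp
  \<comment> \<open>Going out along \<open>p \<sigma>\<close>, along \<open>Q\<close> and back along
    \<open>p \<rho>\<close> is a loop at the base point, past which \<open>n\<close> can be moved.
    The resulting \<open>R\<close> is what \<eta> has to do to \<open>Q\<close>, and the equation is
    the naturality square with components \<open>h\<close>.\<close>
  have transport: "\<exists>R\<in>arr X (v \<sigma>) (v \<rho>).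
      loc Y (vmap \<phi> \<sigma>) (h \<sigma>) \<odot>\<^bsub>Y\<^esub> ind Q = ind R \<odot>\<^bsub>Y\<^esub> loc Y (vmap \<phi> \<rho>) (h \<rho>)"
    if Q: "Q \<in> arr X \<sigma> \<rho>" for Q \<sigma> \<rho>
  proof -
    have s: "\<sigma> \<in> verts X" "\<rho> \<in> verts X" using X.arr_verts[OF Q] by auto
    note pp = p[OF s(1)] p[OF s(2)] p'[OF s(1)] p'[OF s(2)]
    have pQ: "p \<sigma> \<odot>\<^bsub>X\<^esub> Q \<in> arr X \<sigma>\<^sub>0 \<rho>" using pp(1) Q by blast
    let ?P = "p \<sigma> \<odot>\<^bsub>X\<^esub> Q \<odot>\<^bsub>X\<^esub> hinv X (p \<rho>)"
    have P: "?P \<in> arr X \<sigma>\<^sub>0 \<sigma>\<^sub>0" using pQ X.hinv_arr[OF pp(2)] by blast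
    obtain P' where P': "P' \<in> arr X \<sigma>\<^sub>0 \<sigma>\<^sub>0" "n \<odot>\<^bsub>Y\<^esub> ind ?P = ind P' \<odot>\<^bsub>Y\<^esub> n" using conj[OF P] by blast
    have "?P \<odot>\<^bsub>X\<^esub> p \<rho> = p \<sigma> \<odot>\<^bsub>X\<^esub> Q"
      using pp(2) X.one_right[OF pQ] by (simp add: X.hmul_assoc)
    then have "ind ?P \<odot>\<^bsub>Y\<^esub> ind (p \<rho>) = ind (p \<sigma>) \<odot>\<^bsub>Y\<^esub> ind Q"
      using ind_hmul[OF P pp(2)] ind_hmul[OF pp(1) Q] by simp
    then have "n \<odot>\<^bsub>Y\<^esub> ind (p \<sigma>) \<odot>\<^bsub>Y\<^esub> ind Q = n \<odot>\<^bsub>Y\<^esub> ind ?P \<odot>\<^bsub>Y\<^esub> ind (p \<rho>)"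
      by (simp add: Y.hmul_assoc)
    also have "\<dots> = ind P' \<odot>\<^bsub>Y\<^esub> (n \<odot>\<^bsub>Y\<^esub> ind (p \<rho>))"
      unfolding P'(2) by (rule Y.hmul_assoc)
    finally have eq: "ind (p' \<sigma>) \<odot>\<^bsub>Y\<^esub> (loc Y (vmap \<phi> \<sigma>) (h \<sigma>) \<odot>\<^bsub>Y\<^esub> ind Q)
        = ind P' \<odot>\<^bsub>Y\<^esub> (ind (p' \<rho>) \<odot>\<^bsub>Y\<^esub> loc Y (vmap \<phi> \<rho>) (h \<rho>))"
      unfolding np[OF s(1)] np[OF s(2)] by (simp add: Y.hmul_assoc)
    let ?R = "hinv X (p' \<sigma>) \<odot>\<^bsub>X\<^esub> (P' \<odot>\<^bsub>X\<^esub> p' \<rho>)"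
    have P'p: "P' \<odot>\<^bsub>X\<^esub> p' \<rho> \<in> arr X \<sigma>\<^sub>0 (v \<rho>)" using P'(1) pp(4) by blast
    have hp: "hinv X (p' \<sigma>) \<in> arr X (v \<sigma>) \<sigma>\<^sub>0" using pp(3) by blast
    have iR: "ind ?R = hinv Y (ind (p' \<sigma>)) \<odot>\<^bsub>Y\<^esub> (ind P' \<odot>\<^bsub>Y\<^esub> ind (p' \<rho>))"
      unfolding ind_hmul[OF hp P'p] ind_hmul[OF P'(1) pp(4)] ind_hinv[OF pp(3)] ..
    have lQ: "loc Y (vmap \<phi> \<sigma>) (h \<sigma>) \<odot>\<^bsub>Y\<^esub> ind Q \<in> arr Y (vmap \<phi> (v \<sigma>)) (vmap \<phi> \<rho>)"
      using Y.hmul_arr[OF Y.loc_arr[OF vmap_vert[OF s(1)] h[OF s(1)]] ind_arr[OF Q]] s by simp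
    have "loc Y (vmap \<phi> \<sigma>) (h \<sigma>) \<odot>\<^bsub>Y\<^esub> ind Q
        = hinv Y (ind (p' \<sigma>)) \<odot>\<^bsub>Y\<^esub> (ind (p' \<sigma>) \<odot>\<^bsub>Y\<^esub> (loc Y (vmap \<phi> \<sigma>) (h \<sigma>) \<odot>\<^bsub>Y\<^esub> ind Q))"
      by (rule Y.hinv_left_left[OF ind_arr[OF pp(3)] lQ, symmetric])
    then have "loc Y (vmap \<phi> \<sigma>) (h \<sigma>) \<odot>\<^bsub>Y\<^esub> ind Q = ind ?R \<odot>\<^bsub>Y\<^esub> loc Y (vmap \<phi> \<rho>) (h \<rho>)"
      unfolding eq iR by (simp add: Y.hmul_assoc)
    moreover have "?R \<in> arr X (v \<sigma>) (v \<rho>)" using hp P'p by blast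
    ultimately show ?thesis by blast
  qed
  \<comment> \<open>For a local element the image of the transported class \<open>R\<close> is
    itself local; comparing \<open>R\<close> with the trivial path by \<open>unique_lift\<close>
    shows that \<open>R\<close> comes from an element of the local group.\<close>
  have "\<exists>x. x \<in> carrier (grp X (v \<sigma>)) \<and>
      lmap \<phi> (v \<sigma>) x \<otimes>\<^bsub>grp Y (vmap \<phi> \<sigma>)\<^esub> h \<sigma> = h \<sigma> \<otimes>\<^bsub>grp Y (vmap \<phi> \<sigma>)\<^esub> lmap \<phi> \<sigma> g"
    if s: "\<sigma> \<in> verts X" "g \<in> carrier (grp X \<sigma>)" for \<sigma> g
  proof -
    obtain R where R: "R \<in> arr X (v \<sigma>) (v \<sigma>)"
      "loc Y (vmap \<phi> \<sigma>) (h \<sigma>) \<odot>\<^bsub>Y\<^esub> ind (loc X \<sigma> g) = ind R \<odot>\<^bsub>Y\<^esub> loc Y (vmap \<phi> \<sigma>) (h \<sigma>)"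
      using transport[OF X.loc_arr[OF s]] by blast
    let ?y = "h \<sigma> \<otimes>\<^bsub>grp Y (vmap \<phi> \<sigma>)\<^esub> lmap \<phi> \<sigma> g"
    have y: "?y \<in> carrier (grp Y (vmap \<phi> (v \<sigma>)))" using s by simp
    have one: "loc X (v \<sigma>) \<one>\<^bsub>grp X (v \<sigma>)\<^esub> \<in> arr X (v \<sigma>) (v \<sigma>)" using s by simp
    have "ind R \<odot>\<^bsub>Y\<^esub> loc Y (vmap \<phi> (v \<sigma>)) (h \<sigma>)
        = ind (loc X (v \<sigma>) \<one>\<^bsub>grp X (v \<sigma>)\<^esub>) \<odot>\<^bsub>Y\<^esub> loc Y (vmap \<phi> (v \<sigma>)) ?y"
      using s y by (simp add: R(2)[symmetric] Y.loc_mult)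
    from unique_lift[OF R(1) one _ y this] s show ?thesis by auto
  qed
  then obtain L where L [simp]: "\<And>\<sigma> g. \<lbrakk>\<sigma> \<in> verts X; g \<in> carrier (grp X \<sigma>)\<rbrakk> \<Longrightarrow> L \<sigma> g \<in> carrier (grp X (v \<sigma>))"
    and Lh: "\<And>\<sigma> g. \<lbrakk>\<sigma> \<in> verts X; g \<in> carrier (grp X \<sigma>)\<rbrakk> \<Longrightarrow>
      lmap \<phi> (v \<sigma>) (L \<sigma> g) \<otimes>\<^bsub>grp Y (vmap \<phi> \<sigma>)\<^esub> h \<sigma> = h \<sigma> \<otimes>\<^bsub>grp Y (vmap \<phi> \<sigma>)\<^esub> lmap \<phi> \<sigma> g"
    by metis
  \<comment> \<open>The final equation is the edge condition for \<open>h\<close> to be a homotopy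
    from \<phi> to its composite with \<eta>, where \<open>b\<close> is the image of
    \<open>a\<close> and \<open>x\<close> the element attached to \<open>a\<close>.\<close>
  define is_edge_lift where "is_edge_lift a b x \<longleftrightarrow>
      b \<in> edges X \<and> ini X b = v (ini X a) \<and> ter X b = v (ter X a) \<and> emap \<phi> b = emap \<phi> a \<and>
      x \<in> carrier (grp X (v (ter X a))) \<and>
      lmap \<phi> (v (ter X a)) x \<otimes>\<^bsub>grp Y (vmap \<phi> (ter X a))\<^esub>
        (elt \<phi> b \<otimes>\<^bsub>grp Y (vmap \<phi> (ter X a))\<^esub> psi Y (emap \<phi> a) (h (ini X a)))
      = h (ter X a) \<otimes>\<^bsub>grp Y (vmap \<phi> (ter X a))\<^esub> elt \<phi> a" for a b x
  have "\<exists>b x. is_edge_lift a b x" if a: "a \<in> edges X" for a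
  proof -
    let ?i = "ini X a" and ?t = "ter X a"
    let ?H = "grp Y (vmap \<phi> ?t)"
    obtain b where b: "b \<in> edges X" "ini X b = v ?i" "emap \<phi> b = emap \<phi> a"
      using edge_lift[of "v ?i" "emap \<phi> a"] a by auto
    have tb: "vmap \<phi> (ter X b) = vmap \<phi> ?t" using ter_emap[OF b(1)] ter_emap[OF a] b(3) by simp
    have eb: "elt \<phi> b \<in> carrier ?H" using elt_closed[OF b(1)] tb by simp
    have ps: "psi Y (emap \<phi> a) (h ?i) \<in> carrier ?H" using a by simp
    obtain R where R: "R \<in> arr X (v ?i) (v ?t)"
      "loc Y (vmap \<phi> ?i) (h ?i) \<odot>\<^bsub>Y\<^esub> ind (oarr X (Fwd a)) = ind R \<odot>\<^bsub>Y\<^esub> loc Y (vmap \<phi> ?t) (h ?t)"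
      using transport[OF X.oarr_Fwd_arr[OF a]] by blast
    \<comment> \<open>The leftover obtained when the class lifted by \<open>R\<close> is lifted
      through the edge \<open>b\<close> instead.\<close>
    let ?y = "elt \<phi> b \<otimes>\<^bsub>?H\<^esub> psi Y (emap \<phi> a) (h ?i) \<otimes>\<^bsub>?H\<^esub> inv\<^bsub>?H\<^esub> elt \<phi> a"
    have y: "?y \<in> carrier (grp Y (vmap \<phi> (ter X b)))" using a eb ps tb by simp
    have bE: "oarr X (Fwd b) \<in> arr X (v ?i) (ter X b)" using X.oarr_Fwd_arr[OF b(1)] b(2) by simp
    have "loc Y (vmap \<phi> ?i) (h ?i) \<odot>\<^bsub>Y\<^esub> ind (oarr X (Fwd a))
      = (loc Y (vmap \<phi> ?i) (h ?i) \<odot>\<^bsub>Y\<^esub> oarr Y (Fwd (emap \<phi> a))) \<odot>\<^bsub>Y\<^esub> loc Y (vmap \<phi> ?t) (inv\<^bsub>?H\<^esub> elt \<phi> a)"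
      unfolding ind_Fwd[OF a] by (simp add: Y.hmul_assoc)
    also have "loc Y (vmap \<phi> ?i) (h ?i) \<odot>\<^bsub>Y\<^esub> oarr Y (Fwd (emap \<phi> a))
      = ind (oarr X (Fwd b)) \<odot>\<^bsub>Y\<^esub> loc Y (vmap \<phi> ?t) (elt \<phi> b \<otimes>\<^bsub>?H\<^esub> psi Y (emap \<phi> a) (h ?i))"
      using ind_Fwd_elt[OF b(1), of "h ?i"] a b tb by simp
    finally have "ind R \<odot>\<^bsub>Y\<^esub> loc Y (vmap \<phi> (v ?t)) (h ?t) = ind (oarr X (Fwd b)) \<odot>\<^bsub>Y\<^esub> loc Y (vmap \<phi> (ter X b)) ?y"
      unfolding R(2) using a eb ps tb by (simp add: Y.hmul_assoc Y.loc_mult)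
    from unique_lift[OF R(1) bE _ y this] a
    obtain x where x: "ter X b = v ?t" "x \<in> carrier (grp X (v ?t))" "?y = lmap \<phi> (v ?t) x \<otimes>\<^bsub>?H\<^esub> h ?t"
      by auto
    \<comment> \<open>The transported class is the edge \<open>b\<close> followed by
      \<open>x\<close>, whereas the functor of a morphism puts the inverse of \<open>elt\<close>
      behind a forward edge; hence the inverse of \<open>x\<close> is the element to attach.\<close>
    let ?z = "inv\<^bsub>grp X (v ?t)\<^esub> x" and ?l = "lmap \<phi> (v ?t)"
    have lx: "?l x \<in> carrier ?H" using lmap_closed[of "v ?t" x] x(2) a by simp
    have lz: "?l ?z = inv\<^bsub>?H\<^esub> ?l x" using lmap_inv[of "v ?t" x] x(2) a by simp
    have "elt \<phi> b \<otimes>\<^bsub>?H\<^esub> psi Y (emap \<phi> a) (h ?i) = ?y \<otimes>\<^bsub>?H\<^esub> elt \<phi> a"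
      using a eb ps by (simp add: Y.grp_assoc)
    also have "\<dots> = ?l x \<otimes>\<^bsub>?H\<^esub> (h ?t \<otimes>\<^bsub>?H\<^esub> elt \<phi> a)"
      unfolding x(3) using a lx by (simp add: Y.grp_assoc)
    finally have "?l ?z \<otimes>\<^bsub>?H\<^esub> (elt \<phi> b \<otimes>\<^bsub>?H\<^esub> psi Y (emap \<phi> a) (h ?i)) = h ?t \<otimes>\<^bsub>?H\<^esub> elt \<phi> a"
      unfolding lz using a lx by simp
    then show ?thesis
      unfolding is_edge_lift_def using a b x by (intro exI[of _ b] exI[of _ ?z]) simp
  qed
  then obtain E x where Ex: "\<And>a. a \<in> edges X \<Longrightarrow> is_edge_lift a (E a) (x a)" by metis
  have E [simp]: "a \<in> edges X \<Longrightarrow> E a \<in> edges X" "a \<in> edges X \<Longrightarrow> ini X (E a) = v (ini X a)"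
      "a \<in> edges X \<Longrightarrow> ter X (E a) = v (ter X a)" "a \<in> edges X \<Longrightarrow> emap \<phi> (E a) = emap \<phi> a"
    and x [simp]: "a \<in> edges X \<Longrightarrow> x a \<in> carrier (grp X (v (ter X a)))"
    and xh: "a \<in> edges X \<Longrightarrow> lmap \<phi> (v (ter X a)) (x a) \<otimes>\<^bsub>grp Y (vmap \<phi> (ter X a))\<^esub>
        (elt \<phi> (E a) \<otimes>\<^bsub>grp Y (vmap \<phi> (ter X a))\<^esub> psi Y (emap \<phi> a) (h (ini X a)))
      = h (ter X a) \<otimes>\<^bsub>grp Y (vmap \<phi> (ter X a))\<^esub> elt \<phi> a" for a
    using Ex[of a] by (simp_all add: is_edge_lift_def)
  define \<eta> where "\<eta> = \<lparr>vmap = v, emap = E, lmap = L, elt = x\<rparr>"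
  have \<eta> [simp]: "vmap \<eta> = v" "emap \<eta> = E" "lmap \<eta> = L" "elt \<eta> = x" by (simp_all add: \<eta>_def)
  have lv [simp]: "lmap \<phi> (v \<sigma>) g \<in> carrier (grp Y (vmap \<phi> \<sigma>))"
    if "\<sigma> \<in> verts X" "g \<in> carrier (grp X (v \<sigma>))" for \<sigma> g
    using lmap_closed[of "v \<sigma>" g] that by simp
  have lvm: "lmap \<phi> (v \<sigma>) (g \<otimes>\<^bsub>grp X (v \<sigma>)\<^esub> g') = lmap \<phi> (v \<sigma>) g \<otimes>\<^bsub>grp Y (vmap \<phi> \<sigma>)\<^esub> lmap \<phi> (v \<sigma>) g'"
    if "\<sigma> \<in> verts X" "g \<in> carrier (grp X (v \<sigma>))" "g' \<in> carrier (grp X (v \<sigma>))" for \<sigma> g g'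
    using lmap_mult[of "v \<sigma>" g g'] that by simp
  \<comment> \<open>Every identity required of \<eta> is verified in \<open>Y\<close>: apply \<phi>,
    multiply on the right by a suitable local element, compute with the defining equations of
    \<open>L\<close> and \<open>x\<close>, and cancel by local injectivity.\<close>
  have cancel: "g = g'" if "\<sigma> \<in> verts X" "g \<in> carrier (grp X (v \<sigma>))" "g' \<in> carrier (grp X (v \<sigma>))"
    "q \<in> carrier (grp Y (vmap \<phi> \<sigma>))"
    "lmap \<phi> (v \<sigma>) g \<otimes>\<^bsub>grp Y (vmap \<phi> \<sigma>)\<^esub> q = lmap \<phi> (v \<sigma>) g' \<otimes>\<^bsub>grp Y (vmap \<phi> \<sigma>)\<^esub> q" for \<sigma> g g' q
    using that Y.grp_r_cancel[of "vmap \<phi> \<sigma>" q "lmap \<phi> (v \<sigma>) g" "lmap \<phi> (v \<sigma>) g'"] lmap_eq_iff[of "v \<sigma>" g g'] by simp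
  have eE [simp]: "elt \<phi> (E a) \<in> carrier (grp Y (vmap \<phi> (ter X a)))" if "a \<in> edges X" for a
    using elt_closed[of "E a"] that by simp
  have pE [simp]: "psi X (E a) g \<in> carrier (grp X (v (ter X a)))"
    if "a \<in> edges X" "g \<in> carrier (grp X (v (ini X a)))" for a g
    using X.psi_closed[of "E a" g] that by simp
  have slideE: "lmap \<phi> (v (ter X a)) (psi X (E a) g) \<otimes>\<^bsub>grp Y (vmap \<phi> (ter X a))\<^esub> elt \<phi> (E a)
      = elt \<phi> (E a) \<otimes>\<^bsub>grp Y (vmap \<phi> (ter X a))\<^esub> psi Y (emap \<phi> a) (lmap \<phi> (v (ini X a)) g)"
    if "a \<in> edges X" "g \<in> carrier (grp X (v (ini X a)))" for a g
    using elt_slide[of "E a" g] that by simp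
  have E_comp: "E (ecomp X a b) = ecomp X (E a) (E b)"
    if ab: "a \<in> edges X" "b \<in> edges X" "ini X a = ter X b" for a b
  proof -
    note abX = X.ecomp_edge[OF ab]
    have E': "ini X (E a) = ter X (E b)" using ab by simp
    note EX = X.ecomp_edge[OF E(1)[OF ab(1)] E(1)[OF ab(2)] E']
    show ?thesis
      using edge_unique[of "E (ecomp X a b)" "ecomp X (E a) (E b)"] abX EX ab E' by simp
  qed
  have scwol: "is_scwol_mor X X \<eta>"
  proof -
    have "bij_betw E {a \<in> edges X. ini X a = \<sigma>} {a' \<in> edges X. ini X a' = v \<sigma>}" if s: "\<sigma> \<in> verts X" for \<sigma>
    proof (rule bij_betwI')
      fix a b assume "a \<in> {a \<in> edges X. ini X a = \<sigma>}" "b \<in> {a \<in> edges X. ini X a = \<sigma>}"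
      then have "a \<in> edges X" "b \<in> edges X" "ini X a = ini X b" by auto
      then show "E a = E b \<longleftrightarrow> a = b" using edge_unique[of a b] E(4) by metis
    next
      fix a assume "a \<in> {a \<in> edges X. ini X a = \<sigma>}"
      then show "E a \<in> {a' \<in> edges X. ini X a' = v \<sigma>}" by auto
    next
      fix b assume b: "b \<in> {a' \<in> edges X. ini X a' = v \<sigma>}"
      then obtain a where a: "a \<in> edges X" "ini X a = \<sigma>" "emap \<phi> a = emap \<phi> b"
        using edge_lift[of \<sigma> "emap \<phi> b"] s by auto
      then have "b = E a" using edge_unique[of b "E a"] b by simp
      with a show "\<exists>a\<in>{a \<in> edges X. ini X a = \<sigma>}. b = E a" by auto
    qed
    then show ?thesis unfolding is_scwol_mor_def by (auto simp: X.composable_iff E_comp)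
  qed
  have mor: "cog_morphism X X \<eta>"
  proof (rule cog_morphismI)
    show "cog X" "cog X" by (rule X.cog_axioms)+
    show "is_scwol_mor X X \<eta>" by (rule scwol)
  next
    fix \<sigma> g assume "\<sigma> \<in> verts X" "g \<in> carrier (grp X \<sigma>)"
    then show "lmap \<eta> \<sigma> g \<in> carrier (grp X (vmap \<eta> \<sigma>))" by simp
  next
    fix \<sigma> g g' assume s: "\<sigma> \<in> verts X" "g \<in> carrier (grp X \<sigma>)" "g' \<in> carrier (grp X \<sigma>)"
    let ?H = "grp Y (vmap \<phi> \<sigma>)" and ?l = "lmap \<phi> (v \<sigma>)"
    have "?l (L \<sigma> (g \<otimes>\<^bsub>grp X \<sigma>\<^esub> g')) \<otimes>\<^bsub>?H\<^esub> h \<sigma> = (h \<sigma> \<otimes>\<^bsub>?H\<^esub> lmap \<phi> \<sigma> g) \<otimes>\<^bsub>?H\<^esub> lmap \<phi> \<sigma> g'"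
      using s by (simp add: Lh lmap_mult Y.grp_assoc)
    also have "\<dots> = ?l (L \<sigma> g) \<otimes>\<^bsub>?H\<^esub> (h \<sigma> \<otimes>\<^bsub>?H\<^esub> lmap \<phi> \<sigma> g')"
      unfolding Lh[OF s(1,2), symmetric] using s by (simp add: Y.grp_assoc)
    also have "\<dots> = ?l (L \<sigma> g \<otimes>\<^bsub>grp X (v \<sigma>)\<^esub> L \<sigma> g') \<otimes>\<^bsub>?H\<^esub> h \<sigma>"
      unfolding Lh[OF s(1,3), symmetric] using s by (simp add: lvm Y.grp_assoc)
    finally show "lmap \<eta> \<sigma> (g \<otimes>\<^bsub>grp X \<sigma>\<^esub> g') = lmap \<eta> \<sigma> g \<otimes>\<^bsub>grp X (vmap \<eta> \<sigma>)\<^esub> lmap \<eta> \<sigma> g'"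
      using s cancel[OF s(1), of "L \<sigma> (g \<otimes>\<^bsub>grp X \<sigma>\<^esub> g')" "L \<sigma> g \<otimes>\<^bsub>grp X (v \<sigma>)\<^esub> L \<sigma> g'" "h \<sigma>"] by simp
  next
    fix a assume "a \<in> edges X"
    then show "elt \<eta> a \<in> carrier (grp X (vmap \<eta> (ter X a)))" by simp
  next
    fix a g assume a: "a \<in> edges X" "g \<in> carrier (grp X (ini X a))"
    let ?i = "ini X a" and ?t = "ter X a"
    let ?H = "grp Y (vmap \<phi> ?t)" and ?G = "grp X (v ?t)" and ?l = "lmap \<phi> (v ?t)"
    let ?p = "psi Y (emap \<phi> a) (h ?i)" and ?g = "lmap \<phi> ?i g" and ?Lg = "lmap \<phi> (v ?i) (L ?i g)"
    have i: "?i \<in> verts X" using a by simp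
    have cl: "?p \<in> carrier ?H" "?g \<in> carrier (grp Y (vmap \<phi> ?i))" "?Lg \<in> carrier (grp Y (vmap \<phi> ?i))"
      "psi Y (emap \<phi> a) ?g \<in> carrier ?H" "psi Y (emap \<phi> a) ?Lg \<in> carrier ?H"
      "psi X (E a) (L ?i g) \<in> carrier ?G" "L ?t (psi X a g) \<in> carrier ?G"
      using a by auto
    have ps: "psi Y (emap \<phi> a) ?Lg \<otimes>\<^bsub>?H\<^esub> ?p = ?p \<otimes>\<^bsub>?H\<^esub> psi Y (emap \<phi> a) ?g"
      using Lh[OF i a(2)] a cl by (simp add: psi_emap_mult[symmetric])
    have "?l (x a \<otimes>\<^bsub>?G\<^esub> psi X (E a) (L ?i g)) \<otimes>\<^bsub>?H\<^esub> (elt \<phi> (E a) \<otimes>\<^bsub>?H\<^esub> ?p)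
      = ?l (x a) \<otimes>\<^bsub>?H\<^esub> ((?l (psi X (E a) (L ?i g)) \<otimes>\<^bsub>?H\<^esub> elt \<phi> (E a)) \<otimes>\<^bsub>?H\<^esub> ?p)"
      using a cl by (simp add: lvm Y.grp_assoc)
    also have "\<dots> = ?l (x a) \<otimes>\<^bsub>?H\<^esub> (elt \<phi> (E a) \<otimes>\<^bsub>?H\<^esub> ?p) \<otimes>\<^bsub>?H\<^esub> psi Y (emap \<phi> a) ?g"
      using slideE[OF a(1), of "L ?i g"] a cl i ps by (simp add: Y.grp_assoc)
    also have "\<dots> = h ?t \<otimes>\<^bsub>?H\<^esub> lmap \<phi> ?t (psi X a g) \<otimes>\<^bsub>?H\<^esub> elt \<phi> a"
      unfolding xh[OF a(1)] using elt_slide[OF a] a cl by (simp add: Y.grp_assoc)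
    also have "\<dots> = ?l (L ?t (psi X a g)) \<otimes>\<^bsub>?H\<^esub> (h ?t \<otimes>\<^bsub>?H\<^esub> elt \<phi> a)"
      using Lh[of ?t "psi X a g", symmetric] a by (simp add: Y.grp_assoc)
    also have "\<dots> = ?l (L ?t (psi X a g) \<otimes>\<^bsub>?G\<^esub> x a) \<otimes>\<^bsub>?H\<^esub> (elt \<phi> (E a) \<otimes>\<^bsub>?H\<^esub> ?p)"
      unfolding xh[OF a(1), symmetric] using a cl by (simp add: lvm Y.grp_assoc)
    finally show "elt \<eta> a \<otimes>\<^bsub>grp X (vmap \<eta> (ter X a))\<^esub> psi X (emap \<eta> a) (lmap \<eta> (ini X a) g)
      = lmap \<eta> (ter X a) (psi X a g) \<otimes>\<^bsub>grp X (vmap \<eta> (ter X a))\<^esub> elt \<eta> a"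
      using a cl cancel[of ?t "x a \<otimes>\<^bsub>?G\<^esub> psi X (E a) (L ?i g)" "L ?t (psi X a g) \<otimes>\<^bsub>?G\<^esub> x a" "elt \<phi> (E a) \<otimes>\<^bsub>?H\<^esub> ?p"]
      by simp
  next
    fix a b assume ab: "a \<in> edges X" "b \<in> edges X" "ini X a = ter X b"
    let ?i = "ini X b" and ?m = "ini X a" and ?t = "ter X a"
    let ?H = "grp Y (vmap \<phi> ?t)" and ?K = "grp Y (vmap \<phi> ?m)" and ?G = "grp X (v ?t)" and ?l = "lmap \<phi> (v ?t)"
    let ?c = "ecomp X a b"
    let ?fa = "emap \<phi> a" and ?fb = "emap \<phi> b"
    note abX = X.ecomp_edge[OF ab] X.twist_closed[OF ab]
    have E': "ini X (E a) = ter X (E b)" using ab by simp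
    have abY: "ini Y ?fa = ter Y ?fb" using ab by simp
    have tY: "twist Y ?fa ?fb \<in> carrier ?H"
      using Y.twist_closed[OF emap_edge[OF ab(1)] emap_edge[OF ab(2)] abY] ab by simp
    have tE: "twist X (E a) (E b) \<in> carrier ?G"
      using X.twist_closed[OF E(1)[OF ab(1)] E(1)[OF ab(2)] E'] ab by simp
    have xb: "x b \<in> carrier (grp X (v ?m))" and eb: "elt \<phi> b \<in> carrier ?K" and eEb: "elt \<phi> (E b) \<in> carrier ?K"
      using x[OF ab(2)] elt_closed[OF ab(2)] eE[OF ab(2)] ab(3) by simp_all
    have pb: "psi Y ?fb (h ?i) \<in> carrier ?K" using psi_emap_closed[OF ab(2), of "h ?i"] ab by simp
    have m: "?m \<in> verts X" "?t \<in> verts X" using ab(1) by auto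
    have lxb: "lmap \<phi> (v ?m) (x b) \<in> carrier ?K" using lv[OF m(1) xb] .
    have pa: "psi Y ?fa (psi Y ?fb (h ?i)) \<in> carrier ?H" "psi Y ?fa (elt \<phi> b) \<in> carrier ?H"
      "psi Y ?fa (elt \<phi> (E b)) \<in> carrier ?H" "psi Y ?fa (lmap \<phi> (v ?m) (x b)) \<in> carrier ?H"
      "psi Y ?fa (h ?m) \<in> carrier ?H"
      using ab(1) eb eEb pb lxb h[OF m(1)] by blast+
    have pc: "psi Y (ecomp Y ?fa ?fb) (h ?i) \<in> carrier ?H"
      using psi_emap_closed[of ?c "h ?i"] abX ab by simp
    have ec: "elt \<phi> ?c \<in> carrier ?H" "elt \<phi> (E ?c) \<in> carrier ?H" "x ?c \<in> carrier ?G"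
      using elt_closed[of ?c] eE[of ?c] x[of ?c] abX by simp_all
    have px: "psi X (E a) (x b) \<in> carrier ?G" using pE[OF ab(1) xb] .
    \<comment> \<open>This is the factor that accompanies \<open>x ?c\<close> in its defining
      equation. Multiplying the twist law by it lets the values of \<open>x\<close> at
      \<open>a\<close>, \<open>b\<close> and the composite edge be traded for values of
      \<open>h\<close>.\<close>
    have q: "elt \<phi> (E ?c) \<otimes>\<^bsub>?H\<^esub> psi Y (ecomp Y ?fa ?fb) (h ?i) \<in> carrier ?H" using ec pc m by simp
    have xc: "?l (x ?c) \<otimes>\<^bsub>?H\<^esub> (elt \<phi> (E ?c) \<otimes>\<^bsub>?H\<^esub> psi Y (ecomp Y ?fa ?fb) (h ?i)) = h ?t \<otimes>\<^bsub>?H\<^esub> elt \<phi> ?c"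
      using xh[of ?c] abX ab by simp
    have twE: "?l (twist X (E a) (E b)) \<otimes>\<^bsub>?H\<^esub> elt \<phi> (E ?c)
        = elt \<phi> (E a) \<otimes>\<^bsub>?H\<^esub> (psi Y ?fa (elt \<phi> (E b)) \<otimes>\<^bsub>?H\<^esub> twist Y ?fa ?fb)"
      using elt_twist[OF E(1)[OF ab(1)] E(1)[OF ab(2)] E'] ab(1,2) E_comp[OF ab] pa tY by (simp add: Y.grp_assoc)
    have twp: "twist Y ?fa ?fb \<otimes>\<^bsub>?H\<^esub> psi Y (ecomp Y ?fa ?fb) (h ?i)
        = psi Y ?fa (psi Y ?fb (h ?i)) \<otimes>\<^bsub>?H\<^esub> twist Y ?fa ?fb"
      using Y.twist_psi[OF emap_edge[OF ab(1)] emap_edge[OF ab(2)] abY, of "h ?i"] ab(1,2) by simp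
    have xbh: "lmap \<phi> (v ?m) (x b) \<otimes>\<^bsub>?K\<^esub> (elt \<phi> (E b) \<otimes>\<^bsub>?K\<^esub> psi Y ?fb (h ?i)) = h ?m \<otimes>\<^bsub>?K\<^esub> elt \<phi> b"
      using xh[OF ab(2)] ab(3) by simp
    have pxb: "psi Y ?fa (lmap \<phi> (v ?m) (x b)) \<otimes>\<^bsub>?H\<^esub> (psi Y ?fa (elt \<phi> (E b)) \<otimes>\<^bsub>?H\<^esub> psi Y ?fa (psi Y ?fb (h ?i)))
        = psi Y ?fa (h ?m) \<otimes>\<^bsub>?H\<^esub> psi Y ?fa (elt \<phi> b)"
    proof -
      have "psi Y ?fa (lmap \<phi> (v ?m) (x b) \<otimes>\<^bsub>?K\<^esub> (elt \<phi> (E b) \<otimes>\<^bsub>?K\<^esub> psi Y ?fb (h ?i)))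
        = psi Y ?fa (lmap \<phi> (v ?m) (x b)) \<otimes>\<^bsub>?H\<^esub> (psi Y ?fa (elt \<phi> (E b)) \<otimes>\<^bsub>?H\<^esub> psi Y ?fa (psi Y ?fb (h ?i)))"
        by (subst psi_emap_mult[OF ab(1) lxb], use eEb pb m in simp, subst psi_emap_mult[OF ab(1) eEb pb], rule refl)
      moreover have "psi Y ?fa (h ?m \<otimes>\<^bsub>?K\<^esub> elt \<phi> b) = psi Y ?fa (h ?m) \<otimes>\<^bsub>?H\<^esub> psi Y ?fa (elt \<phi> b)"
        by (rule psi_emap_mult[OF ab(1) h[OF m(1)] eb])
      ultimately show ?thesis unfolding xbh by simp
    qed
    note cl = m pa pc ec px tY tE abX(4)
    have lcl: "?l (x a) \<in> carrier ?H" "?l (psi X (E a) (x b)) \<in> carrier ?H" "?l (twist X (E a) (E b)) \<in> carrier ?H"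
      "?l (L ?t (twist X a b)) \<in> carrier ?H" "?l (x ?c) \<in> carrier ?H" "elt \<phi> (E a) \<in> carrier ?H" "elt \<phi> a \<in> carrier ?H"
      "h ?t \<in> carrier ?H" "lmap \<phi> ?t (twist X a b) \<in> carrier ?H" "vmap \<phi> ?t \<in> verts Y"
      using cl ab(1) by simp_all
    have "?l (x a \<otimes>\<^bsub>?G\<^esub> psi X (E a) (x b) \<otimes>\<^bsub>?G\<^esub> twist X (E a) (E b))
        = ?l (x a) \<otimes>\<^bsub>?H\<^esub> (?l (psi X (E a) (x b)) \<otimes>\<^bsub>?H\<^esub> ?l (twist X (E a) (E b)))"
      using cl lcl ab(1) by (simp add: lvm Y.grp_assoc)
    then have "?l (x a \<otimes>\<^bsub>?G\<^esub> psi X (E a) (x b) \<otimes>\<^bsub>?G\<^esub> twist X (E a) (E b))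
        \<otimes>\<^bsub>?H\<^esub> (elt \<phi> (E ?c) \<otimes>\<^bsub>?H\<^esub> psi Y (ecomp Y ?fa ?fb) (h ?i))
      = ?l (x a) \<otimes>\<^bsub>?H\<^esub> (?l (psi X (E a) (x b)) \<otimes>\<^bsub>?H\<^esub>
          ((?l (twist X (E a) (E b)) \<otimes>\<^bsub>?H\<^esub> elt \<phi> (E ?c)) \<otimes>\<^bsub>?H\<^esub> psi Y (ecomp Y ?fa ?fb) (h ?i)))"
      using cl lcl by (simp add: Y.grp_assoc)
    also have "\<dots> = ?l (x a) \<otimes>\<^bsub>?H\<^esub> ((?l (psi X (E a) (x b)) \<otimes>\<^bsub>?H\<^esub> elt \<phi> (E a)) \<otimes>\<^bsub>?H\<^esub>
          (psi Y ?fa (elt \<phi> (E b)) \<otimes>\<^bsub>?H\<^esub> psi Y ?fa (psi Y ?fb (h ?i)))) \<otimes>\<^bsub>?H\<^esub> twist Y ?fa ?fb"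
      unfolding twE using cl lcl twp by (simp add: Y.grp_assoc)
    also have "\<dots> = ?l (x a) \<otimes>\<^bsub>?H\<^esub> (elt \<phi> (E a) \<otimes>\<^bsub>?H\<^esub> (psi Y ?fa (lmap \<phi> (v ?m) (x b)) \<otimes>\<^bsub>?H\<^esub>
          (psi Y ?fa (elt \<phi> (E b)) \<otimes>\<^bsub>?H\<^esub> psi Y ?fa (psi Y ?fb (h ?i))))) \<otimes>\<^bsub>?H\<^esub> twist Y ?fa ?fb"
      unfolding slideE[OF ab(1) xb] using cl lcl by (simp add: Y.grp_assoc)
    also have "\<dots> = (?l (x a) \<otimes>\<^bsub>?H\<^esub> (elt \<phi> (E a) \<otimes>\<^bsub>?H\<^esub> psi Y ?fa (h ?m))) \<otimes>\<^bsub>?H\<^esub>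
          (psi Y ?fa (elt \<phi> b) \<otimes>\<^bsub>?H\<^esub> twist Y ?fa ?fb)"
      unfolding pxb using cl lcl by (simp add: Y.grp_assoc)
    also have "\<dots> = h ?t \<otimes>\<^bsub>?H\<^esub> (elt \<phi> a \<otimes>\<^bsub>?H\<^esub> psi Y ?fa (elt \<phi> b) \<otimes>\<^bsub>?H\<^esub> twist Y ?fa ?fb)"
      unfolding xh[OF ab(1)] using cl lcl by (simp add: Y.grp_assoc)
    also have "\<dots> = (h ?t \<otimes>\<^bsub>?H\<^esub> lmap \<phi> ?t (twist X a b)) \<otimes>\<^bsub>?H\<^esub> elt \<phi> ?c"
      unfolding elt_twist[OF ab, symmetric] using cl lcl by (simp add: Y.grp_assoc)
    also have "\<dots> = ?l (L ?t (twist X a b)) \<otimes>\<^bsub>?H\<^esub> (h ?t \<otimes>\<^bsub>?H\<^esub> elt \<phi> ?c)"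
      unfolding Lh[OF m(2) abX(4), symmetric] using cl lcl by (simp add: Y.grp_assoc)
    also have "\<dots> = ?l (L ?t (twist X a b) \<otimes>\<^bsub>?G\<^esub> x ?c)
        \<otimes>\<^bsub>?H\<^esub> (elt \<phi> (E ?c) \<otimes>\<^bsub>?H\<^esub> psi Y (ecomp Y ?fa ?fb) (h ?i))"
      unfolding xc[symmetric] using cl lcl by (simp add: lvm Y.grp_assoc)
    finally have "?l (x a \<otimes>\<^bsub>?G\<^esub> psi X (E a) (x b) \<otimes>\<^bsub>?G\<^esub> twist X (E a) (E b))
        \<otimes>\<^bsub>?H\<^esub> (elt \<phi> (E ?c) \<otimes>\<^bsub>?H\<^esub> psi Y (ecomp Y ?fa ?fb) (h ?i))
      = ?l (L ?t (twist X a b) \<otimes>\<^bsub>?G\<^esub> x ?c) \<otimes>\<^bsub>?H\<^esub> (elt \<phi> (E ?c) \<otimes>\<^bsub>?H\<^esub> psi Y (ecomp Y ?fa ?fb) (h ?i))" .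
    from cancel[OF m(2) _ _ q this]
    have "x a \<otimes>\<^bsub>?G\<^esub> psi X (E a) (x b) \<otimes>\<^bsub>?G\<^esub> twist X (E a) (E b) = L ?t (twist X a b) \<otimes>\<^bsub>?G\<^esub> x ?c"
      using cl ab(1) by simp
    then show "lmap \<eta> (ter X a) (twist X a b) \<otimes>\<^bsub>grp X (vmap \<eta> (ter X a))\<^esub> elt \<eta> (ecomp X a b)
        = elt \<eta> a \<otimes>\<^bsub>grp X (vmap \<eta> (ter X a))\<^esub> psi X (emap \<eta> a) (elt \<eta> b)
            \<otimes>\<^bsub>grp X (vmap \<eta> (ter X a))\<^esub> twist X (emap \<eta> a) (emap \<eta> b)"
      by simp
  qed
  interpret e: cog_morphism X X \<eta> by (rule mor)
  interpret c: cog_morphism_comp X X Y \<eta> \<phi> ..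
  have "htpy_by X Y \<phi> (mor_comp X Y \<phi> \<eta>) h"
    unfolding htpy_by_def using Lh xh by (simp add: Y.grp_assoc)
  then have "deck_mor X Y \<phi> \<eta> h" by unfold_locales
  moreover have "n = ind (p' \<sigma>\<^sub>0) \<odot>\<^bsub>Y\<^esub> loc Y (vmap \<phi> \<sigma>\<^sub>0) (h \<sigma>\<^sub>0)"
    using np[OF \<sigma>\<^sub>0] \<sigma>\<^sub>0 Y.one_right[OF n] by (simp add: p_def)
  then have "n \<in> deck_coset \<sigma>\<^sub>0 \<eta> h"
    using p'[OF \<sigma>\<^sub>0] unfolding deck_coset_def by auto
  ultimately show ?thesis by blast
qed

end

section \<open>The isomorphism with the quotient of the normalizer\<close>

text \<open>The two inclusions are kept apart because, for the image of \<phi>, they have different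
  reasons: applying \<eta> to a loop, and finding a preimage of a loop under \<eta>.\<close>

lemma (in group) mem_normalizerI:
  assumes H: "H \<subseteq> carrier G" and n: "n \<in> carrier G"
    and "\<And>u. u \<in> H \<Longrightarrow> \<exists>u'\<in>H. n \<otimes> u = u' \<otimes> n" "\<And>u'. u' \<in> H \<Longrightarrow> \<exists>u\<in>H. n \<otimes> u = u' \<otimes> n"
  shows "n \<in> normalizer G H"
proof -
  have *: "n \<otimes> u \<otimes> inv n = u' \<longleftrightarrow> n \<otimes> u = u' \<otimes> n" if "u \<in> H" "u' \<in> H" for u u'
    using inv_solve_right'[of u' "n \<otimes> u" n] that H n by auto
  have "n <# H #> inv n = (\<lambda>u. n \<otimes> u \<otimes> inv n) ` H"
    by (auto simp: l_coset_def r_coset_def)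
  also have "\<dots> = H"
  proof (intro equalityI subsetI)
    fix y assume "y \<in> (\<lambda>u. n \<otimes> u \<otimes> inv n) ` H"
    then obtain u where "u \<in> H" "y = n \<otimes> u \<otimes> inv n" by blast
    with assms(3)[of u] * show "y \<in> H" by metis
  next
    fix y assume y: "y \<in> H"
    then obtain u where "u \<in> H" "n \<otimes> u = y \<otimes> n" using assms(4) by blast
    with y * have "y = n \<otimes> u \<otimes> inv n" by metis
    with \<open>u \<in> H\<close> show "y \<in> (\<lambda>u. n \<otimes> u \<otimes> inv n) ` H" by blast
  qed
  finally show ?thesis
    using H n by (simp add: normalizer_def stabilizer_def)
qed

lemma (in group) mem_normalizerD:
  assumes H: "H \<subseteq> carrier G" and n: "n \<in> normalizer G H" and u: "u \<in> H"
  shows "\<exists>u'\<in>H. n \<otimes> u = u' \<otimes> n"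
proof -
  have c: "n \<in> carrier G" and eq: "n <# H #> inv n = H"
    using H n by (auto simp: normalizer_def stabilizer_def)
  have "n \<otimes> u \<otimes> inv n \<in> n <# H #> inv n"
    using u by (auto simp: l_coset_def r_coset_def)
  then have "n \<otimes> u \<otimes> inv n \<in> H" unfolding eq .
  moreover have "n \<otimes> u = n \<otimes> u \<otimes> inv n \<otimes> n"
    using c u H by (auto simp: m_assoc)
  ultimately show ?thesis by blast
qed

text \<open>Associativity, the unit law and inverses are pulled back along the multiplicative
  bijection \<open>f\<close>; membership in \<open>iso\<close> does not presuppose that
  \<open>D\<close> is a group. Closure and the unit have to be supplied separately.\<close>

lemma (in group) group_if_iso_to:
  assumes f: "f \<in> iso D G"
    and cl: "\<And>x y. \<lbrakk>x \<in> carrier D; y \<in> carrier D\<rbrakk> \<Longrightarrow> x \<otimes>\<^bsub>D\<^esub> y \<in> carrier D"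
    and one: "\<one>\<^bsub>D\<^esub> \<in> carrier D" "\<one>\<^bsub>D\<^esub> \<otimes>\<^bsub>D\<^esub> \<one>\<^bsub>D\<^esub> = \<one>\<^bsub>D\<^esub>"
  shows "group D"
proof -
  have hom: "f (x \<otimes>\<^bsub>D\<^esub> y) = f x \<otimes> f y" if "x \<in> carrier D" "y \<in> carrier D" for x y
    using f that by (auto simp: iso_def hom_def)
  have im: "f x \<in> carrier G" if "x \<in> carrier D" for x
    using f that by (auto simp: iso_def hom_def)
  have inj: "x = y" if "x \<in> carrier D" "y \<in> carrier D" "f x = f y" for x y
    using f that by (auto simp: iso_def bij_betw_def dest: inj_onD)
  have surj: "\<exists>x\<in>carrier D. f x = z" if "z \<in> carrier G" for z
  proof -
    have "z \<in> f ` carrier D" using f that by (simp add: iso_def bij_betw_def)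
    then show ?thesis by (rule imageE) auto
  qed
  \<comment> \<open>The image of the unit is idempotent, and the only idempotent of a group is
    neutral.\<close>
  have one': "f \<one>\<^bsub>D\<^esub> = \<one>"
    using hom[OF one(1) one(1)] l_cancel_one[OF im[OF one(1)] im[OF one(1)]] one(2) by simp
  show ?thesis
  proof (rule groupI)
    fix x y z assume "x \<in> carrier D" "y \<in> carrier D" "z \<in> carrier D"
    then show "x \<otimes>\<^bsub>D\<^esub> y \<otimes>\<^bsub>D\<^esub> z = x \<otimes>\<^bsub>D\<^esub> (y \<otimes>\<^bsub>D\<^esub> z)"
      by (intro inj) (auto simp: cl hom im m_assoc)
  next
    fix x assume x: "x \<in> carrier D"
    then show "\<one>\<^bsub>D\<^esub> \<otimes>\<^bsub>D\<^esub> x = x"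
      by (intro inj) (auto simp: cl one hom one' im)
    obtain y where y: "y \<in> carrier D" "f y = inv f x"
      using surj[OF inv_closed[OF im[OF x]]] by blast
    then have "y \<otimes>\<^bsub>D\<^esub> x = \<one>\<^bsub>D\<^esub>"
      using x by (intro inj) (auto simp: cl one hom one' im)
    with y show "\<exists>y\<in>carrier D. y \<otimes>\<^bsub>D\<^esub> x = \<one>\<^bsub>D\<^esub>" by blast
  qed (use cl one in auto)
qed

section \<open>The identity, isomorphisms and inverses up to homotopy\<close>

context cog
begin

lemma mor_id_simps [simp]:
  "vmap (mor_id X) \<sigma> = \<sigma>" "emap (mor_id X) a = a" "lmap (mor_id X) \<sigma> g = g"
  "elt (mor_id X) a = \<one>\<^bsub>grp X (ter X a)\<^esub>"
  by (simp_all add: mor_id_def)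

lemma cog_morphism_id: "cog_morphism X X (mor_id X)"
proof (rule cog_morphismI)
  have "emap (mor_id X) = (\<lambda>a. a)" by (simp add: mor_id_def id_def)
  then show "is_scwol_mor X X (mor_id X)"
    unfolding is_scwol_mor_def by (auto simp: bij_betw_def)
  fix a b assume ab: "a \<in> edges X" "b \<in> edges X" "ini X a = ter X b"
  have "psi X a \<one>\<^bsub>grp X (ter X b)\<^esub> = \<one>\<^bsub>grp X (ter X a)\<^esub>"
    using psi_one[OF ab(1)] ab(3) by simp
  then show "lmap (mor_id X) (ter X a) (twist X a b) \<otimes>\<^bsub>grp X (vmap (mor_id X) (ter X a))\<^esub> elt (mor_id X) (ecomp X a b)
    = elt (mor_id X) a \<otimes>\<^bsub>grp X (vmap (mor_id X) (ter X a))\<^esub> psi X (emap (mor_id X) a) (elt (mor_id X) b)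
        \<otimes>\<^bsub>grp X (vmap (mor_id X) (ter X a))\<^esub> twist X (emap (mor_id X) a) (emap (mor_id X) b)"
    using ab ecomp_edge[OF ab] twist_closed[OF ab] by simp
qed (auto simp: cog_axioms)

end

context cog_morphism
begin

text \<open>Preimages are built generator by generator, without an inverse morphism. On an edge, the
  factor involving \<open>elt \<phi> a\<close> is removed by a local element \<open>y\<close>, which
  exists because the local maps are onto.\<close>

lemma iso_ind_surj:
  assumes iso: "is_cog_iso X Y \<phi>" and "Q \<in> arr Y \<tau> \<tau>'" "\<sigma> \<in> verts X" "vmap \<phi> \<sigma> = \<tau>"
  shows "\<exists>\<rho> P. P \<in> arr X \<sigma> \<rho> \<and> vmap \<phi> \<rho> = \<tau>' \<and> ind P = Q"
proof -
  have lmap_surj: "\<exists>x\<in>carrier (grp X \<sigma>). lmap \<phi> \<sigma> x = y"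
    if "\<sigma> \<in> verts X" "y \<in> carrier (grp Y (vmap \<phi> \<sigma>))" for \<sigma> y
  proof -
    have "bij_betw (lmap \<phi> \<sigma>) (carrier (grp X \<sigma>)) (carrier (grp Y (vmap \<phi> \<sigma>)))"
      using iso that by (auto simp: is_cog_iso_def iso_def)
    then have "y \<in> lmap \<phi> \<sigma> ` carrier (grp X \<sigma>)" using that(2) by (simp add: bij_betw_def)
    then show ?thesis by (rule imageE) auto
  qed
  have emap_surj: "\<exists>a\<in>edges X. emap \<phi> a = a'" if "a' \<in> edges Y" for a'
  proof -
    have "emap \<phi> ` edges X = edges Y"
      using iso by (simp add: is_cog_iso_def is_scwol_iso_def bij_betw_def)
    then have "a' \<in> emap \<phi> ` edges X" using that by simp
    then show ?thesis by (rule imageE) auto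
  qed
  have vmap_inj: "\<sigma> = \<rho>" if "\<sigma> \<in> verts X" "\<rho> \<in> verts X" "vmap \<phi> \<sigma> = vmap \<phi> \<rho>" for \<sigma> \<rho>
    using iso that unfolding is_cog_iso_def is_scwol_iso_def bij_betw_def by (auto dest: inj_onD)
  have oarr_surj: "\<exists>\<rho> P. P \<in> arr X \<sigma> \<rho> \<and> vmap \<phi> \<rho> = oter Y e \<and> ind P = oarr Y e"
    if e: "uedge e \<in> edges Y" "\<sigma> \<in> verts X" "vmap \<phi> \<sigma> = oini Y e" for e \<sigma>
  proof (cases e)
    case (Fwd a')
    then obtain a where a: "a \<in> edges X" "ini X a = \<sigma>" "emap \<phi> a = a'"
      using edge_lift[of \<sigma> a'] e by auto
    obtain y where y: "y \<in> carrier (grp X (ter X a))" "lmap \<phi> (ter X a) y = elt \<phi> a"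
      using lmap_surj[of "ter X a" "elt \<phi> a"] a by auto
    have F: "oarr X (Fwd a) \<in> arr X \<sigma> (ter X a)" using X.oarr_Fwd_arr[OF a(1)] a(2) by simp
    have ly: "loc X (ter X a) y \<in> arr X (ter X a) (ter X a)" using a y by auto
    have "ind (oarr X (Fwd a) \<odot>\<^bsub>X\<^esub> loc X (ter X a) y) = oarr Y e"
      using ind_hmul[OF F ly] a y Fwd Y.one_right[OF emap_arr(1)[OF a(1)]]
      by (simp add: ind_Fwd Y.hmul_assoc Y.loc_mult)
    with X.hmul_arr[OF F ly] a Fwd ter_emap[OF a(1)] show ?thesis by auto
  next
    case (Bwd a')
    then obtain a where a: "a \<in> edges X" "emap \<phi> a = a'"
      using emap_surj e by auto
    have t: "ter X a = \<sigma>" using vmap_inj[of "ter X a" \<sigma>] a e Bwd by auto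
    obtain y where y: "y \<in> carrier (grp X (ter X a))" "lmap \<phi> (ter X a) y = inv\<^bsub>grp Y (vmap \<phi> (ter X a))\<^esub> elt \<phi> a"
      using lmap_surj[of "ter X a" "inv\<^bsub>grp Y (vmap \<phi> (ter X a))\<^esub> elt \<phi> a"] a by auto
    have F: "oarr X (Bwd a) \<in> arr X (ter X a) (ini X a)" using X.oarr_Bwd_arr[OF a(1)] .
    have ly: "loc X (ter X a) y \<in> arr X (ter X a) (ter X a)" using a y by auto
    have "ind (loc X (ter X a) y \<odot>\<^bsub>X\<^esub> oarr X (Bwd a)) = oarr Y e"
      using ind_hmul[OF ly F] a y Bwd Y.one_left[OF emap_arr(2)[OF a(1)]]
      by (simp add: ind_Bwd Y.hmul_assoc[symmetric] Y.loc_mult)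
    with X.hmul_arr[OF ly F] a t Bwd ini_emap[OF a(1)] show ?thesis by auto
  qed
  show ?thesis
    using assms(2-4)
  proof (induction arbitrary: \<sigma> rule: Y.arr_induct)
    case (loc g)
    then obtain x where "x \<in> carrier (grp X \<sigma>)" "lmap \<phi> \<sigma> x = g" using lmap_surj by blast
    with loc show ?case by (intro exI[of _ \<sigma>] exI[of _ "loc X \<sigma> x"]) auto
  next
    case (step g e Q)
    obtain \<rho> E where E: "E \<in> arr X \<sigma> \<rho>" "vmap \<phi> \<rho> = oter Y e" "ind E = oarr Y e"
      using oarr_surj[OF step(1,5,6)] by blast
    obtain \<rho>' P where P: "P \<in> arr X \<rho> \<rho>'" "vmap \<phi> \<rho>' = \<tau>'" "ind P = Q"
      using step.IH[of \<rho>] X.arr_verts[OF E(1)] E(2) by blast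
    obtain x where x: "x \<in> carrier (grp X \<sigma>)" "lmap \<phi> \<sigma> x = g"
      using lmap_surj[OF step(5)] step(2,6) by auto
    note l = X.loc_arr[OF step(5) x(1)]
    have "ind (loc X \<sigma> x \<odot>\<^bsub>X\<^esub> (E \<odot>\<^bsub>X\<^esub> P)) = loc Y (oini Y e) g \<odot>\<^bsub>Y\<^esub> (oarr Y e \<odot>\<^bsub>Y\<^esub> Q)"
      unfolding ind_hmul[OF l X.hmul_arr[OF E(1) P(1)]] ind_hmul[OF E(1) P(1)] using E P x step by simp
    with X.hmul_arr[OF l X.hmul_arr[OF E(1) P(1)]] P(2) show ?case by blast
  qed
qed

end

lemma cog_iso_comp:
  assumes "cog X" "is_cog_iso X X \<eta>" "is_cog_iso X X \<eta>'"
  shows "is_cog_iso X X (mor_comp X X \<eta> \<eta>')"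
proof -
  interpret X: cog X by fact
  interpret f: cog_morphism X X \<eta>' using assms(3) by unfold_locales (simp add: is_cog_iso_def)
  interpret g: cog_morphism X X \<eta> using assms(2) by unfold_locales (simp add: is_cog_iso_def)
  interpret c: cog_morphism_comp X X X \<eta>' \<eta> ..
  have "lmap (mor_comp X X \<eta> \<eta>') \<sigma> \<in> iso (grp X \<sigma>) (grp X (vmap (mor_comp X X \<eta> \<eta>') \<sigma>))"
    if s: "\<sigma> \<in> verts X" for \<sigma>
  proof -
    have "lmap \<eta>' \<sigma> \<in> iso (grp X \<sigma>) (grp X (vmap \<eta>' \<sigma>))"
      "lmap \<eta> (vmap \<eta>' \<sigma>) \<in> iso (grp X (vmap \<eta>' \<sigma>)) (grp X (vmap \<eta> (vmap \<eta>' \<sigma>)))"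
      using assms(2,3) s by (auto simp: is_cog_iso_def)
    from iso_set_trans[OF this] show ?thesis by (simp add: mor_comp_def)
  qed
  moreover have "bij_betw (vmap (mor_comp X X \<eta> \<eta>')) (verts X) (verts X)"
    "bij_betw (emap (mor_comp X X \<eta> \<eta>')) (edges X) (edges X)"
    using assms(2,3) bij_betw_trans unfolding is_cog_iso_def is_scwol_iso_def by (auto simp: mor_comp_def)
  ultimately show ?thesis
    using c.comp.mor c.comp.scwol_mor by (simp add: is_cog_iso_def is_scwol_iso_def)
qed

text \<open>A homotopy keeps the underlying morphism of scwols, so the maps on vertices and edges
  are inverse on the nose, while the local composites are conjugations. The latter force each local
  map to be bijective.\<close>

lemma cog_iso_if_inverse:
  assumes f: "cog_morphism X X \<eta>" and g: "cog_morphism X X \<eta>'"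
    and h: "cog_htpy X X (mor_id X) (mor_comp X X \<eta> \<eta>') m" "cog_htpy X X (mor_id X) (mor_comp X X \<eta>' \<eta>) m'"
  shows "is_cog_iso X X \<eta>"
proof -
  interpret f: cog_morphism X X \<eta> by fact
  interpret g: cog_morphism X X \<eta>' by fact
  interpret fg: cog_morphism_comp X X X \<eta>' \<eta> ..
  interpret gf: cog_morphism_comp X X X \<eta> \<eta>' ..
  interpret h: cog_htpy X X "mor_id X" "mor_comp X X \<eta> \<eta>'" m by fact
  interpret h': cog_htpy X X "mor_id X" "mor_comp X X \<eta>' \<eta>" m' by fact
  have v: "vmap \<eta> (vmap \<eta>' \<sigma>) = \<sigma>" "vmap \<eta>' (vmap \<eta> \<sigma>) = \<sigma>" if "\<sigma> \<in> verts X" for \<sigma>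
    using h.vmap_eq[OF that] h'.vmap_eq[OF that] by simp_all
  have e: "emap \<eta> (emap \<eta>' a) = a" "emap \<eta>' (emap \<eta> a) = a" if "a \<in> edges X" for a
    using h.emap_eq[OF that] h'.emap_eq[OF that] by simp_all
  have "bij_betw (vmap \<eta>) (verts X) (verts X)"
    by (rule bij_betw_byWitness[where f' = "vmap \<eta>'"]) (auto simp: v)
  moreover have "bij_betw (emap \<eta>) (edges X) (edges X)"
    by (rule bij_betw_byWitness[where f' = "emap \<eta>'"]) (auto simp: e)
  moreover have "lmap \<eta> \<sigma> \<in> iso (grp X \<sigma>) (grp X (vmap \<eta> \<sigma>))" if s: "\<sigma> \<in> verts X" for \<sigma>
  proof -
    have "inj_on (lmap \<eta> \<sigma>) (carrier (grp X \<sigma>))"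
    proof (rule inj_onI)
      fix x y assume xy: "x \<in> carrier (grp X \<sigma>)" "y \<in> carrier (grp X \<sigma>)" "lmap \<eta> \<sigma> x = lmap \<eta> \<sigma> y"
      then have "m' \<sigma> \<otimes>\<^bsub>grp X \<sigma>\<^esub> x = m' \<sigma> \<otimes>\<^bsub>grp X \<sigma>\<^esub> y"
        using h'.lmap_k[OF s xy(1)] h'.lmap_k[OF s xy(2)] by simp
      then show "x = y" using f.X.grp_l_cancel[OF s _ xy(1,2)] h'.k_closed[OF s] by simp
    qed
    moreover have "lmap \<eta> \<sigma> ` carrier (grp X \<sigma>) = carrier (grp X (vmap \<eta> \<sigma>))"
    proof (intro equalityI subsetI)
      fix y assume "y \<in> lmap \<eta> \<sigma> ` carrier (grp X \<sigma>)"
      then show "y \<in> carrier (grp X (vmap \<eta> \<sigma>))" using s by auto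
    next
      fix y assume y: "y \<in> carrier (grp X (vmap \<eta> \<sigma>))"
      let ?t = "vmap \<eta> \<sigma>"
      let ?G = "grp X ?t"
      have t: "?t \<in> verts X" using s by auto
      have m: "m ?t \<in> carrier ?G" using h.k_closed[OF t] by simp
      \<comment> \<open>The local composite at \<open>?t\<close> is conjugation by
        \<open>m ?t\<close>, which takes this element to \<open>y\<close>.\<close>
      let ?z = "inv\<^bsub>?G\<^esub> m ?t \<otimes>\<^bsub>?G\<^esub> y \<otimes>\<^bsub>?G\<^esub> m ?t"
      have z: "?z \<in> carrier ?G" using m y t by simp
      have z': "lmap \<eta>' ?t ?z \<in> carrier (grp X \<sigma>)" using g.lmap_closed[OF t z] v(2)[OF s] by simp
      have "lmap \<eta> \<sigma> (lmap \<eta>' ?t ?z) \<otimes>\<^bsub>?G\<^esub> m ?t = y \<otimes>\<^bsub>?G\<^esub> m ?t"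
        using h.lmap_k[OF t z] v(2)[OF s] m y t by (simp add: f.X.grp_assoc)
      then have "lmap \<eta> \<sigma> (lmap \<eta>' ?t ?z) = y"
        using f.X.grp_r_cancel[OF t m _ y] f.lmap_closed[OF s z'] by blast
      then show "y \<in> lmap \<eta> \<sigma> ` carrier (grp X \<sigma>)" by (rule image_eqI[OF sym z'])
    qed
    moreover have "lmap \<eta> \<sigma> \<in> hom (grp X \<sigma>) (grp X (vmap \<eta> \<sigma>))"
      using f.mor s by (simp add: is_cog_mor_def)
    ultimately show ?thesis by (simp add: iso_def bij_betw_def)
  qed
  ultimately show ?thesis
    using f.mor f.scwol_mor by (simp add: is_cog_iso_def is_scwol_iso_def)
qed

section \<open>The correspondence between deck transformations and cosets\<close>

locale effective_covering = cog_covering X Y \<phi>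
  for X :: "('v, 'e, 'g) cog" and Y :: "('w, 'f, 'h) cog"
    and \<phi> :: "('v, 'e, 'g, 'w, 'f, 'h) cog_mor" +
  fixes \<sigma>\<^sub>0 :: 'v
  assumes base: "\<sigma>\<^sub>0 \<in> verts X"
    and dev: "developable Y"
    and eff: "effective Y (vmap \<phi> \<sigma>\<^sub>0)"
begin

abbreviation "\<tau>\<^sub>0 \<equiv> vmap \<phi> \<sigma>\<^sub>0"

abbreviation "G \<equiv> pi1 Y \<tau>\<^sub>0"

abbreviation "U \<equiv> ind ` arr X \<sigma>\<^sub>0 \<sigma>\<^sub>0"

text \<open>Two homotopies between the same morphisms differ at the base point by a local element that
  fixes the universal complex of \<open>Y\<close> pointwise, since every path lifts.\<close>

lemma deck_k_unique:
  assumes "deck_mor X Y \<phi> \<eta> k" "deck_mor X Y \<phi> \<eta> k'"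
  shows "k \<sigma>\<^sub>0 = k' \<sigma>\<^sub>0"
proof -
  interpret d: deck_mor X Y \<phi> \<eta> k by fact
  interpret d': deck_mor X Y \<phi> \<eta> k' by fact
  let ?H = "grp Y \<tau>\<^sub>0"
  let ?z = "inv\<^bsub>?H\<^esub> k' \<sigma>\<^sub>0 \<otimes>\<^bsub>?H\<^esub> k \<sigma>\<^sub>0"
  have k: "k \<sigma>\<^sub>0 \<in> carrier ?H" "k' \<sigma>\<^sub>0 \<in> carrier ?H" using base by auto
  have t: "\<tau>\<^sub>0 \<in> verts Y" using base by auto
  have z: "?z \<in> carrier ?H" using k t by simp
  have "loc Y \<tau>\<^sub>0 ?z = loc Y \<tau>\<^sub>0 \<one>\<^bsub>?H\<^esub>"
  proof (rule Y.effectiveD[OF eff])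
    show "loc Y \<tau>\<^sub>0 ?z \<in> arr Y \<tau>\<^sub>0 \<tau>\<^sub>0" using z t by blast
  next
    fix R \<rho>' assume R: "R \<in> arr Y \<tau>\<^sub>0 \<rho>'"
    obtain \<rho> S h where S: "S \<in> arr X \<sigma>\<^sub>0 \<rho>" "vmap \<phi> \<rho> = \<rho>'" "h \<in> carrier (grp Y \<rho>')"
      "loc Y \<tau>\<^sub>0 \<one>\<^bsub>?H\<^esub> \<odot>\<^bsub>Y\<^esub> R = ind S \<odot>\<^bsub>Y\<^esub> loc Y \<rho>' h"
      using path_lift[OF R base refl, of "\<one>\<^bsub>?H\<^esub>"] t by auto
    then have R_eq: "R = ind S \<odot>\<^bsub>Y\<^esub> loc Y \<rho>' h" using Y.one_left[OF R] by simp
    let ?K = "grp Y \<rho>'"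
    have \<rho>: "\<rho> \<in> verts X" using X.arr_verts[OF S(1)] by simp
    have \<rho>': "\<rho>' \<in> verts Y" "k \<rho> \<in> carrier ?K" "k' \<rho> \<in> carrier ?K"
      using d.h.k_closed[OF \<rho>] d'.h.k_closed[OF \<rho>] vmap_vert[OF \<rho>] S(2) by simp_all
    let ?J = "ind (d.e.ind S)"
    have J: "?J \<in> arr Y \<tau>\<^sub>0 \<rho>'" using ind_arr[OF d.e.ind_arr[OF S(1)]] base \<rho> S(2) by simp
    have k'S: "loc Y \<tau>\<^sub>0 (k' \<sigma>\<^sub>0) \<odot>\<^bsub>Y\<^esub> ind S = ?J \<odot>\<^bsub>Y\<^esub> loc Y \<rho>' (k' \<rho>)"
      and kS: "loc Y \<tau>\<^sub>0 (k \<sigma>\<^sub>0) \<odot>\<^bsub>Y\<^esub> ind S = ?J \<odot>\<^bsub>Y\<^esub> loc Y \<rho>' (k \<rho>)"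
      using d.natural[OF S(1)] d'.natural[OF S(1)] S(2) by simp_all
    have iS: "ind S \<in> arr Y \<tau>\<^sub>0 \<rho>'" using ind_arr[OF S(1)] S(2) by simp
    have "loc Y \<tau>\<^sub>0 (inv\<^bsub>?H\<^esub> k' \<sigma>\<^sub>0) \<odot>\<^bsub>Y\<^esub> ?J
        = loc Y \<tau>\<^sub>0 (inv\<^bsub>?H\<^esub> k' \<sigma>\<^sub>0) \<odot>\<^bsub>Y\<^esub> (?J \<odot>\<^bsub>Y\<^esub> loc Y \<rho>' (k' \<rho>)) \<odot>\<^bsub>Y\<^esub> loc Y \<rho>' (inv\<^bsub>?K\<^esub> k' \<rho>)"
      using J \<rho>' by (simp add: Y.hmul_assoc Y.loc_mult)
    also have "\<dots> = (loc Y \<tau>\<^sub>0 (inv\<^bsub>?H\<^esub> k' \<sigma>\<^sub>0) \<odot>\<^bsub>Y\<^esub> loc Y \<tau>\<^sub>0 (k' \<sigma>\<^sub>0)) \<odot>\<^bsub>Y\<^esub> ind S \<odot>\<^bsub>Y\<^esub> loc Y \<rho>' (inv\<^bsub>?K\<^esub> k' \<rho>)"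
      unfolding k'S[symmetric] by (simp add: Y.hmul_assoc)
    also have "\<dots> = ind S \<odot>\<^bsub>Y\<^esub> loc Y \<rho>' (inv\<^bsub>?K\<^esub> k' \<rho>)"
      using k t Y.one_left[OF iS] by (simp add: Y.loc_mult)
    finally have J': "loc Y \<tau>\<^sub>0 (inv\<^bsub>?H\<^esub> k' \<sigma>\<^sub>0) \<odot>\<^bsub>Y\<^esub> ?J = ind S \<odot>\<^bsub>Y\<^esub> loc Y \<rho>' (inv\<^bsub>?K\<^esub> k' \<rho>)" .
    \<comment> \<open>The discrepancy of the two homotopies at \<rho>, conjugated by the leftover
      \<open>h\<close> so as to stand at the right end of \<open>R\<close>.\<close>
    let ?g = "inv\<^bsub>?K\<^esub> h \<otimes>\<^bsub>?K\<^esub> (inv\<^bsub>?K\<^esub> k' \<rho> \<otimes>\<^bsub>?K\<^esub> (k \<rho> \<otimes>\<^bsub>?K\<^esub> h))"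
    have "loc Y \<tau>\<^sub>0 ?z \<odot>\<^bsub>Y\<^esub> R
        = loc Y \<tau>\<^sub>0 (inv\<^bsub>?H\<^esub> k' \<sigma>\<^sub>0) \<odot>\<^bsub>Y\<^esub> (loc Y \<tau>\<^sub>0 (k \<sigma>\<^sub>0) \<odot>\<^bsub>Y\<^esub> ind S) \<odot>\<^bsub>Y\<^esub> loc Y \<rho>' h"
      unfolding R_eq using k t by (simp add: Y.hmul_assoc Y.loc_mult[symmetric])
    also have "\<dots> = (loc Y \<tau>\<^sub>0 (inv\<^bsub>?H\<^esub> k' \<sigma>\<^sub>0) \<odot>\<^bsub>Y\<^esub> ?J) \<odot>\<^bsub>Y\<^esub> (loc Y \<rho>' (k \<rho>) \<odot>\<^bsub>Y\<^esub> loc Y \<rho>' h)"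
      unfolding kS by (simp add: Y.hmul_assoc)
    also have "\<dots> = R \<odot>\<^bsub>Y\<^esub> loc Y \<rho>' ?g"
      unfolding J' R_eq using \<rho>' S(3) by (simp add: Y.hmul_assoc Y.loc_mult)
    finally show "\<exists>g\<in>carrier ?K. loc Y \<tau>\<^sub>0 ?z \<odot>\<^bsub>Y\<^esub> R = R \<odot>\<^bsub>Y\<^esub> loc Y \<rho>' g"
      using \<rho>' S(3) by (intro bexI[of _ ?g]) simp_all
  qed
  then have "?z = \<one>\<^bsub>?H\<^esub>"
    using Y.developable_loc_eq_iff[OF dev t z] t by simp
  then have "k' \<sigma>\<^sub>0 \<otimes>\<^bsub>?H\<^esub> ?z = k' \<sigma>\<^sub>0" using k t by simp
  then show ?thesis using k t by simp
qed

lemma deck_coset_unique: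
  "\<lbrakk>deck_mor X Y \<phi> \<eta> k; deck_mor X Y \<phi> \<eta> k'\<rbrakk> \<Longrightarrow> deck_coset \<sigma>\<^sub>0 \<eta> k = deck_coset \<sigma>\<^sub>0 \<eta> k'"
  unfolding deck_coset_def by (simp only: deck_k_unique[of \<eta> k k'])

lemma deck_coset_eqI:
  assumes "deck_mor X Y \<phi> \<eta> k" "deck_mor X Y \<phi> \<eta>' k'" "n \<in> deck_coset \<sigma>\<^sub>0 \<eta> k" "n \<in> deck_coset \<sigma>\<^sub>0 \<eta>' k'"
  shows "deck_coset \<sigma>\<^sub>0 \<eta> k = deck_coset \<sigma>\<^sub>0 \<eta>' k'"
  using deck_mor.deck_coset_eq[OF assms(1) base assms(3)] deck_mor.deck_coset_eq[OF assms(2) base assms(4)] by simp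

text \<open>One direction is invariance of the coset under homotopy, the other is
  \<open>deck_unique\<close>. Homotopy classes thus become fibres of the coset assignment, and
  statements about classes turn into computations with cosets.\<close>

lemma mem_mor_class_iff:
  assumes d: "deck_mor X Y \<phi> \<eta> k"
  shows "\<chi> \<in> mor_class X X \<eta> \<longleftrightarrow> (\<exists>k'. deck_mor X Y \<phi> \<chi> k' \<and> deck_coset \<sigma>\<^sub>0 \<chi> k' = deck_coset \<sigma>\<^sub>0 \<eta> k)"
proof
  interpret d: deck_mor X Y \<phi> \<eta> k by (rule d)
  {
    assume "\<chi> \<in> mor_class X X \<eta>"
    then have \<chi>: "is_cog_mor X X \<chi>" "mor_htpy X X \<eta> \<chi>" by (auto simp: mor_class_def)
    interpret c: cog_morphism X X \<chi> by unfold_locales (rule \<chi>(1))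
    obtain m where "htpy_by X X \<eta> \<chi> m"
      using \<chi>(2) mor_htpy_iff[OF d.e.cog_morphism_axioms c.cog_morphism_axioms] by blast
    then have "cog_htpy X X \<eta> \<chi> m" by unfold_locales
    from d.deck_mor_htpy[OF this] base
    show "\<exists>k'. deck_mor X Y \<phi> \<chi> k' \<and> deck_coset \<sigma>\<^sub>0 \<chi> k' = deck_coset \<sigma>\<^sub>0 \<eta> k" by blast
  }
  assume "\<exists>k'. deck_mor X Y \<phi> \<chi> k' \<and> deck_coset \<sigma>\<^sub>0 \<chi> k' = deck_coset \<sigma>\<^sub>0 \<eta> k"
  then obtain k' where k': "deck_mor X Y \<phi> \<chi> k'" "deck_coset \<sigma>\<^sub>0 \<chi> k' = deck_coset \<sigma>\<^sub>0 \<eta> k" by blast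
  interpret c: deck_mor X Y \<phi> \<chi> k' by (rule k'(1))
  obtain n where n: "n \<in> deck_coset \<sigma>\<^sub>0 \<eta> k" using d.deck_coset_nonempty[OF base] by blast
  obtain m where "cog_htpy X X \<eta> \<chi> m"
    using deck_unique[OF d k'(1) base n] n k'(2) by blast
  then have "mor_htpy X X \<eta> \<chi>"
    using mor_htpy_iff[OF d.e.cog_morphism_axioms c.e.cog_morphism_axioms] cog_htpy.htpy by blast
  then show "\<chi> \<in> mor_class X X \<eta>" using c.e.mor by (simp add: mor_class_def)
qed

lemma mor_class_eqI:
  assumes "deck_mor X Y \<phi> \<eta> k" "deck_mor X Y \<phi> \<eta>' k'" "deck_coset \<sigma>\<^sub>0 \<eta> k = deck_coset \<sigma>\<^sub>0 \<eta>' k'"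
  shows "mor_class X X \<eta> = mor_class X X \<eta>'"
  using mem_mor_class_iff[OF assms(1)] mem_mor_class_iff[OF assms(2)] assms(3) by blast

lemma mem_mor_class_self: "deck_mor X Y \<phi> \<eta> k \<Longrightarrow> \<eta> \<in> mor_class X X \<eta>"
  using mem_mor_class_iff by blast

text \<open>The union over all representatives and all witnesses avoids a choice; its members
  coincide by \<open>deck_to_coset_class\<close>.\<close>

definition deck_to_coset :: "('v, 'e, 'g, 'v, 'e, 'g) cog_mor set \<Rightarrow> ('w, 'f, 'h) gpath set set" where
  "deck_to_coset A = (\<Union>\<eta>\<in>A. \<Union>k\<in>{k. deck_mor X Y \<phi> \<eta> k}. deck_coset \<sigma>\<^sub>0 \<eta> k)"

lemma deck_to_coset_class:
  assumes "deck_mor X Y \<phi> \<eta> k"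
  shows "deck_to_coset (mor_class X X \<eta>) = deck_coset \<sigma>\<^sub>0 \<eta> k"
proof -
  have "deck_coset \<sigma>\<^sub>0 \<chi> k' = deck_coset \<sigma>\<^sub>0 \<eta> k" if "\<chi> \<in> mor_class X X \<eta>" "deck_mor X Y \<phi> \<chi> k'" for \<chi> k'
    using that mem_mor_class_iff[OF assms] deck_coset_unique by blast
  moreover have "\<eta> \<in> mor_class X X \<eta>" using mem_mor_class_self[OF assms] .
  ultimately show ?thesis unfolding deck_to_coset_def using assms by blast
qed

lemma Deck_carrier:
  "A \<in> carrier (Deck X Y \<phi>) \<longleftrightarrow> (\<exists>\<eta> k. A = mor_class X X \<eta> \<and> is_cog_iso X X \<eta> \<and> deck_mor X Y \<phi> \<eta> k)"
proof -
  have "mor_htpy X Y \<phi> (mor_comp X Y \<phi> \<eta>) \<longleftrightarrow> (\<exists>k. deck_mor X Y \<phi> \<eta> k)" if "is_cog_iso X X \<eta>" for \<eta>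
  proof -
    interpret e: cog_morphism X X \<eta> using that by unfold_locales (simp add: is_cog_iso_def)
    interpret c: cog_morphism_comp X X Y \<eta> \<phi> ..
    have "deck_mor X Y \<phi> \<eta> k \<longleftrightarrow> htpy_by X Y \<phi> (mor_comp X Y \<phi> \<eta>) k" for k
      using deck_mor.htpy deck_mor.intro[OF cog_covering_axioms e.cog_morphism_axioms] deck_mor_axioms.intro by blast
    then show ?thesis
      using mor_htpy_iff[OF cog_morphism_axioms c.cog_morphism_comp] by simp
  qed
  then show ?thesis by (auto simp: Deck_def Aut_def)
qed

text \<open>Independence of representatives is not checked on homotopies: whatever the
  representatives, the coset of their composite contains the same product of \<open>n\<close> and
  \<open>n'\<close>.\<close>

lemma Deck_mult:
  assumes "deck_mor X Y \<phi> \<eta> k" "deck_mor X Y \<phi> \<eta>' k'"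
  shows "mor_class X X \<eta> \<otimes>\<^bsub>Deck X Y \<phi>\<^esub> mor_class X X \<eta>' = mor_class X X (mor_comp X X \<eta> \<eta>')"
proof -
  interpret d: deck_mor X Y \<phi> \<eta> k by fact
  interpret d': deck_mor X Y \<phi> \<eta>' k' by fact
  obtain n n' where n: "n \<in> deck_coset \<sigma>\<^sub>0 \<eta> k" "n' \<in> deck_coset \<sigma>\<^sub>0 \<eta>' k'"
    using d.deck_coset_nonempty[OF base] d'.deck_coset_nonempty[OF base] by blast
  have "mor_class X X (mor_comp X X \<chi> \<chi>') = mor_class X X (mor_comp X X \<eta> \<eta>')"
    if \<chi>: "\<chi> \<in> mor_class X X \<eta>" "\<chi>' \<in> mor_class X X \<eta>'" for \<chi> \<chi>'
  proof -
    obtain l l' where l: "deck_mor X Y \<phi> \<chi> l" "deck_coset \<sigma>\<^sub>0 \<chi> l = deck_coset \<sigma>\<^sub>0 \<eta> k"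
      "deck_mor X Y \<phi> \<chi>' l'" "deck_coset \<sigma>\<^sub>0 \<chi>' l' = deck_coset \<sigma>\<^sub>0 \<eta>' k'"
      using \<chi> mem_mor_class_iff[OF assms(1)] mem_mor_class_iff[OF assms(2)] by blast
    obtain k1 where k1: "deck_mor X Y \<phi> (mor_comp X X \<eta> \<eta>') k1" "n \<odot>\<^bsub>Y\<^esub> n' \<in> deck_coset \<sigma>\<^sub>0 (mor_comp X X \<eta> \<eta>') k1"
      using deck_comp[OF assms base n] by blast
    obtain k2 where k2: "deck_mor X Y \<phi> (mor_comp X X \<chi> \<chi>') k2" "n \<odot>\<^bsub>Y\<^esub> n' \<in> deck_coset \<sigma>\<^sub>0 (mor_comp X X \<chi> \<chi>') k2"
      using deck_comp[OF l(1,3) base] n l(2,4) by blast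
    show ?thesis using mor_class_eqI[OF k2(1) k1(1) deck_coset_eqI[OF k2(1) k1(1) k2(2) k1(2)]] .
  qed
  moreover have "mor_class X X \<eta> \<otimes>\<^bsub>Deck X Y \<phi>\<^esub> mor_class X X \<eta>' =
      (\<Union>\<chi>\<in>mor_class X X \<eta>. \<Union>\<chi>'\<in>mor_class X X \<eta>'. mor_class X X (mor_comp X X \<chi> \<chi>'))"
    by (simp add: Deck_def)
  ultimately show ?thesis
    using mem_mor_class_self[OF assms(1)] mem_mor_class_self[OF assms(2)] by blast
qed

lemma deck_id: "deck_mor X Y \<phi> (mor_id X) (\<lambda>\<sigma>. \<one>\<^bsub>grp Y (vmap \<phi> \<sigma>)\<^esub>)"
  and deck_coset_id: "loc Y \<tau>\<^sub>0 \<one>\<^bsub>grp Y \<tau>\<^sub>0\<^esub> \<in> deck_coset \<sigma>\<^sub>0 (mor_id X) (\<lambda>\<sigma>. \<one>\<^bsub>grp Y (vmap \<phi> \<sigma>)\<^esub>)"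
proof -
  interpret i: cog_morphism X X "mor_id X" by (rule X.cog_morphism_id)
  interpret c: cog_morphism_comp X X Y "mor_id X" \<phi> ..
  have "htpy_by X Y \<phi> (mor_comp X Y \<phi> (mor_id X)) (\<lambda>\<sigma>. \<one>\<^bsub>grp Y (vmap \<phi> \<sigma>)\<^esub>)"
    unfolding htpy_by_def by simp
  then show "deck_mor X Y \<phi> (mor_id X) (\<lambda>\<sigma>. \<one>\<^bsub>grp Y (vmap \<phi> \<sigma>)\<^esub>)" by unfold_locales
  show "loc Y \<tau>\<^sub>0 \<one>\<^bsub>grp Y \<tau>\<^sub>0\<^esub> \<in> deck_coset \<sigma>\<^sub>0 (mor_id X) (\<lambda>\<sigma>. \<one>\<^bsub>grp Y (vmap \<phi> \<sigma>)\<^esub>)"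
    unfolding deck_coset_def using base
    by (auto intro!: exI[of _ "loc X \<sigma>\<^sub>0 \<one>\<^bsub>grp X \<sigma>\<^sub>0\<^esub>"] simp: Y.loc_mult)
qed

lemma group_G: "group G"
  using base by (intro Y.group_pi1) auto

lemma U_subset: "U \<subseteq> carrier G"
  by (auto simp: Y.pi1_carrier)

lemma subgroup_U: "subgroup U G"
proof -
  interpret G: group G by (rule group_G)
  interpret K: group "pi1 X \<sigma>\<^sub>0" by (rule X.group_pi1[OF base])
  have "ind \<in> hom (pi1 X \<sigma>\<^sub>0) G"
    by (auto simp: hom_def X.pi1_carrier Y.pi1_carrier X.pi1_mult Y.pi1_mult ind_hmul)
  then interpret h: group_hom "pi1 X \<sigma>\<^sub>0" G ind by unfold_locales
  show ?thesis using h.img_is_subgroup by (simp add: X.pi1_carrier)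
qed

lemma deck_coset_r_coset:
  assumes "deck_mor X Y \<phi> \<eta> k" "n \<in> deck_coset \<sigma>\<^sub>0 \<eta> k"
  shows "deck_coset \<sigma>\<^sub>0 \<eta> k = U #>\<^bsub>G\<^esub> n"
proof -
  have n: "n \<in> arr Y \<tau>\<^sub>0 \<tau>\<^sub>0" by (rule deck_mor.deck_coset_arr[OF assms(1) base assms(2)])
  show ?thesis
    unfolding deck_mor.deck_coset_eq[OF assms(1) base assms(2)] r_coset_def
    using Y.pi1_mult[OF ind_arr n] by auto
qed

text \<open>Conjugation by \<open>n\<close> corresponds in \<open>X\<close> to applying \<eta> to a
  loop and carrying it back to the base point along \<open>C\<close>. That \<eta> is an isomorphism
  makes this correspondence onto, which gives the second inclusion.\<close>

lemma deck_coset_normalizer: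
  assumes d: "deck_mor X Y \<phi> \<eta> k" and iso: "is_cog_iso X X \<eta>" and n: "n \<in> deck_coset \<sigma>\<^sub>0 \<eta> k"
  shows "n \<in> normalizer G U"
proof -
  interpret d: deck_mor X Y \<phi> \<eta> k by (rule d)
  interpret G: group G by (rule group_G)
  have nG: "n \<in> arr Y \<tau>\<^sub>0 \<tau>\<^sub>0" by (rule d.deck_coset_arr[OF base n])
  obtain C where C: "C \<in> arr X \<sigma>\<^sub>0 (vmap \<eta> \<sigma>\<^sub>0)" "n = ind C \<odot>\<^bsub>Y\<^esub> loc Y \<tau>\<^sub>0 (k \<sigma>\<^sub>0)"
    using n unfolding deck_coset_def by blast
  have *: "n \<otimes>\<^bsub>G\<^esub> ind P = ind P' \<otimes>\<^bsub>G\<^esub> n"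
    if P: "P \<in> arr X \<sigma>\<^sub>0 \<sigma>\<^sub>0" "P' \<in> arr X \<sigma>\<^sub>0 \<sigma>\<^sub>0" "C \<odot>\<^bsub>X\<^esub> d.e.ind P = P' \<odot>\<^bsub>X\<^esub> C" for P P'
  proof -
    have "n \<odot>\<^bsub>Y\<^esub> ind P = ind (P' \<odot>\<^bsub>X\<^esub> C) \<odot>\<^bsub>Y\<^esub> loc Y \<tau>\<^sub>0 (k \<sigma>\<^sub>0)"
      using d.deck_coset_act[OF C(1) P(1)] P(3) C(2) by simp
    also have "\<dots> = ind P' \<odot>\<^bsub>Y\<^esub> n"
      unfolding ind_hmul[OF P(2) C(1)] C(2) by (rule Y.hmul_assoc)
    finally show ?thesis using nG P by (simp add: Y.pi1_mult)
  qed
  show ?thesis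
  proof (rule G.mem_normalizerI[OF U_subset])
    show "n \<in> carrier G" using nG by (simp add: Y.pi1_carrier)
  next
    fix u assume "u \<in> U"
    then obtain P where P: "P \<in> arr X \<sigma>\<^sub>0 \<sigma>\<^sub>0" "u = ind P" by blast
    note eP = d.e.ind_arr[OF P(1)]
    let ?P' = "C \<odot>\<^bsub>X\<^esub> d.e.ind P \<odot>\<^bsub>X\<^esub> hinv X C"
    have P': "?P' \<in> arr X \<sigma>\<^sub>0 \<sigma>\<^sub>0" using C(1) eP by blast
    have "C \<odot>\<^bsub>X\<^esub> d.e.ind P = ?P' \<odot>\<^bsub>X\<^esub> C"
      using C(1) eP by (simp add: X.hmul_assoc)
    with *[OF P(1) P'] P' P(2) show "\<exists>u'\<in>U. n \<otimes>\<^bsub>G\<^esub> u = u' \<otimes>\<^bsub>G\<^esub> n" by blast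
  next
    fix u' assume "u' \<in> U"
    then obtain P' where P': "P' \<in> arr X \<sigma>\<^sub>0 \<sigma>\<^sub>0" "u' = ind P'" by blast
    have P'C: "P' \<odot>\<^bsub>X\<^esub> C \<in> arr X \<sigma>\<^sub>0 (vmap \<eta> \<sigma>\<^sub>0)" using P'(1) C(1) by blast
    have Q: "hinv X C \<odot>\<^bsub>X\<^esub> (P' \<odot>\<^bsub>X\<^esub> C) \<in> arr X (vmap \<eta> \<sigma>\<^sub>0) (vmap \<eta> \<sigma>\<^sub>0)" using P'C C(1) by blast
    \<comment> \<open>The loop \<open>P'\<close>, carried along \<open>C\<close> to the image of the
      base point, is pulled back through \<eta>; injectivity on vertices then shows that the
      preimage is again a loop.\<close>
    obtain \<rho> P where P: "P \<in> arr X \<sigma>\<^sub>0 \<rho>" "vmap \<eta> \<rho> = vmap \<eta> \<sigma>\<^sub>0" "d.e.ind P = hinv X C \<odot>\<^bsub>X\<^esub> (P' \<odot>\<^bsub>X\<^esub> C)"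
      using d.e.iso_ind_surj[OF iso Q base refl] by blast
    have "\<rho> = \<sigma>\<^sub>0"
      using iso P(2) base X.arr_verts[OF P(1)]
      unfolding is_cog_iso_def is_scwol_iso_def bij_betw_def by (auto dest: inj_onD)
    moreover have "C \<odot>\<^bsub>X\<^esub> d.e.ind P = P' \<odot>\<^bsub>X\<^esub> C"
      unfolding P(3) using X.hinv_right_left[OF C(1) P'C] .
    ultimately show "\<exists>u\<in>U. n \<otimes>\<^bsub>G\<^esub> u = u' \<otimes>\<^bsub>G\<^esub> n" using *[of P P'] P P' by blast
  qed
qed

lemma deck_exists_normalizer:
  assumes n: "n \<in> normalizer G U"
  shows "\<exists>\<eta> k. deck_mor X Y \<phi> \<eta> k \<and> n \<in> deck_coset \<sigma>\<^sub>0 \<eta> k"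
proof (rule deck_exists[OF base])
  interpret G: group G by (rule group_G)
  have "n \<in> carrier G" using n G.normalizer_imp_subgroup[OF U_subset] subgroup.subset by blast
  then show nG: "n \<in> arr Y \<tau>\<^sub>0 \<tau>\<^sub>0" by (simp add: Y.pi1_carrier)
  fix P assume P: "P \<in> arr X \<sigma>\<^sub>0 \<sigma>\<^sub>0"
  then obtain u' where "u' \<in> U" "n \<otimes>\<^bsub>G\<^esub> ind P = u' \<otimes>\<^bsub>G\<^esub> n"
    using G.mem_normalizerD[OF U_subset n, of "ind P"] by blast
  then obtain P' where "P' \<in> arr X \<sigma>\<^sub>0 \<sigma>\<^sub>0" "n \<otimes>\<^bsub>G\<^esub> ind P = ind P' \<otimes>\<^bsub>G\<^esub> n" by blast
  then show "\<exists>P'\<in>arr X \<sigma>\<^sub>0 \<sigma>\<^sub>0. n \<odot>\<^bsub>Y\<^esub> ind P = ind P' \<odot>\<^bsub>Y\<^esub> n"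
    using nG P by (auto simp: Y.pi1_mult)
qed

text \<open>Morphisms are constructed for \<open>n\<close> and for its inverse. By multiplicativity
  the cosets of both composites contain the neutral element, so the composites are homotopic to the
  identity.\<close>

lemma deck_exists_iso:
  assumes n: "n \<in> normalizer G U"
  shows "\<exists>\<eta> k. is_cog_iso X X \<eta> \<and> deck_mor X Y \<phi> \<eta> k \<and> n \<in> deck_coset \<sigma>\<^sub>0 \<eta> k"
proof -
  interpret G: group G by (rule group_G)
  have N: "subgroup (normalizer G U) G" by (rule G.normalizer_imp_subgroup[OF U_subset])
  have nG: "n \<in> carrier G" using n subgroup.subset[OF N] by blast
  let ?n' = "inv\<^bsub>G\<^esub> n"
  have n': "?n' \<in> normalizer G U" using subgroup.m_inv_closed[OF N n] .
  obtain \<eta> k where d: "deck_mor X Y \<phi> \<eta> k" "n \<in> deck_coset \<sigma>\<^sub>0 \<eta> k"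
    using deck_exists_normalizer[OF n] by blast
  obtain \<eta>' k' where d': "deck_mor X Y \<phi> \<eta>' k'" "?n' \<in> deck_coset \<sigma>\<^sub>0 \<eta>' k'"
    using deck_exists_normalizer[OF n'] by blast
  have nn: "n \<odot>\<^bsub>Y\<^esub> ?n' = loc Y \<tau>\<^sub>0 \<one>\<^bsub>grp Y \<tau>\<^sub>0\<^esub>" "?n' \<odot>\<^bsub>Y\<^esub> n = loc Y \<tau>\<^sub>0 \<one>\<^bsub>grp Y \<tau>\<^sub>0\<^esub>"
    using G.r_inv[OF nG] G.l_inv[OF nG] nG G.inv_closed[OF nG]
    by (simp_all add: Y.pi1_one Y.pi1_carrier Y.pi1_mult)
  obtain l where l: "deck_mor X Y \<phi> (mor_comp X X \<eta> \<eta>') l"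
    "loc Y \<tau>\<^sub>0 \<one>\<^bsub>grp Y \<tau>\<^sub>0\<^esub> \<in> deck_coset \<sigma>\<^sub>0 (mor_comp X X \<eta> \<eta>') l"
    using deck_comp[OF d(1) d'(1) base d(2) d'(2)] nn by auto
  obtain l' where l': "deck_mor X Y \<phi> (mor_comp X X \<eta>' \<eta>) l'"
    "loc Y \<tau>\<^sub>0 \<one>\<^bsub>grp Y \<tau>\<^sub>0\<^esub> \<in> deck_coset \<sigma>\<^sub>0 (mor_comp X X \<eta>' \<eta>) l'"
    using deck_comp[OF d'(1) d(1) base d'(2) d(2)] nn by auto
  obtain m where m: "cog_htpy X X (mor_id X) (mor_comp X X \<eta> \<eta>') m"
    using deck_unique[OF deck_id l(1) base deck_coset_id l(2)] by blast
  obtain m' where m': "cog_htpy X X (mor_id X) (mor_comp X X \<eta>' \<eta>) m'"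
    using deck_unique[OF deck_id l'(1) base deck_coset_id l'(2)] by blast
  interpret d: deck_mor X Y \<phi> \<eta> k by (rule d(1))
  interpret d': deck_mor X Y \<phi> \<eta>' k' by (rule d'(1))
  have "is_cog_iso X X \<eta>"
    by (rule cog_iso_if_inverse[OF d.e.cog_morphism_axioms d'.e.cog_morphism_axioms m m'])
  with d show ?thesis by blast
qed

text \<open>Multiplicativity rests on \<open>deck_comp\<close>, injectivity on the description of
  homotopy classes by cosets, and surjectivity on \<open>deck_exists_iso\<close>.\<close>

lemma deck_to_coset_iso:
  "deck_to_coset \<in> iso (Deck X Y \<phi>) (G\<lparr>carrier := normalizer G U\<rparr> Mod U)"
proof -
  interpret G: group G by (rule group_G)
  interpret N: normal U "G\<lparr>carrier := normalizer G U\<rparr>" by (rule G.subgroup_in_normalizer[OF subgroup_U])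
  let ?N = "G\<lparr>carrier := normalizer G U\<rparr>"
  have coset: "U #>\<^bsub>?N\<^esub> n = U #>\<^bsub>G\<^esub> n" for n by (simp add: r_coset_def)
  have val: "\<exists>n\<in>normalizer G U. n \<in> deck_coset \<sigma>\<^sub>0 \<eta> k \<and> deck_to_coset (mor_class X X \<eta>) = U #>\<^bsub>?N\<^esub> n"
    if \<eta>: "is_cog_iso X X \<eta>" "deck_mor X Y \<phi> \<eta> k" for \<eta> k
  proof -
    obtain n where n: "n \<in> deck_coset \<sigma>\<^sub>0 \<eta> k" using deck_mor.deck_coset_nonempty[OF \<eta>(2) base] by blast
    with deck_coset_normalizer[OF \<eta>(2,1) n] deck_to_coset_class[OF \<eta>(2)] deck_coset_r_coset[OF \<eta>(2) n]
    show ?thesis unfolding coset by auto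
  qed
  have "deck_to_coset \<in> hom (Deck X Y \<phi>) (?N Mod U)"
  proof (rule homI)
    fix A assume "A \<in> carrier (Deck X Y \<phi>)"
    then obtain \<eta> k where "A = mor_class X X \<eta>" "is_cog_iso X X \<eta>" "deck_mor X Y \<phi> \<eta> k"
      unfolding Deck_carrier by blast
    with val[of \<eta> k] show "deck_to_coset A \<in> carrier (?N Mod U)"
      by (auto simp: FactGroup_def RCOSETS_def)
  next
    fix A B assume "A \<in> carrier (Deck X Y \<phi>)" "B \<in> carrier (Deck X Y \<phi>)"
    then obtain \<eta> k \<eta>' k' where \<eta>: "A = mor_class X X \<eta>" "is_cog_iso X X \<eta>" "deck_mor X Y \<phi> \<eta> k"
      and \<eta>': "B = mor_class X X \<eta>'" "is_cog_iso X X \<eta>'" "deck_mor X Y \<phi> \<eta>' k'"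
      unfolding Deck_carrier by blast
    obtain n where n: "n \<in> normalizer G U" "n \<in> deck_coset \<sigma>\<^sub>0 \<eta> k" "deck_to_coset A = U #>\<^bsub>?N\<^esub> n"
      using val[OF \<eta>(2,3)] \<eta>(1) by blast
    obtain n' where n': "n' \<in> normalizer G U" "n' \<in> deck_coset \<sigma>\<^sub>0 \<eta>' k'" "deck_to_coset B = U #>\<^bsub>?N\<^esub> n'"
      using val[OF \<eta>'(2,3)] \<eta>'(1) by blast
    obtain k'' where k'': "deck_mor X Y \<phi> (mor_comp X X \<eta> \<eta>') k''" "n \<odot>\<^bsub>Y\<^esub> n' \<in> deck_coset \<sigma>\<^sub>0 (mor_comp X X \<eta> \<eta>') k''"
      using deck_comp[OF \<eta>(3) \<eta>'(3) base n(2) n'(2)] by blast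
    have nn: "n \<odot>\<^bsub>Y\<^esub> n' = n \<otimes>\<^bsub>G\<^esub> n'"
      using Y.pi1_mult deck_mor.deck_coset_arr[OF \<eta>(3) base n(2)] deck_mor.deck_coset_arr[OF \<eta>'(3) base n'(2)] by simp
    have "deck_to_coset (A \<otimes>\<^bsub>Deck X Y \<phi>\<^esub> B) = U #>\<^bsub>G\<^esub> (n \<otimes>\<^bsub>G\<^esub> n')"
      unfolding \<eta>(1) \<eta>'(1) Deck_mult[OF \<eta>(3) \<eta>'(3)] deck_to_coset_class[OF k''(1)]
        deck_coset_r_coset[OF k''] nn ..
    also have "\<dots> = (U #>\<^bsub>?N\<^esub> n) <#>\<^bsub>?N\<^esub> (U #>\<^bsub>?N\<^esub> n')"
      using N.rcos_sum[of n n'] n(1) n'(1) coset by simp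
    finally show "deck_to_coset (A \<otimes>\<^bsub>Deck X Y \<phi>\<^esub> B) = deck_to_coset A \<otimes>\<^bsub>?N Mod U\<^esub> deck_to_coset B"
      unfolding n(3) n'(3) by (simp add: FactGroup_def)
  qed
  moreover have "inj_on deck_to_coset (carrier (Deck X Y \<phi>))"
  proof (rule inj_onI)
    fix A B assume "A \<in> carrier (Deck X Y \<phi>)" "B \<in> carrier (Deck X Y \<phi>)" and eq: "deck_to_coset A = deck_to_coset B"
    then obtain \<eta> k \<eta>' k' where A: "A = mor_class X X \<eta>" "deck_mor X Y \<phi> \<eta> k"
      and B: "B = mor_class X X \<eta>'" "deck_mor X Y \<phi> \<eta>' k'"
      unfolding Deck_carrier by blast
    show "A = B"
      using eq mor_class_eqI[OF A(2) B(2)]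
      unfolding A(1) B(1) deck_to_coset_class[OF A(2)] deck_to_coset_class[OF B(2)] by blast
  qed
  moreover have "deck_to_coset ` carrier (Deck X Y \<phi>) = carrier (?N Mod U)"
  proof (intro equalityI subsetI)
    fix D assume "D \<in> deck_to_coset ` carrier (Deck X Y \<phi>)"
    then show "D \<in> carrier (?N Mod U)"
      using \<open>deck_to_coset \<in> hom (Deck X Y \<phi>) (?N Mod U)\<close> by (auto simp: hom_def)
  next
    fix D assume "D \<in> carrier (?N Mod U)"
    then obtain n where n: "n \<in> normalizer G U" "D = U #>\<^bsub>G\<^esub> n"
      by (auto simp: FactGroup_def RCOSETS_def coset)
    obtain \<eta> k where \<eta>: "is_cog_iso X X \<eta>" "deck_mor X Y \<phi> \<eta> k" "n \<in> deck_coset \<sigma>\<^sub>0 \<eta> k"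
      using deck_exists_iso[OF n(1)] by blast
    have "D = deck_to_coset (mor_class X X \<eta>)"
      unfolding n(2) deck_to_coset_class[OF \<eta>(2)] deck_coset_r_coset[OF \<eta>(2,3)] ..
    moreover have "mor_class X X \<eta> \<in> carrier (Deck X Y \<phi>)" unfolding Deck_carrier using \<eta> by blast
    ultimately show "D \<in> deck_to_coset ` carrier (Deck X Y \<phi>)" by blast
  qed
  ultimately show ?thesis by (simp add: iso_def bij_betw_def)
qed

text \<open>The group laws are transported back from the quotient along
  \<open>deck_to_coset\<close>; what remains to be checked in \<open>Deck\<close> itself is closure
  under composition and the class of the identity.\<close>

lemma group_Deck: "group (Deck X Y \<phi>)"
proof -
  interpret G: group G by (rule group_G)
  let ?N = "G\<lparr>carrier := normalizer G U\<rparr>"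
  interpret N: normal U ?N by (rule G.subgroup_in_normalizer[OF subgroup_U])
  interpret Q: group "?N Mod U" by (rule N.factorgroup_is_group)
  let ?D = "Deck X Y \<phi>"
  have cl: "A \<otimes>\<^bsub>?D\<^esub> B \<in> carrier ?D" if "A \<in> carrier ?D" "B \<in> carrier ?D" for A B
  proof -
    obtain \<eta> k \<eta>' k' where \<eta>: "A = mor_class X X \<eta>" "is_cog_iso X X \<eta>" "deck_mor X Y \<phi> \<eta> k"
      and \<eta>': "B = mor_class X X \<eta>'" "is_cog_iso X X \<eta>'" "deck_mor X Y \<phi> \<eta>' k'"
      using \<open>A \<in> carrier ?D\<close> \<open>B \<in> carrier ?D\<close> unfolding Deck_carrier by blast
    obtain n n' where "n \<in> deck_coset \<sigma>\<^sub>0 \<eta> k" "n' \<in> deck_coset \<sigma>\<^sub>0 \<eta>' k'"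
      using deck_mor.deck_coset_nonempty[OF \<eta>(3) base] deck_mor.deck_coset_nonempty[OF \<eta>'(3) base] by blast
    from deck_comp[OF \<eta>(3) \<eta>'(3) base this] cog_iso_comp[OF X.cog_axioms \<eta>(2) \<eta>'(2)]
    show ?thesis unfolding Deck_carrier \<eta>(1) \<eta>'(1) Deck_mult[OF \<eta>(3) \<eta>'(3)] by blast
  qed
  have "is_cog_iso X X (mor_id X)"
  proof -
    interpret m: cog_morphism X X "mor_id X" by (rule X.cog_morphism_id)
    have id: "vmap (mor_id X) = id" "emap (mor_id X) = id" "lmap (mor_id X) \<sigma> = id" for \<sigma>
      by (simp_all add: mor_id_def)
    have "lmap (mor_id X) \<sigma> \<in> iso (grp X \<sigma>) (grp X (vmap (mor_id X) \<sigma>))" for \<sigma>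
      unfolding id by (simp add: iso_def hom_def)
    moreover have "bij_betw (vmap (mor_id X)) (verts X) (verts X)" "bij_betw (emap (mor_id X)) (edges X) (edges X)"
      unfolding id by simp_all
    ultimately show ?thesis using m.mor m.scwol_mor unfolding is_cog_iso_def is_scwol_iso_def by blast
  qed
  then have one: "\<one>\<^bsub>?D\<^esub> \<in> carrier ?D"
    unfolding Deck_carrier using deck_id by (auto simp: Deck_def)
  have "\<one>\<^bsub>?D\<^esub> \<otimes>\<^bsub>?D\<^esub> \<one>\<^bsub>?D\<^esub> = \<one>\<^bsub>?D\<^esub>"
  proof -
    have 1: "\<one>\<^bsub>?D\<^esub> = mor_class X X (mor_id X)" by (simp add: Deck_def)
    obtain k where k: "deck_mor X Y \<phi> (mor_comp X X (mor_id X) (mor_id X)) k"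
        "loc Y \<tau>\<^sub>0 \<one>\<^bsub>grp Y \<tau>\<^sub>0\<^esub> \<in> deck_coset \<sigma>\<^sub>0 (mor_comp X X (mor_id X) (mor_id X)) k"
      using deck_comp[OF deck_id deck_id base deck_coset_id deck_coset_id] base by (auto simp: Y.loc_mult)
    show ?thesis unfolding 1 Deck_mult[OF deck_id deck_id]
      by (rule mor_class_eqI[OF k(1) deck_id deck_coset_eqI[OF k(1) deck_id k(2) deck_coset_id]])
  qed
  with Q.group_if_iso_to[OF deck_to_coset_iso] cl one show ?thesis by blast
qed

end

theorem corollary1p2:
  fixes X :: "('v, 'e, 'g) cog" and Y :: "('w, 'f, 'h) cog"
    and \<phi> :: "('v, 'e, 'g, 'w, 'f, 'h) cog_mor"
    and \<sigma>\<^sub>0 :: 'v and \<tau>\<^sub>0 :: 'w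
  assumes "complex_of_groups X" and "complex_of_groups Y"
    and "covering X Y \<phi>" and "\<sigma>\<^sub>0 \<in> verts X" and "vmap \<phi> \<sigma>\<^sub>0 = \<tau>\<^sub>0"
    and "developable X" and "developable Y"
    and "effective Y \<tau>\<^sub>0"
  shows "let G = pi1 Y \<tau>\<^sub>0;
             U = induced X Y \<phi> ` carrier (pi1 X \<sigma>\<^sub>0)
         in group G \<and> subgroup U G \<and> group (Deck X Y \<phi>) \<and>
            Deck X Y \<phi> \<cong> G\<lparr>carrier := normalizer G U\<rparr> Mod U"
proof -
  interpret effective_covering X Y \<phi> \<sigma>\<^sub>0
    using assms by unfold_locales (auto simp: covering_def)
  show ?thesis
    using group_G subgroup_U group_Deck deck_to_coset_iso
    by (auto simp: Let_def X.pi1_carrier is_iso_def assms(5)[symmetric])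
qed

end
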